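(* Let $E = \bigwedge_{\mathbb{C}} \langle e_1,\ldots,e_6 \rangle$. Consider an ideal $I = (f_1,\ldots,f_6) \subseteq E$ generated by $6$ generic quadrics. Then $E/I$ is Koszul but not LG-quadratic.
   Context: $E$ is the exterior algebra over $\mathbb{C}$, graded by $\deg e_i=1$. A quadric is a homogeneous element of degree $2$. A quadric $\sum_{i<j}\alpha_{i,j}e_ie_j$ is identified with the point $[\alpha_{1,2}:\cdots:\alpha_{5,6}]$ of the projective space $\mathbb{P}^{14}_{\mathbb{C}}$, and a choice of $6$ generic quadrics corresponds to a choice of $6$ generic points of this projective space. Koszul: a positively graded $\mathbb{K}$-algebra $R$ ($\mathbb{K}$ a field) is Koszul if its residue field $\mathbb{K}$ has a linear free resolution as an $R$-module; equivalently, $\mathrm{Tor}^R_i(\mathbb{K},\mathbb{K})_j = 0$ for all $i \neq j$. Regular sequence: a linear form $\ell$ is regular on a graded module $M$ if $\{m \in M \mid \ell m = 0\} = \ell M$. A sequence $\ell_1,\ldots,\ell_r$ of linear forms is a regular sequence on $M$ if $\ell_i$ is regular on $M/(\ell_1,\ldots,\ell_{i-1})M$ for each $i$. Gröbner bases: for a monomial order $<$ on an exterior algebra $E'$ and a graded ideal $J\subseteq E'$, $LT(f)$ denotes the leading term of $f$, $in_<(J) = (LT(f) : f \in J)$, and a Gröbner basis of $J$ is a finite set of elements of $J$ whose leading terms generate $in_<(J)$. G-quadratic: a quotient $A=E'/J$ of an exterior algebra $E'$ (on any finite number of variables) by a graded ideal $J$ is G-quadratic if $J$ has a Gröbner basis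 consisting of quadrics with respect to some coordinates on $E'_1$ and some monomial order on $E'$. LG-quadratic: a quotient $R$ of an exterior algebra is LG-quadratic if there exist a G-quadratic algebra $A$ and a regular sequence of linear forms $\ell_1,\ldots,\ell_r$ on $A$ such that $R \cong A/(\ell_1,\ldots,\ell_r)$. *)

theory Defs
  imports Complex_Main "HOL-Library.Poly_Mapping" "HOL-Algebra.QuotRing" "HOL-Algebra.Module"
begin

section \<open>Graded complex algebras\<close>

text \<open>A graded algebra is a ring record with a scalar multiplication (the record of
  \<^theory>\<open>HOL-Algebra.Module\<close>; its locale \<open>algebra\<close> is unusable because it demands commutativity)
  together with its homogeneous components. The operations below are applied only to exterior
  algebras and their quotients, so no axioms are bundled with the record.\<close>

record 'b graded_algebra = "(complex, 'b) module" +
  component :: "nat \<Rightarrow> 'b set"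

definition quotient_algebra :: "'b graded_algebra \<Rightarrow> 'b set \<Rightarrow> 'b set graded_algebra"
  where "quotient_algebra A J =
    \<lparr>carrier = carrier (A Quot J), mult = mult (A Quot J), one = one (A Quot J),
     zero = zero (A Quot J), add = add (A Quot J),
     smult = (\<lambda>c X. \<Union>x\<in>X. J +>\<^bsub>A\<^esub> (c \<odot>\<^bsub>A\<^esub> x)),
     component = (\<lambda>d. (\<lambda>x. J +>\<^bsub>A\<^esub> x) ` component A d)\<rparr>"

definition graded_iso :: "'b graded_algebra \<Rightarrow> 'c graded_algebra \<Rightarrow> bool"
  where "graded_iso A B \<longleftrightarrow>
    (\<exists>h \<in> ring_iso A B.
       (\<forall>c. \<forall>x\<in>carrier A. h (c \<odot>\<^bsub>A\<^esub> x) = c \<odot>\<^bsub>B\<^esub> h x) \<and>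
       (\<forall>d. h ` component A d = component B d))"


section \<open>Koszul algebras\<close>

definition irrelevant_ideal :: "'b graded_algebra \<Rightarrow> 'b set"
  where "irrelevant_ideal R = Idl\<^bsub>R\<^esub> (\<Union>d\<in>{1..}. component R d)"

text \<open>The free left module of rank \<open>p\<close>, and the map of free left modules given by a matrix acting
  on row vectors from the right.\<close>

definition free_module :: "'b graded_algebra \<Rightarrow> nat \<Rightarrow> (nat \<Rightarrow> 'b) set"
  where "free_module R p = {..<p} \<rightarrow>\<^sub>E carrier R"

definition matrix_map ::
    "'b graded_algebra \<Rightarrow> nat \<Rightarrow> nat \<Rightarrow> (nat \<Rightarrow> nat \<Rightarrow> 'b) \<Rightarrow> (nat \<Rightarrow> 'b) \<Rightarrow> (nat \<Rightarrow> 'b)"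
  where "matrix_map R p q D v = (\<lambda>t\<in>{..<q}. \<Oplus>\<^bsub>R\<^esub>s\<in>{..<p}. v s \<otimes>\<^bsub>R\<^esub> D s t)"

text \<open>A linear free resolution
  \<open>\<dots> \<rightarrow> R(-2)^(b 2) \<rightarrow> R(-1)^(b 1) \<rightarrow> R \<rightarrow> K \<rightarrow> 0\<close> of the residue field \<open>K = R / R_+\<close>, where
  \<open>R \<rightarrow> K\<close> is the projection. A homogeneous map of degree \<open>0\<close> from \<open>R(-i-1)^(b (i+1))\<close> to
  \<open>R(-i)^(b i)\<close> is the same thing as a matrix of elements of \<open>R_1\<close>.\<close>

definition linear_resolution_of_residue_field ::
    "'b graded_algebra \<Rightarrow> (nat \<Rightarrow> nat) \<Rightarrow> (nat \<Rightarrow> nat \<Rightarrow> nat \<Rightarrow> 'b) \<Rightarrow> bool"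
  where "linear_resolution_of_residue_field R b D \<longleftrightarrow>
    b 0 = 1 \<and>
    (\<forall>i. \<forall>s<b (Suc i). \<forall>t<b i. D i s t \<in> component R 1) \<and>
    matrix_map R (b 1) (b 0) (D 0) ` free_module R (b 1)
      = {v \<in> free_module R (b 0). v 0 \<in> irrelevant_ideal R} \<and>
    (\<forall>i. matrix_map R (b (i + 2)) (b (i + 1)) (D (i + 1)) ` free_module R (b (i + 2))
      = {v \<in> free_module R (b (i + 1)).
           matrix_map R (b (i + 1)) (b i) (D i) v = (\<lambda>t\<in>{..<b i}. \<zero>\<^bsub>R\<^esub>)})"

definition koszul :: "'b graded_algebra \<Rightarrow> bool"
  where "koszul R \<longleftrightarrow> (\<exists>b D. linear_resolution_of_residue_field R b D)"


section \<open>Exterior algebras\<close>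

text \<open>The generators are \<open>e_0, \<dots>, e_(n-1)\<close>. An element is its family of coordinates in the basis
  \<open>e_S = e_(s_1) \<dots> e_(s_k)\<close>, where \<open>S = {s_1 < \<dots> < s_k}\<close>; for disjoint \<open>T\<close> and \<open>U\<close> one has
  \<open>e_T e_U = wedge_sign T U e_(T \<union> U)\<close>.\<close>

type_synonym ext = "nat set \<Rightarrow> complex"

definition wedge_sign :: "nat set \<Rightarrow> nat set \<Rightarrow> complex"
  where "wedge_sign T U = (-1) ^ card {(t, u). t \<in> T \<and> u \<in> U \<and> u < t}"

definition ext_carrier :: "nat \<Rightarrow> ext set"
  where "ext_carrier n = {f. \<forall>S. f S \<noteq> 0 \<longrightarrow> S \<subseteq> {..<n}}"

definition exterior :: "nat \<Rightarrow> ext graded_algebra"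
  where "exterior n =
    \<lparr>carrier = ext_carrier n,
     mult = (\<lambda>f g S. \<Sum>T\<in>Pow S. wedge_sign T (S - T) * f T * g (S - T)),
     one = (\<lambda>S. if S = {} then 1 else 0),
     zero = (\<lambda>S. 0),
     add = (\<lambda>f g S. f S + g S),
     smult = (\<lambda>c f S. c * f S),
     component = (\<lambda>d. {f \<in> ext_carrier n. \<forall>S. f S \<noteq> 0 \<longrightarrow> card S = d})\<rparr>"

definition ext_gen :: "nat \<Rightarrow> ext"
  where "ext_gen i = (\<lambda>S. if S = {i} then 1 else 0)"

definition graded_ideal :: "nat \<Rightarrow> ext set \<Rightarrow> bool"
  where "graded_ideal n J \<longleftrightarrow>
    ideal J (exterior n) \<and> (\<forall>f\<in>J. \<forall>d. (\<lambda>S. if card S = d then f S else 0) \<in> J)"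


section \<open>Groebner bases, G-quadratic and LG-quadratic algebras\<close>

text \<open>Coordinates are an arbitrary basis \<open>y_0, \<dots>, y_(n-1)\<close> of the space of linear forms. A monomial
  is identified with the set of indices occurring in it. Monomial orders are the strict total orders
  usual for exterior algebras: \<open>1\<close> is the smallest monomial, and \<open>u < v\<close> implies \<open>u w < v w\<close> whenever
  both products are nonzero.\<close>

definition coordinates :: "nat \<Rightarrow> (nat \<Rightarrow> ext) \<Rightarrow> bool"
  where "coordinates n y \<longleftrightarrow>
    (\<forall>i<n. y i \<in> component (exterior n) 1) \<and>
    (\<forall>v \<in> component (exterior n) 1. \<exists>!c. c \<in> {..<n} \<rightarrow>\<^sub>E (UNIV :: complex set) \<and>
        v = (\<Oplus>\<^bsub>exterior n\<^esub>i\<in>{..<n}. c i \<odot>\<^bsub>exterior n\<^esub> y i))"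

definition coord_monomial :: "nat \<Rightarrow> (nat \<Rightarrow> ext) \<Rightarrow> nat set \<Rightarrow> ext"
  where "coord_monomial n y S =
    foldr (\<lambda>i f. y i \<otimes>\<^bsub>exterior n\<^esub> f) (sorted_list_of_set S) \<one>\<^bsub>exterior n\<^esub>"

definition monomial_order :: "nat \<Rightarrow> nat set rel \<Rightarrow> bool"
  where "monomial_order n r \<longleftrightarrow>
    strict_linear_order_on (Pow {..<n}) r \<and>
    (\<forall>S. S \<subseteq> {..<n} \<and> S \<noteq> {} \<longrightarrow> ({}, S) \<in> r) \<and>
    (\<forall>S T U. S \<subseteq> {..<n} \<and> T \<subseteq> {..<n} \<and> U \<subseteq> {..<n} \<and> S \<inter> U = {} \<and> T \<inter> U = {} \<and> (S, T) \<in> r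
       \<longrightarrow> (S \<union> U, T \<union> U) \<in> r)"

text \<open>Here \<open>t\<close> is the leading term of the nonzero element \<open>f\<close>.\<close>

definition is_leading_term :: "nat \<Rightarrow> (nat \<Rightarrow> ext) \<Rightarrow> nat set rel \<Rightarrow> ext \<Rightarrow> ext \<Rightarrow> bool"
  where "is_leading_term n y r f t \<longleftrightarrow>
    (\<exists>a M. f = (\<Oplus>\<^bsub>exterior n\<^esub>S\<in>Pow {..<n}. a S \<odot>\<^bsub>exterior n\<^esub> coord_monomial n y S) \<and>
       M \<subseteq> {..<n} \<and> a M \<noteq> 0 \<and>
       (\<forall>S. S \<subseteq> {..<n} \<and> a S \<noteq> 0 \<and> S \<noteq> M \<longrightarrow> (S, M) \<in> r) \<and>
       t = a M \<odot>\<^bsub>exterior n\<^esub> coord_monomial n y M)"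

definition leading_ideal :: "nat \<Rightarrow> (nat \<Rightarrow> ext) \<Rightarrow> nat set rel \<Rightarrow> ext set \<Rightarrow> ext set"
  where "leading_ideal n y r F = Idl\<^bsub>exterior n\<^esub> {t. \<exists>f\<in>F. is_leading_term n y r f t}"

definition groebner_basis :: "nat \<Rightarrow> (nat \<Rightarrow> ext) \<Rightarrow> nat set rel \<Rightarrow> ext set \<Rightarrow> ext set \<Rightarrow> bool"
  where "groebner_basis n y r J G \<longleftrightarrow>
    finite G \<and> G \<subseteq> J \<and> leading_ideal n y r G = leading_ideal n y r J"

text \<open>\<open>g_quadratic n J\<close> says that the quotient of \<open>exterior n\<close> by \<open>J\<close> is G-quadratic.\<close>

definition g_quadratic :: "nat \<Rightarrow> ext set \<Rightarrow> bool"
  where "g_quadratic n J \<longleftrightarrow> graded_ideal n J \<and>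
    (\<exists>y r G. coordinates n y \<and> monomial_order n r \<and>
       groebner_basis n y r J G \<and> G \<subseteq> component (exterior n) 2)"

definition regular_form :: "'b graded_algebra \<Rightarrow> 'b \<Rightarrow> bool"
  where "regular_form M l \<longleftrightarrow>
    {m \<in> carrier M. l \<otimes>\<^bsub>M\<^esub> m = \<zero>\<^bsub>M\<^esub>} = (\<lambda>m. l \<otimes>\<^bsub>M\<^esub> m) ` carrier M"

definition regular_sequence :: "'b graded_algebra \<Rightarrow> 'b list \<Rightarrow> bool"
  where "regular_sequence A ls \<longleftrightarrow> set ls \<subseteq> component A 1 \<and>
    (\<forall>i<length ls. let J = Idl\<^bsub>A\<^esub> (set (take i ls)) in
       regular_form (quotient_algebra A J) (J +>\<^bsub>A\<^esub> (ls ! i)))"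

definition lg_quadratic :: "'b graded_algebra \<Rightarrow> bool"
  where "lg_quadratic R \<longleftrightarrow>
    (\<exists>n J ls. g_quadratic n J \<and>
       (let A = quotient_algebra (exterior n) J in
          regular_sequence A ls \<and> graded_iso R (quotient_algebra A (Idl\<^bsub>A\<^esub> (set ls)))))"


section \<open>Generic quadrics\<close>

text \<open>\<open>r\<close> quadrics in \<open>n\<close> variables, i.e. \<open>r\<close> points of the projective space with homogeneous
  coordinates \<open>\<alpha>_(i,j)\<close>, \<open>i < j < n\<close>, are given by \<open>x\<close>, where \<open>x (k, i, j)\<close> is the coordinate
  \<open>\<alpha>_(i,j)\<close> of the \<open>k\<close>-th point. Polynomials in these coordinates are finitely supported maps from
  exponent vectors to coefficients; the subvarieties of the product of \<open>r\<close> such projective spaces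
  are the zero sets of polynomials homogeneous in each group of variables.\<close>

type_synonym coord = "nat \<times> nat \<times> nat"
type_synonym coord_poly = "(coord \<Rightarrow>\<^sub>0 nat) \<Rightarrow>\<^sub>0 complex"

definition index_pairs :: "nat \<Rightarrow> (nat \<times> nat) set"
  where "index_pairs n = {(i, j). i < j \<and> j < n}"

definition quadric :: "nat \<Rightarrow> (nat \<times> nat \<Rightarrow> complex) \<Rightarrow> ext"
  where "quadric n \<alpha> = (\<Oplus>\<^bsub>exterior n\<^esub>q\<in>index_pairs n.
    \<alpha> q \<odot>\<^bsub>exterior n\<^esub> (ext_gen (fst q) \<otimes>\<^bsub>exterior n\<^esub> ext_gen (snd q)))"

definition poly_value :: "coord_poly \<Rightarrow> (coord \<Rightarrow> complex) \<Rightarrow> complex"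
  where "poly_value p x =
    (\<Sum>m\<in>Poly_Mapping.keys p. Poly_Mapping.lookup p m *
       (\<Prod>v\<in>Poly_Mapping.keys m. x v ^ Poly_Mapping.lookup m v))"

definition multihomogeneous :: "nat \<Rightarrow> nat \<Rightarrow> coord_poly \<Rightarrow> bool"
  where "multihomogeneous n r p \<longleftrightarrow>
    (\<exists>d. \<forall>m\<in>Poly_Mapping.keys p.
       Poly_Mapping.keys m \<subseteq> {..<r} \<times> index_pairs n \<and>
       (\<forall>k<r. (\<Sum>q\<in>index_pairs n. Poly_Mapping.lookup m (k, q)) = d k))"

text \<open>A property holds for \<open>r\<close> generic quadrics if it holds for all \<open>r\<close>-tuples of points outside a
  countable union of proper closed subvarieties, i.e. on a countable intersection of nonempty
  Zariski open sets (every proper closed subvariety lies in a hypersurface, and a constant sequence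
  \<open>P\<close> gives a single open set). Countably many conditions have to be allowed because Koszulness is
  an infinite condition: the vanishing of each single \<open>Tor_i(K, K)_j\<close> is an open condition on the
  algebras with a given Hilbert function, and generic Koszulness refers to all of them at once.
  Over the complex numbers the points that remain are dense.\<close>

definition holds_for_generic_quadrics :: "nat \<Rightarrow> nat \<Rightarrow> ((nat \<Rightarrow> ext) \<Rightarrow> bool) \<Rightarrow> bool"
  where "holds_for_generic_quadrics n r Q \<longleftrightarrow>
    (\<exists>P :: nat \<Rightarrow> coord_poly.
       (\<forall>j. P j \<noteq> 0 \<and> multihomogeneous n r (P j)) \<and>
       (\<forall>x. (\<forall>k<r. \<exists>q\<in>index_pairs n. x (k, q) \<noteq> 0) \<and> (\<forall>j. poly_value (P j) x \<noteq> 0)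
          \<longrightarrow> Q (\<lambda>k. quadric n (\<lambda>q. x (k, q)))))"

end

theory Submission
  imports Defs "HOL-Library.Function_Algebras" "HOL-Library.Multiset"
begin

text \<open>A generic five-dimensional linear system of quadrics in six variables misses the Grassmannian of
  products of linear forms, and its ideal contains all cubics. A tensor of the Koszul dual is
  determined by its coordinates at the words that begin with letters from the first three variables
  and end with letters from the last three: in each degree this is an open condition, which holds
  for the six products of variables from the same half. Counting these words, \<open>(i + 1) 3^i\<close> in
  degree \<open>i\<close>, shows that the linear complex given by the dual tensors is exact.

  A G-quadratic lift \<open>A\<close> along a regular sequence would inherit from \<open>R\<close> that its ideal contains at
  most six independent quadrics, none of them a product of linear forms, and everything in
  codegree three. The leading monomials of its quadrics then form a graph with six edges, without
  leaves and without large independent sets, hence two disjoint triangles, and this configuration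
  is excluded by comparing leading terms.\<close>

text \<open>The quotient has Hilbert series (1 + 3t)^2, that is 1, 6, 9, so a linear resolution must
  have the coefficients of 1 / (1 - 3t)^2 as its ranks; these are the numbers (i + 1) 3^i. The
  quotient by the six products of variables from the same half, the edge ideal of two disjoint
  triangles, has the same Hilbert function and is G-quadratic. Hence the Hilbert function cannot
  decide the question; what does is that the generic ideal contains no nonzero product of linear
  forms. The special quotient is therefore a test point for Koszulness but not for the absence of
  products, which needs a witness of its own. Only upper bounds for spaces of tensors are open
  conditions. The matching lower bounds come from linear systems with equally many equations and
  unknowns, where uniqueness of the solution gives existence. On the negative side the lift may have
  arbitrarily many variables. Properties of the quotient are pulled back one linear form at a time,
  and the surplus variables reappear as isolated vertices of the graph.\<close>

lemma sum_fun_apply: "(\<Sum>i\<in>A. f i) x = (\<Sum>i\<in>A. f i x :: 'b::comm_monoid_add)"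
  by (induction A rule: infinite_finite_induct) auto

section \<open>Homogeneous linear systems\<close>

lemma underdetermined_system:
  fixes M :: "'r \<Rightarrow> 'c \<Rightarrow> 'a::field"
  assumes "finite R" "finite C" "card R < card C"
  shows "\<exists>y. (\<exists>j\<in>C. y j \<noteq> 0) \<and> (\<forall>i\<in>R. (\<Sum>j\<in>C. M i j * y j) = 0)"
  using assms
proof (induction R arbitrary: C M rule: finite_induct)
  case empty
  then obtain j where "j \<in> C" by fastforce
  then show ?case by (intro exI[of _ "\<lambda>_. 1"]) auto
next
  case (insert i R)
  show ?case
  proof (cases "\<forall>j\<in>C. M i j = 0")
    case True
    moreover have "card R < card C" using insert by auto
    ultimately show ?thesis using insert.IH[of C M] insert.prems by auto
  next
    case False
    then obtain c where c: "c \<in> C" "M i c \<noteq> 0" by auto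
    define M' where "M' k j = M k j - M k c * M i j / M i c" for k j
    have "card R < card (C - {c})" using insert c by auto
    with insert.IH[of "C - {c}" M'] insert.prems obtain y
      where y: "\<exists>j\<in>C - {c}. y j \<noteq> 0" "\<And>k. k \<in> R \<Longrightarrow> (\<Sum>j\<in>C - {c}. M' k j * y j) = 0" by auto
    define y' where "y' = y(c := - (\<Sum>j\<in>C - {c}. M i j * y j) / M i c)"
    have split: "(\<Sum>j\<in>C. M k j * y' j) = M k c * y' c + (\<Sum>j\<in>C - {c}. M k j * y j)" for k
      using c insert.prems by (subst sum.remove[of _ c]) (auto simp: y'_def intro!: sum.cong)
    have "(\<Sum>j\<in>C. M i j * y' j) = 0" using c by (subst split) (simp add: y'_def)
    moreover have "(\<Sum>j\<in>C. M k j * y' j) = 0" if "k \<in> R" for k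
    proof -
      have "(\<Sum>j\<in>C - {c}. M' k j * y j)
          = (\<Sum>j\<in>C - {c}. M k j * y j) - M k c / M i c * (\<Sum>j\<in>C - {c}. M i j * y j)"
        by (simp add: M'_def sum_subtractf sum_distrib_left algebra_simps)
      then show ?thesis using y(2)[OF that] by (subst split) (simp add: y'_def)
    qed
    moreover have "\<exists>j\<in>C. y' j \<noteq> 0" using y(1) by (auto simp: y'_def)
    ultimately show ?thesis by blast
  qed
qed

text \<open>The right-hand side is adjoined as the column \<open>None\<close>, which makes the
  homogeneous system underdetermined. Injectivity on the old columns forces the \<open>None\<close>
  coordinate of a nonzero solution to be nonzero, and dividing by it solves the system. This turns
  uniqueness into existence, both for the resolution and for the generation of the cubics.\<close>

lemma square_system_solvable:
  fixes M :: "'r \<Rightarrow> 'c \<Rightarrow> 'a::field"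
  assumes fin: "finite R" "finite C" and card: "card R \<le> card C"
    and triv: "\<And>y. (\<And>i. i \<in> R \<Longrightarrow> (\<Sum>j\<in>C. M i j * y j) = 0) \<Longrightarrow> \<forall>j\<in>C. y j = 0"
  shows "\<exists>y. \<forall>i\<in>R. (\<Sum>j\<in>C. M i j * y j) = b i"
proof -
  define M' where "M' i = case_option (- b i) (M i)" for i
  have C': "(\<Sum>j\<in>insert None (Some ` C). M' i j * y j) = - b i * y None + (\<Sum>j\<in>C. M i j * y (Some j))"
    for i y using fin by (simp add: sum.reindex M'_def)
  have "card R < card (insert None (Some ` C))" using card fin by (simp add: card_image)
  from underdetermined_system[OF fin(1) _ this, of M'] fin(2) obtain y
    where nz: "\<exists>j\<in>insert None (Some ` C). y j \<noteq> 0"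
      and y: "\<forall>i\<in>R. - b i * y None + (\<Sum>j\<in>C. M i j * y (Some j)) = 0"
    unfolding C' by auto
  have "y None \<noteq> 0"
  proof
    assume "y None = 0"
    with y triv[of "\<lambda>j. y (Some j)"] have "\<forall>j\<in>C. y (Some j) = 0" by auto
    with \<open>y None = 0\<close> nz show False by auto
  qed
  then have "(\<Sum>j\<in>C. M i j * (y (Some j) / y None)) = b i" if "i \<in> R" for i
    using y that by (simp add: field_simps flip: sum_divide_distrib)
  then show ?thesis by (intro exI[of _ "\<lambda>j. y (Some j) / y None"]) auto
qed

section \<open>Multihomogeneous functions of the coordinates\<close>

definition monomial_value :: "(coord \<Rightarrow>\<^sub>0 nat) \<Rightarrow> (coord \<Rightarrow> complex) \<Rightarrow> complex"
  where "monomial_value m x = (\<Prod>v\<in>Poly_Mapping.keys m. x v ^ Poly_Mapping.lookup m v)"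

lemma monomial_value_superset:
  assumes "finite A" "Poly_Mapping.keys m \<subseteq> A"
  shows "monomial_value m x = (\<Prod>v\<in>A. x v ^ Poly_Mapping.lookup m v)"
  unfolding monomial_value_def using assms
  by (intro prod.mono_neutral_left) (auto simp: in_keys_iff)

lemma monomial_value_add: "monomial_value (m + m') x = monomial_value m x * monomial_value m' x"
proof -
  let ?A = "Poly_Mapping.keys m \<union> Poly_Mapping.keys m'"
  have "Poly_Mapping.keys (m + m') \<subseteq> ?A" by (rule Poly_Mapping.keys_add)
  then show ?thesis
    by (simp add: monomial_value_superset[of ?A] lookup_add power_add prod.distrib)
qed

lemma poly_value_superset:
  assumes "finite A" "Poly_Mapping.keys p \<subseteq> A"
  shows "poly_value p x = (\<Sum>m\<in>A. Poly_Mapping.lookup p m * monomial_value m x)"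
  unfolding poly_value_def monomial_value_def[symmetric] using assms
  by (intro sum.mono_neutral_left) (auto simp: in_keys_iff)

lemma poly_value_0 [simp]: "poly_value 0 x = 0"
  by (simp add: poly_value_def)

lemma poly_value_single: "poly_value (Poly_Mapping.single m c) x = c * monomial_value m x"
  by (subst poly_value_superset[of "{m}"]) auto

lemma poly_value_add: "poly_value (p + q) x = poly_value p x + poly_value q x"
proof -
  let ?A = "Poly_Mapping.keys p \<union> Poly_Mapping.keys q"
  have "Poly_Mapping.keys (p + q) \<subseteq> ?A" by (rule Poly_Mapping.keys_add)
  then show ?thesis
    by (simp add: poly_value_superset[of ?A] lookup_add sum.distrib ring_distribs)
qed

lemma poly_value_sum: "poly_value (\<Sum>i\<in>A. p i) x = (\<Sum>i\<in>A. poly_value (p i) x)"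
  by (induction A rule: infinite_finite_induct) (auto simp: poly_value_add)

lemma poly_mapping_eq_sum_single:
  "p = (\<Sum>m\<in>Poly_Mapping.keys p. Poly_Mapping.single m (Poly_Mapping.lookup p m))"
  by (rule poly_mapping_eqI)
     (auto simp: lookup_sum lookup_single when_def in_keys_iff)

lemma poly_value_mult: "poly_value (p * q) x = poly_value p x * poly_value q x"
proof -
  have "p * q = (\<Sum>m\<in>Poly_Mapping.keys p. \<Sum>l\<in>Poly_Mapping.keys q.
      Poly_Mapping.single (m + l) (Poly_Mapping.lookup p m * Poly_Mapping.lookup q l))"
    by (subst poly_mapping_eq_sum_single[of p], subst poly_mapping_eq_sum_single[of q])
       (simp add: sum_product mult_single)
  then show ?thesis
    by (simp add: poly_value_sum poly_value_single monomial_value_add poly_value_superset[OF _ order.refl]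
        sum_product algebra_simps)
qed

text \<open>Degrees are integers so that the degrees of a row and of a column of a matrix may be split
  freely; a function of negative degree is zero.\<close>

definition multihom :: "nat \<Rightarrow> nat \<Rightarrow> (nat \<Rightarrow> int) \<Rightarrow> ((coord \<Rightarrow> complex) \<Rightarrow> complex) \<Rightarrow> bool"
  where "multihom n r d F \<longleftrightarrow>
    (\<exists>p. (\<forall>m\<in>Poly_Mapping.keys p. Poly_Mapping.keys m \<subseteq> {..<r} \<times> index_pairs n \<and>
            (\<forall>k<r. int (\<Sum>q\<in>index_pairs n. Poly_Mapping.lookup m (k, q)) = d k)) \<and>
         (\<forall>x. poly_value p x = F x))"

lemma multihom_0: "multihom n r d (\<lambda>_. 0)"
  unfolding multihom_def by (intro exI[of _ 0]) auto

lemma multihom_const: "multihom n r (\<lambda>_. 0) (\<lambda>_. c)"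
  unfolding multihom_def
  by (intro exI[of _ "Poly_Mapping.single 0 c"]) (auto simp: poly_value_single monomial_value_def)

lemma finite_index_pairs: "finite (index_pairs n)"
proof -
  have "index_pairs n \<subseteq> {..<n} \<times> {..<n}" by (auto simp: index_pairs_def)
  then show ?thesis by (rule finite_subset) auto
qed

lemma multihom_var:
  assumes "k < r" "q \<in> index_pairs n"
  shows "multihom n r (\<lambda>i. of_bool (i = k)) (\<lambda>x. x (k, q))"
  unfolding multihom_def using assms finite_index_pairs[of n]
  by (intro exI[of _ "Poly_Mapping.single (Poly_Mapping.single (k, q) 1) 1"])
     (auto simp: poly_value_single monomial_value_def lookup_single when_def simp flip: of_nat_sum
       split: if_splits)

lemma multihom_add:
  assumes "multihom n r d F" "multihom n r d G"
  shows "multihom n r d (\<lambda>x. F x + G x)"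
proof -
  from assms obtain p q where
    p: "\<And>m. m \<in> Poly_Mapping.keys p \<Longrightarrow> Poly_Mapping.keys m \<subseteq> {..<r} \<times> index_pairs n \<and>
            (\<forall>k<r. int (\<Sum>q\<in>index_pairs n. Poly_Mapping.lookup m (k, q)) = d k)" "\<And>x. poly_value p x = F x" and
    q: "\<And>m. m \<in> Poly_Mapping.keys q \<Longrightarrow> Poly_Mapping.keys m \<subseteq> {..<r} \<times> index_pairs n \<and>
            (\<forall>k<r. int (\<Sum>q\<in>index_pairs n. Poly_Mapping.lookup m (k, q)) = d k)" "\<And>x. poly_value q x = G x"
    unfolding multihom_def by metis
  show ?thesis unfolding multihom_def
  proof (intro exI[of _ "p + q"] conjI ballI allI)
    fix x show "poly_value (p + q) x = F x + G x" by (simp add: poly_value_add p q)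
  qed (use p(1) q(1) Poly_Mapping.keys_add[of p q] in blast)+
qed

lemma multihom_mult:
  assumes "multihom n r d F" "multihom n r e G"
  shows "multihom n r (\<lambda>k. d k + e k) (\<lambda>x. F x * G x)"
proof -
  from assms obtain p q where
    p: "\<And>m. m \<in> Poly_Mapping.keys p \<Longrightarrow> Poly_Mapping.keys m \<subseteq> {..<r} \<times> index_pairs n \<and>
            (\<forall>k<r. int (\<Sum>q\<in>index_pairs n. Poly_Mapping.lookup m (k, q)) = d k)" "\<And>x. poly_value p x = F x" and
    q: "\<And>m. m \<in> Poly_Mapping.keys q \<Longrightarrow> Poly_Mapping.keys m \<subseteq> {..<r} \<times> index_pairs n \<and>
            (\<forall>k<r. int (\<Sum>q\<in>index_pairs n. Poly_Mapping.lookup m (k, q)) = e k)" "\<And>x. poly_value q x = G x"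
    unfolding multihom_def by metis
  show ?thesis unfolding multihom_def
  proof (intro exI[of _ "p * q"] conjI ballI)
    show "\<forall>x. poly_value (p * q) x = F x * G x" by (simp add: poly_value_mult p q)
    fix m assume "m \<in> Poly_Mapping.keys (p * q)"
    then obtain a b where ab: "m = a + b" "a \<in> Poly_Mapping.keys p" "b \<in> Poly_Mapping.keys q"
      using keys_mult[of p q] by blast
    show "Poly_Mapping.keys m \<subseteq> {..<r} \<times> index_pairs n"
      using Poly_Mapping.keys_add[of a b] p(1)[OF ab(2)] q(1)[OF ab(3)] unfolding ab(1) by blast
    show "\<forall>k<r. int (\<Sum>q\<in>index_pairs n. Poly_Mapping.lookup m (k, q)) = d k + e k"
      using p(1)[OF ab(2)] q(1)[OF ab(3)] by (simp add: ab(1) lookup_add sum.distrib)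
  qed
qed

lemma multihom_cmult: "multihom n r d F \<Longrightarrow> multihom n r d (\<lambda>x. c * F x)"
  using multihom_mult[OF multihom_const[of n r c], of d F] by simp

lemma multihom_uminus: "multihom n r d F \<Longrightarrow> multihom n r d (\<lambda>x. - F x)"
  using multihom_cmult[of n r d F "-1"] by simp

lemma multihom_diff: "multihom n r d F \<Longrightarrow> multihom n r d G \<Longrightarrow> multihom n r d (\<lambda>x. F x - G x)"
  using multihom_add[OF _ multihom_uminus, of n r d F G] by simp

lemma multihom_sum:
  assumes "\<And>i. i \<in> A \<Longrightarrow> multihom n r d (F i)"
  shows "multihom n r d (\<lambda>x. \<Sum>i\<in>A. F i x)"
  using assms
  by (induction A rule: infinite_finite_induct) (auto intro: multihom_0 multihom_add)

section \<open>Injectivity of a matrix of multihomogeneous functions as an open condition\<close>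

definition trivial_kernel :: "'r set \<Rightarrow> 'c set \<Rightarrow> ('r \<Rightarrow> 'c \<Rightarrow> complex) \<Rightarrow> bool"
  where "trivial_kernel R C M \<longleftrightarrow>
    (\<forall>y. (\<forall>i\<in>R. (\<Sum>j\<in>C. M i j * y j) = 0) \<longrightarrow> (\<forall>j\<in>C. y j = 0))"

lemma trivial_kernelD:
  "trivial_kernel R C M \<Longrightarrow> (\<And>i. i \<in> R \<Longrightarrow> (\<Sum>j\<in>C. M i j * y j) = 0) \<Longrightarrow> j \<in> C \<Longrightarrow> y j = 0"
  unfolding trivial_kernel_def by blast

text \<open>Elimination of the pivot column \<open>c\<close> by means of the row \<open>i\<close>, without divisions.\<close>

lemma trivial_kernel_pivot:
  assumes C: "finite C" "c \<notin> C" and i: "i \<in> R" and piv: "M i c \<noteq> 0"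
  shows "trivial_kernel R (insert c C) M \<longleftrightarrow>
    trivial_kernel R C (\<lambda>k j. M i c * M k j - M k c * M i j)" (is "?L \<longleftrightarrow> ?R")
proof -
  have red: "(\<Sum>j\<in>C. (M i c * M k j - M k c * M i j) * y j)
      = M i c * (\<Sum>j\<in>C. M k j * y j) - M k c * (\<Sum>j\<in>C. M i j * y j)" for k y
    by (simp add: sum_subtractf sum_distrib_left algebra_simps)
  show ?thesis
  proof
    assume L: ?L
    show ?R unfolding trivial_kernel_def red
    proof (intro allI impI)
      fix y assume y: "\<forall>k\<in>R. M i c * (\<Sum>j\<in>C. M k j * y j) - M k c * (\<Sum>j\<in>C. M i j * y j) = 0"
      define y' where "y' = y(c := - (\<Sum>j\<in>C. M i j * y j) / M i c)"
      have [simp]: "(\<Sum>j\<in>C. M k j * y' j) = (\<Sum>j\<in>C. M k j * y j)" for k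
        using C by (intro sum.cong) (auto simp: y'_def)
      have "(\<Sum>j\<in>insert c C. M k j * y' j) = 0" if "k \<in> R" for k
        using C piv y that by (simp, simp add: y'_def divide_simps) (simp add: algebra_simps)
      from trivial_kernelD[OF L this] show "\<forall>j\<in>C. y j = 0"
        using C by (metis fun_upd_other insertCI y'_def)
    qed
  next
    assume R: ?R
    show ?L unfolding trivial_kernel_def
    proof (intro allI impI)
      fix y assume y: "\<forall>k\<in>R. (\<Sum>j\<in>insert c C. M k j * y j) = 0"
      have eq: "(\<Sum>j\<in>C. M k j * y j) = - M k c * y c" if "k \<in> R" for k
        using y C that by (simp add: add_eq_0_iff)
      have 0: "\<forall>j\<in>C. y j = 0"
        using R eq i unfolding trivial_kernel_def red by auto
      with eq[OF i] piv have "y c = 0" by auto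
      with 0 show "\<forall>j\<in>insert c C. y j = 0" by auto
    qed
  qed
qed

text \<open>Elimination with pivots chosen at \<open>x0\<close>. \<open>F\<close> is the product of
  the pivots met on the way, so it is nonzero at \<open>x0\<close>, and wherever it is nonzero the
  same elimination succeeds. Splitting the degree of an entry into a row part and a column part
  gives both products in a new entry the same multidegree, and the splitting survives the
  step.\<close>

lemma trivial_kernel_open:
  fixes M :: "'r \<Rightarrow> 'c \<Rightarrow> (coord \<Rightarrow> complex) \<Rightarrow> complex"
  assumes "finite C"
    and "\<And>i j. i \<in> R \<Longrightarrow> j \<in> C \<Longrightarrow> multihom n r (\<lambda>k. d i k + e j k) (M i j)"
    and "trivial_kernel R C (\<lambda>i j. M i j x0)"
  shows "\<exists>F dF. multihom n r dF F \<and> F x0 \<noteq> 0 \<and>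
    (\<forall>x. F x \<noteq> 0 \<longrightarrow> trivial_kernel R C (\<lambda>i j. M i j x))"
  using assms
proof (induction C arbitrary: M d rule: finite_induct)
  case empty
  then show ?case
    by (intro exI[of _ "\<lambda>_. 1"] exI[of _ "\<lambda>_. 0"]) (auto simp: multihom_const trivial_kernel_def)
next
  case (insert c C)
  \<comment> \<open>A column vanishing at \<open>x0\<close> would put its unit vector into the
    kernel.\<close>
  have "\<exists>i\<in>R. M i c x0 \<noteq> 0"
  proof (rule ccontr)
    assume neg: "\<not> ?thesis"
    have "(\<Sum>j\<in>insert c C. M i j x0 * of_bool (j = c)) = 0" if "i \<in> R" for i
      using neg that by (intro sum.neutral) auto
    from trivial_kernelD[OF insert.prems(2) this, of c] show False by simp
  qed
  then obtain i where i: "i \<in> R" "M i c x0 \<noteq> 0" by blast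
  define M' where "M' k j x = M i c x * M k j x - M k c x * M i j x" for k j x
  have pivot: "trivial_kernel R (insert c C) (\<lambda>i j. M i j x) \<longleftrightarrow> trivial_kernel R C (\<lambda>i j. M' i j x)"
    if "M i c x \<noteq> 0" for x
    unfolding M'_def
    using trivial_kernel_pivot[OF insert.hyps i(1), of "\<lambda>i j. M i j x"] that by simp
  have "multihom n r (\<lambda>l. (d i l + e c l + d k l) + e j l) (M' k j)" if "k \<in> R" "j \<in> C" for k j
  proof -
    have "multihom n r (\<lambda>l. (d i l + e c l) + (d k l + e j l)) (\<lambda>x. M i c x * M k j x)"
      using that i by (intro multihom_mult insert.prems(1)) auto
    moreover have "multihom n r (\<lambda>l. (d k l + e c l) + (d i l + e j l)) (\<lambda>x. M k c x * M i j x)"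
      using that i by (intro multihom_mult insert.prems(1)) auto
    ultimately show ?thesis unfolding M'_def by (intro multihom_diff) (simp_all add: ac_simps)
  qed
  from insert.IH[of "\<lambda>k l. d i l + e c l + d k l" M', OF this] insert.prems(2) pivot[OF i(2)] obtain F dF where
    F: "multihom n r dF F" "F x0 \<noteq> 0" "\<And>x. F x \<noteq> 0 \<Longrightarrow> trivial_kernel R C (\<lambda>i j. M' i j x)"
    by blast
  have "multihom n r (\<lambda>l. (d i l + e c l) + dF l) (\<lambda>x. M i c x * F x)"
    using i by (intro multihom_mult F insert.prems(1)) auto
  with F i(2) pivot show ?case
    by (intro exI[of _ "\<lambda>x. M i c x * F x"] exI[of _ "\<lambda>l. (d i l + e c l) + dF l"]) auto
qed

lemma trivial_kernel_generic:
  fixes M :: "'r \<Rightarrow> 'c \<Rightarrow> (coord \<Rightarrow> complex) \<Rightarrow> complex"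
  assumes "finite C"
    and "\<And>i j. i \<in> R \<Longrightarrow> j \<in> C \<Longrightarrow> multihom n r (\<lambda>k. d i k + e j k) (M i j)"
    and "trivial_kernel R C (\<lambda>i j. M i j x0)"
  shows "\<exists>p. p \<noteq> 0 \<and> multihomogeneous n r p \<and>
    (\<forall>x. poly_value p x \<noteq> 0 \<longrightarrow> trivial_kernel R C (\<lambda>i j. M i j x))"
proof -
  obtain F dF where F: "multihom n r dF F" "F x0 \<noteq> 0"
      "\<And>x. F x \<noteq> 0 \<Longrightarrow> trivial_kernel R C (\<lambda>i j. M i j x)"
    using trivial_kernel_open[OF assms] by blast
  from F(1) obtain p where p: "\<forall>m\<in>Poly_Mapping.keys p. Poly_Mapping.keys m \<subseteq> {..<r} \<times> index_pairs n \<and>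
            (\<forall>k<r. int (\<Sum>q\<in>index_pairs n. Poly_Mapping.lookup m (k, q)) = dF k)"
      "\<And>x. poly_value p x = F x"
    unfolding multihom_def by blast
  have "p \<noteq> 0" using p(2)[of x0] F(2) by auto
  moreover have "multihomogeneous n r p"
    unfolding multihomogeneous_def
  \<comment> \<open>Passing to \<open>nat\<close> loses nothing: any monomial of \<open>p\<close>
    shows that \<open>dF k\<close> is a natural number.\<close>
  proof (intro exI[of _ "\<lambda>k. nat (dF k)"] ballI conjI allI impI)
    fix m k assume "m \<in> Poly_Mapping.keys p" "k < r"
    with p(1) have "int (\<Sum>q\<in>index_pairs n. Poly_Mapping.lookup m (k, q)) = dF k" by blast
    then show "(\<Sum>q\<in>index_pairs n. Poly_Mapping.lookup m (k, q)) = nat (dF k)" by linarith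
  qed (use p(1) in blast)
  ultimately show ?thesis using p(2) F(3) by auto
qed

section \<open>Generic conditions\<close>

lemma lessThan_6: "{..<6::nat} = {0, 1, 2, 3, 4, 5}"
  by auto

section \<open>Linear systems of quadrics that miss the Grassmannian\<close>

text \<open>A bilinear form whose diagonal is half the coefficient of e_i e_j e_k e_l in the square
  of a quadric. These diagonal values all vanish exactly for products of two linear forms. Keeping
  two arguments lets the relation for a combination of quadrics expand as a double sum.\<close>

definition plucker_form :: "(nat \<times> nat \<Rightarrow> complex) \<Rightarrow> (nat \<times> nat \<Rightarrow> complex) \<Rightarrow> nat \<Rightarrow> nat \<Rightarrow> nat \<Rightarrow> nat \<Rightarrow> complex"
  where "plucker_form \<alpha> \<beta> i j k l = \<alpha> (i, j) * \<beta> (k, l) - \<alpha> (i, k) * \<beta> (j, l) + \<alpha> (i, l) * \<beta> (j, k)"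

text \<open>The Grassmannian has dimension 8 in P^14, and 5 + 8 < 14, so a generic five-dimensional
  linear subspace misses it. Linear independence of the six quadrics is included, since a linear
  relation would satisfy all Pluecker relations.\<close>

definition plucker_anisotropic :: "(coord \<Rightarrow> complex) \<Rightarrow> bool"
  where "plucker_anisotropic x \<longleftrightarrow>
    (\<forall>y. (\<forall>i j k l. i < j \<and> j < k \<and> k < l \<and> l < 6 \<longrightarrow>
            (let \<alpha> = (\<lambda>q. \<Sum>a<6. y a * x (a, q)) in plucker_form \<alpha> \<alpha> i j k l = 0)) \<longrightarrow>
         (\<forall>a<6. y a = 0))"

text \<open>Multisets of size four are the monomials of degree four in the six coefficients y. By
  the Nullstellensatz, absence of a nontrivial common zero means that the relations generate all
  forms of some degree; degree four works at the witness below.\<close>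

definition quartics :: "nat multiset set"
  where "quartics = {s. size s = 4 \<and> set_mset s \<subseteq> {..<6}}"

lemma finite_quartics: "finite quartics"
proof (rule finite_subset)
  show "quartics \<subseteq> mset ` {xs. set xs \<subseteq> {..<6} \<and> length xs = 4}"
  proof
    fix s assume s: "s \<in> quartics"
    obtain xs where "s = mset xs" using ex_mset[of s] by metis
    with s show "s \<in> mset ` {xs. set xs \<subseteq> {..<6} \<and> length xs = 4}"
      by (intro image_eqI[of _ _ xs]) (simp_all add: quartics_def)
  qed
  show "finite (mset ` {xs. set xs \<subseteq> {..<6::nat} \<and> length xs = 4})"
    by (intro finite_imageI finite_lists_length_eq) simp
qed

type_synonym plucker_row = "(nat \<times> nat \<times> nat \<times> nat) \<times> nat \<times> nat"

definition plucker_rows :: "plucker_row set"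
  where "plucker_rows = {((i, j, k, l), m, m'). i < j \<and> j < k \<and> k < l \<and> l < 6 \<and> m < 6 \<and> m' < 6}"

text \<open>The rows say that a linear functional on quartic forms in \<open>y\<close> vanishes on all products of
  \<open>y_m y_m'\<close> with a Pluecker relation of \<open>\<Sum>a. y_a f_a\<close>. Having trivial kernel is an open condition,
  and evaluation at a common zero \<open>y\<close> of the Pluecker relations belongs to the kernel.\<close>

fun plucker_matrix :: "plucker_row \<Rightarrow> nat multiset \<Rightarrow> (coord \<Rightarrow> complex) \<Rightarrow> complex"
  where "plucker_matrix ((i, j, k, l), m, m') s x =
    (\<Sum>a<6. \<Sum>b<6. of_bool ({#m, m', a, b#} = s) *
      plucker_form (\<lambda>q. x (a, q)) (\<lambda>q. x (b, q)) i j k l)"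

lemma plucker_matrix_row:
  assumes "((i, j, k, l), m, m') \<in> plucker_rows"
  shows "(\<Sum>s\<in>quartics. plucker_matrix ((i, j, k, l), m, m') s x * Y s) =
    (\<Sum>a<6. \<Sum>b<6. plucker_form (\<lambda>q. x (a, q)) (\<lambda>q. x (b, q)) i j k l * Y {#m, m', a, b#})"
proof -
  have "(\<Sum>s\<in>quartics. plucker_matrix ((i, j, k, l), m, m') s x * Y s) =
     (\<Sum>a<6. \<Sum>b<6. \<Sum>s\<in>quartics. of_bool ({#m, m', a, b#} = s) *
      plucker_form (\<lambda>q. x (a, q)) (\<lambda>q. x (b, q)) i j k l * Y s)"
    unfolding plucker_matrix.simps sum_distrib_right
    by (rule trans[OF sum.swap], rule sum.cong[OF refl], rule sum.swap)
  also have "\<dots> = (\<Sum>a<6. \<Sum>b<6. plucker_form (\<lambda>q. x (a, q)) (\<lambda>q. x (b, q)) i j k l * Y {#m, m', a, b#})"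
  proof (intro sum.cong refl)
    fix a b :: nat assume "a \<in> {..<6}" "b \<in> {..<6}"
    then have "{#m, m', a, b#} \<in> quartics" using assms by (auto simp: quartics_def plucker_rows_def)
    then show "(\<Sum>s\<in>quartics. of_bool ({#m, m', a, b#} = s) *
      plucker_form (\<lambda>q. x (a, q)) (\<lambda>q. x (b, q)) i j k l * Y s) =
      plucker_form (\<lambda>q. x (a, q)) (\<lambda>q. x (b, q)) i j k l * Y {#m, m', a, b#}"
      using finite_quartics
      by (subst sum.remove[of _ "{#m, m', a, b#}"]) (auto intro!: sum.neutral)
  qed
  finally show ?thesis .
qed

lemma plucker_anisotropicI:
  assumes "trivial_kernel plucker_rows quartics (\<lambda>i s. plucker_matrix i s x)"
  shows "plucker_anisotropic x"
  unfolding plucker_anisotropic_def Let_def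
proof (intro allI impI)
  fix y :: "nat \<Rightarrow> complex" and a :: nat
  assume pl: "\<forall>i j k l. i < j \<and> j < k \<and> k < l \<and> l < 6 \<longrightarrow>
      plucker_form (\<lambda>q. \<Sum>a<6. y a * x (a, q)) (\<lambda>q. \<Sum>a<6. y a * x (a, q)) i j k l = 0"
    and a: "a < 6"
  define Y where "Y s = (\<Prod>c\<in>#s. y c)" for s
  have form: "plucker_form (\<lambda>q. \<Sum>a<6. y a * x (a, q)) (\<lambda>q. \<Sum>a<6. y a * x (a, q)) i j k l
      = (\<Sum>a<6. \<Sum>b<6. plucker_form (\<lambda>q. x (a, q)) (\<lambda>q. x (b, q)) i j k l * (y a * y b))" for i j k l
    unfolding plucker_form_def sum_product
    by (simp add: sum_subtractf sum.distrib ring_distribs mult_ac)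
  have "(\<Sum>s\<in>quartics. plucker_matrix r s x * Y s) = 0" if r: "r \<in> plucker_rows" for r
  proof -
    obtain i j k l m m' where [simp]: "r = ((i, j, k, l), m, m')" by (metis prod.exhaust)
    have "(\<Sum>s\<in>quartics. plucker_matrix r s x * Y s) = y m * y m' *
       plucker_form (\<lambda>q. \<Sum>a<6. y a * x (a, q)) (\<lambda>q. \<Sum>a<6. y a * x (a, q)) i j k l"
      using plucker_matrix_row[of i j k l m m' x Y] r
      by (simp add: form sum_distrib_left Y_def mult_ac)
    then show ?thesis using pl r by (auto simp: plucker_rows_def)
  qed
  from trivial_kernelD[OF assms this, of "{#a, a, a, a#}"] a show "y a = 0"
    by (auto simp: quartics_def Y_def)
qed

text \<open>Give e_i e_j with i < j the weight i + j; the quadrics are differences of two monomials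
  of equal weight. If a and b have least indices p and q, which may be assumed distinct, then the
  only term of weight p + q in a b is e_p e_q. So the coefficients of a b in that weight do not add
  up to 0, whereas for combinations of these quadrics they do in every weight. This is why the
  system contains no product; the proof below makes it effective in degree four.\<close>

definition anisotropic_point :: "coord \<Rightarrow> complex"
  where "anisotropic_point v =
    (if v \<in> {(0, 0, 3), (1, 0, 4), (2, 0, 5), (3, 1, 4), (4, 1, 5), (5, 2, 5)} then 1
     else if v \<in> {(0, 1, 2), (1, 1, 3), (2, 2, 3), (3, 2, 3), (4, 2, 4), (5, 3, 4)} then - 1 else 0)"

lemma eq_if_diff: "c = 0 \<Longrightarrow> a - b = c \<Longrightarrow> a = b" for a b c :: complex
  by simp

lemma eq_if_minus_diff: "c = 0 \<Longrightarrow> a - b = - c \<Longrightarrow> a = b" for a b c :: complex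
  by simp

lemma sum_anisotropic_point:
  fixes G :: "nat \<Rightarrow> complex"
  shows
    "(\<Sum>a<6. anisotropic_point (a, 0, 1) * G a) = 0"
    "(\<Sum>a<6. anisotropic_point (a, 0, 2) * G a) = 0"
    "(\<Sum>a<6. anisotropic_point (a, 0, 3) * G a) = G 0"
    "(\<Sum>a<6. anisotropic_point (a, 0, 4) * G a) = G 1"
    "(\<Sum>a<6. anisotropic_point (a, 0, 5) * G a) = G 2"
    "(\<Sum>a<6. anisotropic_point (a, 1, 2) * G a) = - G 0"
    "(\<Sum>a<6. anisotropic_point (a, 1, 3) * G a) = - G 1"
    "(\<Sum>a<6. anisotropic_point (a, 1, 4) * G a) = G 3"
    "(\<Sum>a<6. anisotropic_point (a, 1, 5) * G a) = G 4"
    "(\<Sum>a<6. anisotropic_point (a, 2, 3) * G a) = - G 2 - G 3"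
    "(\<Sum>a<6. anisotropic_point (a, 2, 4) * G a) = - G 4"
    "(\<Sum>a<6. anisotropic_point (a, 2, 5) * G a) = G 5"
    "(\<Sum>a<6. anisotropic_point (a, 3, 4) * G a) = - G 5"
    "(\<Sum>a<6. anisotropic_point (a, 3, 5) * G a) = 0"
    "(\<Sum>a<6. anisotropic_point (a, 4, 5) * G a) = 0"
  by (simp_all add: lessThan_6 anisotropic_point_def)

text \<open>The quadrics \<open>e_0 e_3 - e_1 e_2\<close>, \<open>e_0 e_4 - e_1 e_3\<close>, \<dots> are those of the kernel of
  \<open>e_i e_j \<mapsto> t^(i + j)\<close>. In the quotient by the Pluecker relations every quadratic form is a
  combination of the products of \<open>std\<close> below.\<close>

lemma trivial_kernel_anisotropic_point:
  "trivial_kernel plucker_rows quartics (\<lambda>i s. plucker_matrix i s anisotropic_point)"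
  unfolding trivial_kernel_def
proof (intro allI impI ballI)
  fix Y :: "nat multiset \<Rightarrow> complex" and s
  assume Y: "\<forall>i\<in>plucker_rows. (\<Sum>s\<in>quartics. plucker_matrix i s anisotropic_point * Y s) = 0"
    and s: "s \<in> quartics"
  define P where "P q G = (\<Sum>a<6. anisotropic_point (a, q) * G a)" for q and G :: "nat \<Rightarrow> complex"
  define Z where "Z m m' a b = Y {#m, m', a, b#}" for m m' a b
  have Zc: "Z m m' a b = Z m m' b a" for m m' a b
    unfolding Z_def by (simp add: add_mset_commute)
  have Y': "P (i, j) (\<lambda>a. P (k, l) (Z m m' a)) - P (i, k) (\<lambda>a. P (j, l) (Z m m' a))
      + P (i, l) (\<lambda>a. P (j, k) (Z m m' a)) = 0"
    if "i < j \<and> j < k \<and> k < l \<and> l < 6" "m < 6" "m' < 6" for i j k l m m'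
  proof -
    have r: "((i, j, k, l), m, m') \<in> plucker_rows" using that by (simp add: plucker_rows_def)
    from bspec[OF Y r] have "(\<Sum>a<6. \<Sum>b<6. plucker_form (\<lambda>q. anisotropic_point (a, q)) (\<lambda>q. anisotropic_point (b, q)) i j k l
      * Y {#m, m', a, b#}) = 0"
      unfolding plucker_matrix_row[OF r] .
    then show ?thesis
      by (simp add: P_def Z_def plucker_form_def ring_distribs sum.distrib sum_subtractf sum_distrib_left mult.assoc)
  qed
  note P = sum_anisotropic_point[folded P_def]
  \<comment> \<open>One relation for each of the fifteen choices of i < j < k < l. Together they
    express every \<open>Z m m' a b\<close> through the six pairs collected in
    \<open>std\<close>.\<close>
  have E1: "Z m m' 0 0 = 0" if m: "m < 6" "m' < 6" for m m'
  proof -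
    have "0 < (1::nat) \<and> 1 < (2::nat) \<and> 2 < (3::nat) \<and> 3 < (6::nat)" by simp
    note raw = Y'[OF this m, unfolded P]
    show ?thesis by (rule eq_if_minus_diff[OF raw]) (simp del: One_nat_def add: algebra_simps)
  qed
  have E2: "Z m m' 0 1 = 0" if m: "m < 6" "m' < 6" for m m'
  proof -
    have "0 < (1::nat) \<and> 1 < (2::nat) \<and> 2 < (4::nat) \<and> 4 < (6::nat)" by simp
    note raw = Y'[OF this m, unfolded P]
    show ?thesis by (rule eq_if_minus_diff[OF raw]) (simp del: One_nat_def add: Zc[of m m' 1 0] algebra_simps)
  qed
  have E3: "Z m m' 0 2 = 0" if m: "m < 6" "m' < 6" for m m'
  proof -
    have "0 < (1::nat) \<and> 1 < (2::nat) \<and> 2 < (5::nat) \<and> 5 < (6::nat)" by simp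
    note raw = Y'[OF this m, unfolded P]
    show ?thesis by (rule eq_if_minus_diff[OF raw]) (simp del: One_nat_def add: Zc[of m m' 2 0] algebra_simps)
  qed
  have E4: "Z m m' 0 3 + Z m m' 1 1 = 0" if m: "m < 6" "m' < 6" for m m'
  proof -
    have "0 < (1::nat) \<and> 1 < (3::nat) \<and> 3 < (4::nat) \<and> 4 < (6::nat)" by simp
    note raw = Y'[OF this m, unfolded P]
    show ?thesis by (rule eq_if_minus_diff[OF raw]) (simp del: One_nat_def add: algebra_simps)
  qed
  have E5: "Z m m' 0 4 + Z m m' 1 2 = 0" if m: "m < 6" "m' < 6" for m m'
  proof -
    have "0 < (1::nat) \<and> 1 < (3::nat) \<and> 3 < (5::nat) \<and> 5 < (6::nat)" by simp
    note raw = Y'[OF this m, unfolded P]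
    show ?thesis by (rule eq_if_minus_diff[OF raw]) (simp del: One_nat_def add: Zc[of m m' 2 1] algebra_simps)
  qed
  have E6: "Z m m' 1 4 = Z m m' 2 3" if m: "m < 6" "m' < 6" for m m'
  proof -
    have "0 < (1::nat) \<and> 1 < (4::nat) \<and> 4 < (5::nat) \<and> 5 < (6::nat)" by simp
    note raw = Y'[OF this m, unfolded P]
    show ?thesis by (rule eq_if_minus_diff[OF raw]) (simp del: One_nat_def add: algebra_simps)
  qed
  have E7: "Z m m' 0 4 = Z m m' 1 2 + Z m m' 1 3" if m: "m < 6" "m' < 6" for m m'
  proof -
    have "0 < (2::nat) \<and> 2 < (3::nat) \<and> 3 < (4::nat) \<and> 4 < (6::nat)" by simp
    note raw = Y'[OF this m, unfolded P]
    show ?thesis by (rule eq_if_diff[OF raw]) (simp del: One_nat_def add: algebra_simps)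
  qed
  have E8: "Z m m' 0 5 + Z m m' 2 2 + Z m m' 2 3 = 0" if m: "m < 6" "m' < 6" for m m'
  proof -
    have "0 < (2::nat) \<and> 2 < (3::nat) \<and> 3 < (5::nat) \<and> 5 < (6::nat)" by simp
    note raw = Y'[OF this m, unfolded P]
    show ?thesis by (rule eq_if_minus_diff[OF raw]) (simp del: One_nat_def add: algebra_simps)
  qed
  have E9: "Z m m' 1 5 + Z m m' 2 4 = 0" if m: "m < 6" "m' < 6" for m m'
  proof -
    have "0 < (2::nat) \<and> 2 < (4::nat) \<and> 4 < (5::nat) \<and> 5 < (6::nat)" by simp
    note raw = Y'[OF this m, unfolded P]
    show ?thesis by (rule eq_if_minus_diff[OF raw]) (simp del: One_nat_def add: algebra_simps)
  qed
  have E10: "Z m m' 2 5 = 0" if m: "m < 6" "m' < 6" for m m'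
  proof -
    have "0 < (3::nat) \<and> 3 < (4::nat) \<and> 4 < (5::nat) \<and> 5 < (6::nat)" by simp
    note raw = Y'[OF this m, unfolded P]
    show ?thesis by (rule eq_if_minus_diff[OF raw]) (simp del: One_nat_def add: algebra_simps)
  qed
  have E11: "Z m m' 0 5 = Z m m' 1 4 + Z m m' 2 3 + Z m m' 3 3" if m: "m < 6" "m' < 6" for m m'
  proof -
    have "1 < (2::nat) \<and> 2 < (3::nat) \<and> 3 < (4::nat) \<and> 4 < (6::nat)" by simp
    note raw = Y'[OF this m, unfolded P]
    show ?thesis by (rule eq_if_diff[OF raw]) (simp del: One_nat_def add: Zc[of m m' 3 2] algebra_simps)
  qed
  have E12: "Z m m' 1 5 = Z m m' 2 4 + Z m m' 3 4" if m: "m < 6" "m' < 6" for m m'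
  proof -
    have "1 < (2::nat) \<and> 2 < (3::nat) \<and> 3 < (5::nat) \<and> 5 < (6::nat)" by simp
    note raw = Y'[OF this m, unfolded P]
    show ?thesis by (rule eq_if_diff[OF raw]) (simp del: One_nat_def add: Zc[of m m' 4 2] Zc[of m m' 4 3] algebra_simps)
  qed
  have E13: "Z m m' 3 5 + Z m m' 4 4 = 0" if m: "m < 6" "m' < 6" for m m'
  proof -
    have "1 < (2::nat) \<and> 2 < (4::nat) \<and> 4 < (5::nat) \<and> 5 < (6::nat)" by simp
    note raw = Y'[OF this m, unfolded P]
    show ?thesis by (rule eq_if_minus_diff[OF raw]) (simp del: One_nat_def add: algebra_simps)
  qed
  have E14: "Z m m' 4 5 = 0" if m: "m < 6" "m' < 6" for m m'
  proof -
    have "1 < (3::nat) \<and> 3 < (4::nat) \<and> 4 < (5::nat) \<and> 5 < (6::nat)" by simp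
    note raw = Y'[OF this m, unfolded P]
    show ?thesis by (rule eq_if_minus_diff[OF raw]) (simp del: One_nat_def add: algebra_simps)
  qed
  have E15: "Z m m' 5 5 = 0" if m: "m < 6" "m' < 6" for m m'
  proof -
    have "2 < (3::nat) \<and> 3 < (4::nat) \<and> 4 < (5::nat) \<and> 5 < (6::nat)" by simp
    note raw = Y'[OF this m, unfolded P]
    show ?thesis by (rule eq_if_minus_diff[OF raw]) (simp del: One_nat_def add: algebra_simps)
  qed
  have Zs: "Z a b c d = Z c d a b" and Zp: "Z a b c d = Z b d a c" for a b c d
    unfolding Z_def by (simp_all add: add_mset_commute)
  \<comment> \<open>Each of these nineteen quartics is divisible by y_0^2, y_0 y_1, y_4 y_5 or
    y_5^2, whose multiples are annihilated by the relations just derived.\<close>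
  have std0:
    "Z 0 3 0 3 = 0"
    "Z 0 3 0 4 = 0"
    "Z 0 3 0 5 = 0"
    "Z 0 3 1 4 = 0"
    "Z 0 3 1 5 = 0"
    "Z 0 4 0 4 = 0"
    "Z 0 4 0 5 = 0"
    "Z 0 4 1 4 = 0"
    "Z 0 4 1 5 = 0"
    "Z 0 4 3 5 = 0"
    "Z 0 5 0 5 = 0"
    "Z 0 5 1 4 = 0"
    "Z 0 5 1 5 = 0"
    "Z 0 5 3 5 = 0"
    "Z 1 4 1 5 = 0"
    "Z 1 4 3 5 = 0"
    "Z 1 5 1 5 = 0"
    "Z 1 5 3 5 = 0"
    "Z 3 5 3 5 = 0"
    using E1[of 3 3] E1[of 3 4] E1[of 3 5] E1[of 4 4] E1[of 4 5] E1[of 5 5] E2[of 3 4] E2[of 3 5] E2[of 4 4] E2[of 4 5] E2[of 5 5] E14[of 0 3] E14[of 1 1] E14[of 1 3] E15[of 0 3] E15[of 1 1] E15[of 1 3] E15[of 3 3]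
    by (simp_all add: Z_def add_mset_commute)
  \<comment> \<open>Two products of standard pairs are left, y_0 y_3^2 y_5 and y_1^2 y_4^2. The
    first comes from the relations for y_3^2 multiplied by y_0 y_5; the second is reduced to it
    through y_0 y_3 y_4^2.\<close>
  have "Z 0 5 3 3 = 0"
    using E6[of 0 5] E11[of 0 5] E1[of 5 5] E2[of 4 5] by (simp add: Z_def add_mset_commute)
  then have std1: "Z 0 3 3 5 = 0" by (simp add: Z_def add_mset_commute)
  then have "Z 0 3 4 4 = 0" using E13[of 0 3] by simp
  then have std2: "Z 1 4 1 4 = 0" using E4[of 4 4] by (simp add: Z_def add_mset_commute)
  define std where "std = {(0::nat, 3::nat), (0, 4), (0, 5), (1, 4), (1, 5), (3, 5)}"
  have red: "Z m m' a b = 0"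
    if m: "m < 6" "m' < 6" and 0: "\<And>p q. (p, q) \<in> std \<Longrightarrow> Z m m' p q = 0" and ab: "a < 6" "b < 6" for m m' a b
  proof -
    have "Z m m' 0 3 = 0" "Z m m' 0 4 = 0" "Z m m' 0 5 = 0" "Z m m' 1 4 = 0" "Z m m' 1 5 = 0" "Z m m' 3 5 = 0"
      using 0 by (simp_all add: std_def)
    then have *: "Z m m' a b = 0" if "a \<le> b" "a \<in> {0, 1, 2, 3, 4, 5}" "b \<in> {0, 1, 2, 3, 4, 5}" for a b
      using that E1[OF m] E2[OF m] E3[OF m] E4[OF m] E5[OF m] E6[OF m] E7[OF m] E8[OF m] E9[OF m] E10[OF m] E11[OF m] E12[OF m] E13[OF m] E14[OF m] E15[OF m]
      by (auto simp: add_eq_0_iff)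
    have "a \<in> {0, 1, 2, 3, 4, 5}" "b \<in> {0, 1, 2, 3, 4, 5}" using ab by auto
    then show ?thesis using *[of a b] *[of b a] Zc[of m m' a b] by (cases "a \<le> b") auto
  qed
  have std3: "Z p q p' q' = 0" if "(p, q) \<in> std" "(p', q') \<in> std" for p q p' q'
    using that std0 std1 std2 Zs unfolding std_def by auto
  \<comment> \<open>The reduction is applied to one pair of letters and then, after exchanging the
    pairs, to the other.\<close>
  have std4: "Z a b p q = 0" if "(p, q) \<in> std" "a < 6" "b < 6" for a b p q
  proof -
    have "p < 6" "q < 6" using that(1) by (auto simp: std_def)
    from red[OF this std3[OF that(1)] that(2,3)] show ?thesis using Zs[of a b p q] by simp
  qed
  have all: "Z a b c d = 0" if "a < 6" "b < 6" "c < 6" "d < 6" for a b c d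
    using red[OF that(1,2) std4[OF _ that(1,2)] that(3,4)] .
  obtain xs where xs: "s = mset xs" using ex_mset[of s] by metis
  with s have "length xs = 4" "set xs \<subseteq> {..<6}" by (auto simp: quartics_def)
  then obtain a b c d where "xs = [a, b, c, d]" by (auto simp: length_Suc_conv numeral_eq_Suc)
  with xs \<open>set xs \<subseteq> {..<6}\<close> show "Y s = 0" using all[of a b c d] by (auto simp: Z_def)
qed

lemma plucker_anisotropic_generic:
  "\<exists>p. p \<noteq> 0 \<and> multihomogeneous 6 6 p \<and> (\<forall>x. poly_value p x \<noteq> 0 \<longrightarrow> plucker_anisotropic x)"
proof -
  \<comment> \<open>A nonzero entry has s = m m' a b and is bilinear in the points a and b. Its
    degree is thus the count of s minus the count of m, m', which is where negative row degrees
    arise.\<close>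
  define d :: "plucker_row \<Rightarrow> nat \<Rightarrow> int" where "d = (\<lambda>(_, m, m') c. - int (count {#m, m'#} c))"
  have hom: "multihom 6 6 (\<lambda>c. d r c + int (count s c)) (plucker_matrix r s)"
    if "r \<in> plucker_rows" "s \<in> quartics" for r s
  proof -
    obtain i j k l m m' where r: "r = ((i, j, k, l), m, m')" by (metis prod.exhaust)
    have ijkl: "i < j" "j < k" "k < l" "l < 6" using that by (auto simp: r plucker_rows_def)
    have "multihom 6 6 (\<lambda>c. d r c + int (count s c))
        (\<lambda>x. of_bool ({#m, m', a, b#} = s) * plucker_form (\<lambda>q. x (a, q)) (\<lambda>q. x (b, q)) i j k l)"
      if ab: "a < 6" "b < 6" for a b
    proof (cases "{#m, m', a, b#} = s")
      case True
      have deg: "(\<lambda>c. d r c + int (count s c)) = (\<lambda>c. of_bool (c = a) + of_bool (c = b))"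
        by (auto simp: d_def r True[symmetric] fun_eq_iff)
      have "multihom 6 6 (\<lambda>c. of_bool (c = a) + of_bool (c = b)) (\<lambda>x. x (a, q) * x (b, q'))"
        if "q \<in> index_pairs 6" "q' \<in> index_pairs 6" for q q'
        using that ab by (intro multihom_mult multihom_var)
      then show ?thesis unfolding plucker_form_def deg using ijkl True
        by (simp, intro multihom_add multihom_diff) (auto simp: index_pairs_def)
    qed (simp add: multihom_0)
    then show ?thesis unfolding r plucker_matrix.simps by (intro multihom_sum) (auto simp: r)
  qed
  show ?thesis
    using trivial_kernel_generic[OF finite_quartics hom trivial_kernel_anisotropic_point]
      plucker_anisotropicI by metis
qed

section \<open>Tensors of the Koszul dual are determined at the normal words\<close>

definition words :: "nat \<Rightarrow> nat list set"
  where "words i = {w. set w \<subseteq> {..<6} \<and> length w = i}"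

text \<open>At the special point the tensors are the functionals on the tensor product of two free
  algebras on three letters each, and these words are its monomial basis.\<close>

definition normal_words :: "nat \<Rightarrow> nat list set"
  where "normal_words i = {w \<in> words i. \<exists>v v'. w = v @ v' \<and> set v \<subseteq> {..<3} \<and> set v' \<subseteq> {3..<6}}"

text \<open>A tensor of degree \<open>i\<close> is a function on words. It lies in the intersection of the spaces
  \<open>V^p \<otimes> W \<otimes> V^s\<close>, where \<open>W \<subseteq> V \<otimes> V\<close> is the space of relations of the quotient of the tensor
  algebra by the symmetric tensors and the quadrics \<open>x\<close>.\<close>

definition koszul_tensor :: "(coord \<Rightarrow> complex) \<Rightarrow> nat \<Rightarrow> (nat list \<Rightarrow> complex) \<Rightarrow> bool"
  where "koszul_tensor x i u \<longleftrightarrow>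
    (\<forall>p s. set p \<subseteq> {..<6} \<and> set s \<subseteq> {..<6} \<and> length p + length s + 2 = i \<longrightarrow>
      (\<exists>c. \<forall>j k. j < k \<and> k < 6 \<longrightarrow>
         u (p @ j # k # s) - u (p @ k # j # s) = (\<Sum>a<6. c a * x (a, j, k))))"

text \<open>This is the upper bound, by the number of normal words, on the dimension of the space of
  tensors. It is injectivity of a restriction map, hence an open condition. Each degree contributes
  its own condition, so the resulting open sets form a countable family.\<close>

definition normal_determined :: "(coord \<Rightarrow> complex) \<Rightarrow> nat \<Rightarrow> bool"
  where "normal_determined x i \<longleftrightarrow>
    (\<forall>u. koszul_tensor x i u \<and> (\<forall>w\<in>normal_words i. u w = 0) \<longrightarrow> (\<forall>w\<in>words i. u w = 0))"

definition block_pair :: "nat \<Rightarrow> nat \<times> nat"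
  where "block_pair a = [(0, 1), (0, 2), (1, 2), (3, 4), (3, 5), (4, 5)] ! a"

text \<open>A test point made of monomials. It satisfies the tensor and cubic conditions but
  contains products of linear forms, so it is not a witness for \<open>plucker_anisotropic\<close>.
  Separate witnesses suffice because each one only shows that a separate polynomial is
  nonzero.\<close>

definition block_point :: "coord \<Rightarrow> complex"
  where "block_point v = of_bool (fst v < 6 \<and> snd v = block_pair (fst v))"

lemma finite_words: "finite (words i)"
  unfolding words_def by (intro finite_lists_length_eq) simp

type_synonym slice = "nat list \<times> nat list"

definition slices :: "nat \<Rightarrow> slice set"
  where "slices i = {(p, s). set p \<subseteq> {..<6} \<and> set s \<subseteq> {..<6} \<and> length p + length s + 2 = i}"

lemma finite_slices: "finite (slices i)"
proof (rule finite_subset)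
  let ?A = "{w. set w \<subseteq> {..<6::nat} \<and> length w \<le> i}"
  show "slices i \<subseteq> ?A \<times> ?A" by (auto simp: slices_def)
  show "finite (?A \<times> ?A)" by (intro finite_cartesian_product finite_lists_length_le) simp_all
qed

text \<open>The coefficients of the quadrics in the slices are treated as further unknowns.\<close>

definition tensor_rows :: "nat \<Rightarrow> (nat list + slice \<times> nat \<times> nat) set"
  where "tensor_rows i = Sum_Type.Plus (normal_words i) (slices i \<times> {(j, k). j < k \<and> k < 6})"

definition tensor_cols :: "nat \<Rightarrow> (nat list + slice \<times> nat) set"
  where "tensor_cols i = Sum_Type.Plus (words i) (slices i \<times> {..<6})"

fun tensor_matrix ::
    "(nat list + slice \<times> nat \<times> nat) \<Rightarrow> (nat list + slice \<times> nat) \<Rightarrow> (coord \<Rightarrow> complex) \<Rightarrow> complex"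
  where
    "tensor_matrix (Inl v) (Inl w) x = of_bool (v = w)"
  | "tensor_matrix (Inl v) (Inr c) x = 0"
  | "tensor_matrix (Inr ((p, s), j, k)) (Inl w) x =
       of_bool (p @ j # k # s = w) - of_bool (p @ k # j # s = w)"
  | "tensor_matrix (Inr (q, j, k)) (Inr (q', a)) x = of_bool (q = q') * - x (a, j, k)"

lemma finite_tensor_cols: "finite (tensor_cols i)"
  unfolding tensor_cols_def by (intro finite_Plus finite_words finite_cartesian_product finite_slices) simp

lemma sum_tensor_cols:
  "(\<Sum>c\<in>tensor_cols i. F c) = (\<Sum>w\<in>words i. F (Inl w)) + (\<Sum>q\<in>slices i. \<Sum>a<6. F (Inr (q, a)))"
  unfolding tensor_cols_def
  by (subst sum.Plus) (auto simp: finite_words finite_slices sum.cartesian_product comp_def case_prod_beta)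

lemma sum_of_bool_mult:
  fixes f :: "'b \<Rightarrow> 'c::semiring_1"
  assumes "finite A" "b \<in> A"
  shows "(\<Sum>c\<in>A. of_bool (b = c) * f c) = f b"
  using assms by (subst sum.remove[of _ b]) (auto intro!: sum.neutral)

lemma tensor_matrix_normal_row:
  assumes "v \<in> normal_words i"
  shows "(\<Sum>c\<in>tensor_cols i. tensor_matrix (Inl v) c x * y c) = y (Inl v)"
proof -
  have "v \<in> words i" using assms by (simp add: normal_words_def)
  then show ?thesis by (simp add: sum_tensor_cols sum_of_bool_mult finite_words)
qed

lemma tensor_matrix_slice_row:
  assumes "(p, s) \<in> slices i" "j < k" "k < 6"
  shows "(\<Sum>c\<in>tensor_cols i. tensor_matrix (Inr ((p, s), j, k)) c x * y c) =
    y (Inl (p @ j # k # s)) - y (Inl (p @ k # j # s)) - (\<Sum>a<6. y (Inr ((p, s), a)) * x (a, j, k))"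
proof -
  have w: "p @ j # k # s \<in> words i" "p @ k # j # s \<in> words i"
    using assms by (auto simp: words_def slices_def)
  have "(\<Sum>q\<in>slices i. \<Sum>a<6. tensor_matrix (Inr ((p, s), j, k)) (Inr (q, a)) x * y (Inr (q, a)))
     = (\<Sum>q\<in>slices i. of_bool ((p, s) = q) * (\<Sum>a<6. - (y (Inr (q, a)) * x (a, j, k))))"
    by (intro sum.cong refl) (auto simp: sum_distrib_left mult_ac)
  also have "\<dots> = - (\<Sum>a<6. y (Inr ((p, s), a)) * x (a, j, k))"
    using assms by (subst sum_of_bool_mult) (auto simp: finite_slices sum_negf)
  finally show ?thesis using w
    by (simp add: sum_tensor_cols left_diff_distrib sum_subtractf sum_of_bool_mult finite_words
        del: tensor_matrix.simps(4))
qed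

lemma normal_determinedI:
  assumes "trivial_kernel (tensor_rows i) (tensor_cols i) (\<lambda>r c. tensor_matrix r c x)"
  shows "normal_determined x i"
  unfolding normal_determined_def
proof (intro allI impI ballI)
  fix u w assume u: "koszul_tensor x i u \<and> (\<forall>w\<in>normal_words i. u w = 0)" and w: "w \<in> words i"
  have "\<exists>c. \<forall>j k. j < k \<and> k < 6 \<longrightarrow>
         u (fst q @ j # k # snd q) - u (fst q @ k # j # snd q) = (\<Sum>a<6. c a * x (a, j, k))"
    if "q \<in> slices i" for q
    using conjunct1[OF u] that unfolding koszul_tensor_def slices_def by (cases q) simp
  then have "\<forall>q\<in>slices i. \<exists>c. \<forall>j k. j < k \<and> k < 6 \<longrightarrow>
         u (fst q @ j # k # snd q) - u (fst q @ k # j # snd q) = (\<Sum>a<6. c a * x (a, j, k))"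
    by (intro ballI)
  from bchoice[OF this] obtain c where c: "\<forall>q\<in>slices i. \<forall>j k. j < k \<and> k < 6 \<longrightarrow>
         u (fst q @ j # k # snd q) - u (fst q @ k # j # snd q) = (\<Sum>a<6. c q a * x (a, j, k))" ..
  define y where "y = case_sum u (\<lambda>(q, a). c q a)"
  have "(\<Sum>c\<in>tensor_cols i. tensor_matrix r c x * y c) = 0" if r: "r \<in> tensor_rows i" for r
  proof (cases r)
    case (Inl v)
    then show ?thesis using r u by (auto simp: tensor_rows_def tensor_matrix_normal_row y_def)
  next
    case (Inr r')
    then obtain p s j k where "r = Inr ((p, s), j, k)" by (metis prod.exhaust)
    with r bspec[OF c, of "(p, s)"] show ?thesis
      by (auto simp: tensor_rows_def tensor_matrix_slice_row y_def)
  qed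
  from trivial_kernelD[OF assms this, of "Inl w"] w show "u w = 0"
    by (auto simp: tensor_cols_def y_def)
qed

lemma less_6_cases: "(a::nat) < 6 \<longleftrightarrow> a = 0 \<or> a = 1 \<or> a = 2 \<or> a = 3 \<or> a = 4 \<or> a = 5"
  by linarith

lemma block_pair_blocks:
  assumes "a < 6" "block_pair a = (j, k)"
  shows "j < k \<and> k < 6 \<and> (j < 3 \<longleftrightarrow> k < 3)"
  using assms(1) unfolding less_6_cases[of a]
  by (elim disjE) (use assms(2) in \<open>auto simp: block_pair_def\<close>)

lemma block_pair_inj: "inj_on block_pair {..<6}"
  unfolding lessThan_6 by (simp add: block_pair_def)

text \<open>Letters below \<open>3\<close> commute with the others, which sorts every word into a normal one.\<close>

lemma swap_invariant_eq_0:
  fixes u :: "nat list \<Rightarrow> complex"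
  assumes swap: "\<And>p s j k. p @ j # k # s \<in> words i \<Longrightarrow> j < 3 \<Longrightarrow> 3 \<le> k \<Longrightarrow>
      u (p @ j # k # s) = u (p @ k # j # s)"
    and normal: "\<And>w. w \<in> normal_words i \<Longrightarrow> u w = 0"
    and w: "w \<in> words i"
  shows "u w = 0"
proof -
  have move: "u (v @ v' @ j # s) = u (v @ j # v' @ s)"
    if "v @ v' @ j # s \<in> words i" "set v' \<subseteq> {3..<6}" "j < 3" for v v' j s
    using that
  proof (induction v' arbitrary: s rule: rev_induct)
    case (snoc k v')
    have "u ((v @ v') @ k # j # s) = u ((v @ v') @ j # k # s)"
      using snoc.prems by (intro swap[symmetric]) (auto simp: words_def)
    moreover have "u (v @ v' @ j # (k # s)) = u (v @ j # v' @ (k # s))"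
      using snoc.prems by (intro snoc.IH) (auto simp: words_def)
    ultimately show ?case by simp
  qed simp
  have "u (v @ v' @ s) = 0"
    if "v @ v' @ s \<in> words i" "set v \<subseteq> {..<3}" "set v' \<subseteq> {3..<6}" for v v' s
    using that
  proof (induction s arbitrary: v v')
    case Nil
    then show ?case by (intro normal) (auto simp: normal_words_def)
  next
    case (Cons j s)
    show ?case
    proof (cases "j < 3")
      case True
      have "u ((v @ [j]) @ v' @ s) = 0"
        using Cons.prems True by (intro Cons.IH) (auto simp: words_def)
      then show ?thesis using move[OF Cons.prems(1,3) True] by simp
    next
      case False
      have "u (v @ (v' @ [j]) @ s) = 0"
        using Cons.prems False by (intro Cons.IH) (auto simp: words_def)
      then show ?thesis by simp
    qed
  qed
  from this[of "[]" "[]" w] w show ?thesis by simp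
qed

text \<open>No quadric of the point involves letters from both halves, so such letters may be
  exchanged and sorting the word kills the tensor. Once the tensor is zero, the row of the pair
  \<open>block_pair a\<close> isolates the unknown coefficient of the a-th quadric.\<close>

lemma trivial_kernel_block_point:
  "trivial_kernel (tensor_rows i) (tensor_cols i) (\<lambda>r c. tensor_matrix r c block_point)"
  unfolding trivial_kernel_def
proof (intro allI impI ballI)
  fix y :: "nat list + slice \<times> nat \<Rightarrow> complex" and c
  assume y: "\<forall>r\<in>tensor_rows i. (\<Sum>c\<in>tensor_cols i. tensor_matrix r c block_point * y c) = 0"
    and c: "c \<in> tensor_cols i"
  have normal: "y (Inl w) = 0" if "w \<in> normal_words i" for w
  proof -
    have "Inl w \<in> tensor_rows i" using that by (auto simp: tensor_rows_def)
    from bspec[OF y this] show ?thesis unfolding tensor_matrix_normal_row[OF that] .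
  qed
  have slice: "y (Inl (p @ j # k # s)) - y (Inl (p @ k # j # s))
      = (\<Sum>a<6. y (Inr ((p, s), a)) * block_point (a, j, k))"
    if "(p, s) \<in> slices i" "j < k" "k < 6" for p s j k
  proof -
    have "Inr ((p, s), j, k) \<in> tensor_rows i" using that by (auto simp: tensor_rows_def)
    from bspec[OF y this] show ?thesis unfolding tensor_matrix_slice_row[OF that] by simp
  qed
  have words0: "y (Inl w) = 0" if "w \<in> words i" for w
  proof (rule swap_invariant_eq_0[OF _ normal that])
    fix p s and j k :: nat assume jk: "p @ j # k # s \<in> words i" "j < 3" "3 \<le> k"
    then have ps: "(p, s) \<in> slices i" "j < k" "k < 6" by (auto simp: words_def slices_def)
    have "(\<Sum>a<6. y (Inr ((p, s), a)) * block_point (a, j, k)) = 0"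
    proof (intro sum.neutral ballI)
      fix a :: nat assume "a \<in> {..<6}"
      then have "(j, k) \<noteq> block_pair a" using jk block_pair_blocks[of a j k] by force
      then show "y (Inr ((p, s), a)) * block_point (a, j, k) = 0" by (simp add: block_point_def)
    qed
    with slice[OF ps] show "y (Inl (p @ j # k # s)) = y (Inl (p @ k # j # s))" by simp
  qed
  have "y (Inr ((p, s), a)) = 0" if ps: "(p, s) \<in> slices i" and a: "a < 6" for p s a
  proof -
    obtain j k where jk: "block_pair a = (j, k)" by (metis prod.exhaust)
    note jk' = block_pair_blocks[OF a jk]
    have "p @ j # k # s \<in> words i" "p @ k # j # s \<in> words i"
      using ps jk' by (auto simp: words_def slices_def)
    then have "(\<Sum>b<6. y (Inr ((p, s), b)) * block_point (b, j, k)) = 0"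
      using slice[OF ps, of j k] jk' words0 by simp
    also have "(\<Sum>b<6. y (Inr ((p, s), b)) * block_point (b, j, k))
        = (\<Sum>b<6. of_bool (a = b) * y (Inr ((p, s), b)))"
      using inj_onD[OF block_pair_inj, of a] a jk by (intro sum.cong) (auto simp: block_point_def)
    also have "\<dots> = y (Inr ((p, s), a))" using a by (intro sum_of_bool_mult) auto
    finally show ?thesis .
  qed
  with words0 c show "y c = 0" by (auto simp: tensor_cols_def)
qed

lemma normal_determined_generic:
  "\<exists>p. p \<noteq> 0 \<and> multihomogeneous 6 6 p \<and> (\<forall>x. poly_value p x \<noteq> 0 \<longrightarrow> normal_determined x i)"
proof -
  \<comment> \<open>Entries are constants, except that the unknown coefficient of the a-th quadric
    is multiplied by a coordinate of the a-th point. So all row degrees can be 0.\<close>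
  define e :: "nat list + slice \<times> nat \<Rightarrow> nat \<Rightarrow> int"
    where "e = case_sum (\<lambda>_ _. 0) (\<lambda>(q, a) c. of_bool (c = a))"
  have entries:
    "tensor_matrix (Inl v) (Inl w) = (\<lambda>_. of_bool (v = w))"
    "tensor_matrix (Inl v) (Inr z) = (\<lambda>_. 0)"
    "tensor_matrix (Inr (q, j, k)) (Inl w)
      = (\<lambda>_. of_bool (fst q @ j # k # snd q = w) - of_bool (fst q @ k # j # snd q = w))"
    "tensor_matrix (Inr (q', j, k)) (Inr (q'', a)) = (\<lambda>x. of_bool (q' = q'') * - x (a, j, k))"
    for v w z q q' q'' j k a
    by (simp_all add: fun_eq_iff) (cases q, simp)
  have hom: "multihom 6 6 (\<lambda>k. 0 + e c k) (tensor_matrix r c)"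
    if "r \<in> tensor_rows i" "c \<in> tensor_cols i" for r c
    using that unfolding tensor_rows_def tensor_cols_def
    by (elim PlusE SigmaE) (auto simp: entries e_def index_pairs_def simp del: mult_minus_right
      intro!: multihom_const multihom_0 multihom_uminus multihom_cmult multihom_var)
  show ?thesis
    using trivial_kernel_generic[OF finite_tensor_cols hom trivial_kernel_block_point]
      normal_determinedI by metis
qed

section \<open>Cubic elements\<close>

definition triples :: "nat set set"
  where "triples = {S. S \<subseteq> {..<6} \<and> card S = 3}"

text \<open>The coefficient of e_S in the product of e_j with the a-th quadric, for a triple
  S.\<close>

definition cubic_entry :: "nat \<Rightarrow> nat \<Rightarrow> (coord \<Rightarrow> complex) \<Rightarrow> nat set \<Rightarrow> complex"
  where "cubic_entry j a x S =
    (if j \<in> S then wedge_sign {j} (S - {j}) * x (a, Min (S - {j}), Max (S - {j})) else 0)"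

text \<open>The twenty products, one per triple, are fixed before the right-hand side. This makes
  the condition surjectivity of a square matrix, which follows from injectivity and is therefore
  open.\<close>

definition cubics_generated :: "(coord \<Rightarrow> complex) \<Rightarrow> bool"
  where "cubics_generated x \<longleftrightarrow> (\<exists>j a. (\<forall>T\<in>triples. j T < 6 \<and> a T < 6) \<and>
     (\<forall>b. \<exists>c. \<forall>S\<in>triples. (\<Sum>T\<in>triples. c T * cubic_entry (j T) (a T) x S) = b S))"

lemma finite_triples: "finite triples"
  by (rule finite_subset[of _ "Pow {..<6}"]) (auto simp: triples_def)

text \<open>Two of three indices lie in the same half, so the monomial of a triple is, up to sign, a
  variable times one of the special quadrics.\<close>

lemma triple_block:
  assumes "T \<in> triples"
  shows "\<exists>j a. j < 6 \<and> a < 6 \<and> (\<exists>k l. block_pair a = (k, l) \<and> j \<noteq> k \<and> j \<noteq> l \<and> T = {j, k, l})"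
proof -
  have "\<exists>a b c. T = {a, b, c} \<and> a \<noteq> b \<and> a \<noteq> c \<and> b \<noteq> c"
    using assms by (auto simp: triples_def card_3_iff)
  then obtain a b c where abc: "T = {a, b, c}" "a \<noteq> b" "a \<noteq> c" "b \<noteq> c" by blast
  have pair: "\<exists>m<6. block_pair m = (k, l)" if "k < l" "l < 6" "k < 3 \<longleftrightarrow> l < 3" for k l
  proof -
    have "k = 0 \<and> l = 1 \<or> k = 0 \<and> l = 2 \<or> k = 1 \<and> l = 2 \<or> k = 3 \<and> l = 4 \<or> k = 3 \<and> l = 5 \<or> k = 4 \<and> l = 5"
      using that by linarith
    then have "(k, l) \<in> block_pair ` {..<6}" unfolding lessThan_6 by (auto simp: block_pair_def)
    then show ?thesis by auto
  qed
  have lt: "a < 6" "b < 6" "c < 6" using assms abc(1) by (auto simp: triples_def)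
  have *: "\<exists>j a. j < 6 \<and> a < 6 \<and> (\<exists>k l. block_pair a = (k, l) \<and> j \<noteq> k \<and> j \<noteq> l \<and> T = {j, k, l})"
    if "T = {j, k, l}" "j \<noteq> k" "j \<noteq> l" "k \<noteq> l" "k < 3 \<longleftrightarrow> l < 3" "j < 6" "k < 6" "l < 6" for j k l
  proof (cases "k < l")
    case True
    then show ?thesis using pair[of k l] that by blast
  next
    case False
    then have "l < k" using that by simp
    moreover have "T = {j, l, k}" using that by auto
    ultimately show ?thesis using pair[of l k] that by blast
  qed
  consider "a < 3 \<longleftrightarrow> b < 3" | "a < 3 \<longleftrightarrow> c < 3" | "b < 3 \<longleftrightarrow> c < 3" by blast
  then show ?thesis
  proof cases
    case 1 then show ?thesis using *[of c a b] abc lt by (simp add: insert_commute)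
  next
    case 2 then show ?thesis using *[of b a c] abc lt by (simp add: insert_commute)
  next
    case 3 then show ?thesis using *[of a b c] abc lt by (simp add: insert_commute)
  qed
qed

text \<open>At the special point the product chosen for T is e_T up to sign, so the matrix is
  diagonal with entries 1 and -1.\<close>

lemma cubics_generated_generic:
  "\<exists>p. p \<noteq> 0 \<and> multihomogeneous 6 6 p \<and> (\<forall>x. poly_value p x \<noteq> 0 \<longrightarrow> cubics_generated x)"
proof -
  obtain j a where ja: "\<And>T. T \<in> triples \<Longrightarrow> j T < 6 \<and> a T < 6 \<and>
      (\<exists>k l. block_pair (a T) = (k, l) \<and> j T \<noteq> k \<and> j T \<noteq> l \<and> T = {j T, k, l})"
    using triple_block by metis
  have jT: "j T \<in> T" if "T \<in> triples" for T using ja[OF that] by blast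
  have entry: "cubic_entry (j T) (a T) block_point S = of_bool (T = S) * wedge_sign {j T} (S - {j T})"
    if T: "T \<in> triples" and S: "S \<in> triples" for S T
  proof (cases "j T \<in> S")
    case True
    obtain k l where kl: "block_pair (a T) = (k, l)" "j T \<noteq> k" "j T \<noteq> l" "T = {j T, k, l}"
      using ja[OF T] by blast
    have "k < l" using block_pair_blocks[OF _ kl(1)] ja[OF T] by simp
    have fin: "finite (S - {j T})" and card: "card (S - {j T}) = 2"
      using S True finite_subset[of S "{..<6}"] by (auto simp: triples_def)
    then obtain m n where mn: "S - {j T} = {m, n}" "m \<noteq> n" by (auto simp: card_2_iff)
    have "(Min (S - {j T}), Max (S - {j T})) = (k, l) \<longleftrightarrow> S - {j T} = {k, l}"
      unfolding mn using \<open>k < l\<close> mn(2) by (auto simp: min_def max_def doubleton_eq_iff)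
    also have "{k, l} = T - {j T}" using kl(2,3) by (subst kl(4)) auto
    also have "S - {j T} = T - {j T} \<longleftrightarrow> T = S" using True jT[OF T] by blast
    finally show ?thesis using True kl(1) ja[OF T]
      by (simp add: cubic_entry_def block_point_def)
  next
    case False
    with jT[OF T] show ?thesis by (auto simp: cubic_entry_def)
  qed
  have triv: "trivial_kernel triples triples (\<lambda>S T. cubic_entry (j T) (a T) block_point S)"
    unfolding trivial_kernel_def
  proof (intro allI impI ballI)
    fix y T assume y: "\<forall>S\<in>triples. (\<Sum>T\<in>triples. cubic_entry (j T) (a T) block_point S * y T) = 0"
      and T: "T \<in> triples"
    have "(\<Sum>S\<in>triples. cubic_entry (j S) (a S) block_point T * y S)
       = (\<Sum>S\<in>triples. of_bool (T = S) * (wedge_sign {j T} (T - {j T}) * y S))"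
      using T by (intro sum.cong) (auto simp: entry)
    also have "\<dots> = wedge_sign {j T} (T - {j T}) * y T"
      using T finite_triples by (simp add: sum_of_bool_mult)
    finally show "y T = 0" using y T by (simp add: wedge_sign_def)
  qed
  have hom: "multihom 6 6 (\<lambda>k. 0 + of_bool (k = a T)) (\<lambda>x. cubic_entry (j T) (a T) x S)"
    if S: "S \<in> triples" and T: "T \<in> triples" for S T
  proof (cases "j T \<in> S")
    case True
    have fin: "finite (S - {j T})" and card: "card (S - {j T}) = 2"
      using S True finite_subset[of S "{..<6}"] by (auto simp: triples_def)
    then obtain m n where mn: "S - {j T} = {m, n}" "m \<noteq> n" by (auto simp: card_2_iff)
    have "m < 6" "n < 6" using mn S by (auto simp: triples_def)
    then have "(Min (S - {j T}), Max (S - {j T})) \<in> index_pairs 6"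
      unfolding mn using mn(2) by (auto simp: index_pairs_def min_def max_def)
    then show ?thesis unfolding cubic_entry_def using True ja[OF T]
      by (simp add: multihom_cmult multihom_var)
  qed (simp add: cubic_entry_def multihom_0)
  have "cubics_generated x"
    if "trivial_kernel triples triples (\<lambda>S T. cubic_entry (j T) (a T) x S)" for x
    unfolding cubics_generated_def
  proof (rule exI[of _ j], rule exI[of _ a], rule conjI)
    show "\<forall>T\<in>triples. j T < 6 \<and> a T < 6" using ja by blast
    have *: "\<forall>S\<in>triples. (\<Sum>T\<in>triples. cubic_entry (j T) (a T) x S * y T) = 0 \<Longrightarrow> \<forall>T\<in>triples. y T = 0" for y
      using that unfolding trivial_kernel_def by blast
    show "\<forall>b. \<exists>c. \<forall>S\<in>triples. (\<Sum>T\<in>triples. c T * cubic_entry (j T) (a T) x S) = b S"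
    proof
      fix b :: "nat set \<Rightarrow> complex"
      have "\<exists>y. \<forall>S\<in>triples. (\<Sum>T\<in>triples. cubic_entry (j T) (a T) x S * y T) = b S"
        by (rule square_system_solvable[OF finite_triples finite_triples order.refl]) (use * in blast)
      then show "\<exists>c. \<forall>S\<in>triples. (\<Sum>T\<in>triples. c T * cubic_entry (j T) (a T) x S) = b S"
        by (simp only: mult.commute)
    qed
  qed
  then show ?thesis
    using trivial_kernel_generic[OF finite_triples hom triv] by blast
qed

section \<open>Exterior algebras\<close>

lemma sum_closed:
  fixes f :: "'a \<Rightarrow> 'b::comm_monoid_add"
  assumes "0 \<in> X" "\<And>a b. a \<in> X \<Longrightarrow> b \<in> X \<Longrightarrow> a + b \<in> X" "\<And>i. i \<in> A \<Longrightarrow> f i \<in> X"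
  shows "(\<Sum>i\<in>A. f i) \<in> X"
  using assms(3) by (induction A rule: infinite_finite_induct) (auto intro: assms)

definition wedge :: "ext \<Rightarrow> ext \<Rightarrow> ext"  (infixl "\<cdot>" 70)
  where "f \<cdot> g = (\<lambda>S. \<Sum>T\<in>Pow S. wedge_sign T (S - T) * f T * g (S - T))"

definition scale :: "complex \<Rightarrow> ext \<Rightarrow> ext"  (infixr "*\<^sub>e" 75)
  where "c *\<^sub>e f = (\<lambda>S. c * f S)"

definition mono :: "nat set \<Rightarrow> ext"
  where "mono S = (\<lambda>T. if T = S then 1 else 0)"

definition homog :: "nat \<Rightarrow> nat \<Rightarrow> ext set"
  where "homog n d = {f \<in> ext_carrier n. \<forall>S. f S \<noteq> 0 \<longrightarrow> card S = d}"

definition part :: "nat \<Rightarrow> ext \<Rightarrow> ext"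
  where "part d f = (\<lambda>S. if card S = d then f S else 0)"

lemma scale_apply [simp]: "(c *\<^sub>e f) S = c * f S"
  by (simp add: scale_def)

lemma scale_simps [simp]:
  "0 *\<^sub>e f = 0" "c *\<^sub>e 0 = 0" "1 *\<^sub>e f = f" "c *\<^sub>e (d *\<^sub>e f) = (c * d) *\<^sub>e f" "(- 1) *\<^sub>e f = - f"
  by (auto simp: fun_eq_iff)

lemma scale_distribs:
  "c *\<^sub>e (f + g) = c *\<^sub>e f + c *\<^sub>e g" "(c + d) *\<^sub>e f = c *\<^sub>e f + d *\<^sub>e f"
  "c *\<^sub>e (f - g) = c *\<^sub>e f - c *\<^sub>e g" "(c - d) *\<^sub>e f = c *\<^sub>e f - d *\<^sub>e f"
  "c *\<^sub>e (- f) = - (c *\<^sub>e f)" "(- c) *\<^sub>e f = - (c *\<^sub>e f)"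
  by (auto simp: fun_eq_iff algebra_simps)

lemma scale_sum: fixes f :: "'a \<Rightarrow> ext" shows "c *\<^sub>e (\<Sum>i\<in>A. f i) = (\<Sum>i\<in>A. c *\<^sub>e f i)"
  by (auto simp: fun_eq_iff sum_fun_apply sum_distrib_left)

lemma sum_scale: fixes c :: "'a \<Rightarrow> complex" shows "(\<Sum>i\<in>A. c i) *\<^sub>e f = (\<Sum>i\<in>A. c i *\<^sub>e f)"
  by (auto simp: fun_eq_iff sum_fun_apply sum_distrib_right)

lemma wedge_distribs:
  "(f + g) \<cdot> h = f \<cdot> h + g \<cdot> h" "h \<cdot> (f + g) = h \<cdot> f + h \<cdot> g"
  "(f - g) \<cdot> h = f \<cdot> h - g \<cdot> h" "h \<cdot> (f - g) = h \<cdot> f - h \<cdot> g"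
  by (auto simp: wedge_def fun_eq_iff sum.distrib sum_subtractf algebra_simps)

lemma wedge_simps [simp]:
  "0 \<cdot> f = 0" "f \<cdot> 0 = 0" "(- f) \<cdot> g = - (f \<cdot> g)" "f \<cdot> (- g) = - (f \<cdot> g)"
  "(c *\<^sub>e f) \<cdot> g = c *\<^sub>e (f \<cdot> g)" "f \<cdot> (c *\<^sub>e g) = c *\<^sub>e (f \<cdot> g)"
  by (auto simp: wedge_def fun_eq_iff sum_negf sum_distrib_left algebra_simps)

lemma wedge_sum_left: fixes f :: "'a \<Rightarrow> ext" shows "(\<Sum>i\<in>A. f i) \<cdot> g = (\<Sum>i\<in>A. f i \<cdot> g)"
  using sum_comp_morphism[of "\<lambda>x. x \<cdot> g" f A] by (simp add: wedge_distribs comp_def)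

lemma wedge_sum_right: fixes f :: "'a \<Rightarrow> ext" shows "g \<cdot> (\<Sum>i\<in>A. f i) = (\<Sum>i\<in>A. g \<cdot> f i)"
  using sum_comp_morphism[of "\<lambda>x. g \<cdot> x" f A] by (simp add: wedge_distribs comp_def)

text \<open>For infinite S the sum over \<open>Pow S\<close> is 0 by convention. This default is the
  reason for the case distinctions on finiteness of the index set below.\<close>

lemma wedge_infinite: "infinite S \<Longrightarrow> (f \<cdot> g) S = 0"
  by (simp add: wedge_def)

lemma wedge_sign_mult_self [simp]: "wedge_sign T U * wedge_sign T U = 1"
  by (simp add: wedge_sign_def power2_eq_square[symmetric] power_mult[symmetric] mult.commute)

lemma wedge_sign_nonzero [simp]: "wedge_sign T U \<noteq> 0"
  by (simp add: wedge_sign_def)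

lemma wedge_sign_empty [simp]: "wedge_sign {} U = 1" "wedge_sign T {} = 1"
  by (simp_all add: wedge_sign_def)

lemma wedge_sign_Un_left:
  assumes "finite T" "finite U" "finite W" "T \<inter> U = {}"
  shows "wedge_sign (T \<union> U) W = wedge_sign T W * wedge_sign U W"
proof -
  have "{(t, w). t \<in> T \<union> U \<and> w \<in> W \<and> w < t}
      = {(t, w). t \<in> T \<and> w \<in> W \<and> w < t} \<union> {(t, w). t \<in> U \<and> w \<in> W \<and> w < t}" by auto
  moreover have "finite {(t, w). t \<in> T \<and> w \<in> W \<and> w < t}" "finite {(t, w). t \<in> U \<and> w \<in> W \<and> w < t}"
    using assms by (auto intro: finite_subset[of _ "T \<times> W"] finite_subset[of _ "U \<times> W"])
  ultimately show ?thesis using assms(4) unfolding wedge_sign_def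
    by (subst power_add[symmetric], subst card_Un_disjoint[symmetric]) auto
qed

lemma wedge_sign_Un_right:
  assumes "finite T" "finite U" "finite W" "U \<inter> W = {}"
  shows "wedge_sign T (U \<union> W) = wedge_sign T U * wedge_sign T W"
proof -
  have "{(t, w). t \<in> T \<and> w \<in> U \<union> W \<and> w < t}
      = {(t, w). t \<in> T \<and> w \<in> U \<and> w < t} \<union> {(t, w). t \<in> T \<and> w \<in> W \<and> w < t}" by auto
  moreover have "finite {(t, w). t \<in> T \<and> w \<in> U \<and> w < t}" "finite {(t, w). t \<in> T \<and> w \<in> W \<and> w < t}"
    using assms by (auto intro: finite_subset[of _ "T \<times> U"] finite_subset[of _ "T \<times> W"])
  ultimately show ?thesis using assms(4) unfolding wedge_sign_def
    by (subst power_add[symmetric], subst card_Un_disjoint[symmetric]) auto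
qed

text \<open>Every pair in the product of T and U is an inversion for exactly one of the two orders,
  so the two numbers of inversions add up to \<open>card T * card U\<close>.\<close>

lemma wedge_sign_commute:
  assumes "finite T" "finite U" "T \<inter> U = {}"
  shows "wedge_sign U T = (- 1) ^ (card T * card U) * wedge_sign T U"
proof -
  let ?A = "{(t, u). t \<in> T \<and> u \<in> U \<and> u < t}" and ?B = "{(u, t). u \<in> U \<and> t \<in> T \<and> t < u}"
  have fin: "finite ?A" "finite ?B"
    using assms by (auto intro: finite_subset[of _ "T \<times> U"] finite_subset[of _ "U \<times> T"])
  have "card (T \<times> U) = card (?A \<union> prod.swap ` ?B)"
    using assms(3) by (intro arg_cong[of _ _ card]) (auto simp: image_iff)
  also have "\<dots> = card ?A + card (prod.swap ` ?B)"
    using fin by (intro card_Un_disjoint) auto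
  also have "card (prod.swap ` ?B) = card ?B" by (intro card_image) auto
  finally have "card T * card U = card ?A + card ?B" by (simp add: card_cartesian_product)
  then show ?thesis
    by (simp add: wedge_sign_def power_add mult.assoc mult.left_commute[of "(-1) ^ card ?A"]
        flip: power_mult_distrib)
qed

text \<open>Both bracketings run over the ordered partitions of S into three parts. The signs agree
  because \<open>wedge_sign\<close> is multiplicative on disjoint unions in either argument.\<close>

lemma wedge_assoc: "(f \<cdot> g) \<cdot> h = f \<cdot> (g \<cdot> h)"
proof
  fix S
  show "((f \<cdot> g) \<cdot> h) S = (f \<cdot> (g \<cdot> h)) S"
  proof (cases "finite S")
    case fin: True
    have "((f \<cdot> g) \<cdot> h) S = (\<Sum>(X, T)\<in>(SIGMA X:Pow S. Pow X).
        wedge_sign X (S - X) * (wedge_sign T (X - T) * f T * g (X - T)) * h (S - X))"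
      using fin by (simp add: wedge_def sum_distrib_left sum_distrib_right finite_subset flip: sum.Sigma)
    also have "\<dots> = (\<Sum>(T, U)\<in>(SIGMA T:Pow S. Pow (S - T)).
        wedge_sign T (S - T) * f T * (wedge_sign U (S - T - U) * g U * h (S - T - U)))"
    proof (rule sum.reindex_bij_witness[of _ "\<lambda>(T, U). (T \<union> U, T)" "\<lambda>(X, T). (T, X - T)"])
      fix p assume p: "p \<in> (SIGMA X:Pow S. Pow X)"
      then obtain X T where XT: "p = (X, T)" "X \<subseteq> S" "T \<subseteq> X" by auto
      have finite: "finite X" "finite T" "finite (X - T)" "finite (S - X)"
        using fin XT by (auto intro: finite_subset)
      have "X = T \<union> (X - T)" using XT by auto
      then have 1: "wedge_sign X (S - X) = wedge_sign T (S - X) * wedge_sign (X - T) (S - X)"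
        using wedge_sign_Un_left[of T "X - T" "S - X"] finite by auto
      have "S - T = (X - T) \<union> (S - X)" using XT by auto
      then have 2: "wedge_sign T (S - T) = wedge_sign T (X - T) * wedge_sign T (S - X)"
        using wedge_sign_Un_right[of T "X - T" "S - X"] finite by auto
      have 3: "S - T - (X - T) = S - X" using XT by auto
      show "(case case p of (X, T) \<Rightarrow> (T, X - T) of (T, U) \<Rightarrow>
          wedge_sign T (S - T) * f T * (wedge_sign U (S - T - U) * g U * h (S - T - U)))
        = (case p of (X, T) \<Rightarrow>
          wedge_sign X (S - X) * (wedge_sign T (X - T) * f T * g (X - T)) * h (S - X))"
        unfolding XT(1) prod.case 1 2 3 by (simp add: mult_ac)
    qed (auto)
    also have "\<dots> = (f \<cdot> (g \<cdot> h)) S"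
      using fin by (simp add: wedge_def sum_distrib_left sum_distrib_right finite_subset flip: sum.Sigma)
    finally show ?thesis .
  qed (simp add: wedge_infinite)
qed

lemma wedge_swap:
  assumes "finite S"
  shows "(g \<cdot> f) S = (\<Sum>T\<in>Pow S. (- 1) ^ (card T * card (S - T)) * wedge_sign T (S - T) * f T * g (S - T))"
  unfolding wedge_def
proof (rule sum.reindex_bij_witness[of _ "\<lambda>T. S - T" "\<lambda>T. S - T"])
  fix T assume "T \<in> Pow S"
  then have T: "T \<subseteq> S" "S - (S - T) = T" by auto
  then have "finite T" "finite (S - T)" using assms by (auto intro: finite_subset)
  from wedge_sign_commute[OF this]
  have "wedge_sign (S - T) T = (- 1) ^ (card T * card (S - T)) * wedge_sign T (S - T)" by blast
  then show "(- 1) ^ (card (S - T) * card (S - (S - T))) * wedge_sign (S - T) (S - (S - T)) *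
        f (S - T) * g (S - (S - T)) = wedge_sign T (S - T) * g T * f (S - T)"
    unfolding T(2) by (simp add: mult_ac flip: power_mult_distrib)
qed (use assms in auto)

lemma ext_carrier_infinite: "f \<in> ext_carrier n \<Longrightarrow> infinite S \<Longrightarrow> f S = 0"
  by (auto simp: ext_carrier_def intro: finite_subset[of S "{..<n}"])

lemma homogD: "f \<in> homog n d \<Longrightarrow> f S \<noteq> 0 \<Longrightarrow> S \<subseteq> {..<n} \<and> card S = d"
  by (auto simp: homog_def ext_carrier_def)

lemma homogI: "(\<And>S. f S \<noteq> 0 \<Longrightarrow> S \<subseteq> {..<n} \<and> card S = d) \<Longrightarrow> f \<in> homog n d"
  by (auto simp: homog_def ext_carrier_def)

lemma homog_carrier: "f \<in> homog n d \<Longrightarrow> f \<in> ext_carrier n"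
  by (simp add: homog_def)

lemma ext_carrier_closed [intro, simp]:
  "0 \<in> ext_carrier n" "f \<in> ext_carrier n \<Longrightarrow> g \<in> ext_carrier n \<Longrightarrow> f + g \<in> ext_carrier n"
  "f \<in> ext_carrier n \<Longrightarrow> g \<in> ext_carrier n \<Longrightarrow> f - g \<in> ext_carrier n"
  "f \<in> ext_carrier n \<Longrightarrow> - f \<in> ext_carrier n" "f \<in> ext_carrier n \<Longrightarrow> c *\<^sub>e f \<in> ext_carrier n"
  by (auto simp: ext_carrier_def) (metis add.right_neutral subset_iff lessThan_iff diff_0_right)+

lemma ext_carrier_sum:
  fixes f :: "'a \<Rightarrow> ext"
  shows "(\<And>i. i \<in> A \<Longrightarrow> f i \<in> ext_carrier n) \<Longrightarrow> (\<Sum>i\<in>A. f i) \<in> ext_carrier n"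
  by (rule sum_closed) auto

lemma wedge_nonzero: "(f \<cdot> g) S \<noteq> 0 \<Longrightarrow> \<exists>T. T \<subseteq> S \<and> f T \<noteq> 0 \<and> g (S - T) \<noteq> 0 \<and> finite S"
  by (metis (no_types, lifting) PowD mult_eq_0_iff sum.neutral wedge_def wedge_infinite)

lemma ext_carrier_wedge [intro, simp]:
  assumes "f \<in> ext_carrier n" "g \<in> ext_carrier n"
  shows "f \<cdot> g \<in> ext_carrier n"
  unfolding ext_carrier_def
proof (intro CollectI allI impI)
  fix S assume "(f \<cdot> g) S \<noteq> 0"
  then obtain T where "T \<subseteq> S" "f T \<noteq> 0" "g (S - T) \<noteq> 0" using wedge_nonzero by blast
  with assms show "S \<subseteq> {..<n}" unfolding ext_carrier_def by blast
qed

lemma homog_wedge: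
  assumes "f \<in> homog n d" "g \<in> homog n e"
  shows "f \<cdot> g \<in> homog n (d + e)"
proof (rule homogI)
  fix S assume "(f \<cdot> g) S \<noteq> 0"
  then obtain T where T: "T \<subseteq> S" "f T \<noteq> 0" "g (S - T) \<noteq> 0" "finite S" using wedge_nonzero by blast
  then have "T \<subseteq> {..<n}" "card T = d" "S - T \<subseteq> {..<n}" "card (S - T) = e"
    using assms homogD by blast+
  moreover have "card S = card T + card (S - T)"
    using T by (metis card_Diff_subset card_mono finite_subset le_add_diff_inverse)
  ultimately show "S \<subseteq> {..<n} \<and> card S = d + e" by auto
qed

lemma homog_closed [simp]:
  "0 \<in> homog n d" "f \<in> homog n d \<Longrightarrow> g \<in> homog n d \<Longrightarrow> f + g \<in> homog n d"
  "f \<in> homog n d \<Longrightarrow> g \<in> homog n d \<Longrightarrow> f - g \<in> homog n d"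
  "f \<in> homog n d \<Longrightarrow> - f \<in> homog n d" "f \<in> homog n d \<Longrightarrow> c *\<^sub>e f \<in> homog n d"
  unfolding homog_def by (auto) (metis add.right_neutral diff_0_right)+

lemma homog_sum:
  fixes f :: "'a \<Rightarrow> ext"
  shows "(\<And>i. i \<in> A \<Longrightarrow> f i \<in> homog n d) \<Longrightarrow> (\<Sum>i\<in>A. f i) \<in> homog n d"
  by (rule sum_closed) auto

lemma part_homog: "f \<in> ext_carrier n \<Longrightarrow> part d f \<in> homog n d"
  by (auto simp: part_def homog_def ext_carrier_def split: if_splits)

lemma part_of_homog: "f \<in> homog n d \<Longrightarrow> part e f = (if e = d then f else 0)"
  by (auto simp: part_def homog_def fun_eq_iff)

lemma part_linear:
  "part d (f + g) = part d f + part d g" "part d (f - g) = part d f - part d g"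
  "part d (c *\<^sub>e f) = c *\<^sub>e part d f" "part d (- f) = - part d f" "part d 0 = 0"
  by (auto simp: part_def fun_eq_iff)

lemma part_sum: fixes f :: "'a \<Rightarrow> ext" shows "part d (\<Sum>i\<in>A. f i) = (\<Sum>i\<in>A. part d (f i))"
  using sum_comp_morphism[of "part d" f A] by (simp add: part_linear comp_def)

lemma mono_in: "S \<subseteq> {..<n} \<Longrightarrow> mono S \<in> homog n (card S)"
  by (auto simp: mono_def homog_def ext_carrier_def split: if_splits)

lemma mono_wedge:
  assumes "finite S" "finite T"
  shows "mono S \<cdot> mono T = (if S \<inter> T = {} then wedge_sign S T *\<^sub>e mono (S \<union> T) else 0)"
proof
  fix X
  show "(mono S \<cdot> mono T) X = (if S \<inter> T = {} then wedge_sign S T *\<^sub>e mono (S \<union> T) else 0) X"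
  proof (cases "finite X \<and> S \<inter> T = {} \<and> X = S \<union> T")
    case True
    then have X: "X = S \<union> T" "X - S = T" by auto
    have "(mono S \<cdot> mono T) X = (\<Sum>Y\<in>Pow X. of_bool (S = Y) * (wedge_sign Y (X - Y) * mono T (X - Y)))"
      unfolding wedge_def by (intro sum.cong) (auto simp: mono_def)
    also have "\<dots> = wedge_sign S T" using True X by (subst sum_of_bool_mult) (auto simp: mono_def)
    finally show ?thesis using True by (simp add: mono_def)
  next
    case False
    have "(mono S \<cdot> mono T) X = 0"
    proof (rule ccontr)
      assume "(mono S \<cdot> mono T) X \<noteq> 0"
      then obtain Y where "Y \<subseteq> X" "mono S Y \<noteq> 0" "mono T (X - Y) \<noteq> 0" "finite X"
        using wedge_nonzero by blast
      with False show False by (auto simp: mono_def split: if_splits)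
    qed
    with False assms show ?thesis by (auto simp: mono_def)
  qed
qed

lemma ext_eq_sum_mono:
  assumes "f \<in> ext_carrier n"
  shows "f = (\<Sum>S\<in>Pow {..<n}. f S *\<^sub>e mono S)"
proof
  fix T
  have "(\<Sum>S\<in>Pow {..<n}. f S *\<^sub>e mono S) T = (\<Sum>S\<in>Pow {..<n}. of_bool (T = S) * f S)"
    unfolding sum_fun_apply by (intro sum.cong refl) (simp add: mono_def)
  also have "\<dots> = f T"
  proof (cases "T \<in> Pow {..<n}")
    case True then show ?thesis by (intro sum_of_bool_mult) auto
  next
    case False
    then have "f T = 0" using assms by (auto simp: ext_carrier_def)
    with False show ?thesis by (auto intro!: sum.neutral)
  qed
  finally show "f T = (\<Sum>S\<in>Pow {..<n}. f S *\<^sub>e mono S) T" by simp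
qed

lemma linear_eq_sum:
  assumes "a \<in> homog n 1"
  shows "a = (\<Sum>i<n. a {i} *\<^sub>e mono {i})"
proof
  fix S
  have "(\<Sum>i<n. a {i} *\<^sub>e mono {i}) S = (\<Sum>i<n. a S * of_bool (S = {i}))"
    unfolding sum_fun_apply by (intro sum.cong refl) (simp add: mono_def)
  also have "\<dots> = a S"
  proof (cases "a S = 0")
    case False
    then obtain i where "S = {i}" "i < n" using homogD[OF assms False] by (auto simp: card_1_singleton_iff)
    then show ?thesis using sum_of_bool_mult[of "{..<n}" i "\<lambda>_. a S"]
      by (simp add: mult.commute eq_commute)
  qed simp
  finally show "a S = (\<Sum>i<n. a {i} *\<^sub>e mono {i}) S" by simp
qed

lemma wedge_commute:
  assumes "f \<in> homog n d" "g \<in> homog n e"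
  shows "g \<cdot> f = (- 1) ^ (d * e) *\<^sub>e (f \<cdot> g)"
proof
  fix S
  show "(g \<cdot> f) S = ((- 1) ^ (d * e) *\<^sub>e (f \<cdot> g)) S"
  proof (cases "finite S")
    case True
    have "(- 1) ^ (card T * card (S - T)) * wedge_sign T (S - T) * f T * g (S - T)
        = (- 1) ^ (d * e) * (wedge_sign T (S - T) * f T * g (S - T))" for T
      using homogD[OF assms(1), of T] homogD[OF assms(2), of "S - T"] by (cases "f T = 0"; cases "g (S - T) = 0") auto
    then show ?thesis unfolding wedge_swap[OF True, of g f] scale_apply
      unfolding wedge_def sum_distrib_left by (intro sum.cong refl)
  qed (simp add: wedge_infinite)
qed

lemma linear_anticommute: "a \<in> homog n 1 \<Longrightarrow> b \<in> homog n 1 \<Longrightarrow> b \<cdot> a = - (a \<cdot> b)"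
  using wedge_commute[of a n 1 b 1] by simp

lemma linear_square: "a \<in> homog n 1 \<Longrightarrow> a \<cdot> a = 0"
  using linear_anticommute[of a n a] by (auto simp: fun_eq_iff)

text \<open>The parity automorphism. With it a linear form can be moved across an element that is
  not homogeneous.\<close>

definition involute :: "ext \<Rightarrow> ext"
  where "involute f = (\<lambda>S. (- 1) ^ card S * f S)"

lemma involute_carrier [simp]: "f \<in> ext_carrier n \<Longrightarrow> involute f \<in> ext_carrier n"
  by (auto simp: involute_def ext_carrier_def)

lemma linear_involute:
  assumes "a \<in> homog n 1"
  shows "w \<cdot> a = a \<cdot> involute w"
proof
  fix S
  show "(w \<cdot> a) S = (a \<cdot> involute w) S"
  proof (cases "finite S")
    case True
    have "(- 1) ^ (card T * card (S - T)) * wedge_sign T (S - T) * a T * w (S - T)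
        = wedge_sign T (S - T) * a T * involute w (S - T)" for T
      using homogD[OF assms, of T] by (cases "a T = 0") (auto simp: involute_def)
    then show ?thesis unfolding wedge_swap[OF True, of w a] unfolding wedge_def by (intro sum.cong refl)
  qed (simp add: wedge_infinite)
qed

lemma part_linear_wedge:
  assumes "a \<in> homog n 1"
  shows "part (Suc d) (a \<cdot> w) = a \<cdot> part d w"
proof
  fix S
  show "part (Suc d) (a \<cdot> w) S = (a \<cdot> part d w) S"
  proof (cases "finite S")
    case True
    have "a T * part d w (S - T) = (if card S = Suc d then a T * w (S - T) else 0)" if "T \<subseteq> S" for T
    proof (cases "a T = 0")
      case False
      then have "card T = 1" using homogD[OF assms] by blast
      moreover have "card (S - T) = card S - card T" "card T \<le> card S"
        using that True by (auto simp: card_Diff_subset finite_subset card_mono)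
      ultimately show ?thesis by (auto simp: part_def)
    qed simp
    then have "wedge_sign T (S - T) * a T * part d w (S - T)
        = (if card S = Suc d then wedge_sign T (S - T) * a T * w (S - T) else 0)" if "T \<subseteq> S" for T
      using that by (simp add: mult.assoc)
    then show ?thesis by (simp add: wedge_def) (simp add: part_def)
  qed (simp add: wedge_infinite part_def)
qed

section \<open>The exterior algebra as a ring, and its ideals\<close>

lemma exterior_sel [simp]:
  "carrier (exterior n) = ext_carrier n" "monoid.mult (exterior n) = (\<cdot>)" "zero (exterior n) = 0"
  "add (exterior n) = (+)" "smult (exterior n) = (*\<^sub>e)" "component (exterior n) d = homog n d"
  "one (exterior n) = mono {}"
  by (auto simp: exterior_def wedge_def scale_def homog_def mono_def fun_eq_iff)

lemma ext_gen_eq: "ext_gen i = mono {i}"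
  by (simp add: ext_gen_def mono_def)

lemma one_in_homog: "mono {} \<in> homog n 0"
  using mono_in[of "{}" n] by simp

lemma wedge_one:
  assumes "f \<in> ext_carrier n"
  shows "mono {} \<cdot> f = f" "f \<cdot> mono {} = f"
proof -
  have "(mono {} \<cdot> f) S = f S \<and> (f \<cdot> mono {}) S = f S" for S
  proof (cases "finite S")
    case True
    have "(mono {} \<cdot> f) S = (\<Sum>T\<in>Pow S. of_bool ({} = T) * f (S - T))"
      unfolding wedge_def by (intro sum.cong) (auto simp: mono_def)
    moreover have "(f \<cdot> mono {}) S = (\<Sum>T\<in>Pow S. of_bool (S = T) * f T)"
      unfolding wedge_def by (intro sum.cong) (auto simp: mono_def)
    ultimately show ?thesis using True by (subst (asm) (1 2) sum_of_bool_mult) auto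
  qed (use assms in \<open>simp add: wedge_infinite ext_carrier_infinite\<close>)
  then show "mono {} \<cdot> f = f" "f \<cdot> mono {} = f" by (auto simp: fun_eq_iff)
qed

lemma ring_exterior: "ring (exterior n)"
proof (rule ringI)
  show "abelian_group (exterior n)"
  proof (rule abelian_groupI)
    fix f assume "f \<in> carrier (exterior n)"
    then show "\<exists>g\<in>carrier (exterior n). g \<oplus>\<^bsub>exterior n\<^esub> f = \<zero>\<^bsub>exterior n\<^esub>"
      by (intro bexI[of _ "- f"]) auto
  qed (auto simp: add_ac)
  show "monoid (exterior n)"
    using homog_carrier[OF one_in_homog, of n] by (intro monoidI) (auto simp: wedge_assoc wedge_one)
qed (auto simp: wedge_distribs)

interpretation exterior: ring "exterior n" for n
  by (rule ring_exterior)

lemma finsum_exterior: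
  fixes f :: "'a \<Rightarrow> ext"
  assumes "\<And>i. i \<in> A \<Longrightarrow> f i \<in> ext_carrier n"
  shows "(\<Oplus>\<^bsub>exterior n\<^esub>i\<in>A. f i) = (\<Sum>i\<in>A. f i)"
  using assms
proof (induction A rule: infinite_finite_induct)
  case (insert i A)
  then show ?case by (subst exterior.finsum_insert) auto
qed (auto simp: exterior.finsum_infinite)

lemma a_minus_exterior:
  assumes "f \<in> ext_carrier n" "g \<in> ext_carrier n"
  shows "\<ominus>\<^bsub>exterior n\<^esub> g = - g" "f \<ominus>\<^bsub>exterior n\<^esub> g = f - g"
proof -
  have "\<ominus>\<^bsub>exterior n\<^esub> g = - g"
    using assms by (intro exterior.minus_equality) auto
  then show "\<ominus>\<^bsub>exterior n\<^esub> g = - g" "f \<ominus>\<^bsub>exterior n\<^esub> g = f - g"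
    by (simp_all add: a_minus_def)
qed

lemma ideal_exteriorI:
  assumes "J \<subseteq> ext_carrier n" "0 \<in> J" "\<And>f g. f \<in> J \<Longrightarrow> g \<in> J \<Longrightarrow> f + g \<in> J"
    "\<And>f g. f \<in> J \<Longrightarrow> g \<in> ext_carrier n \<Longrightarrow> g \<cdot> f \<in> J"
    "\<And>f g. f \<in> J \<Longrightarrow> g \<in> ext_carrier n \<Longrightarrow> f \<cdot> g \<in> J"
  shows "ideal J (exterior n)"
proof (rule idealI)
  have neg: "- f \<in> J" if "f \<in> J" for f
  proof -
    have "((- 1) *\<^sub>e mono {}) \<cdot> f \<in> J"
      using that by (intro assms(4)) (simp_all add: homog_carrier[OF one_in_homog])
    then show ?thesis using that assms(1) wedge_one[of f n] by auto
  qed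
  show "subgroup J (add_monoid (exterior n))"
  proof (rule exterior.add.subgroupI)
    fix f assume f: "f \<in> J"
    then have "\<ominus>\<^bsub>exterior n\<^esub> f = - f" using a_minus_exterior(1)[of f n f] assms(1) by auto
    then show "\<ominus>\<^bsub>exterior n\<^esub> f \<in> J" using neg f by simp
  qed (use assms in auto)
qed (use assms ring_exterior in auto)

lemma ideal_exteriorD:
  assumes "ideal J (exterior n)"
  shows "J \<subseteq> ext_carrier n" "0 \<in> J" "\<And>f g. f \<in> J \<Longrightarrow> g \<in> J \<Longrightarrow> f + g \<in> J"
    "\<And>f g. f \<in> J \<Longrightarrow> g \<in> J \<Longrightarrow> f - g \<in> J" "\<And>f. f \<in> J \<Longrightarrow> - f \<in> J"
    "\<And>f g. f \<in> J \<Longrightarrow> g \<in> ext_carrier n \<Longrightarrow> g \<cdot> f \<in> J"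
    "\<And>f g. f \<in> J \<Longrightarrow> g \<in> ext_carrier n \<Longrightarrow> f \<cdot> g \<in> J"
    "\<And>f c. f \<in> J \<Longrightarrow> c *\<^sub>e f \<in> J"
proof -
  interpret ideal J "exterior n" by fact
  show sub: "J \<subseteq> ext_carrier n" using a_subset by simp
  show "0 \<in> J" using zero_closed by simp
  show add: "f + g \<in> J" if "f \<in> J" "g \<in> J" for f g using a_closed[OF that] by simp
  show l: "g \<cdot> f \<in> J" if "f \<in> J" "g \<in> ext_carrier n" for f g using I_l_closed[of f g] that by simp
  show "f \<cdot> g \<in> J" if "f \<in> J" "g \<in> ext_carrier n" for f g using I_r_closed[of f g] that by simp
  show sc: "c *\<^sub>e f \<in> J" if "f \<in> J" for f c
  proof -
    have "(c *\<^sub>e mono {}) \<cdot> f \<in> J"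
      using that by (intro l) (simp_all add: homog_carrier[OF one_in_homog])
    then show ?thesis by (simp add: wedge_one(1)[OF subsetD[OF sub that]])
  qed
  show neg: "- f \<in> J" if "f \<in> J" for f using sc[OF that, of "-1"] by simp
  show "f - g \<in> J" if "f \<in> J" "g \<in> J" for f g using add[OF that(1) neg[OF that(2)]] by simp
qed

lemma ideal_exterior_sum:
  fixes f :: "'a \<Rightarrow> ext"
  assumes "ideal J (exterior n)" "\<And>i. i \<in> A \<Longrightarrow> f i \<in> J"
  shows "(\<Sum>i\<in>A. f i) \<in> J"
  by (rule sum_closed) (fact ideal_exteriorD(2,3)[OF assms(1)] assms(2))+

lemma quadric_homog_apply:
  shows quadric_homog: "quadric n \<alpha> \<in> homog n 2"
    and quadric_apply: "i < j \<Longrightarrow> j < n \<Longrightarrow> quadric n \<alpha> {i, j} = \<alpha> (i, j)"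
proof -
  have gen: "mono {fst q} \<cdot> mono {snd q} = mono {fst q, snd q}" if "q \<in> index_pairs n" for q
  proof -
    have "{(t, u). t \<in> {fst q} \<and> u \<in> {snd q} \<and> u < t} = {}" using that by (auto simp: index_pairs_def)
    then have "wedge_sign {fst q} {snd q} = 1" unfolding wedge_sign_def by (metis card.empty power_0)
    then show ?thesis using that by (auto simp: mono_wedge index_pairs_def insert_commute)
  qed
  have hom: "mono {fst q, snd q} \<in> homog n 2" if "q \<in> index_pairs n" for q
    using that mono_in[of "{fst q, snd q}" n] by (auto simp: index_pairs_def numeral_2_eq_2)
  have eq: "quadric n \<alpha> = (\<Sum>q\<in>index_pairs n. \<alpha> q *\<^sub>e mono {fst q, snd q})"
    unfolding quadric_def ext_gen_eq
    by (subst finsum_exterior) (simp_all add: gen homog_carrier[OF hom])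
  show "quadric n \<alpha> \<in> homog n 2" unfolding eq using hom by (intro homog_sum) simp
  show "quadric n \<alpha> {i, j} = \<alpha> (i, j)" if ij: "i < j" "j < n"
  proof -
    have "quadric n \<alpha> {i, j} = (\<Sum>q\<in>index_pairs n. of_bool ((i, j) = q) * \<alpha> q)"
      unfolding eq sum_fun_apply using ij
      by (intro sum.cong) (auto simp: mono_def doubleton_eq_iff index_pairs_def)
    also have "\<dots> = \<alpha> (i, j)" using ij finite_index_pairs
      by (intro sum_of_bool_mult) (auto simp: index_pairs_def)
    finally show ?thesis .
  qed
qed

section \<open>Quotients of graded algebras\<close>

text \<open>Scalars act as multiplication by c 1, hence preserve every ideal. The property passes to
  quotients, so it is available for the quotient of a quotient that occurs in
  \<open>lg_quadratic\<close>.\<close>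

locale scalar_ring = ring A for A :: "'b graded_algebra" (structure) +
  assumes smult_closed: "x \<in> carrier A \<Longrightarrow> c \<odot> x \<in> carrier A"
    and smult_eq_mult: "x \<in> carrier A \<Longrightarrow> c \<odot> x = (c \<odot> \<one>) \<otimes> x"

lemma scalar_ring_exterior: "scalar_ring (exterior n)"
  unfolding scalar_ring_def scalar_ring_axioms_def using ring_exterior
  by (auto simp: wedge_one)

lemma rcos_eq_iff:
  assumes "ideal J A" "x \<in> carrier A" "y \<in> carrier A"
  shows "J +>\<^bsub>A\<^esub> x = J +>\<^bsub>A\<^esub> y \<longleftrightarrow> x \<ominus>\<^bsub>A\<^esub> y \<in> J"
proof -
  interpret ideal J A by fact
  show ?thesis using quotient_eq_iff_same_a_r_cos[OF assms] by blast
qed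

lemma quotient_algebra_sel:
  "carrier (quotient_algebra A J) = (+>\<^bsub>A\<^esub>) J ` carrier A"
  "one (quotient_algebra A J) = J +>\<^bsub>A\<^esub> \<one>\<^bsub>A\<^esub>" "zero (quotient_algebra A J) = J"
  "component (quotient_algebra A J) d = (+>\<^bsub>A\<^esub>) J ` component A d"
  by (auto simp: quotient_algebra_def FactRing_def A_RCOSETS_def' image_iff)

lemma quotient_algebra_ops:
  assumes "ideal J A" "x \<in> carrier A" "y \<in> carrier A"
  shows "(J +>\<^bsub>A\<^esub> x) \<otimes>\<^bsub>quotient_algebra A J\<^esub> (J +>\<^bsub>A\<^esub> y) = J +>\<^bsub>A\<^esub> (x \<otimes>\<^bsub>A\<^esub> y)"
    and "(J +>\<^bsub>A\<^esub> x) \<oplus>\<^bsub>quotient_algebra A J\<^esub> (J +>\<^bsub>A\<^esub> y) = J +>\<^bsub>A\<^esub> (x \<oplus>\<^bsub>A\<^esub> y)"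
proof -
  interpret ideal J A by fact
  note hom = rcos_ring_hom
  show "(J +>\<^bsub>A\<^esub> x) \<otimes>\<^bsub>quotient_algebra A J\<^esub> (J +>\<^bsub>A\<^esub> y) = J +>\<^bsub>A\<^esub> (x \<otimes>\<^bsub>A\<^esub> y)"
    "(J +>\<^bsub>A\<^esub> x) \<oplus>\<^bsub>quotient_algebra A J\<^esub> (J +>\<^bsub>A\<^esub> y) = J +>\<^bsub>A\<^esub> (x \<oplus>\<^bsub>A\<^esub> y)"
    using ring_hom_mult[OF hom assms(2,3)] ring_hom_add[OF hom assms(2,3)]
    by (simp_all add: quotient_algebra_def)
qed

lemma ring_quotient_algebra:
  assumes "ideal J A"
  shows "ring (quotient_algebra A J)"
proof -
  interpret ideal J A by fact
  interpret Q: ring "A Quot J" by (rule quotient_is_ring)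
  have "id \<in> ring_iso (A Quot J) (quotient_algebra A J)"
    by (auto simp: ring_iso_def ring_hom_def quotient_algebra_def)
  from Q.ring_iso_imp_img_ring[OF this] show ?thesis
    by (simp add: quotient_algebra_def)
qed

lemma ring_hom_quotient_algebra:
  assumes "ideal J A"
  shows "ring_hom_ring A (quotient_algebra A J) ((+>\<^bsub>A\<^esub>) J)"
proof -
  interpret ideal J A by fact
  show ?thesis
    by (intro ring_hom_ringI2 ring_quotient_algebra assms ring_axioms ring_hom_memI)
       (auto simp: quotient_algebra_sel quotient_algebra_ops[OF assms])
qed

text \<open>All representatives of a coset give the same coset after scaling, so the union in the
  definition of the scalar multiplication collapses.\<close>

lemma (in scalar_ring) quotient_algebra_smult:
  assumes "ideal J A" "x \<in> carrier A"
  shows "c \<odot>\<^bsub>quotient_algebra A J\<^esub> (J +> x) = J +> (c \<odot> x)"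
proof -
  interpret J: ideal J A by fact
  have "J +> (c \<odot> y) = J +> (c \<odot> x)" if y: "y \<in> J +> x" for y
  proof -
    obtain j where j: "j \<in> J" "y = j \<oplus> x" using y by (auto simp: a_r_coset_def')
    then have cl: "j \<in> carrier A" "y \<in> carrier A" using assms J.a_Hcarr by auto
    have "c \<odot> y \<ominus> c \<odot> x = (c \<odot> \<one>) \<otimes> (y \<ominus> x)"
      using cl assms smult_closed by (simp add: smult_eq_mult[of y] smult_eq_mult[of x] r_distr r_minus a_minus_def)
    also have "y \<ominus> x = j" using cl assms j by (simp add: a_minus_def a_assoc r_neg)
    finally have "c \<odot> y \<ominus> c \<odot> x \<in> J" using J.I_l_closed[OF j(1)] smult_closed by simp
    then show ?thesis using rcos_eq_iff[OF assms(1)] cl assms smult_closed by simp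
  qed
  moreover have "x \<in> J +> x" using assms J.a_rcos_self by simp
  ultimately have "(\<Union>y\<in>J +> x. J +> (c \<odot> y)) = J +> (c \<odot> x)" by blast
  then show ?thesis by (simp add: quotient_algebra_def)
qed

lemma (in scalar_ring) scalar_ring_quotient_algebra:
  assumes "ideal J A"
  shows "scalar_ring (quotient_algebra A J)"
proof -
  interpret Q: ring "quotient_algebra A J" by (rule ring_quotient_algebra[OF assms])
  show ?thesis
  proof
    fix c X assume "X \<in> carrier (quotient_algebra A J)"
    then obtain x where x: "x \<in> carrier A" "X = J +> x" by (auto simp: quotient_algebra_sel)
    show "c \<odot>\<^bsub>quotient_algebra A J\<^esub> X \<in> carrier (quotient_algebra A J)"
      using x by (auto simp: quotient_algebra_smult[OF assms] quotient_algebra_sel smult_closed)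
    show "c \<odot>\<^bsub>quotient_algebra A J\<^esub> X
        = (c \<odot>\<^bsub>quotient_algebra A J\<^esub> \<one>\<^bsub>quotient_algebra A J\<^esub>) \<otimes>\<^bsub>quotient_algebra A J\<^esub> X"
      using x smult_closed smult_eq_mult[of x c]
      by (simp add: quotient_algebra_smult[OF assms] quotient_algebra_sel quotient_algebra_ops[OF assms])
  qed
qed

lemma ideal_image_quotient_algebra:
  assumes J: "ideal J A" and K: "ideal K A"
  shows "ideal ((+>\<^bsub>A\<^esub>) J ` K) (quotient_algebra A J)"
proof -
  interpret ring A using J ideal.axioms(2) by blast
  interpret Q: ring "quotient_algebra A J" by (rule ring_quotient_algebra[OF J])
  interpret QK: ideal "(+>\<^bsub>A\<^esub>) J ` K" "A Quot J"
    by (rule ring_ideal_imp_quot_ideal[OF J K])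
  have [simp]: "carrier (quotient_algebra A J) = carrier (A Quot J)"
    "monoid.mult (quotient_algebra A J) = monoid.mult (A Quot J)"
    "add (quotient_algebra A J) = add (A Quot J)" "zero (quotient_algebra A J) = zero (A Quot J)"
    by (simp_all add: quotient_algebra_def)
  show ?thesis
  proof (rule idealI)
    show "subgroup ((+>\<^bsub>A\<^esub>) J ` K) (add_monoid (quotient_algebra A J))"
      using QK.a_subgroup unfolding additive_subgroup_def subgroup_def m_inv_def by simp
  qed (use QK.I_l_closed QK.I_r_closed Q.ring_axioms in auto)
qed

section \<open>The ideal of generic quadrics\<close>

definition gen_quadric :: "(coord \<Rightarrow> complex) \<Rightarrow> nat \<Rightarrow> ext"
  where "gen_quadric x a = quadric 6 (\<lambda>q. x (a, q))"

definition quad_span :: "(coord \<Rightarrow> complex) \<Rightarrow> ext set"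
  where "quad_span x = {g. \<exists>c. g = (\<Sum>a<6. c a *\<^sub>e gen_quadric x a)}"

text \<open>The shape that the generated ideal takes once it contains all cubics: nothing in degrees
  0 and 1, the span in degree 2, everything above. Membership becomes a condition on the parts of
  degree at most 2.\<close>

definition quad_ideal :: "(coord \<Rightarrow> complex) \<Rightarrow> ext set"
  where "quad_ideal x = {g \<in> ext_carrier 6. part 0 g = 0 \<and> part 1 g = 0 \<and> part 2 g \<in> quad_span x}"

lemma quad_spanI: "(\<Sum>a<6. c a *\<^sub>e gen_quadric x a) \<in> quad_span x"
  by (auto simp: quad_span_def)

lemma quad_span_homog: "g \<in> quad_span x \<Longrightarrow> g \<in> homog 6 2"
  by (auto simp: quad_span_def gen_quadric_def intro!: homog_sum homog_closed quadric_homog)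

lemma quad_span_closed:
  "0 \<in> quad_span x" "g \<in> quad_span x \<Longrightarrow> h \<in> quad_span x \<Longrightarrow> g + h \<in> quad_span x"
  "g \<in> quad_span x \<Longrightarrow> c *\<^sub>e g \<in> quad_span x"
proof -
  show "0 \<in> quad_span x" using quad_spanI[of "\<lambda>_. 0"] by simp
  show "g + h \<in> quad_span x" if gh: "g \<in> quad_span x" "h \<in> quad_span x"
  proof -
    obtain c d where "g = (\<Sum>a<6. c a *\<^sub>e gen_quadric x a)" "h = (\<Sum>a<6. d a *\<^sub>e gen_quadric x a)"
      using gh by (auto simp: quad_span_def)
    then have "g + h = (\<Sum>a<6. (c a + d a) *\<^sub>e gen_quadric x a)"
      by (simp add: scale_distribs sum.distrib)
    then show ?thesis using quad_spanI by metis
  qed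
  show "c *\<^sub>e g \<in> quad_span x" if g: "g \<in> quad_span x"
  proof -
    obtain d where "g = (\<Sum>a<6. d a *\<^sub>e gen_quadric x a)" using g by (auto simp: quad_span_def)
    then have "c *\<^sub>e g = (\<Sum>a<6. (c * d a) *\<^sub>e gen_quadric x a)" by (simp add: scale_sum)
    then show ?thesis using quad_spanI by metis
  qed
qed

lemma homog_2_eqI:
  assumes "g \<in> homog n 2" "h \<in> homog n 2" "\<And>j k. j < k \<Longrightarrow> k < n \<Longrightarrow> g {j, k} = h {j, k}"
  shows "g = h"
proof
  fix S
  show "g S = h S"
  proof (cases "S \<subseteq> {..<n} \<and> card S = 2")
    case True
    then obtain a b where ab: "S = {a, b}" "a \<noteq> b" by (auto simp: card_2_iff)
    show ?thesis
    proof (cases "a < b")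
      case True
      then show ?thesis using assms(3)[of a b] ab \<open>S \<subseteq> {..<n} \<and> card S = 2\<close> by auto
    next
      case False
      then show ?thesis using assms(3)[of b a] ab \<open>S \<subseteq> {..<n} \<and> card S = 2\<close> by (auto simp: insert_commute)
    qed
  next
    case False
    then show ?thesis using homogD[OF assms(1), of S] homogD[OF assms(2), of S] by metis
  qed
qed

lemma quad_span_iff:
  assumes "g \<in> homog 6 2"
  shows "g \<in> quad_span x \<longleftrightarrow> (\<exists>c. \<forall>j k. j < k \<and> k < 6 \<longrightarrow> g {j, k} = (\<Sum>a<6. c a * x (a, j, k)))"
proof -
  have val: "(\<Sum>a<6. c a *\<^sub>e gen_quadric x a) {j, k} = (\<Sum>a<6. c a * x (a, j, k))" if "j < k" "k < 6" for c j k
    using that by (simp add: sum_fun_apply gen_quadric_def quadric_apply)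
  show ?thesis
  proof
    assume "g \<in> quad_span x"
    then show "\<exists>c. \<forall>j k. j < k \<and> k < 6 \<longrightarrow> g {j, k} = (\<Sum>a<6. c a * x (a, j, k))"
      using val by (auto simp: quad_span_def)
  next
    assume "\<exists>c. \<forall>j k. j < k \<and> k < 6 \<longrightarrow> g {j, k} = (\<Sum>a<6. c a * x (a, j, k))"
    then obtain c where c: "\<And>j k. j < k \<Longrightarrow> k < 6 \<Longrightarrow> g {j, k} = (\<Sum>a<6. c a * x (a, j, k))" by blast
    have "g = (\<Sum>a<6. c a *\<^sub>e gen_quadric x a)"
      using assms quad_span_homog[OF quad_spanI] by (rule homog_2_eqI) (simp add: c val)
    then show "g \<in> quad_span x" using quad_spanI by metis
  qed
qed

text \<open>As g starts in degree 2, only the constant term of w contributes to a product in degrees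
  up to 2.\<close>

lemma wedge_low_parts:
  assumes "g \<in> ext_carrier n" "part 0 g = 0" "part 1 g = 0" "w \<in> ext_carrier n"
  shows "part 0 (w \<cdot> g) = 0" "part 1 (w \<cdot> g) = 0" "part 2 (w \<cdot> g) = w {} *\<^sub>e part 2 g"
    "part 0 (g \<cdot> w) = 0" "part 1 (g \<cdot> w) = 0" "part 2 (g \<cdot> w) = w {} *\<^sub>e part 2 g"
proof -
  have g0: "g T = 0" if "card T < 2" for T
    using that fun_cong[OF assms(2), of T] fun_cong[OF assms(3), of T]
    by (auto simp: part_def less_2_cases_iff split: if_splits)
  have l: "(w \<cdot> g) S = w {} * g S" and r: "(g \<cdot> w) S = w {} * g S" if "card S \<le> 2" for S
  proof -
    have "(w \<cdot> g) S = w {} * g S \<and> (g \<cdot> w) S = w {} * g S"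
    proof (cases "finite S")
      case True
      have 0: "g T = 0" if "T \<subset> S" for T
        using psubset_card_mono[OF True that] \<open>card S \<le> 2\<close> by (intro g0) simp
      have 1: "wedge_sign T (S - T) * w T * g (S - T) = of_bool ({} = T) * (w T * g (S - T))"
        if "T \<in> Pow S" for T
      proof (cases "T = {}")
        case False
        then have "S - T \<subset> S" using that by auto
        with False show ?thesis by (simp add: 0)
      qed simp
      have 2: "wedge_sign T (S - T) * g T * w (S - T) = of_bool (S = T) * (g T * w (S - T))"
        if "T \<in> Pow S" for T
      proof (cases "T = S")
        case False
        then have "T \<subset> S" using that by auto
        with False show ?thesis by (simp add: 0)
      qed simp
      have "(w \<cdot> g) S = (\<Sum>T\<in>Pow S. of_bool ({} = T) * (w T * g (S - T)))"
        unfolding wedge_def by (intro sum.cong refl 1)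
      moreover have "(g \<cdot> w) S = (\<Sum>T\<in>Pow S. of_bool (S = T) * (g T * w (S - T)))"
        unfolding wedge_def by (intro sum.cong refl 2)
      ultimately show ?thesis using True by (subst (asm) (1 2) sum_of_bool_mult) auto
    qed (use assms in \<open>simp add: wedge_infinite ext_carrier_infinite\<close>)
    then show "(w \<cdot> g) S = w {} * g S" "(g \<cdot> w) S = w {} * g S" by auto
  qed
  show "part 0 (w \<cdot> g) = 0" "part 1 (w \<cdot> g) = 0" "part 2 (w \<cdot> g) = w {} *\<^sub>e part 2 g"
    "part 0 (g \<cdot> w) = 0" "part 1 (g \<cdot> w) = 0" "part 2 (g \<cdot> w) = w {} *\<^sub>e part 2 g"
    using l r g0 by (auto simp: part_def fun_eq_iff)
qed

lemma ideal_quad_ideal: "ideal (quad_ideal x) (exterior 6)"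
  by (rule ideal_exteriorI)
     (auto simp: quad_ideal_def part_linear quad_span_closed wedge_low_parts simp del: One_nat_def)

lemma gen_quadric_in_quad_span: "a < 6 \<Longrightarrow> gen_quadric x a \<in> quad_span x"
proof -
  assume a: "a < 6"
  have "(\<Sum>b<6. of_bool (a = b) *\<^sub>e gen_quadric x b) = gen_quadric x a"
  proof
    fix S
    show "(\<Sum>b<6. of_bool (a = b) *\<^sub>e gen_quadric x b) S = gen_quadric x a S"
      using sum_of_bool_mult[of "{..<6}" a "\<lambda>b. gen_quadric x b S"] a by (simp add: sum_fun_apply)
  qed
  then show ?thesis using quad_spanI by metis
qed

lemma quad_span_in_quad_ideal: "g \<in> quad_span x \<Longrightarrow> g \<in> quad_ideal x"
  using quad_span_homog[of g x] homog_carrier by (auto simp: quad_ideal_def part_of_homog)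

lemma homog_in_quad_ideal: "g \<in> homog 6 d \<Longrightarrow> d \<ge> 3 \<Longrightarrow> g \<in> quad_ideal x"
  using homog_carrier by (auto simp: quad_ideal_def part_of_homog quad_span_closed)

lemma mono_singleton_wedge:
  assumes "w \<in> ext_carrier n"
  shows "(mono {j} \<cdot> w) S = (if j \<in> S then wedge_sign {j} (S - {j}) * w (S - {j}) else 0)"
proof (cases "finite S \<and> j \<in> S")
  case True
  have "(mono {j} \<cdot> w) S = (\<Sum>T\<in>Pow S. of_bool ({j} = T) * (wedge_sign T (S - T) * w (S - T)))"
    unfolding wedge_def by (intro sum.cong) (auto simp: mono_def)
  then show ?thesis using True sum_of_bool_mult[of "Pow S" "{j}" "\<lambda>T. wedge_sign T (S - T) * w (S - T)"] by simp
next
  case False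
  have "(mono {j} \<cdot> w) S = 0"
  proof (rule ccontr)
    assume "(mono {j} \<cdot> w) S \<noteq> 0"
    then obtain T where "T \<subseteq> S" "mono {j} T \<noteq> 0" "finite S" using wedge_nonzero by blast
    with False show False by (auto simp: mono_def split: if_splits)
  qed
  moreover have "w (S - {j}) = 0" if "j \<in> S" using False that assms by (intro ext_carrier_infinite) auto
  ultimately show ?thesis by auto
qed

lemma ext_eq_sum_parts: "g \<in> ext_carrier n \<Longrightarrow> g = (\<Sum>d\<le>n. part d g)"
proof
  fix S assume g: "g \<in> ext_carrier n"
  show "g S = (\<Sum>d\<le>n. part d g) S"
  proof (cases "g S = 0")
    case True
    then show ?thesis by (simp add: sum_fun_apply part_def)
  next
    case False
    then have "card S \<le> n" using g card_mono[of "{..<n}" S] by (auto simp: ext_carrier_def)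
    then show ?thesis using sum_of_bool_mult[of "{..n}" "card S" "\<lambda>_. g S"]
      by (simp add: sum_fun_apply part_def of_bool_def)
  qed
qed

lemma cubics_generatedD:
  assumes x: "cubics_generated x" and J: "ideal J (exterior 6)"
    and gen: "\<And>a. a < 6 \<Longrightarrow> gen_quadric x a \<in> J" and h: "h \<in> homog 6 3"
  shows "h \<in> J"
proof -
  obtain j a where ja: "\<And>T. T \<in> triples \<Longrightarrow> j T < 6 \<and> a T < 6"
    and surj: "\<And>b. \<exists>c. \<forall>S\<in>triples. (\<Sum>T\<in>triples. c T * cubic_entry (j T) (a T) x S) = b S"
    using x unfolding cubics_generated_def by blast
  obtain c where c: "\<And>S. S \<in> triples \<Longrightarrow> (\<Sum>T\<in>triples. c T * cubic_entry (j T) (a T) x S) = h S"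
    using surj[of h] by blast
  have quad: "gen_quadric x b \<in> homog 6 2" for b by (simp add: gen_quadric_def quadric_homog)
  have lin: "mono {j T} \<in> homog 6 1" if "T \<in> triples" for T using mono_in[of "{j T}" 6] ja[OF that] by simp
  have entry: "(mono {i} \<cdot> gen_quadric x b) S = cubic_entry i b x S" if S: "S \<in> triples" for i b S
  proof (cases "i \<in> S")
    case True
    have "card (S - {i}) = 2" using S True finite_subset[of S "{..<6}"] by (auto simp: triples_def)
    then obtain m n where mn: "S - {i} = {m, n}" "m \<noteq> n" by (auto simp: card_2_iff)
    then have lt: "m < 6" "n < 6" using S by (auto simp: triples_def)
    have "gen_quadric x b {m, n} = x (b, Min {m, n}, Max {m, n})"
      unfolding gen_quadric_def using quadric_apply[of m n 6] quadric_apply[of n m 6] mn(2) lt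
      by (cases "m < n") (auto simp: insert_commute min_def max_def)
    then show ?thesis using True
      unfolding mono_singleton_wedge[OF homog_carrier[OF quad]] cubic_entry_def mn(1) by simp
  qed (simp add: mono_singleton_wedge[OF homog_carrier[OF quad]] cubic_entry_def)
  have "h = (\<Sum>T\<in>triples. c T *\<^sub>e (mono {j T} \<cdot> gen_quadric x (a T)))" (is "h = ?r")
  proof
    fix S
    have r: "?r \<in> homog 6 3"
      using homog_wedge[OF lin quad] by (intro homog_sum homog_closed) (simp add: numeral_3_eq_3)
    show "h S = ?r S"
    proof (cases "S \<in> triples")
      case True
      then show ?thesis by (simp add: sum_fun_apply entry c)
    next
      case False
      then have *: "\<not> (S \<subseteq> {..<6} \<and> card S = 3)" by (simp add: triples_def)
      have "h S = 0" using homogD[OF h] * by blast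
      moreover have "?r S = 0" using homogD[OF r] * by blast
      ultimately show ?thesis by simp
    qed
  qed
  also have "\<dots> \<in> J"
    by (intro ideal_exterior_sum[OF J] ideal_exteriorD(8)[OF J] ideal_exteriorD(6)[OF J] gen
        homog_carrier[OF lin]) (simp_all add: ja)
  finally show ?thesis .
qed

text \<open>A monomial of degree at least 3 is, up to sign, a cubic monomial times another one, so
  containing all cubics means containing everything of higher degree.\<close>

lemma Idl_generic:
  assumes x: "cubics_generated x"
  shows "Idl\<^bsub>exterior 6\<^esub> (gen_quadric x ` {..<6}) = quad_ideal x" (is "?I = _")
proof
  show "?I \<subseteq> quad_ideal x"
    using gen_quadric_in_quad_span quad_span_in_quad_ideal
    by (intro exterior.genideal_minimal ideal_quad_ideal) auto
  have sub: "gen_quadric x ` {..<6} \<subseteq> carrier (exterior 6)"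
    by (auto simp: gen_quadric_def intro: homog_carrier quadric_homog)
  have I: "ideal ?I (exterior 6)" by (rule exterior.genideal_ideal[OF sub])
  have gen: "gen_quadric x a \<in> ?I" if "a < 6" for a
    using exterior.genideal_self[OF sub] that by auto
  have mono: "mono S \<in> ?I" if S: "S \<subseteq> {..<6}" "card S \<ge> 3" for S
  proof -
    obtain T where T: "T \<subseteq> S" "card T = 3" using S(2) by (meson obtain_subset_with_card_n)
    have "finite S" using S(1) by (rule finite_subset) simp
    then have fin: "finite T" "finite (S - T)" using T by (auto intro: finite_subset)
    have "mono T \<in> ?I" using mono_in[of T 6] T S by (intro cubics_generatedD[OF x I gen]) auto
    then have "mono T \<cdot> mono (S - T) \<in> ?I"
      using S homog_carrier[OF mono_in[of "S - T" 6]] by (intro ideal_exteriorD(7)[OF I]) auto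
    then have "wedge_sign T (S - T) *\<^sub>e (mono T \<cdot> mono (S - T)) \<in> ?I" by (rule ideal_exteriorD(8)[OF I])
    then show ?thesis using fin T by (simp add: mono_wedge Un_absorb1)
  qed
  show "quad_ideal x \<subseteq> ?I"
  proof
    fix g assume g: "g \<in> quad_ideal x"
    then have car: "g \<in> ext_carrier 6" by (simp add: quad_ideal_def)
    have "part d g \<in> ?I" for d
    proof -
      consider "d = 0" | "d = 1" | "d = 2" | "d \<ge> 3" by linarith
      then show ?thesis
      proof cases
        case 3
        then obtain c where c: "part d g = (\<Sum>a<6. c a *\<^sub>e gen_quadric x a)"
          using g by (auto simp: quad_ideal_def quad_span_def)
        show ?thesis unfolding c
          by (intro ideal_exterior_sum[OF I] ideal_exteriorD(8)[OF I] gen) simp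
      next
        case 4
        have hom: "part d g \<in> homog 6 d" by (rule part_homog[OF car])
        have "part d g S *\<^sub>e mono S \<in> ?I" if "S \<in> Pow {..<6}" for S
        proof (cases "part d g S = 0")
          case False
          then have "card S = d" using homogD[OF hom] by blast
          then show ?thesis using that 4 by (intro ideal_exteriorD(8)[OF I] mono) auto
        qed (simp add: ideal_exteriorD(2)[OF I])
        then show ?thesis
          by (subst ext_eq_sum_mono[OF homog_carrier[OF hom]]) (rule ideal_exterior_sum[OF I])
      qed (use g ideal_exteriorD(2)[OF I] in \<open>auto simp: quad_ideal_def\<close>)
    qed
    then show "g \<in> ?I" by (subst ext_eq_sum_parts[OF car]) (rule ideal_exterior_sum[OF I])
  qed
qed

lemma plucker_anisotropic_independent:
  assumes "plucker_anisotropic x" "\<And>j k. j < k \<Longrightarrow> k < 6 \<Longrightarrow> (\<Sum>a<6. c a * x (a, j, k)) = 0" "a < 6"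
  shows "c a = 0"
  using assms unfolding plucker_anisotropic_def Let_def plucker_form_def by auto

section \<open>The linear resolution\<close>

text \<open>The sequence satisfies N(i+2) = 6 N(i+1) - 9 N(i), which is what exactness of a linear
  resolution requires over an algebra with Hilbert function 1, 6, 9.\<close>

definition ncount :: "nat \<Rightarrow> nat"
  where "ncount i = Suc i * 3 ^ i"

lemma card_normal_words: "card (normal_words i) = ncount i"
proof -
  define A where "A = (SIGMA a:{..i}. {v. set v \<subseteq> {..<3::nat} \<and> length v = a} \<times>
    {v'. set v' \<subseteq> {3..<6::nat} \<and> length v' = i - a})"
  define f where "f = (\<lambda>(a::nat, v::nat list, v'). v @ v')"
  have "f ` A = normal_words i"
  proof (intro equalityI subsetI)
    fix w assume "w \<in> normal_words i"
    then obtain v v' where v: "w = v @ v'" "set v \<subseteq> {..<3}" "set v' \<subseteq> {3..<6}" "w \<in> words i"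
      unfolding normal_words_def by blast
    then have "(length v, v, v') \<in> A" "w = f (length v, v, v')" by (auto simp: A_def f_def words_def)
    then show "w \<in> f ` A" by blast
  next
    fix w assume "w \<in> f ` A"
    then obtain v v' where "w = v @ v'" "set v \<subseteq> {..<3}" "set v' \<subseteq> {3..<6}" "length v + length v' = i"
      by (auto simp: A_def f_def)
    then show "w \<in> normal_words i" by (fastforce simp: normal_words_def words_def)
  qed
  moreover have "inj_on f A"
  proof (rule inj_onI)
    fix p q assume pq: "p \<in> A" "q \<in> A" "f p = f q"
    obtain a v v' b w w' where eq: "p = (a, v, v')" "q = (b, w, w')" by (metis prod.exhaust)
    \<comment> \<open>The cut is recovered from the word as the end of its longest prefix of letters
      below 3.\<close>
    have tw: "takeWhile (\<lambda>j. j < 3) (v @ v') = v"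
      if "set v \<subseteq> {..<3}" "set v' \<subseteq> {3..<6}" for v v' :: "nat list"
    proof -
      have "takeWhile (\<lambda>j. j < 3) v' = []" using that(2) by (cases v') auto
      then show ?thesis using that(1) by (subst takeWhile_append2) auto
    qed
    have "v @ v' = w @ w'" using pq eq by (simp add: f_def)
    moreover have "v = w" using tw[of v v'] tw[of w w'] calculation pq eq by (auto simp: A_def)
    ultimately show "p = q" using pq eq by (auto simp: A_def)
  qed
  ultimately have "card (normal_words i) = card A" using card_image by metis
  also have "card A = (\<Sum>a\<le>i. 3 ^ a * 3 ^ (i - a))"
    unfolding A_def
    by (subst card_SigmaI) (auto simp: card_cartesian_product card_lists_length_eq finite_lists_length_eq)
  also have "\<dots> = (\<Sum>a\<le>i. 3 ^ i)" by (intro sum.cong) (auto simp flip: power_add)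
  finally show ?thesis by (simp add: ncount_def)
qed

definition normal_word :: "nat \<Rightarrow> nat \<Rightarrow> nat list"
  where "normal_word i = (SOME f. bij_betw f {..<ncount i} (normal_words i))"

lemma bij_normal_word: "bij_betw (normal_word i) {..<ncount i} (normal_words i)"
proof -
  have "finite (normal_words i)" using finite_words by (simp add: normal_words_def)
  from ex_bij_betw_nat_finite[OF this] have "\<exists>f. bij_betw f {..<ncount i} (normal_words i)"
    by (simp add: card_normal_words atLeast0LessThan)
  then show ?thesis unfolding normal_word_def by (rule someI_ex)
qed

lemma normal_word_in: "s < ncount i \<Longrightarrow> normal_word i s \<in> normal_words i"
  using bij_normal_word[of i] by (auto simp: bij_betw_def)

lemma normal_word_words: "s < ncount i \<Longrightarrow> normal_word i s \<in> words i"
  using normal_word_in[of s i] by (simp add: normal_words_def)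

lemma normal_wordE:
  assumes "w \<in> normal_words i"
  obtains s where "s < ncount i" "w = normal_word i s"
  using assms bij_normal_word[of i] by (auto simp: bij_betw_def)

lemma normal_words_01: "i < 2 \<Longrightarrow> normal_words i = words i"
proof -
  assume "i < 2"
  have "\<exists>v v'. w = v @ v' \<and> set v \<subseteq> {..<3} \<and> set v' \<subseteq> {3..<6}" if w: "w \<in> words i" for w
  proof (cases w)
    case Nil
    then show ?thesis by (intro exI[of _ "[]"]) simp
  next
    case (Cons j v)
    then have "w = [j]" "j < 6" using w \<open>i < 2\<close> by (auto simp: words_def)
    then show ?thesis
      by (cases "j < 3") (auto intro: exI[of _ "[j]"] exI[of _ "[]"])
  qed
  then show ?thesis by (auto simp: normal_words_def)
qed

section \<open>Closure properties of Koszul tensors and dual bases\<close>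

lemma koszul_tensor_sum:
  assumes "\<And>s. s \<in> A \<Longrightarrow> koszul_tensor x i (u s)"
  shows "koszul_tensor x i (\<lambda>w. \<Sum>s\<in>A. c s * u s w)"
  unfolding koszul_tensor_def
proof (intro allI impI)
  fix p s :: "nat list"
  assume ps: "set p \<subseteq> {..<6} \<and> set s \<subseteq> {..<6} \<and> length p + length s + 2 = i"
  have "\<forall>r\<in>A. \<exists>d. \<forall>j k. j < k \<and> k < 6 \<longrightarrow>
         u r (p @ j # k # s) - u r (p @ k # j # s) = (\<Sum>a<6. d a * x (a, j, k))"
    using assms ps unfolding koszul_tensor_def by blast
  from bchoice[OF this] obtain d where d: "\<forall>r\<in>A. \<forall>j k. j < k \<and> k < 6 \<longrightarrow>
         u r (p @ j # k # s) - u r (p @ k # j # s) = (\<Sum>a<6. d r a * x (a, j, k))" ..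
  have "(\<Sum>r\<in>A. c r * u r (p @ j # k # s)) - (\<Sum>r\<in>A. c r * u r (p @ k # j # s))
      = (\<Sum>a<6. (\<Sum>r\<in>A. c r * d r a) * x (a, j, k))" if jk: "j < k \<and> k < 6" for j k
  proof -
    have "(\<Sum>r\<in>A. c r * u r (p @ j # k # s)) - (\<Sum>r\<in>A. c r * u r (p @ k # j # s))
        = (\<Sum>r\<in>A. c r * (u r (p @ j # k # s) - u r (p @ k # j # s)))"
      by (simp add: sum_subtractf right_diff_distrib)
    also have "\<dots> = (\<Sum>r\<in>A. \<Sum>a<6. c r * d r a * x (a, j, k))"
      using d jk by (intro sum.cong refl) (simp add: sum_distrib_left mult.assoc)
    also have "\<dots> = (\<Sum>a<6. \<Sum>r\<in>A. c r * d r a * x (a, j, k))" by (rule sum.swap)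
    finally show ?thesis by (simp add: sum_distrib_right)
  qed
  then show "\<exists>d. \<forall>j k. j < k \<and> k < 6 \<longrightarrow>
      (\<Sum>r\<in>A. c r * u r (p @ j # k # s)) - (\<Sum>r\<in>A. c r * u r (p @ k # j # s))
      = (\<Sum>a<6. d a * x (a, j, k))"
    by (intro exI[of _ "\<lambda>a. \<Sum>r\<in>A. c r * d r a"]) blast
qed

lemma koszul_tensor_diff:
  assumes "koszul_tensor x i u" "koszul_tensor x i v"
  shows "koszul_tensor x i (\<lambda>w. u w - v w)"
proof -
  have "koszul_tensor x i (\<lambda>w. \<Sum>s\<in>{True, False}. (if s then 1 else - 1) * (if s then u else v) w)"
    using assms by (intro koszul_tensor_sum) auto
  then show ?thesis by simp
qed

lemma koszul_tensor_Cons: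
  assumes "koszul_tensor x (Suc i) u" "j < 6"
  shows "koszul_tensor x i (\<lambda>w. u (j # w))"
  unfolding koszul_tensor_def
proof (intro allI impI)
  fix p s :: "nat list"
  assume "set p \<subseteq> {..<6} \<and> set s \<subseteq> {..<6} \<and> length p + length s + 2 = i"
  then have "set (j # p) \<subseteq> {..<6} \<and> set s \<subseteq> {..<6} \<and> length (j # p) + length s + 2 = Suc i"
    using assms(2) by simp
  from assms(1)[unfolded koszul_tensor_def, rule_format, OF this]
  show "\<exists>c. \<forall>k l. k < l \<and> l < 6 \<longrightarrow>
      u (j # p @ k # l # s) - u (j # p @ l # k # s) = (\<Sum>a<6. c a * x (a, k, l))"
    by simp
qed

text \<open>A slice with a nonempty prefix is a slice of a tail, so beyond the tails only the slices
  at the front have to be checked.\<close>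

lemma koszul_tensor_ConsI:
  assumes tail: "\<And>j. j < 6 \<Longrightarrow> koszul_tensor x (Suc i) (\<lambda>w. u (j # w))"
    and slice: "\<And>s. s \<in> words i \<Longrightarrow> \<exists>c. \<forall>j k. j < k \<and> k < 6 \<longrightarrow>
      u (j # k # s) - u (k # j # s) = (\<Sum>a<6. c a * x (a, j, k))"
  shows "koszul_tensor x (Suc (Suc i)) u"
  unfolding koszul_tensor_def
proof (intro allI impI)
  fix p s :: "nat list"
  assume ps: "set p \<subseteq> {..<6} \<and> set s \<subseteq> {..<6} \<and> length p + length s + 2 = Suc (Suc i)"
  show "\<exists>c. \<forall>j k. j < k \<and> k < 6 \<longrightarrow>
      u (p @ j # k # s) - u (p @ k # j # s) = (\<Sum>a<6. c a * x (a, j, k))"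
  proof (cases p)
    case Nil
    then show ?thesis using slice[of s] ps by (simp add: words_def)
  next
    case (Cons l p')
    then show ?thesis using tail[of l] ps unfolding koszul_tensor_def by simp
  qed
qed

lemma koszul_tensor_01: "i < 2 \<Longrightarrow> koszul_tensor x i u"
  by (auto simp: koszul_tensor_def)

text \<open>The basis dual to the coordinates at the normal words. Its existence says that these
  coordinates can be prescribed freely, which is the lower bound matching
  \<open>normal_determined\<close>.\<close>

definition dual_tensors :: "(coord \<Rightarrow> complex) \<Rightarrow> nat \<Rightarrow> (nat \<Rightarrow> nat list \<Rightarrow> complex) \<Rightarrow> bool"
  where "dual_tensors x i \<kappa> \<longleftrightarrow> (\<forall>s<ncount i. koszul_tensor x i (\<kappa> s) \<and>
    (\<forall>t<ncount i. \<kappa> s (normal_word i t) = of_bool (t = s)))"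

text \<open>A general element of V \<otimes> T, where T is the span of the tensors
  \<open>\<kappa> s\<close> and \<open>z s j\<close> is the coefficient of e_j \<otimes>
  \<open>\<kappa> s\<close>. Every Koszul tensor of the next degree has this form on words.\<close>

definition cons_tensor :: "nat \<Rightarrow> (nat \<Rightarrow> nat list \<Rightarrow> complex) \<Rightarrow> (nat \<Rightarrow> nat \<Rightarrow> complex) \<Rightarrow> nat list \<Rightarrow> complex"
  where "cons_tensor i \<kappa> z w = (\<Sum>s<ncount i. z s (hd w) * \<kappa> s (tl w))"

section \<open>Existence of the dual tensors\<close>

locale generic_quadrics =
  fixes x :: "coord \<Rightarrow> complex"
  assumes anisotropic: "plucker_anisotropic x"
    and determined: "\<And>i. normal_determined x i"
    and cubics: "cubics_generated x"
begin

text \<open>The difference of the two sides is a Koszul tensor that vanishes at the normal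
  words.\<close>

lemma tensor_expansion:
  assumes \<kappa>: "dual_tensors x i \<kappa>" and u: "koszul_tensor x i u" and w: "w \<in> words i"
  shows "u w = (\<Sum>s<ncount i. u (normal_word i s) * \<kappa> s w)"
proof -
  define v where "v w = u w - (\<Sum>s<ncount i. u (normal_word i s) * \<kappa> s w)" for w
  have "koszul_tensor x i v" unfolding v_def
    using \<kappa> by (intro koszul_tensor_diff u koszul_tensor_sum) (simp add: dual_tensors_def)
  moreover have "v w' = 0" if w': "w' \<in> normal_words i" for w'
  proof -
    obtain t where t: "t < ncount i" "w' = normal_word i t" by (rule normal_wordE[OF w'])
    have "(\<Sum>s<ncount i. u (normal_word i s) * \<kappa> s w') = (\<Sum>s<ncount i. of_bool (t = s) * u (normal_word i s))"
      using \<kappa> t by (intro sum.cong) (auto simp: dual_tensors_def)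
    also have "\<dots> = u w'" using t by (subst sum_of_bool_mult) auto
    finally show ?thesis by (simp add: v_def)
  qed
  ultimately have "v w = 0" using determined[of i] w unfolding normal_determined_def by blast
  then show ?thesis by (simp add: v_def)
qed

context
  fixes i \<kappa> \<kappa>'
  assumes \<kappa>: "dual_tensors x i \<kappa>" and \<kappa>': "dual_tensors x (Suc i) \<kappa>'"
begin

abbreviation U :: "(nat \<Rightarrow> nat \<Rightarrow> complex) \<Rightarrow> nat list \<Rightarrow> complex"
  where "U \<equiv> cons_tensor (Suc i) \<kappa>'"

lemma koszul_tensor_tail_cons_tensor: "koszul_tensor x (Suc i) (\<lambda>w. U z (j # w))"
  unfolding cons_tensor_def list.sel
  using \<kappa>' by (intro koszul_tensor_sum) (simp add: dual_tensors_def)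

lemma cons_tensor_normal:
  assumes "s < ncount (Suc i)"
  shows "U z (j # normal_word (Suc i) s) = z s j"
proof -
  have "U z (j # normal_word (Suc i) s) = (\<Sum>r<ncount (Suc i). of_bool (s = r) * z r j)"
    unfolding cons_tensor_def list.sel using \<kappa>' assms by (intro sum.cong) (auto simp: dual_tensors_def)
  also have "\<dots> = z s j" using assms by (subst sum_of_bool_mult) auto
  finally show ?thesis .
qed

text \<open>For fixed first letters the entry is a Koszul tensor in the remaining word and so
  expands in the dual basis. Hence the front slices need testing only at normal tails, which keeps
  the number of equations small enough for the count below.\<close>

lemma koszul_tensor_cons_tensor:
  assumes c: "\<And>t j k. t < ncount i \<Longrightarrow> j < k \<Longrightarrow> k < 6 \<Longrightarrow>
      U z (j # k # normal_word i t) - U z (k # j # normal_word i t) = (\<Sum>a<6. c t a * x (a, j, k))"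
  shows "koszul_tensor x (Suc (Suc i)) (U z)"
proof (rule koszul_tensor_ConsI[OF koszul_tensor_tail_cons_tensor])
  fix w assume w: "w \<in> words i"
  have exp: "U z (j # k # w) = (\<Sum>t<ncount i. U z (j # k # normal_word i t) * \<kappa> t w)" if "k < 6" for j k
    using koszul_tensor_Cons[OF koszul_tensor_tail_cons_tensor that] by (rule tensor_expansion[OF \<kappa> _ w])
  have "U z (j # k # w) - U z (k # j # w) = (\<Sum>a<6. (\<Sum>t<ncount i. \<kappa> t w * c t a) * x (a, j, k))"
    if jk: "j < k" "k < 6" for j k
  proof -
    have "U z (j # k # w) - U z (k # j # w)
        = (\<Sum>t<ncount i. (U z (j # k # normal_word i t) - U z (k # j # normal_word i t)) * \<kappa> t w)"
      using jk by (simp add: exp sum_subtractf left_diff_distrib)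
    also have "\<dots> = (\<Sum>t<ncount i. \<Sum>a<6. \<kappa> t w * c t a * x (a, j, k))"
      using c jk by (intro sum.cong refl) (simp add: sum_distrib_left sum_distrib_right mult_ac)
    also have "\<dots> = (\<Sum>a<6. \<Sum>t<ncount i. \<kappa> t w * c t a * x (a, j, k))" by (rule sum.swap)
    finally show ?thesis by (simp add: sum_distrib_right)
  qed
  then show "\<exists>c. \<forall>j k. j < k \<and> k < 6 \<longrightarrow> U z (j # k # w) - U z (k # j # w) = (\<Sum>a<6. c a * x (a, j, k))"
    by (intro exI[of _ "\<lambda>a. \<Sum>t<ncount i. \<kappa> t w * c t a"]) blast
qed

text \<open>There is one equation per pair of letters and normal tail, saying that the front slice
  is a combination of the quadrics, and one per normal word of the next degree, prescribing the
  coordinate there. The unknowns are the coefficients of a \<open>cons_tensor\<close> and those of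
  the quadrics in the slices.\<close>

definition sys_rows :: "(nat \<times> nat \<times> nat + nat) set"
  where "sys_rows = Sum_Type.Plus ({..<ncount i} \<times> index_pairs 6) {..<ncount (Suc (Suc i))}"

definition sys_cols :: "(nat \<times> nat + nat \<times> nat) set"
  where "sys_cols = Sum_Type.Plus ({..<ncount (Suc i)} \<times> {..<6}) ({..<ncount i} \<times> {..<6})"

fun sys_matrix :: "(nat \<times> nat \<times> nat + nat) \<Rightarrow> (nat \<times> nat + nat \<times> nat) \<Rightarrow> complex"
  where
    "sys_matrix (Inl (t, j, k)) (Inl (s, l)) =
       of_bool (j = l) * \<kappa>' s (k # normal_word i t) - of_bool (k = l) * \<kappa>' s (j # normal_word i t)"
  | "sys_matrix (Inl (t, j, k)) (Inr (t', a)) = of_bool (t = t') * - x (a, j, k)"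
  | "sys_matrix (Inr r) (Inl (s, l)) = of_bool (hd (normal_word (Suc (Suc i)) r) = l)
       * \<kappa>' s (tl (normal_word (Suc (Suc i)) r))"
  | "sys_matrix (Inr r) (Inr c) = 0"

lemma card_index_pairs_6: "card (index_pairs 6) = 15"
proof -
  have "index_pairs 6 = prod.swap ` (SIGMA k:{..<6}. {..<k})" by (force simp: index_pairs_def)
  then have "card (index_pairs 6) = card (SIGMA k:{..<6::nat}. {..<k})"
    by (simp add: card_image)
  also have "\<dots> = (\<Sum>k<6. k)" by (subst card_SigmaI) auto
  also have "\<dots> = 15" by (simp add: lessThan_6)
  finally show ?thesis .
qed

lemma sys_card: "finite sys_rows" "finite sys_cols" "card sys_rows \<le> card sys_cols"
proof -
  show "finite sys_rows" "finite sys_cols"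
    by (auto simp: sys_rows_def sys_cols_def finite_index_pairs)
  \<comment> \<open>The two numbers are in fact equal: 15 N(i) + N(i+2) = 6 N(i+1) + 6 N(i), by the
    recurrence for \<open>ncount\<close>.\<close>
  show "card sys_rows \<le> card sys_cols"
    by (simp add: sys_rows_def sys_cols_def card_Plus finite_index_pairs card_cartesian_product
        card_index_pairs_6 ncount_def algebra_simps)
qed

lemma sum_sys_cols:
  "(\<Sum>c\<in>sys_cols. F c) = (\<Sum>s<ncount (Suc i). \<Sum>j<6. F (Inl (s, j))) + (\<Sum>t<ncount i. \<Sum>a<6. F (Inr (t, a)))"
  unfolding sys_cols_def
  by (subst sum.Plus) (auto simp: sum.cartesian_product comp_def case_prod_beta)

lemma sys_matrix_slice_row:
  assumes "t < ncount i" "j < 6" "k < 6"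
  shows "(\<Sum>c\<in>sys_cols. sys_matrix (Inl (t, j, k)) c * case_sum (case_prod z) (case_prod c') c)
    = U z (j # k # normal_word i t) - U z (k # j # normal_word i t) - (\<Sum>a<6. c' t a * x (a, j, k))"
proof -
  have 1: "(\<Sum>s<ncount (Suc i). \<Sum>l<6. sys_matrix (Inl (t, j, k)) (Inl (s, l)) * z s l)
      = U z (j # k # normal_word i t) - U z (k # j # normal_word i t)"
    unfolding cons_tensor_def list.sel sum_subtractf[symmetric]
  proof (intro sum.cong refl)
    fix s
    have "(\<Sum>l<6. sys_matrix (Inl (t, j, k)) (Inl (s, l)) * z s l)
        = (\<Sum>l<6. of_bool (j = l) * (\<kappa>' s (k # normal_word i t) * z s l))
        - (\<Sum>l<6. of_bool (k = l) * (\<kappa>' s (j # normal_word i t) * z s l))"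
      by (simp add: sum_subtractf left_diff_distrib mult.assoc)
    then show "(\<Sum>l<6. sys_matrix (Inl (t, j, k)) (Inl (s, l)) * z s l)
        = z s j * \<kappa>' s (k # normal_word i t) - z s k * \<kappa>' s (j # normal_word i t)"
      using assms by (subst (asm) (1 2) sum_of_bool_mult) (auto simp: mult_ac)
  qed
  have "(\<Sum>t'<ncount i. \<Sum>a<6. sys_matrix (Inl (t, j, k)) (Inr (t', a)) * c' t' a)
      = (\<Sum>t'<ncount i. of_bool (t = t') * (\<Sum>a<6. - (c' t' a * x (a, j, k))))"
    by (intro sum.cong refl) (auto simp: sum_distrib_left mult_ac)
  also have "\<dots> = - (\<Sum>a<6. c' t a * x (a, j, k))"
    using assms by (subst sum_of_bool_mult) (auto simp: sum_negf)
  finally show ?thesis using 1 by (simp only: sum_sys_cols sum.case prod.case) simp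
qed

lemma sys_matrix_normal_row:
  assumes "r < ncount (Suc (Suc i))"
  shows "(\<Sum>c\<in>sys_cols. sys_matrix (Inr r) c * case_sum (case_prod z) (case_prod c') c)
    = U z (normal_word (Suc (Suc i)) r)"
proof -
  let ?w = "normal_word (Suc (Suc i)) r"
  have "hd ?w < 6" using normal_word_words[OF assms] by (cases ?w) (auto simp: words_def)
  then have "(\<Sum>l<6. of_bool (hd ?w = l) * (\<kappa>' s (tl ?w) * z s l)) = \<kappa>' s (tl ?w) * z s (hd ?w)" for s
    by (intro sum_of_bool_mult) auto
  then show ?thesis
    by (simp only: sum_sys_cols sum.case prod.case sys_matrix.simps mult.assoc)
       (simp add: cons_tensor_def mult.commute)
qed

text \<open>Solvability has two uses. With \<open>B\<close> = 0 it produces Koszul tensors with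
  prescribed normal coordinates, hence the dual basis in the next degree. With arbitrary
  \<open>B\<close> it shows that all quadrics are reached modulo the span, which is exactness at the
  top degree of the algebra.\<close>

lemma sys_solvable:
  "\<exists>z c. (\<forall>t<ncount i. \<forall>j k. j < k \<and> k < 6 \<longrightarrow> U z (j # k # normal_word i t)
        - U z (k # j # normal_word i t) - (\<Sum>a<6. c t a * x (a, j, k)) = B t j k) \<and>
     (\<forall>r<ncount (Suc (Suc i)). U z (normal_word (Suc (Suc i)) r) = G r)"
proof -
  have triv: "\<forall>c\<in>sys_cols. y c = 0" if y: "\<And>r. r \<in> sys_rows \<Longrightarrow> (\<Sum>c\<in>sys_cols. sys_matrix r c * y c) = 0" for y
  proof -
    define z c where "z s j = y (Inl (s, j))" and "c t a = y (Inr (t, a))" for s j t a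
    have y_eq: "y = case_sum (case_prod z) (case_prod c)" by (auto simp: z_def c_def fun_eq_iff split: sum.split)
    have slice: "U z (j # k # normal_word i t) - U z (k # j # normal_word i t) = (\<Sum>a<6. c t a * x (a, j, k))"
      if "t < ncount i" "j < k" "k < 6" for t j k
    proof -
      have "Inl (t, j, k) \<in> sys_rows" using that by (auto simp: sys_rows_def index_pairs_def)
      from y[OF this] sys_matrix_slice_row[of t j k z c] that show ?thesis unfolding y_eq[symmetric] by simp
    qed
    have normal: "U z w = 0" if w: "w \<in> normal_words (Suc (Suc i))" for w
    proof -
      obtain r where r: "r < ncount (Suc (Suc i))" "w = normal_word (Suc (Suc i)) r" by (rule normal_wordE[OF w])
      then have "Inr r \<in> sys_rows" by (auto simp: sys_rows_def)
      from y[OF this] sys_matrix_normal_row[OF r(1), of z c] r(2) show ?thesis unfolding y_eq[symmetric] by simp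
    qed
    \<comment> \<open>A homogeneous solution gives a Koszul tensor with vanishing normal
      coordinates, so it is zero. Its coefficients \<open>z\<close> are values of the tensor, and
      \<open>c\<close> vanishes because the six quadrics are independent.\<close>
    have 0: "U z w = 0" if "w \<in> words (Suc (Suc i))" for w
      using determined[of "Suc (Suc i)"] koszul_tensor_cons_tensor[OF slice] normal that
      unfolding normal_determined_def by blast
    have "z s j = 0" if "s < ncount (Suc i)" "j < 6" for s j
      using 0[of "j # normal_word (Suc i) s"] cons_tensor_normal[OF that(1), of z j] normal_word_words[OF that(1)] that
      by (simp add: words_def)
    moreover have "c t a = 0" if t: "t < ncount i" and a: "a < 6" for t a
    proof (rule plucker_anisotropic_independent[OF anisotropic _ a])
      fix j k :: nat assume jk: "j < k" "k < 6"
      have "j # k # normal_word i t \<in> words (Suc (Suc i))" "k # j # normal_word i t \<in> words (Suc (Suc i))"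
        using normal_word_words[OF t] jk by (auto simp: words_def)
      then show "(\<Sum>a<6. c t a * x (a, j, k)) = 0" using slice[OF t jk] by (simp add: 0)
    qed
    ultimately show ?thesis by (auto simp: y_eq sys_cols_def)
  qed
  have "\<exists>y. \<forall>r\<in>sys_rows. (\<Sum>c\<in>sys_cols. sys_matrix r c * y c) = case_sum (\<lambda>(t, j, k). B t j k) G r"
    by (rule square_system_solvable[OF sys_card triv])
  then obtain y where y: "\<And>r. r \<in> sys_rows \<Longrightarrow>
      (\<Sum>c\<in>sys_cols. sys_matrix r c * y c) = case_sum (\<lambda>(t, j, k). B t j k) G r" by blast
  define z c where "z s j = y (Inl (s, j))" and "c t a = y (Inr (t, a))" for s j t a
  have y_eq: "y = case_sum (case_prod z) (case_prod c)" by (auto simp: z_def c_def fun_eq_iff split: sum.split)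
  show ?thesis
  proof (rule exI[of _ z], rule exI[of _ c], intro conjI allI impI)
    fix t j k :: nat assume t: "t < ncount i" and jk: "j < k \<and> k < 6"
    then have "Inl (t, j, k) \<in> sys_rows" by (auto simp: sys_rows_def index_pairs_def)
    from y[OF this] sys_matrix_slice_row[of t j k z c] t jk
    show "U z (j # k # normal_word i t) - U z (k # j # normal_word i t) - (\<Sum>a<6. c t a * x (a, j, k)) = B t j k"
      unfolding y_eq[symmetric] by simp
  next
    fix r assume r: "r < ncount (Suc (Suc i))"
    then have "Inr r \<in> sys_rows" by (auto simp: sys_rows_def)
    from y[OF this] sys_matrix_normal_row[OF r, of z c]
    show "U z (normal_word (Suc (Suc i)) r) = G r" unfolding y_eq[symmetric] by simp
  qed
qed

lemma dual_tensors_step: "\<exists>\<kappa>''. dual_tensors x (Suc (Suc i)) \<kappa>''"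
proof -
  have "\<exists>u. koszul_tensor x (Suc (Suc i)) u \<and>
      (\<forall>t<ncount (Suc (Suc i)). u (normal_word (Suc (Suc i)) t) = of_bool (t = s))" for s
  proof -
    obtain z c where z: "\<And>t j k. t < ncount i \<Longrightarrow> j < k \<Longrightarrow> k < 6 \<Longrightarrow> U z (j # k # normal_word i t)
        - U z (k # j # normal_word i t) - (\<Sum>a<6. c t a * x (a, j, k)) = 0"
      "\<And>r. r < ncount (Suc (Suc i)) \<Longrightarrow> U z (normal_word (Suc (Suc i)) r) = of_bool (r = s)"
      using sys_solvable[of "\<lambda>_ _ _. 0" "\<lambda>r. of_bool (r = s)"] by blast
    have "koszul_tensor x (Suc (Suc i)) (U z)"
      by (rule koszul_tensor_cons_tensor[of z c]) (use z(1) in auto)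
    with z(2) show ?thesis by blast
  qed
  then have "\<exists>\<kappa>''. \<forall>s. koszul_tensor x (Suc (Suc i)) (\<kappa>'' s) \<and>
      (\<forall>t<ncount (Suc (Suc i)). \<kappa>'' s (normal_word (Suc (Suc i)) t) = of_bool (t = s))" by (intro choice) blast
  then show ?thesis unfolding dual_tensors_def by blast
qed

end

lemma dual_tensors_exist: "\<exists>\<kappa>. dual_tensors x i \<kappa>"
proof (induction i rule: induct_nat_012)
  case (ge2 i)
  then show ?case using dual_tensors_step by blast
next
  \<comment> \<open>In degrees 0 and 1 the Koszul condition is empty, so indicator functions of the
    normal words serve as the dual basis.\<close>
  have *: "dual_tensors x i (\<lambda>s w. of_bool (w = normal_word i s))" if "i < 2" for i
    using koszul_tensor_01[OF that] inj_onD[OF bij_betw_imp_inj_on[OF bij_normal_word[of i]]]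
    by (auto simp: dual_tensors_def)
  case 0 show ?case using *[of 0] by auto
  case 1 show ?case using *[of "Suc 0"] by auto
qed

end

section \<open>The differentials and their exactness, on representatives in the exterior
  algebra\<close>

lemma part_involute: "part d (involute w) = involute (part d w)"
  by (auto simp: part_def involute_def fun_eq_iff)

lemma part_wedge_linear: "a \<in> homog n 1 \<Longrightarrow> part (Suc d) (w \<cdot> a) = part d w \<cdot> a"
  using linear_involute[of a n w] linear_involute[of a n "part d w"] part_linear_wedge[of a n d "involute w"]
  by (simp add: part_involute)

lemma part_0_eq:
  assumes "g \<in> ext_carrier n"
  shows "part 0 g = g {} *\<^sub>e mono {}"
proof
  fix S
  show "part 0 g S = (g {} *\<^sub>e mono {}) S"
    using ext_carrier_infinite[OF assms, of S] by (cases "finite S") (auto simp: part_def mono_def)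
qed

lemma part_1_eq: "g \<in> ext_carrier n \<Longrightarrow> part 1 g = (\<Sum>j<n. g {j} *\<^sub>e mono {j})"
  using linear_eq_sum[OF part_homog[of g n 1]] by (simp add: part_def)

text \<open>Its coordinates are the antisymmetrisation of M. For M given by
  \<open>u (j # k # w)\<close>, membership in the ideal is thus the Koszul condition on the front
  slice of u at w; this translates products of matrices into tensors.\<close>

definition bilinear_quadric :: "(nat \<Rightarrow> nat \<Rightarrow> complex) \<Rightarrow> ext"
  where "bilinear_quadric M = (\<Sum>j<6. \<Sum>k<6. M j k *\<^sub>e (mono {j} \<cdot> mono {k}))"

lemma mono_singleton_homog: "j < n \<Longrightarrow> mono {j} \<in> homog n 1"
  using mono_in[of "{j}" n] by simp

lemma bilinear_quadric_homog: "bilinear_quadric M \<in> homog 6 2"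
proof -
  have "mono {j} \<cdot> mono {k} \<in> homog 6 2" if "j < 6" "k < 6" for j k
    using homog_wedge[OF mono_singleton_homog mono_singleton_homog, OF that] by (simp add: numeral_2_eq_2)
  then show ?thesis unfolding bilinear_quadric_def by (intro homog_sum homog_closed) auto
qed

lemma mono_wedge_mono_apply:
  assumes "j < k"
  shows "(mono {a} \<cdot> mono {b}) {j, k} = of_bool (j = a \<and> k = b) - of_bool (k = a \<and> j = b)"
proof -
  have "wedge_sign {j} {k} = 1"
  proof -
    have "{(t, u). t \<in> {j} \<and> u \<in> {k} \<and> u < t} = {}" using assms by auto
    then show ?thesis by (simp only: wedge_sign_def card.empty power_0)
  qed
  moreover from this have "wedge_sign {k} {j} = - 1"
    using wedge_sign_commute[of "{j}" "{k}"] assms by simp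
  moreover have "(mono {a} \<cdot> mono {b}) {j, k} =
      (if {a} \<inter> {b} = {} then wedge_sign {a} {b} *\<^sub>e mono ({a} \<union> {b}) else 0) {j, k}"
    by (subst mono_wedge) auto
  ultimately show ?thesis using assms by (auto simp: mono_def doubleton_eq_iff)
qed

lemma bilinear_quadric_apply:
  assumes "j < k" "k < 6"
  shows "bilinear_quadric M {j, k} = M j k - M k j"
proof -
  have "bilinear_quadric M {j, k} = (\<Sum>a<6. \<Sum>b<6. M a b * (of_bool (j = a \<and> k = b) - of_bool (k = a \<and> j = b)))"
    by (simp add: bilinear_quadric_def sum_fun_apply mono_wedge_mono_apply[OF assms(1)])
  also have "\<dots> = (\<Sum>a<6. of_bool (j = a) * (\<Sum>b<6. of_bool (k = b) * M a b))
      - (\<Sum>a<6. of_bool (k = a) * (\<Sum>b<6. of_bool (j = b) * M a b))"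
    unfolding sum_distrib_left sum_subtractf[symmetric]
    by (intro sum.cong refl) (simp add: of_bool_conj algebra_simps)
  also have "\<dots> = M j k - M k j"
  proof -
    have "(\<Sum>a<6. of_bool (j = a) * (\<Sum>b<6. of_bool (k = b) * M a b)) = (\<Sum>b<6. of_bool (k = b) * M j b)"
      using assms by (intro sum_of_bool_mult) auto
    moreover have "(\<Sum>a<6. of_bool (k = a) * (\<Sum>b<6. of_bool (j = b) * M a b)) = (\<Sum>b<6. of_bool (j = b) * M k b)"
      using assms by (intro sum_of_bool_mult) auto
    moreover have "(\<Sum>b<6. of_bool (k = b) * M j b) = M j k" "(\<Sum>b<6. of_bool (j = b) * M k b) = M k j"
      using assms by (intro sum_of_bool_mult; auto)+
    ultimately show ?thesis by simp
  qed
  finally show ?thesis .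
qed

lemma wedge_linear_linear:
  "(\<Sum>j<6. a j *\<^sub>e mono {j}) \<cdot> (\<Sum>k<6. b k *\<^sub>e mono {k}) = bilinear_quadric (\<lambda>j k. a j * b k)"
  unfolding bilinear_quadric_def wedge_sum_left wedge_sum_right by (subst sum.swap) (simp add: mult.commute)

lemma bilinear_quadric_sum:
  "(\<Sum>s\<in>A. bilinear_quadric (M s)) = bilinear_quadric (\<lambda>j k. \<Sum>s\<in>A. M s j k)"
proof -
  have "(\<Sum>s\<in>A. bilinear_quadric (M s)) = (\<Sum>j<6. \<Sum>s\<in>A. \<Sum>k<6. M s j k *\<^sub>e (mono {j} \<cdot> mono {k}))"
    unfolding bilinear_quadric_def by (rule sum.swap)
  also have "\<dots> = (\<Sum>j<6. \<Sum>k<6. \<Sum>s\<in>A. M s j k *\<^sub>e (mono {j} \<cdot> mono {k}))"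
    by (intro sum.cong refl sum.swap)
  finally show ?thesis by (simp add: bilinear_quadric_def sum_scale)
qed

lemma quad_ideal_iff:
  assumes "g \<in> homog 6 2"
  shows "g \<in> quad_ideal x \<longleftrightarrow> (\<exists>c. \<forall>j k. j < k \<and> k < 6 \<longrightarrow> g {j, k} = (\<Sum>a<6. c a * x (a, j, k)))"
  using quad_span_iff[OF assms] homog_carrier[OF assms] assms
  by (simp add: quad_ideal_def part_of_homog)

context generic_quadrics
begin

definition dual :: "nat \<Rightarrow> nat \<Rightarrow> nat list \<Rightarrow> complex"
  where "dual i = (SOME \<kappa>. dual_tensors x i \<kappa>)"

lemma dual: "dual_tensors x i (dual i)"
  unfolding dual_def using dual_tensors_exist by (rule someI_ex)

lemma dual_tensor: "s < ncount i \<Longrightarrow> koszul_tensor x i (dual i s)"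
  using dual[of i] by (simp add: dual_tensors_def)

text \<open>Splitting off the first tensor factor writes the s-th dual tensor of degree i + 1 as a
  sum of entries e_j \<otimes> \<open>dual i t\<close>. The coefficients for fixed s and t form the
  linear form that is the matrix entry of the differential.\<close>

definition entry :: "nat \<Rightarrow> nat \<Rightarrow> nat \<Rightarrow> ext"
  where "entry i s t = (\<Sum>j<6. dual (Suc i) s (j # normal_word i t) *\<^sub>e mono {j})"

lemma entry_homog: "entry i s t \<in> homog 6 1"
  unfolding entry_def by (intro homog_sum homog_closed mono_singleton_homog) simp

lemma entry_carrier: "entry i s t \<in> ext_carrier 6"
  by (rule homog_carrier[OF entry_homog])

lemma linear_wedge_entry:
  "(\<Sum>s<ncount (Suc i). (\<Sum>j<6. z s j *\<^sub>e mono {j}) \<cdot> entry i s t)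
    = bilinear_quadric (\<lambda>j k. cons_tensor (Suc i) (dual (Suc i)) z (j # k # normal_word i t))"
  unfolding entry_def wedge_linear_linear bilinear_quadric_sum cons_tensor_def by simp

lemma entry_apply: "j < 6 \<Longrightarrow> entry i s t {j} = dual (Suc i) s (j # normal_word i t)"
proof -
  assume j: "j < 6"
  have "entry i s t {j} = (\<Sum>k<6. of_bool (j = k) * dual (Suc i) s (k # normal_word i t))"
    unfolding entry_def sum_fun_apply by (intro sum.cong) (auto simp: mono_def)
  also have "\<dots> = dual (Suc i) s (j # normal_word i t)" using j by (intro sum_of_bool_mult) auto
  finally show ?thesis .
qed

lemma cons_tensor_in_quad_ideal:
  assumes "bilinear_quadric (\<lambda>j k. u (j # k # w)) \<in> quad_ideal x"
  shows "\<exists>c. \<forall>j k. j < k \<and> k < 6 \<longrightarrow> u (j # k # w) - u (k # j # w) = (\<Sum>a<6. c a * x (a, j, k))"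
  using assms unfolding quad_ideal_iff[OF bilinear_quadric_homog] by (simp add: bilinear_quadric_apply)

text \<open>The entry (s, t) of the product of two differentials is the quadric of the front slice
  of the dual tensor s at the t-th normal word, and this slice lies in the span of the
  quadrics.\<close>

lemma entry_complex:
  assumes "s < ncount (Suc (Suc i))" "t < ncount i"
  shows "(\<Sum>r<ncount (Suc i). entry (Suc i) s r \<cdot> entry i r t) \<in> quad_ideal x"
proof -
  define z where "z r j = dual (Suc (Suc i)) s (j # normal_word (Suc i) r)" for r j
  have z: "cons_tensor (Suc i) (dual (Suc i)) z (j # w) = dual (Suc (Suc i)) s (j # w)"
    if "j < 6" "w \<in> words (Suc i)" for j w
    using tensor_expansion[OF dual koszul_tensor_Cons[OF dual_tensor[OF assms(1)] that(1)] that(2)]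
    by (simp add: cons_tensor_def z_def)
  have eq: "(\<Sum>r<ncount (Suc i). entry (Suc i) s r \<cdot> entry i r t)
      = bilinear_quadric (\<lambda>j k. cons_tensor (Suc i) (dual (Suc i)) z (j # k # normal_word i t))"
    unfolding linear_wedge_entry[symmetric] by (simp add: entry_def z_def)
  have "\<exists>c. \<forall>j k. j < k \<and> k < 6 \<longrightarrow> dual (Suc (Suc i)) s (j # k # normal_word i t)
      - dual (Suc (Suc i)) s (k # j # normal_word i t) = (\<Sum>a<6. c a * x (a, j, k))"
    using dual_tensor[OF assms(1), unfolded koszul_tensor_def, rule_format, of "[]" "normal_word i t"]
      normal_word_words[OF assms(2)] by (simp add: words_def)
  moreover have "k # normal_word i t \<in> words (Suc i)" if "k < 6" for k
    using normal_word_words[OF assms(2)] that by (auto simp: words_def)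
  ultimately show ?thesis
    unfolding eq quad_ideal_iff[OF bilinear_quadric_homog] by (simp add: bilinear_quadric_apply z)
qed

text \<open>Modulo the ideal a cycle has parts of degrees 0, 1 and 2 only, and each is treated
  separately: the constant part vanishes, the linear part is a Koszul tensor and expands in the dual
  basis, and every quadratic part is a boundary.\<close>

lemma entry_exact:
  assumes g: "\<And>s. s < ncount (Suc i) \<Longrightarrow> g s \<in> ext_carrier 6"
    and ker: "\<And>t. t < ncount i \<Longrightarrow> (\<Sum>s<ncount (Suc i). g s \<cdot> entry i s t) \<in> quad_ideal x"
  shows "\<exists>h. (\<forall>r. h r \<in> ext_carrier 6) \<and> (\<forall>s<ncount (Suc i).
    g s - (\<Sum>r<ncount (Suc (Suc i)). h r \<cdot> entry (Suc i) r s) \<in> quad_ideal x)"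
proof -
  note I = ideal_exteriorD[OF ideal_quad_ideal[of x]]
  let ?N = "ncount (Suc i)" and ?N' = "ncount (Suc (Suc i))"
  have part_sum_entry: "part (Suc d) (\<Sum>s<?N. g s \<cdot> entry i s t) = (\<Sum>s<?N. part d (g s) \<cdot> entry i s t)" for d t
    by (simp add: part_sum part_wedge_linear[OF entry_homog])
  \<comment> \<open>The constants combine the dual tensors to one tensor u. The kernel condition in
    degree 1 kills all its tails, hence u itself, and its normal coordinates are the
    constants.\<close>
  have g0: "part 0 (g s) = 0" if s: "s < ?N" for s
  proof -
    define u where "u w = (\<Sum>s<?N. g s {} * dual (Suc i) s w)" for w
    have u: "koszul_tensor x (Suc i) u"
      unfolding u_def by (intro koszul_tensor_sum) (simp add: dual_tensor)
    have u0: "u (j # normal_word i t) = 0" if "t < ncount i" "j < 6" for j t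
    proof -
      have "(\<Sum>s<?N. part 0 (g s) \<cdot> entry i s t) = 0"
        unfolding part_sum_entry[symmetric] using ker[OF that(1)] by (simp add: quad_ideal_def)
      moreover have "part 0 (g s) \<cdot> entry i s t = g s {} *\<^sub>e entry i s t" if "s < ?N" for s
        using part_0_eq[OF g[OF that]] wedge_one(1)[OF entry_carrier] by simp
      ultimately have "(\<Sum>s<?N. g s {} *\<^sub>e entry i s t) {j} = 0" by simp
      then show ?thesis using that(2) by (simp add: sum_fun_apply entry_apply u_def)
    qed
    have "u (j # w) = 0" if jw: "j < 6" "w \<in> words i" for j w
      using tensor_expansion[OF dual koszul_tensor_Cons[OF u jw(1)] jw(2)] u0[OF _ jw(1)] by simp
    moreover obtain j w where "normal_word (Suc i) s = j # w"
      using normal_word_words[OF s] by (cases "normal_word (Suc i) s") (auto simp: words_def)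
    moreover have "j < 6 \<and> w \<in> words i" if "normal_word (Suc i) s = j # w" for j w
      using normal_word_words[OF s] that by (simp add: words_def)
    ultimately have "u (normal_word (Suc i) s) = 0" by metis
    moreover have "u (normal_word (Suc i) s) = (\<Sum>r<?N. of_bool (s = r) * g r {})"
      unfolding u_def using dual[of "Suc i"] s by (intro sum.cong) (auto simp: dual_tensors_def)
    moreover have "\<dots> = g s {}" using s by (intro sum_of_bool_mult) auto
    ultimately show ?thesis using part_0_eq[OF g[OF s]] by simp
  qed
  define z where "z s j = g s {j}" for s j
  have g1: "part 1 (g s) = (\<Sum>j<6. z s j *\<^sub>e mono {j})" if "s < ?N" for s
    using part_1_eq[OF g[OF that]] by (simp add: z_def)
  let ?U = "cons_tensor (Suc i) (dual (Suc i)) z"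
  \<comment> \<open>The kernel condition in degree 2 is the Koszul condition at the front for the
    tensor formed by the linear parts.\<close>
  have "\<exists>c. \<forall>j k. j < k \<and> k < 6 \<longrightarrow> ?U (j # k # normal_word i t) - ?U (k # j # normal_word i t)
      = (\<Sum>a<6. c a * x (a, j, k))" if t: "t < ncount i" for t
  proof (rule cons_tensor_in_quad_ideal)
    have "(\<Sum>s<?N. part 1 (g s) \<cdot> entry i s t) \<in> quad_span x"
      unfolding part_sum_entry[symmetric] using ker[OF t] by (simp add: quad_ideal_def numeral_2_eq_2)
    moreover have "(\<Sum>s<?N. part 1 (g s) \<cdot> entry i s t) = bilinear_quadric (\<lambda>j k. ?U (j # k # normal_word i t))"
      unfolding linear_wedge_entry[symmetric] by (intro sum.cong refl) (simp add: g1 del: One_nat_def)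
    ultimately show "bilinear_quadric (\<lambda>j k. ?U (j # k # normal_word i t)) \<in> quad_ideal x"
      using quad_span_in_quad_ideal by simp
  qed
  then have "\<forall>t\<in>{..<ncount i}. \<exists>c. \<forall>j k. j < k \<and> k < 6 \<longrightarrow>
      ?U (j # k # normal_word i t) - ?U (k # j # normal_word i t) = (\<Sum>a<6. c a * x (a, j, k))" by blast
  from bchoice[OF this] obtain c where c: "\<forall>t\<in>{..<ncount i}. \<forall>j k. j < k \<and> k < 6 \<longrightarrow>
      ?U (j # k # normal_word i t) - ?U (k # j # normal_word i t) = (\<Sum>a<6. c t a * x (a, j, k))" ..
  have U: "koszul_tensor x (Suc (Suc i)) ?U"
    by (rule koszul_tensor_cons_tensor[OF dual dual, of i z c]) (use c in auto)
  define \<theta> where "\<theta> r = ?U (normal_word (Suc (Suc i)) r)" for r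
  have z_eq: "z s j = (\<Sum>r<?N'. \<theta> r * dual (Suc (Suc i)) r (j # normal_word (Suc i) s))"
    if "s < ?N" "j < 6" for s j
  proof -
    have "j # normal_word (Suc i) s \<in> words (Suc (Suc i))"
      using normal_word_words[OF that(1)] that(2) by (auto simp: words_def)
    from tensor_expansion[OF dual U this] show ?thesis
      by (simp add: \<theta>_def cons_tensor_normal[OF dual dual that(1)])
  qed
  have lin: "part 1 (g s) = (\<Sum>r<?N'. \<theta> r *\<^sub>e entry (Suc i) r s)" if s: "s < ?N" for s
  proof -
    have "(\<Sum>r<?N'. \<theta> r *\<^sub>e entry (Suc i) r s)
        = (\<Sum>j<6. \<Sum>r<?N'. (\<theta> r * dual (Suc (Suc i)) r (j # normal_word (Suc i) s)) *\<^sub>e mono {j})"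
      unfolding entry_def scale_sum by (subst sum.swap) simp
    also have "\<dots> = (\<Sum>j<6. z s j *\<^sub>e mono {j})"
      by (intro sum.cong refl) (simp add: z_eq[OF s] sum_scale)
    finally show ?thesis using g1[OF s] by simp
  qed
  let ?V = "cons_tensor (Suc (Suc i)) (dual (Suc (Suc i)))"
  \<comment> \<open>The given quadratic parts are taken as slice data, and the normal coordinates
    are prescribed as 0.\<close>
  obtain z' c' where "\<forall>s<?N. \<forall>j k. j < k \<and> k < 6 \<longrightarrow>
      ?V z' (j # k # normal_word (Suc i) s) - ?V z' (k # j # normal_word (Suc i) s)
      - (\<Sum>a<6. c' s a * x (a, j, k)) = part 2 (g s) {j, k}"
    using sys_solvable[OF dual[of "Suc i"] dual[of "Suc (Suc i)"], of "\<lambda>s j k. part 2 (g s) {j, k}" "\<lambda>_. 0"] by blast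
  then have z': "part 2 (g s) {j, k} = ?V z' (j # k # normal_word (Suc i) s)
      - ?V z' (k # j # normal_word (Suc i) s) - (\<Sum>a<6. c' s a * x (a, j, k))"
    if "s < ?N" "j < k" "k < 6" for s j k using that by simp
  \<comment> \<open>The constant part of the preimage accounts for the linear part of the cycle, its
    linear part for the quadratic one.\<close>
  define h where "h r = \<theta> r *\<^sub>e mono {} + (\<Sum>j<6. z' r j *\<^sub>e mono {j})" for r
  have lin': "(\<Sum>j<6. z' r j *\<^sub>e mono {j}) \<in> homog 6 1" for r
    by (intro homog_sum homog_closed mono_singleton_homog) simp
  have "h r \<in> ext_carrier 6" for r
    unfolding h_def using homog_carrier[OF lin'] homog_carrier[OF one_in_homog] by simp
  moreover have "g s - (\<Sum>r<?N'. h r \<cdot> entry (Suc i) r s) \<in> quad_ideal x" if s: "s < ?N" for s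
  proof -
    define q where "q = bilinear_quadric (\<lambda>j k. ?V z' (j # k # normal_word (Suc i) s))"
    have q: "q \<in> homog 6 2" unfolding q_def by (rule bilinear_quadric_homog)
    have "(\<Sum>r<?N'. h r \<cdot> entry (Suc i) r s) = part 1 (g s) + q"
      unfolding q_def linear_wedge_entry[symmetric] lin[OF s] sum.distrib[symmetric]
      by (intro sum.cong refl) (simp add: h_def wedge_distribs wedge_one[OF entry_carrier])
    then have eq: "g s - (\<Sum>r<?N'. h r \<cdot> entry (Suc i) r s) = g s - part 1 (g s) - q" by simp
    have "part 2 (g s) - q \<in> quad_span x"
    proof -
      have hom: "part 2 (g s) - q \<in> homog 6 2" using q part_homog[OF g[OF s]] by simp
      show ?thesis unfolding quad_span_iff[OF hom]
        by (rule exI[of _ "\<lambda>a. - c' s a"])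
           (simp add: z'[OF s] q_def bilinear_quadric_apply sum_negf)
    qed
    moreover have "g s - part 1 (g s) - q \<in> ext_carrier 6"
      using g[OF s] homog_carrier[OF q] homog_carrier[OF part_homog[OF g[OF s]]] by simp
    ultimately show ?thesis unfolding eq quad_ideal_def
      using g0[OF s] part_of_homog[OF part_homog[OF g[OF s], of 1]] part_of_homog[OF q]
      by (simp add: part_linear del: One_nat_def)
  qed
  ultimately show ?thesis by blast
qed

end

section \<open>Passage to the quotient ring\<close>

lemma wedge_empty: "(f \<cdot> g) {} = f {} * g {}"
  by (simp add: wedge_def)

lemma ideal_irrelevant_exterior: "ideal {y \<in> ext_carrier n. y {} = 0} (exterior n)"
  by (rule ideal_exteriorI) (auto simp: wedge_empty)

lemma finsum_additive:
  fixes h :: "'b::comm_monoid_add \<Rightarrow> 'c" and G (structure)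
  assumes "abelian_monoid G" "h 0 = \<zero>" "0 \<in> X" "\<And>a b. a \<in> X \<Longrightarrow> b \<in> X \<Longrightarrow> a + b \<in> X"
    "\<And>a b. a \<in> X \<Longrightarrow> b \<in> X \<Longrightarrow> h (a + b) = h a \<oplus> h b" "\<And>a. a \<in> X \<Longrightarrow> h a \<in> carrier G"
    "\<And>i. i \<in> A \<Longrightarrow> f i \<in> X"
  shows "(\<Oplus>i\<in>A. h (f i)) = h (\<Sum>i\<in>A. f i)"
proof -
  interpret abelian_monoid G by fact
  show ?thesis using assms(7)
  proof (induction A rule: infinite_finite_induct)
    case (insert i A)
    have "(\<Sum>i\<in>A. f i) \<in> X" using insert.prems by (intro sum_closed assms(3,4)) auto
    then show ?case using insert assms(5,6) by (simp add: finsum_insert Pi_def)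
  qed (auto simp: assms(2) finsum_infinite)
qed

context generic_quadrics
begin

abbreviation proj :: "ext \<Rightarrow> ext set"
  where "proj \<equiv> (+>\<^bsub>exterior 6\<^esub>) (quad_ideal x)"

abbreviation R :: "ext set graded_algebra"
  where "R \<equiv> quotient_algebra (exterior 6) (quad_ideal x)"

interpretation proj: ring_hom_ring "exterior 6" R proj
  by (rule ring_hom_quotient_algebra[OF ideal_quad_ideal])

lemma proj_eq_iff:
  assumes "a \<in> ext_carrier 6" "b \<in> ext_carrier 6"
  shows "proj a = proj b \<longleftrightarrow> a - b \<in> quad_ideal x"
  using rcos_eq_iff[OF ideal_quad_ideal[of x], of a b] assms a_minus_exterior(2)[OF assms] by simp

lemma proj_eq_zero_iff: "a \<in> ext_carrier 6 \<Longrightarrow> proj a = \<zero>\<^bsub>R\<^esub> \<longleftrightarrow> a \<in> quad_ideal x"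
  using proj_eq_iff[of a 0] proj.hom_zero by simp

lemma proj_mult: "a \<in> ext_carrier 6 \<Longrightarrow> b \<in> ext_carrier 6 \<Longrightarrow> proj a \<otimes>\<^bsub>R\<^esub> proj b = proj (a \<cdot> b)"
  using proj.hom_mult[of a b] by simp

lemma proj_closed: "a \<in> ext_carrier 6 \<Longrightarrow> proj a \<in> carrier R"
  using proj.hom_closed[of a] by simp

lemma proj_sum:
  fixes f :: "'a \<Rightarrow> ext"
  assumes "\<And>i. i \<in> A \<Longrightarrow> f i \<in> ext_carrier 6"
  shows "(\<Oplus>\<^bsub>R\<^esub>i\<in>A. proj (f i)) = proj (\<Sum>i\<in>A. f i)"
  using finsum_additive[of R proj "ext_carrier 6" A f] proj.S.abelian_monoid_axioms
    proj.hom_zero proj.hom_add assms proj_closed by simp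

lemma matrix_map_proj:
  assumes "\<And>s. g s \<in> ext_carrier 6" "\<And>s t. d s t \<in> ext_carrier 6"
  shows "matrix_map R m n (\<lambda>s t. proj (d s t)) (\<lambda>s\<in>{..<m}. proj (g s))
    = (\<lambda>t\<in>{..<n}. proj (\<Sum>s<m. g s \<cdot> d s t))"
proof -
  have "(\<Oplus>\<^bsub>R\<^esub>s\<in>{..<m}. (\<lambda>s\<in>{..<m}. proj (g s)) s \<otimes>\<^bsub>R\<^esub> proj (d s t)) = proj (\<Sum>s<m. g s \<cdot> d s t)" for t
  proof -
    have "(\<Oplus>\<^bsub>R\<^esub>s\<in>{..<m}. (\<lambda>s\<in>{..<m}. proj (g s)) s \<otimes>\<^bsub>R\<^esub> proj (d s t))
        = (\<Oplus>\<^bsub>R\<^esub>s\<in>{..<m}. proj (g s \<cdot> d s t))"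
      using assms by (intro proj.S.finsum_cong') (simp_all add: proj_mult proj_closed)
    also have "\<dots> = proj (\<Sum>s<m. g s \<cdot> d s t)" using assms by (intro proj_sum) simp
    finally show ?thesis .
  qed
  then show ?thesis by (simp add: matrix_map_def)
qed

lemma free_moduleE:
  assumes "v \<in> free_module R m"
  obtains g where "\<And>s. g s \<in> ext_carrier 6" "v = (\<lambda>s\<in>{..<m}. proj (g s))"
proof -
  have "\<exists>a. a \<in> ext_carrier 6 \<and> (s < m \<longrightarrow> v s = proj a)" for s
  proof (cases "s < m")
    case True
    then have "v s \<in> carrier R" using assms by (auto simp: free_module_def)
    then show ?thesis by (auto simp: quotient_algebra_sel)
  qed (auto intro: exI[of _ 0])
  then obtain g where g: "\<And>s. g s \<in> ext_carrier 6" "\<And>s. s < m \<Longrightarrow> v s = proj (g s)" by metis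
  have "v = (\<lambda>s\<in>{..<m}. proj (g s))"
  proof
    fix s show "v s = (\<lambda>s\<in>{..<m}. proj (g s)) s"
      using assms g(2)[of s] PiE_arb[of v "{..<m}" _ s] by (auto simp: free_module_def)
  qed
  with g(1) show ?thesis by (rule that)
qed

lemma free_moduleI: "(\<And>s. g s \<in> ext_carrier 6) \<Longrightarrow> (\<lambda>s\<in>{..<m}. proj (g s)) \<in> free_module R m"
  by (auto simp: free_module_def proj_closed)

lemma irrelevant_ideal_eq: "irrelevant_ideal R = proj ` {y \<in> ext_carrier 6. y {} = 0}"
proof
  have sub: "(\<Union>d\<in>{1..}. component R d) \<subseteq> proj ` {y \<in> ext_carrier 6. y {} = 0}"
  proof
    fix a assume "a \<in> (\<Union>d\<in>{1..}. component R d)"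
    then obtain d y where y: "d \<ge> 1" "y \<in> homog 6 d" "a = proj y" by (auto simp: quotient_algebra_sel)
    then have "y {} = 0" using homogD[of y 6 d "{}"] by auto
    with y homog_carrier show "a \<in> proj ` {y \<in> ext_carrier 6. y {} = 0}" by blast
  qed
  then show "irrelevant_ideal R \<subseteq> proj ` {y \<in> ext_carrier 6. y {} = 0}"
    unfolding irrelevant_ideal_def
    by (intro proj.S.genideal_minimal ideal_image_quotient_algebra ideal_quad_ideal ideal_irrelevant_exterior)
  have car: "(\<Union>d\<in>{1..}. component R d) \<subseteq> carrier R"
    using homog_carrier proj_closed by (auto simp: quotient_algebra_sel)
  interpret Irr: ideal "irrelevant_ideal R" R
    unfolding irrelevant_ideal_def by (rule proj.S.genideal_ideal[OF car])
  show "proj ` {y \<in> ext_carrier 6. y {} = 0} \<subseteq> irrelevant_ideal R"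
  proof
    fix a assume "a \<in> proj ` {y \<in> ext_carrier 6. y {} = 0}"
    then obtain y where y: "y \<in> ext_carrier 6" "y {} = 0" "a = proj y" by blast
    have "part d y \<in> {y \<in> ext_carrier 6. proj y \<in> irrelevant_ideal R}" for d
    proof (cases "d = 0")
      case True
      then have "part d y = 0" using y part_0_eq[OF y(1)] by simp
      then show ?thesis using proj.hom_zero Irr.zero_closed by simp
    next
      case False
      then have "proj (part d y) \<in> (\<Union>d\<in>{1..}. component R d)"
        using part_homog[OF y(1), of d] by (auto simp: quotient_algebra_sel)
      then show ?thesis
        using proj.S.genideal_self[OF car] homog_carrier[OF part_homog[OF y(1)]]
        by (auto simp: irrelevant_ideal_def)
    qed
    then have "(\<Sum>d\<le>6. part d y) \<in> {y \<in> ext_carrier 6. proj y \<in> irrelevant_ideal R}"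
      using proj.hom_zero Irr.zero_closed Irr.a_closed proj.hom_add by (intro sum_closed) auto
    then show "a \<in> irrelevant_ideal R" using ext_eq_sum_parts[OF y(1)] y(3) by simp
  qed
qed

lemma ncount_0_1: "ncount 0 = 1" "ncount 1 = 6"
  by (simp_all add: ncount_def)

text \<open>Every word of length one is normal, so the dual basis in degree 1 is the standard one
  and the first differential is the row of variables in some order.\<close>

lemma entry_0:
  assumes "s < ncount 1" "normal_word 1 s = [k]"
  shows "entry 0 s 0 = mono {k}"
proof -
  have "normal_word 0 0 = []" using normal_word_words[of 0 0] by (simp add: ncount_def words_def)
  moreover have "dual 1 s [j] = of_bool (k = j)" if "j < 6" for j
  proof -
    have "[j] \<in> normal_words 1" using that normal_words_01[of 1] by (simp add: words_def)
    then obtain t where t: "t < ncount 1" "[j] = normal_word 1 t" by (rule normal_wordE)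
    then have "dual 1 s [j] = of_bool (t = s)" using dual[of 1] assms(1) by (simp add: dual_tensors_def)
    moreover have "t = s \<longleftrightarrow> k = j"
      using t assms inj_onD[OF bij_betw_imp_inj_on[OF bij_normal_word[of 1]], of t s] by auto
    ultimately show ?thesis by simp
  qed
  moreover have "k < 6" using normal_word_words[OF assms(1)] assms(2) by (simp add: words_def)
  ultimately have "entry 0 s 0 S = mono {k} S" for S
    using sum_of_bool_mult[of "{..<6}" k "\<lambda>j. mono {j} S"]
    by (simp add: entry_def sum_fun_apply)
  then show ?thesis by (simp add: fun_eq_iff)
qed

lemma irrelevant_generated:
  assumes "y \<in> ext_carrier 6" "y {} = 0"
  shows "\<exists>g. (\<forall>s. g s \<in> ext_carrier 6) \<and> y = (\<Sum>s<ncount 1. g s \<cdot> entry 0 s 0)"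
proof -
  define X where "X = {y. \<exists>g. (\<forall>s. g s \<in> ext_carrier 6) \<and> y = (\<Sum>s<ncount 1. g s \<cdot> entry 0 s 0)}"
  have 0: "0 \<in> X" unfolding X_def by (intro CollectI exI[of _ "\<lambda>_. 0"]) simp
  have "y S *\<^sub>e mono S \<in> X" if S: "S \<in> Pow {..<6}" for S
  proof (cases "S = {}")
    case True
    then show ?thesis using assms(2) 0 by simp
  next
    case False
    then obtain k where k: "k \<in> S" "k < 6" using S by auto
    have "[k] \<in> normal_words 1" using k normal_words_01[of 1] by (simp add: words_def)
    then obtain s where s: "s < ncount 1" "[k] = normal_word 1 s" by (rule normal_wordE)
    \<comment> \<open>The sign compensates for splitting off e_k on the right.\<close>
    let ?c = "y S * wedge_sign (S - {k}) {k}"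
    define g where "g r = (if r = s then ?c *\<^sub>e mono (S - {k}) else 0)" for r
    have fin: "finite S" using S finite_subset by auto
    have "g r \<in> ext_carrier 6" for r
      using S homog_carrier[OF mono_in[of "S - {k}" 6]] by (auto simp: g_def)
    moreover have "(\<Sum>r<ncount 1. g r \<cdot> entry 0 r 0) = g s \<cdot> entry 0 s 0"
      using s(1) by (subst sum.remove[of _ s]) (auto simp: g_def intro!: sum.neutral)
    moreover have "g s \<cdot> entry 0 s 0 = y S *\<^sub>e mono S"
      using entry_0[OF s(1) s(2)[symmetric]] fin k
      by (simp add: g_def mono_wedge mult.assoc insert_absorb)
    ultimately show ?thesis unfolding X_def by (intro CollectI exI[of _ g]) auto
  qed
  moreover have "a + b \<in> X" if ab: "a \<in> X" "b \<in> X" for a b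
  proof -
    obtain g h where gh: "\<forall>s. g s \<in> ext_carrier 6" "a = (\<Sum>s<ncount 1. g s \<cdot> entry 0 s 0)"
        "\<forall>s. h s \<in> ext_carrier 6" "b = (\<Sum>s<ncount 1. h s \<cdot> entry 0 s 0)"
      using ab unfolding X_def by blast
    show ?thesis unfolding X_def
      by (intro CollectI exI[of _ "\<lambda>s. g s + h s"]) (simp add: gh wedge_distribs sum.distrib)
  qed
  ultimately have "(\<Sum>S\<in>Pow {..<6}. y S *\<^sub>e mono S) \<in> X" using 0 by (intro sum_closed)
  then show ?thesis using ext_eq_sum_mono[OF assms(1)] by (simp add: X_def)
qed

lemma linear_resolution:
  "linear_resolution_of_residue_field R ncount (\<lambda>i s t. proj (entry i s t))"
  unfolding linear_resolution_of_residue_field_def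
proof (intro conjI allI impI)
  show "ncount 0 = 1" by (simp add: ncount_def)
  show "proj (entry i s t) \<in> component R 1" for i s t
    using entry_homog by (auto simp: quotient_algebra_sel)
  show "matrix_map R (ncount 1) (ncount 0) (\<lambda>s t. proj (entry 0 s t)) ` free_module R (ncount 1)
      = {v \<in> free_module R (ncount 0). v 0 \<in> irrelevant_ideal R}" (is "?L = ?R")
  proof (intro equalityI subsetI)
    fix v assume "v \<in> ?L"
    then obtain u where u: "u \<in> free_module R (ncount 1)"
        "v = matrix_map R (ncount 1) (ncount 0) (\<lambda>s t. proj (entry 0 s t)) u" by blast
    obtain g where g: "\<And>s. g s \<in> ext_carrier 6" "u = (\<lambda>s\<in>{..<ncount 1}. proj (g s))"
      using free_moduleE[OF u(1)] by blast
    let ?y = "\<lambda>t. \<Sum>s<ncount 1. g s \<cdot> entry 0 s t"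
    have v: "v = (\<lambda>t\<in>{..<ncount 0}. proj (?y t))"
      unfolding u(2) g(2) by (rule matrix_map_proj[OF g(1) entry_carrier])
    have y: "?y t \<in> ext_carrier 6" for t using g(1) entry_carrier by (intro ext_carrier_sum) simp
    have "entry 0 s t {} = 0" for s t using homogD[OF entry_homog, of 0 s t "{}"] by auto
    then have "?y 0 {} = 0" by (simp add: sum_fun_apply wedge_empty)
    then show "v \<in> ?R" unfolding v irrelevant_ideal_eq using y
      by (auto simp: ncount_0_1 intro!: free_moduleI)
  next
    fix v assume v: "v \<in> ?R"
    then obtain y where y: "y \<in> ext_carrier 6" "y {} = 0" "v 0 = proj y"
      unfolding irrelevant_ideal_eq by blast
    obtain g where g: "\<And>s. g s \<in> ext_carrier 6" "y = (\<Sum>s<ncount 1. g s \<cdot> entry 0 s 0)"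
      using irrelevant_generated[OF y(1,2)] by blast
    have "v = (\<lambda>t\<in>{..<ncount 0}. proj (\<Sum>s<ncount 1. g s \<cdot> entry 0 s t))"
    proof
      fix t
      show "v t = (\<lambda>t\<in>{..<ncount 0}. proj (\<Sum>s<ncount 1. g s \<cdot> entry 0 s t)) t"
        using v y(3) g(2) PiE_arb[of v "{..<ncount 0}" _ t]
        by (cases "t = 0") (auto simp: free_module_def ncount_0_1)
    qed
    also have "\<dots> = matrix_map R (ncount 1) (ncount 0) (\<lambda>s t. proj (entry 0 s t)) (\<lambda>s\<in>{..<ncount 1}. proj (g s))"
      by (rule matrix_map_proj[OF g(1) entry_carrier, symmetric])
    finally show "v \<in> ?L" using free_moduleI[of g, OF g(1)] by blast
  qed
  fix i
  show "matrix_map R (ncount (i + 2)) (ncount (i + 1)) (\<lambda>s t. proj (entry (i + 1) s t)) ` free_module R (ncount (i + 2))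
      = {v \<in> free_module R (ncount (i + 1)).
           matrix_map R (ncount (i + 1)) (ncount i) (\<lambda>s t. proj (entry i s t)) v = (\<lambda>t\<in>{..<ncount i}. \<zero>\<^bsub>R\<^esub>)}"
      (is "?L = ?R")
  proof (intro equalityI subsetI)
    fix v assume "v \<in> ?L"
    then obtain u where u: "u \<in> free_module R (ncount (i + 2))"
        "v = matrix_map R (ncount (i + 2)) (ncount (i + 1)) (\<lambda>s t. proj (entry (i + 1) s t)) u" by blast
    obtain h where h: "\<And>s. h s \<in> ext_carrier 6" "u = (\<lambda>s\<in>{..<ncount (i + 2)}. proj (h s))"
      using free_moduleE[OF u(1)] by blast
    let ?g = "\<lambda>s. \<Sum>r<ncount (i + 2). h r \<cdot> entry (i + 1) r s"
    have g: "?g s \<in> ext_carrier 6" for s using h(1) entry_carrier by (intro ext_carrier_sum) simp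
    have v: "v = (\<lambda>s\<in>{..<ncount (i + 1)}. proj (?g s))"
      unfolding u(2) h(2) by (rule matrix_map_proj[OF h(1) entry_carrier])
    have "proj (\<Sum>s<ncount (i + 1). ?g s \<cdot> entry i s t) = \<zero>\<^bsub>R\<^esub>" if t: "t < ncount i" for t
    proof -
      have "(\<Sum>s<ncount (i + 1). ?g s \<cdot> entry i s t)
          = (\<Sum>r<ncount (i + 2). h r \<cdot> (\<Sum>s<ncount (i + 1). entry (i + 1) r s \<cdot> entry i s t))"
        unfolding wedge_sum_left wedge_sum_right wedge_assoc by (rule sum.swap)
      also have "\<dots> \<in> quad_ideal x"
      proof (rule ideal_exterior_sum[OF ideal_quad_ideal])
        fix r assume "r \<in> {..<ncount (i + 2)}"
        then have "(\<Sum>s<ncount (i + 1). entry (i + 1) r s \<cdot> entry i s t) \<in> quad_ideal x"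
          using entry_complex[OF _ t, of r] by simp
        then show "h r \<cdot> (\<Sum>s<ncount (i + 1). entry (i + 1) r s \<cdot> entry i s t) \<in> quad_ideal x"
          by (rule ideal_exteriorD(6)[OF ideal_quad_ideal]) (rule h(1))
      qed
      finally have "(\<Sum>s<ncount (i + 1). ?g s \<cdot> entry i s t) \<in> quad_ideal x" .
      then show ?thesis using proj_eq_zero_iff ideal_exteriorD(1)[OF ideal_quad_ideal] by blast
    qed
    then have "matrix_map R (ncount (i + 1)) (ncount i) (\<lambda>s t. proj (entry i s t)) v = (\<lambda>t\<in>{..<ncount i}. \<zero>\<^bsub>R\<^esub>)"
      unfolding v matrix_map_proj[OF g entry_carrier] by (intro restrict_ext) simp
    then show "v \<in> ?R" using free_moduleI[of ?g, OF g] v by simp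
  next
    fix v assume v: "v \<in> ?R"
    then obtain g where g: "\<And>s. g s \<in> ext_carrier 6" "v = (\<lambda>s\<in>{..<ncount (i + 1)}. proj (g s))"
      using free_moduleE[of v] by blast
    have "(\<Sum>s<ncount (i + 1). g s \<cdot> entry i s t) \<in> quad_ideal x" if t: "t < ncount i" for t
    proof -
      have "matrix_map R (ncount (i + 1)) (ncount i) (\<lambda>s t. proj (entry i s t)) v = (\<lambda>t\<in>{..<ncount i}. \<zero>\<^bsub>R\<^esub>)"
        using v by blast
      from fun_cong[OF this[unfolded g(2) matrix_map_proj[OF g(1) entry_carrier]], of t] have "proj (\<Sum>s<ncount (i + 1). g s \<cdot> entry i s t) = \<zero>\<^bsub>R\<^esub>" using t by simp
      moreover have "(\<Sum>s<ncount (i + 1). g s \<cdot> entry i s t) \<in> ext_carrier 6"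
        using g(1) entry_carrier by (intro ext_carrier_sum) simp
      ultimately show ?thesis using proj_eq_zero_iff by blast
    qed
    then obtain h where h: "\<forall>r. h r \<in> ext_carrier 6" "\<forall>s<ncount (i + 1).
        g s - (\<Sum>r<ncount (i + 2). h r \<cdot> entry (i + 1) r s) \<in> quad_ideal x"
      using entry_exact[of i g] g(1) by auto
    have "v = (\<lambda>s\<in>{..<ncount (i + 1)}. proj (\<Sum>r<ncount (i + 2). h r \<cdot> entry (i + 1) r s))"
      unfolding g(2)
    proof (rule restrict_ext)
      fix s assume "s \<in> {..<ncount (i + 1)}"
      moreover have "(\<Sum>r<ncount (i + 2). h r \<cdot> entry (i + 1) r s) \<in> ext_carrier 6"
        using h(1) entry_carrier by (intro ext_carrier_sum) simp
      ultimately show "proj (g s) = proj (\<Sum>r<ncount (i + 2). h r \<cdot> entry (i + 1) r s)"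
        using h(2) proj_eq_iff[OF g(1)] by simp
    qed
    also have "\<dots> = matrix_map R (ncount (i + 2)) (ncount (i + 1)) (\<lambda>s t. proj (entry (i + 1) s t))
        (\<lambda>s\<in>{..<ncount (i + 2)}. proj (h s))"
      using h(1) by (intro matrix_map_proj[symmetric] entry_carrier) simp
    finally show "v \<in> ?L" using free_moduleI[of h] h(1) by blast
  qed
qed

lemma koszul_generic: "koszul R"
  unfolding koszul_def using linear_resolution by blast

end

section \<open>Leading monomials\<close>

text \<open>Zero is lower than every monomial, so a remainder that vanishes needs no separate
  treatment.\<close>

definition lower :: "nat set rel \<Rightarrow> ext \<Rightarrow> nat set \<Rightarrow> bool"
  where "lower r f M \<longleftrightarrow> (\<forall>S. f S \<noteq> 0 \<longrightarrow> (S, M) \<in> r)"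

definition lead :: "nat set rel \<Rightarrow> ext \<Rightarrow> nat set \<Rightarrow> bool"
  where "lead r f M \<longleftrightarrow> f M \<noteq> 0 \<and> (\<forall>S. f S \<noteq> 0 \<and> S \<noteq> M \<longrightarrow> (S, M) \<in> r)"

lemma linear_wedge_apply:
  assumes "a \<in> homog n 1" "F \<in> ext_carrier n"
  shows "(a \<cdot> F) X = (\<Sum>j\<in>X. wedge_sign {j} (X - {j}) * a {j} * F (X - {j}))"
proof (cases "finite X")
  case True
  have "(a \<cdot> F) X = (\<Sum>T\<in>(\<lambda>j. {j}) ` X. wedge_sign T (X - T) * a T * F (X - T))"
    unfolding wedge_def
  proof (rule sum.mono_neutral_right)
    show "\<forall>T\<in>Pow X - (\<lambda>j. {j}) ` X. wedge_sign T (X - T) * a T * F (X - T) = 0"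
    proof
      fix T assume T: "T \<in> Pow X - (\<lambda>j. {j}) ` X"
      have "card T \<noteq> 1" using T by (auto simp: card_1_singleton_iff)
      then have "a T = 0" using homogD[OF assms(1), of T] by blast
      then show "wedge_sign T (X - T) * a T * F (X - T) = 0" by simp
    qed
  qed (use True in auto)
  also have "\<dots> = (\<Sum>j\<in>X. wedge_sign {j} (X - {j}) * a {j} * F (X - {j}))"
    by (subst sum.reindex) (auto simp: inj_on_def)
  finally show ?thesis .
qed (simp add: wedge_infinite)

locale ext_order =
  fixes n :: nat and r :: "nat set rel"
  assumes order: "monomial_order n r"
begin

abbreviation less_mon :: "nat set \<Rightarrow> nat set \<Rightarrow> bool"  (infix "\<prec>" 50)
  where "S \<prec> T \<equiv> (S, T) \<in> r"

lemma order_axioms: "trans r" "irrefl r" "total_on (Pow {..<n}) r"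
  using conjunct1[OF order[unfolded monomial_order_def]] by (simp_all add: strict_linear_order_on_def)

lemma less_trans: "S \<prec> T \<Longrightarrow> T \<prec> U \<Longrightarrow> S \<prec> U"
  using order_axioms(1) by (rule transD)

lemma less_irrefl: "\<not> S \<prec> S"
  using order_axioms(2) by (simp add: irrefl_def)

lemma less_asym: "S \<prec> T \<Longrightarrow> \<not> T \<prec> S"
  using less_trans less_irrefl by blast

lemma less_total: "S \<subseteq> {..<n} \<Longrightarrow> T \<subseteq> {..<n} \<Longrightarrow> S \<noteq> T \<Longrightarrow> S \<prec> T \<or> T \<prec> S"
  using order_axioms(3) by (simp add: total_on_def)

lemma less_Un:
  assumes "S \<prec> T" "S \<subseteq> {..<n}" "T \<subseteq> {..<n}" "U \<subseteq> {..<n}" "S \<inter> U = {}" "T \<inter> U = {}"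
  shows "S \<union> U \<prec> T \<union> U"
proof -
  have "\<forall>S T U. S \<subseteq> {..<n} \<and> T \<subseteq> {..<n} \<and> U \<subseteq> {..<n} \<and> S \<inter> U = {} \<and> T \<inter> U = {} \<and> S \<prec> T
       \<longrightarrow> S \<union> U \<prec> T \<union> U"
    by (rule conjunct2[OF conjunct2[OF order[unfolded monomial_order_def]]])
  from this[rule_format, of S T U] show ?thesis using assms by simp
qed

lemma less_insert:
  assumes "S \<prec> T" "S \<subseteq> {..<n}" "T \<subseteq> {..<n}" "i < n" "i \<notin> S" "i \<notin> T"
  shows "insert i S \<prec> insert i T"
  using less_Un[of S T "{i}"] assms by simp

text \<open>By totality the failure of the claim reverses the comparison, and multiplying back
  contradicts the assumption.\<close>

lemma less_insert_cancel:
  assumes "insert i S \<prec> insert i T" "S \<subseteq> {..<n}" "T \<subseteq> {..<n}" "i < n" "i \<notin> S" "i \<notin> T"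
  shows "S \<prec> T"
proof (rule ccontr)
  assume "\<not> S \<prec> T"
  moreover have "S \<noteq> T" using assms(1) less_irrefl by auto
  ultimately have "T \<prec> S" using less_total[OF assms(2,3)] by blast
  from less_insert[OF this assms(3,2,4,6,5)] show False using assms(1) less_asym by blast
qed

lemma lead_exists:
  assumes "f \<in> ext_carrier n" "f \<noteq> 0"
  shows "\<exists>M. lead r f M"
proof -
  let ?A = "{S. f S \<noteq> 0}"
  have sub: "?A \<subseteq> Pow {..<n}" using assms(1) by (auto simp: ext_carrier_def)
  have fin: "finite ?A" by (rule finite_subset[OF sub]) simp
  obtain S0 where "f S0 \<noteq> 0" using assms(2) by (auto simp: fun_eq_iff)
  then have ne: "?A \<noteq> {}" by blast
  have "\<exists>M\<in>B. \<forall>S\<in>B. S \<noteq> M \<longrightarrow> S \<prec> M" if "finite B" "B \<noteq> {}" "B \<subseteq> Pow {..<n}" for B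
    using that
  proof (induction B rule: finite_ne_induct)
    case (insert T B)
    then obtain M where M: "M \<in> B" "\<forall>S\<in>B. S \<noteq> M \<longrightarrow> S \<prec> M" by auto
    have "T \<noteq> M" using M insert by blast
    then have "T \<prec> M \<or> M \<prec> T" using less_total[of T M] M insert by auto
    then show ?case
    proof
      assume "T \<prec> M"
      with M show ?case by (intro bexI[of _ M]) auto
    next
      assume "M \<prec> T"
      with M show ?case by (intro bexI[of _ T]) (auto intro: less_trans)
    qed
  qed simp
  from this[OF fin ne sub] show ?thesis unfolding lead_def by blast
qed

lemma lead_subset: "f \<in> homog n d \<Longrightarrow> lead r f M \<Longrightarrow> M \<subseteq> {..<n} \<and> card M = d"
  using homogD unfolding lead_def by blast

lemma lower_lead_less: "lower r f M \<Longrightarrow> lead r f S \<Longrightarrow> S \<prec> M"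
  by (auto simp: lower_def lead_def)

lemma lower_if_less: "lead r f S \<Longrightarrow> S \<prec> M \<Longrightarrow> lower r f M"
  unfolding lead_def lower_def using less_trans by blast

lemma lower_closed:
  "lower r f M \<Longrightarrow> lower r g M \<Longrightarrow> lower r (f + g) M" "lower r f M \<Longrightarrow> lower r g M \<Longrightarrow> lower r (f - g) M"
  "lower r f M \<Longrightarrow> lower r (c *\<^sub>e f) M"
proof -
  show "lower r (f + g) M" "lower r (f - g) M" if "lower r f M" "lower r g M"
  proof -
    have "f S \<noteq> 0 \<or> g S \<noteq> 0 \<longrightarrow> S \<prec> M" for S using that by (auto simp: lower_def)
    then show "lower r (f + g) M" "lower r (f - g) M"
      unfolding lower_def by (simp_all; metis add.right_neutral diff_0_right)+
  qed
qed (auto simp: lower_def)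

lemma lead_add_lower: "lead r f M \<Longrightarrow> lower r g M \<Longrightarrow> lead r (f + g) M"
proof -
  assume f: "lead r f M" and g: "lower r g M"
  have "g M = 0" using g less_irrefl unfolding lower_def by blast
  moreover have "S \<prec> M" if "f S + g S \<noteq> 0" "S \<noteq> M" for S
  proof (cases "f S = 0")
    case True
    then show ?thesis using that g by (simp add: lower_def)
  next
    case False
    then show ?thesis using that f by (simp add: lead_def)
  qed
  ultimately show ?thesis using f by (simp add: lead_def)
qed

lemma lead_scale: "lead r f M \<Longrightarrow> c \<noteq> 0 \<Longrightarrow> lead r (c *\<^sub>e f) M"
  by (auto simp: lead_def)

lemma lead_mono: "lead r (mono M) M"
  by (simp add: lead_def mono_def)

lemma lead_cancel:
  assumes "lead r f M" "lead r g M"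
  shows "\<exists>c. c \<noteq> 0 \<and> lower r (f - c *\<^sub>e g) M"
proof (intro exI[of _ "f M / g M"] conjI)
  show "f M / g M \<noteq> 0" using assms by (simp add: lead_def)
  show "lower r (f - (f M / g M) *\<^sub>e g) M"
    unfolding lower_def
  proof (intro allI impI)
    fix S assume S: "(f - (f M / g M) *\<^sub>e g) S \<noteq> 0"
    then have "S \<noteq> M" using assms by (auto simp: lead_def)
    moreover have "f S \<noteq> 0 \<or> g S \<noteq> 0" using S by auto
    ultimately show "S \<prec> M" using assms by (auto simp: lead_def)
  qed
qed

text \<open>Monomial orders on exterior algebras respect only nonzero products, so the leading
  monomial of a product is delicate: terms of F divisible by e_i cannot be compared by multiplying
  with e_i. The condition \<open>i \<notin> M\<close> is what makes the expected monomial
  survive.\<close>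

lemma lead_linear_wedge:
  assumes a: "a \<in> homog n 1" "lead r a {i}" and F: "F \<in> ext_carrier n" "lead r F M" and iM: "i \<notin> M"
  shows "lead r (a \<cdot> F) (insert i M)"
proof -
  have i: "i < n" using lead_subset[OF a] by simp
  have M: "M \<subseteq> {..<n}" using F by (auto simp: lead_def ext_carrier_def)
  have main: "insert j S \<prec> insert i M \<or> (j = i \<and> S = M)"
    if j: "a {j} \<noteq> 0" and S: "F S \<noteq> 0" "j \<notin> S" for j S
  proof -
    have Sn: "S \<subseteq> {..<n}" using F(1) S(1) by (auto simp: ext_carrier_def)
    have jn: "j < n" using homogD[OF a(1) j] by simp
    have SM: "S = M \<or> S \<prec> M" using F(2) S(1) by (auto simp: lead_def)
    show ?thesis
    proof (cases "j = i")
      case True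
      then show ?thesis using SM less_insert[of S M i] Sn M i iM S(2) by blast
    next
      case False
      then have ji: "{j} \<prec> {i}" using a(2) j by (auto simp: lead_def)
      show ?thesis
      proof (cases "i \<in> S")
        case False
        have "{j} \<union> S \<prec> {i} \<union> S" using ji jn i Sn S(2) False by (intro less_Un) auto
        moreover have "S = M \<or> insert i S \<prec> insert i M" using SM less_insert[of S M i] Sn M i iM False by blast
        ultimately show ?thesis using less_trans by auto
      next
        \<comment> \<open>Writing S = i S', one has j S' below i S' = S, hence below M; multiplying
          this comparison by i is allowed and gives j S below i M.\<close>
        case True
        define S' where "S' = S - {i}"
        have S': "S = insert i S'" "i \<notin> S'" "S' \<subseteq> {..<n}" "j \<notin> S'" using True Sn S(2) by (auto simp: S'_def)
        have "{j} \<union> S' \<prec> {i} \<union> S'" using ji jn i S' by (intro less_Un) auto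
        then have "insert j S' \<prec> S" using S'(1) by simp
        then have "insert j S' \<prec> M" using SM less_trans by blast
        then have "insert i (insert j S') \<prec> insert i M"
          using jn i S' M iM False by (intro less_insert) auto
        then show ?thesis using S'(1) by (simp add: insert_commute)
      qed
    qed
  qed
  have fin: "finite (insert i M)" using M finite_subset by auto
  have "(a \<cdot> F) (insert i M) = (\<Sum>j\<in>{i}. wedge_sign {j} (insert i M - {j}) * a {j} * F (insert i M - {j}))"
    unfolding linear_wedge_apply[OF a(1) F(1)]
  proof (rule sum.mono_neutral_right[OF fin])
    show "\<forall>j\<in>insert i M - {i}. wedge_sign {j} (insert i M - {j}) * a {j} * F (insert i M - {j}) = 0"
    proof
      fix j assume j: "j \<in> insert i M - {i}"
      then have "insert j (insert i M - {j}) = insert i M" by auto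
      then have "\<not> insert j (insert i M - {j}) \<prec> insert i M" using less_irrefl by simp
      then have "a {j} = 0 \<or> F (insert i M - {j}) = 0" using main[of j "insert i M - {j}"] j by blast
      then show "wedge_sign {j} (insert i M - {j}) * a {j} * F (insert i M - {j}) = 0" by auto
    qed
  qed auto
  then have "(a \<cdot> F) (insert i M) \<noteq> 0" using a(2) F(2) iM by (simp add: lead_def)
  moreover have "X \<prec> insert i M" if X: "(a \<cdot> F) X \<noteq> 0" "X \<noteq> insert i M" for X
  proof -
    obtain j where j: "j \<in> X" "wedge_sign {j} (X - {j}) * a {j} * F (X - {j}) \<noteq> 0"
      using X(1) unfolding linear_wedge_apply[OF a(1) F(1)] by (meson sum.neutral)
    then have "insert j (X - {j}) = X" by auto
    with main[of j "X - {j}"] j X(2) show ?thesis by auto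
  qed
  ultimately show ?thesis unfolding lead_def by blast
qed

text \<open>The size of the down-set generated by the support. It drops when the leading monomial
  does, so minimal remainders can be chosen by a natural number.\<close>

definition rank :: "ext \<Rightarrow> nat"
  where "rank h = card {S \<in> Pow {..<n}. \<exists>M. h M \<noteq> 0 \<and> (S = M \<or> S \<prec> M)}"

lemma rank_less:
  assumes h: "h \<in> ext_carrier n" "lead r h M" and h': "lower r h' M"
  shows "rank h' < rank h"
  unfolding rank_def
proof (rule psubset_card_mono)
  let ?A = "{S \<in> Pow {..<n}. \<exists>M. h' M \<noteq> 0 \<and> (S = M \<or> S \<prec> M)}"
    and ?B = "{S \<in> Pow {..<n}. \<exists>M. h M \<noteq> 0 \<and> (S = M \<or> S \<prec> M)}"
  have hM: "h M \<noteq> 0" using h(2) by (simp add: lead_def)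
  have less: "S \<prec> M" if "S \<in> ?A" for S
    using that h' less_trans unfolding lower_def by blast
  then have "?A \<subseteq> ?B" using hM by blast
  moreover have "M \<in> ?B" using h hM by (auto simp: ext_carrier_def)
  moreover have "M \<notin> ?A" using less less_irrefl by blast
  ultimately show "?A \<subset> ?B" by blast
qed simp

lemma linear_independent_leads:
  assumes "a \<in> homog n 1" "b \<in> homog n 1" "lead r a {p}" "lead r b {q}" "p \<noteq> q"
    and 0: "c *\<^sub>e a + d *\<^sub>e b = 0"
  shows "c = 0 \<and> d = 0"
proof -
  have *: "c = 0 \<and> d = 0" if a: "lead r a {p}" and b: "lead r b {q}" and "{p} \<prec> {q}"
    and 0: "c *\<^sub>e a + d *\<^sub>e b = 0" for a b p q c d
  proof -
    have "a {q} = 0" using that(3) a less_asym[of "{p}" "{q}"] less_irrefl by (auto simp: lead_def)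
    then have d: "d = 0" using fun_cong[OF 0, of "{q}"] b by (auto simp: lead_def)
    then have "c = 0" using fun_cong[OF 0, of "{p}"] a by (auto simp: lead_def)
    with d show ?thesis by simp
  qed
  have "p < n" "q < n" using lead_subset[OF assms(1,3)] lead_subset[OF assms(2,4)] by auto
  then consider "{p} \<prec> {q}" | "{q} \<prec> {p}" using less_total[of "{p}" "{q}"] assms(5) by auto
  then show ?thesis
  proof cases
    case 1 then show ?thesis using *[OF assms(3,4) _ 0] by blast
  next
    case 2
    have "d *\<^sub>e b + c *\<^sub>e a = 0" using 0 by (simp add: add.commute)
    then show ?thesis using *[OF assms(4,3) 2] by blast
  qed
qed

end

section \<open>Graphs with six edges\<close>

text \<open>Vertices stand for variables and edges for leading monomials of quadrics.
  \<open>independent\<close> expresses that no monomial of degree \<open>card V - 3\<close> or more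
  is standard, and \<open>no_leaf\<close> will come from syzygies of a single quadric.\<close>

locale six_edge_graph =
  fixes V :: "'a set" and H :: "'a set set"
  assumes finite_V: "finite V"
    and edges: "\<And>N. N \<in> H \<Longrightarrow> N \<subseteq> V \<and> card N = 2"
    and card_edges: "card H \<le> 6"
    and independent: "\<And>T. T \<subseteq> V \<Longrightarrow> (\<And>N. N \<in> H \<Longrightarrow> \<not> N \<subseteq> T) \<Longrightarrow> card T + 4 \<le> card V"
    and no_leaf: "\<And>p q. {p, q} \<in> H \<Longrightarrow> \<exists>s. s \<noteq> q \<and> {p, s} \<in> H"
begin

lemma finite_H: "finite H"
  by (rule finite_subset[of _ "Pow V"]) (use edges finite_V in auto)

lemma edge_distinct: "{p, q} \<in> H \<Longrightarrow> p \<noteq> q"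
  using edges[of "{p, q}"] by auto

definition W :: "'a set"
  where "W = \<Union> H"

definition nbrs :: "'a \<Rightarrow> 'a set"
  where "nbrs v = {w. {v, w} \<in> H}"

lemma W_subset: "W \<subseteq> V"
  using edges by (auto simp: W_def)

lemma finite_W: "finite W"
  using W_subset finite_V finite_subset by blast

lemma nbrs_subset: "nbrs v \<subseteq> W - {v}"
  using edge_distinct by (auto simp: W_def nbrs_def)

lemma finite_nbrs: "finite (nbrs v)"
  using nbrs_subset finite_W by (meson finite_Diff finite_subset)

lemma nbrs_commute: "v \<in> nbrs w \<longleftrightarrow> w \<in> nbrs v"
  by (simp add: nbrs_def insert_commute)

lemma card_nbrs_eq: "card (nbrs v) = card {N \<in> H. v \<in> N}"
proof -
  have "(\<lambda>w. {v, w}) ` nbrs v = {N \<in> H. v \<in> N}"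
  proof (intro equalityI subsetI)
    fix N assume N: "N \<in> {N \<in> H. v \<in> N}"
    then have "card N = 2" using edges by blast
    then obtain a b where "N = {a, b}" by (auto simp: card_2_iff)
    then obtain w where "N = {v, w}" using N by (auto simp: insert_commute)
    with N show "N \<in> (\<lambda>w. {v, w}) ` nbrs v" by (auto simp: nbrs_def)
  qed (auto simp: nbrs_def)
  moreover have "inj_on (\<lambda>w. {v, w}) (nbrs v)"
    by (rule inj_onI) (auto simp: doubleton_eq_iff)
  ultimately show ?thesis using card_image by metis
qed

lemma card_nbrs_ge: "v \<in> W \<Longrightarrow> 2 \<le> card (nbrs v)"
proof -
  assume "v \<in> W"
  then obtain N where N: "N \<in> H" "v \<in> N" by (auto simp: W_def)
  then have "card {N \<in> H. v \<in> N} \<noteq> 0" using finite_H by auto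
  then have "nbrs v \<noteq> {}" using card_nbrs_eq[of v] by auto
  then obtain q where q: "q \<in> nbrs v" by blast
  then obtain s where s: "s \<noteq> q" "s \<in> nbrs v" using no_leaf[of v q] by (auto simp: nbrs_def)
  have "card {q, s} \<le> card (nbrs v)" using q s finite_nbrs by (intro card_mono) auto
  then show ?thesis using s by simp
qed

lemma sum_card_nbrs: "(\<Sum>v\<in>W. card (nbrs v)) = 2 * card H"
proof -
  have "(\<Sum>v\<in>W. card (nbrs v)) = (\<Sum>v\<in>W. \<Sum>N\<in>H. of_bool (v \<in> N))"
    using finite_H by (simp add: card_nbrs_eq Int_def)
  also have "\<dots> = (\<Sum>N\<in>H. \<Sum>v\<in>W. of_bool (v \<in> N))" by (rule sum.swap)
  also have "\<dots> = (\<Sum>N\<in>H. 2)"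
  proof (rule sum.cong[OF refl])
    fix N assume N: "N \<in> H"
    then have "W \<inter> {v. v \<in> N} = N" by (auto simp: W_def)
    then show "(\<Sum>v\<in>W. of_bool (v \<in> N)) = (2 :: nat)" using edges[OF N] finite_W by simp
  qed
  finally show ?thesis by simp
qed

lemma card_W_le: "card W \<le> 6"
proof -
  have "2 * card W = (\<Sum>v\<in>W. 2)" by simp
  also have "\<dots> \<le> (\<Sum>v\<in>W. card (nbrs v))" by (intro sum_mono card_nbrs_ge)
  finally show ?thesis using sum_card_nbrs card_edges by simp
qed

text \<open>Isolated vertices can be added to any independent set, so the bound relative to
  \<open>V\<close> becomes the same bound relative to the vertices of the edges.\<close>

lemma independent_W:
  assumes "T \<subseteq> W" "\<And>N. N \<in> H \<Longrightarrow> \<not> N \<subseteq> T"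
  shows "card T + 4 \<le> card W"
proof -
  have "\<not> N \<subseteq> (V - W) \<union> T" if "N \<in> H" for N
    using assms(2)[OF that] that by (auto simp: W_def)
  then have "card ((V - W) \<union> T) + 4 \<le> card V" using W_subset assms(1) by (intro independent) auto
  moreover have "card ((V - W) \<union> T) = card (V - W) + card T"
    using assms(1) finite_V finite_W finite_subset by (intro card_Un_disjoint) auto
  moreover have "card (V - W) = card V - card W" "card W \<le> card V"
    using W_subset finite_V finite_W by (simp_all add: card_Diff_subset card_mono)
  ultimately show ?thesis by simp
qed

lemma pair_edge: "card W < 6 \<Longrightarrow> u \<in> W \<Longrightarrow> v \<in> W \<Longrightarrow> u \<noteq> v \<Longrightarrow> {u, v} \<in> H"
proof (rule ccontr)
  assume W: "card W < 6" and uv: "u \<in> W" "v \<in> W" "u \<noteq> v" and "{u, v} \<notin> H"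
  then have "\<not> N \<subseteq> {u, v}" if "N \<in> H" for N
    using edges[OF that] that card_subset_eq[of "{u, v}" N] by auto
  from independent_W[OF _ this] uv W show False by auto
qed

text \<open>A single vertex is independent, so there are at least five vertices. With exactly five,
  every pair would have to be an edge, which makes ten edges.\<close>

lemma card_W: "card W = 6"
proof -
  have ne: "W \<noteq> {}"
  proof
    assume W: "W = {}"
    then have "\<not> N \<subseteq> {}" if "N \<in> H" for N using edges[OF that] by auto
    from independent_W[OF _ this] show False by (simp add: W)
  qed
  then obtain w where w: "w \<in> W" by blast
  have "\<not> N \<subseteq> {w}" if "N \<in> H" for N
    using edges[OF that] card_mono[of "{w}" N] by auto
  from independent_W[OF _ this] w have ge: "5 \<le> card W" by auto
  have "card W \<noteq> 5"
  proof
    assume 5: "card W = 5"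
    have "N \<in> H" if N: "N \<subseteq> W" "card N = 2" for N
    proof -
      obtain u v where "N = {u, v}" "u \<noteq> v" using N(2) by (auto simp: card_2_iff)
      then show ?thesis using pair_edge[of u v] 5 N(1) by auto
    qed
    then have "{N. N \<subseteq> W \<and> card N = 2} \<subseteq> H" by blast
    then have "card {N. N \<subseteq> W \<and> card N = 2} \<le> card H" using finite_H by (rule card_mono[rotated])
    moreover have "card {N. N \<subseteq> W \<and> card N = 2} = 10"
      using n_subsets[OF finite_W, of 2] 5 by (simp add: choose_two)
    ultimately show False using card_edges by simp
  qed
  with ge card_W_le show ?thesis by simp
qed

text \<open>Six vertices of degree at least 2 share a degree sum of at most 12.\<close>

lemma card_nbrs: "v \<in> W \<Longrightarrow> card (nbrs v) = 2"
proof (rule ccontr)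
  assume v: "v \<in> W" "card (nbrs v) \<noteq> 2"
  then have "2 < card (nbrs v)" using card_nbrs_ge[of v] by simp
  with v(1) have "\<exists>v\<in>W. 2 < card (nbrs v)" by blast
  then have "(\<Sum>v\<in>W. 2) < (\<Sum>v\<in>W. card (nbrs v))"
    using card_nbrs_ge by (intro sum_strict_mono_ex1 finite_W) auto
  then show False using sum_card_nbrs card_edges card_W by simp
qed

text \<open>Outside p and its two neighbours three vertices remain. Two nonadjacent ones among them
  would form with p an independent set of size three, so they are a triangle, which uses up their
  degrees and leaves q and k adjacent to each other.\<close>

lemma triangle:
  assumes p: "p \<in> W"
  shows "\<exists>q k. p \<noteq> q \<and> p \<noteq> k \<and> q \<noteq> k \<and> nbrs p = {q, k} \<and> nbrs q = {p, k} \<and> nbrs k = {p, q}"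
proof -
  obtain q k where qk: "nbrs p = {q, k}" "q \<noteq> k" using card_nbrs[OF p] by (auto simp: card_2_iff)
  have pqk: "p \<noteq> q" "p \<noteq> k" "q \<in> W" "k \<in> W" using nbrs_subset[of p] qk by auto
  define X where "X = W - {p, q, k}"
  have cardX: "card X = 3"
    using pqk qk p card_W finite_W by (simp add: X_def card_Diff_subset)
  then have finX: "finite X" by (metis card.infinite zero_neq_numeral)
  have X_nbrs: "nbrs u = X - {u}" if u: "u \<in> X" for u
  proof -
    have "{u, u'} \<in> H" if u': "u' \<in> X" "u \<noteq> u'" for u'
    proof (rule ccontr)
      assume no: "{u, u'} \<notin> H"
      have "\<not> N \<subseteq> {p, u, u'}" if N: "N \<in> H" for N
      proof
        assume sub: "N \<subseteq> {p, u, u'}"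
        obtain a b where ab: "N = {a, b}" "a \<noteq> b" using edges[OF N] by (auto simp: card_2_iff)
        have "u \<notin> nbrs p" "u' \<notin> nbrs p" using u u' qk by (auto simp: X_def)
        then have "{p, u} \<notin> H" "{p, u'} \<notin> H" by (auto simp: nbrs_def)
        with no ab N sub show False by (auto simp: insert_commute)
      qed
      from independent_W[OF _ this] have "card {p, u, u'} + 4 \<le> card W" using p u u' by (auto simp: X_def)
      moreover have "card {p, u, u'} = 3" using u u' by (auto simp: X_def)
      ultimately show False by (simp add: card_W)
    qed
    then have "X - {u} \<subseteq> nbrs u" by (auto simp: nbrs_def)
    moreover have "card (X - {u}) = card (nbrs u)"
      using card_nbrs[of u] u cardX finX by (simp add: X_def)
    ultimately show ?thesis using finite_nbrs card_subset_eq by metis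
  qed
  have closed: "nbrs v = {p, q, k} - {v}" if v: "v \<in> {q, k}" for v
  proof -
    have "v \<in> W" using v pqk by auto
    have "nbrs v \<subseteq> {p, q, k} - {v}"
    proof
      fix w assume w: "w \<in> nbrs v"
      have "w \<notin> X"
      proof
        assume "w \<in> X"
        then have "v \<in> X" using X_nbrs[of w] w nbrs_commute[of w v] by auto
        then show False using v by (auto simp: X_def)
      qed
      then show "w \<in> {p, q, k} - {v}" using w nbrs_subset[of v] by (auto simp: X_def)
    qed
    moreover have "card ({p, q, k} - {v}) = card (nbrs v)"
      using card_nbrs[OF \<open>v \<in> W\<close>] v pqk qk by auto
    ultimately show ?thesis by (intro card_subset_eq) auto
  qed
  have "nbrs q = {p, k}" "nbrs k = {p, q}" using closed[of q] closed[of k] pqk qk by auto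
  with pqk qk show ?thesis by blast
qed

end

section \<open>A quadratic Groebner basis produces a quadric of rank two\<close>

text \<open>\<open>H\<close> is the set of edges. The hypothesis \<open>no_rank_two\<close> is the
  one to be contradicted; the other conditions determine the graph. The bound in \<open>top\<close>
  is the codegree-three condition on the n variables.\<close>

locale quadratic_groebner = ext_order n r for n r +
  fixes J :: "ext set" and H :: "nat set set"
  assumes ideal_J: "ideal J (exterior n)"
    and H: "\<And>N. N \<in> H \<Longrightarrow> N \<subseteq> {..<n} \<and> card N = 2 \<and> (\<exists>g\<in>J. g \<in> homog n 2 \<and> lead r g N)"
    and groebner: "\<And>f M. f \<in> J \<Longrightarrow> lead r f M \<Longrightarrow> \<exists>N\<in>H. N \<subseteq> M"
    and no_rank_two: "\<And>a b. a \<in> homog n 1 \<Longrightarrow> b \<in> homog n 1 \<Longrightarrow> a \<cdot> b \<in> J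
      \<Longrightarrow> \<exists>c d. (c \<noteq> 0 \<or> d \<noteq> 0) \<and> c *\<^sub>e a + d *\<^sub>e b = 0"
    and card_H: "card H \<le> 6"
    and top: "homog n (n - 3) \<subseteq> J" "6 \<le> n"
begin

lemmas J = ideal_exteriorD[OF ideal_J]

lemma no_product:
  assumes "a \<in> homog n 1" "b \<in> homog n 1" "lead r a {p}" "lead r b {q}" "p \<noteq> q"
  shows "a \<cdot> b \<notin> J"
  using no_rank_two[OF assms(1,2)] linear_independent_leads[OF assms] by blast

lemma lower_trans: "lower r f M \<Longrightarrow> M \<prec> M' \<Longrightarrow> lower r f M'"
  unfolding lower_def using less_trans by blast

lemma reduce_edge:
  assumes "lead r h N" "N \<in> H"
  shows "\<exists>g\<in>J. g \<in> homog n 2 \<and> lower r (h - g) N"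
proof -
  obtain g where g: "g \<in> J" "g \<in> homog n 2" "lead r g N" using H[OF assms(2)] by blast
  obtain c where "lower r (h - c *\<^sub>e g) N" using lead_cancel[OF assms(1) g(3)] by blast
  with g J(8) show ?thesis by (intro bexI[of _ "c *\<^sub>e g"]) auto
qed

lemma lead_linear_mono:
  assumes "a \<in> homog n 1" "lead r a {i}" "j < n" "i \<noteq> j"
  shows "lead r (a \<cdot> mono {j}) {i, j}"
  using lead_linear_wedge[OF assms(1,2) homog_carrier[OF mono_singleton_homog[OF assms(3)]] lead_mono]
    assms(4) by simp

lemma wedge_mono_homog: "a \<in> homog n 1 \<Longrightarrow> j < n \<Longrightarrow> a \<cdot> mono {j} \<in> homog n 2"
  using homog_wedge[OF _ mono_singleton_homog, of a n 1 j] by (simp add: numeral_2_eq_2)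

lemma linear_product_homog: "a \<in> homog n 1 \<Longrightarrow> b \<in> homog n 1 \<Longrightarrow> a \<cdot> b \<in> homog n 2"
  using homog_wedge[of a n 1 b 1] by (simp add: numeral_2_eq_2)

text \<open>A leading term of the remainder that involves the leading variable of a factor a is
  cancelled by a multiple of a e_j, which can be moved into the other factor of the product.\<close>

lemma absorb:
  assumes "a \<in> homog n 1" "lead r a {i}" "j < n" "i \<noteq> j" "lead r h {i, j}"
  shows "\<exists>c. lower r (h - c *\<^sub>e (a \<cdot> mono {j})) {i, j}"
  using lead_cancel[OF assms(5) lead_linear_mono[OF assms(1-4)]] by blast

lemma lead_perturb:
  assumes "lead r b {q}" "{s} \<prec> {q}"
  shows "lead r (b + c *\<^sub>e mono {s}) {q}" "lead r (b - c *\<^sub>e mono {s}) {q}"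
proof -
  have low: "lower r (c *\<^sub>e mono {s}) {q}" for c using lower_closed(3)[OF lower_if_less[OF lead_mono assms(2)]] .
  show "lead r (b + c *\<^sub>e mono {s}) {q}" by (rule lead_add_lower[OF assms(1) low])
  show "lead r (b - c *\<^sub>e mono {s}) {q}"
    using lead_add_lower[OF assms(1) low[of "- c"]] by (simp add: scale_distribs)
qed

lemma pair_less_cancel:
  assumes "{p, s} \<prec> {p, q}" "p < n" "q < n" "s < n" "p \<noteq> s" "p \<noteq> q"
  shows "{s} \<prec> {q}"
  using less_insert_cancel[of p "{s}" "{q}"] assms by auto

lemma lead_pairE:
  assumes "h \<in> homog n 2" "lead r h M"
  obtains s t where "M = {s, t}" "s \<noteq> t" "s < n" "t < n"
proof -
  have "M \<subseteq> {..<n}" "card M = 2" using lead_subset[OF assms] by auto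
  then show ?thesis using that by (auto simp: card_2_iff)
qed

text \<open>Among all a b + h in J with leading variables p and q, one with minimal h is taken. Its
  leading monomial M is no edge, since otherwise an element of J reduces it. It avoids p, since
  otherwise the term is absorbed into b, where it stays below q because M is below p q; likewise for
  q. Finally h is nonzero since J contains no such product.\<close>

lemma edge_completion:
  assumes pq: "{p, q} \<in> H"
  shows "\<exists>a b h M. a \<in> homog n 1 \<and> b \<in> homog n 1 \<and> h \<in> homog n 2 \<and> lead r a {p} \<and> lead r b {q} \<and>
    lead r h M \<and> M \<prec> {p, q} \<and> a \<cdot> b + h \<in> J \<and> M \<notin> H \<and> p \<notin> M \<and> q \<notin> M"
proof -
  have "card {p, q} = 2" using H[OF pq] by blast
  then have ne: "p \<noteq> q" by auto
  have lt: "p < n" "q < n" using H[OF pq] by auto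
  define P where "P = (\<lambda>(a, b, h). a \<in> homog n 1 \<and> b \<in> homog n 1 \<and> h \<in> homog n 2 \<and> lead r a {p} \<and>
    lead r b {q} \<and> lower r h {p, q} \<and> a \<cdot> b + h \<in> J)"
  have "\<exists>z. P z"
  proof -
    obtain g where g: "g \<in> J" "g \<in> homog n 2" "lead r g {p, q}" using H[OF pq] by blast
    obtain c where c: "c \<noteq> 0" "lower r (g - c *\<^sub>e (mono {p} \<cdot> mono {q})) {p, q}"
      using lead_cancel[OF g(3) lead_linear_mono[OF mono_singleton_homog[OF lt(1)] lead_mono lt(2) ne]] by blast
    have "P (c *\<^sub>e mono {p}, mono {q}, g - c *\<^sub>e (mono {p} \<cdot> mono {q}))"
      using c g lead_scale[OF lead_mono c(1)] lead_mono mono_singleton_homog[OF lt(1)] mono_singleton_homog[OF lt(2)]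
        wedge_mono_homog[OF mono_singleton_homog[OF lt(1)] lt(2)] by (simp add: P_def)
    then show ?thesis by blast
  qed
  then obtain z where z: "P z" "\<And>z'. P z' \<Longrightarrow> rank (snd (snd z)) \<le> rank (snd (snd z'))"
    using ex_has_least_nat[of P _ "\<lambda>z. rank (snd (snd z))"] by blast
  obtain a b h where [simp]: "z = (a, b, h)" by (metis prod.exhaust)
  have abh: "a \<in> homog n 1" "b \<in> homog n 1" "h \<in> homog n 2" "lead r a {p}" "lead r b {q}"
    "lower r h {p, q}" "a \<cdot> b + h \<in> J" using z(1) by (simp_all add: P_def)
  have "h \<noteq> 0" using no_product[OF abh(1,2,4,5) ne] abh(7) by auto
  then obtain M where M: "lead r h M" using lead_exists homog_carrier abh(3) by blast
  have Mpq: "M \<prec> {p, q}" using lower_lead_less abh(6) M by blast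
  obtain s t where st: "M = {s, t}" "s \<noteq> t" "s < n" "t < n" by (rule lead_pairE[OF abh(3) M])
  have contra: False if "P (a', b', h')" "lower r h' M" for a' b' h'
    using z(2)[OF that(1)] rank_less[OF homog_carrier[OF abh(3)] M that(2)] by simp
  have "M \<notin> H"
  proof
    assume "M \<in> H"
    then obtain g where g: "g \<in> J" "g \<in> homog n 2" "lower r (h - g) M" using reduce_edge[OF M] by blast
    have "a \<cdot> b + (h - g) \<in> J" using J(4)[OF abh(7) g(1)] by (simp add: add_diff_eq)
    then have "P (a, b, h - g)"
      using abh g lower_trans[OF g(3) Mpq] by (simp add: P_def)
    then show False using contra g(3) by blast
  qed
  moreover have "p \<notin> M"
  proof
    assume "p \<in> M"
    then obtain u where u: "M = {p, u}" "u < n" "p \<noteq> u" using st by auto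
    obtain c where c: "lower r (h - c *\<^sub>e (a \<cdot> mono {u})) M"
      using absorb[OF abh(1,4) u(2,3)] M u(1) by blast
    have "{u} \<prec> {q}" using pair_less_cancel[of p u q] Mpq u lt ne by simp
    then have ld: "lead r (b + c *\<^sub>e mono {u}) {q}" using lead_perturb abh(5) by blast
    have eq: "a \<cdot> (b + c *\<^sub>e mono {u}) + (h - c *\<^sub>e (a \<cdot> mono {u})) = a \<cdot> b + h"
      by (simp add: wedge_distribs)
    have mem: "a \<cdot> (b + c *\<^sub>e mono {u}) + (h - c *\<^sub>e (a \<cdot> mono {u})) \<in> J"
      unfolding eq by (rule abh(7))
    have "P (a, b + c *\<^sub>e mono {u}, h - c *\<^sub>e (a \<cdot> mono {u}))"
      using ld mem abh lower_trans[OF c Mpq] mono_singleton_homog[OF u(2)] wedge_mono_homog[OF abh(1) u(2)]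
      by (simp add: P_def)
    then show False using contra c by blast
  qed
  moreover have "q \<notin> M"
  proof
    assume "q \<in> M"
    then obtain u where u: "M = {q, u}" "u < n" "q \<noteq> u" using st by auto
    obtain c where c: "lower r (h - c *\<^sub>e (b \<cdot> mono {u})) M"
      using absorb[OF abh(2,5) u(2,3)] M u(1) by blast
    have "{q, u} \<prec> {q, p}" using Mpq u(1) by (simp add: insert_commute)
    then have "{u} \<prec> {p}" using pair_less_cancel[of q u p] u lt ne by simp
    then have ld: "lead r (a - c *\<^sub>e mono {u}) {p}" using lead_perturb abh(4) by blast
    have eq: "(a - c *\<^sub>e mono {u}) \<cdot> b + (h - c *\<^sub>e (b \<cdot> mono {u})) = a \<cdot> b + h"
      using linear_anticommute[OF abh(2) mono_singleton_homog[OF u(2)]]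
      by (simp add: wedge_distribs scale_distribs)
    have mem: "(a - c *\<^sub>e mono {u}) \<cdot> b + (h - c *\<^sub>e (b \<cdot> mono {u})) \<in> J"
      unfolding eq by (rule abh(7))
    have "P (a - c *\<^sub>e mono {u}, b, h - c *\<^sub>e (b \<cdot> mono {u}))"
      using ld mem abh lower_trans[OF c Mpq] mono_singleton_homog[OF u(2)] wedge_mono_homog[OF abh(2) u(2)]
      by (simp add: P_def)
    then show False using contra c by blast
  qed
  ultimately show ?thesis using abh M Mpq by blast
qed

lemma edge_in_insert:
  assumes "N \<in> H" "N \<subseteq> insert p M" "M \<notin> H" "card M = 2"
  shows "\<exists>k\<in>M. {p, k} \<in> H"
proof -
  obtain s t where st: "N = {s, t}" "s \<noteq> t" using H[OF assms(1)] by (auto simp: card_2_iff)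
  have "finite M" using assms(4) by (metis card.infinite zero_neq_numeral)
  have "p \<in> N"
  proof (rule ccontr)
    assume "p \<notin> N"
    then have "N = M" using assms H[OF assms(1)] \<open>finite M\<close> by (intro card_subset_eq) auto
    then show False using assms by blast
  qed
  then obtain k where "N = {p, k}" "k \<noteq> p" using st by auto
  then show ?thesis using assms by auto
qed

text \<open>Multiplying a b + h by a removes the product and leaves a h in J, with leading monomial
  p M. An edge dividing it is not M, so it joins p to M. The factor b gives the same for q.\<close>

lemma completion_neighbours:
  assumes "a \<in> homog n 1" "b \<in> homog n 1" "h \<in> homog n 2" "lead r a {p}" "lead r b {q}"
    "lead r h M" "a \<cdot> b + h \<in> J" "M \<notin> H" "p \<notin> M" "q \<notin> M"
  shows "\<exists>k\<in>M. {p, k} \<in> H" "\<exists>k\<in>M. {q, k} \<in> H"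
proof -
  have car: "a \<in> ext_carrier n" "b \<in> ext_carrier n" using assms(1,2) homog_carrier by auto
  have cardM: "card M = 2" using lead_subset[OF assms(3,6)] by blast
  have "a \<cdot> (a \<cdot> b + h) = a \<cdot> h"
    using linear_square[OF assms(1)] by (simp add: wedge_distribs flip: wedge_assoc)
  then have "a \<cdot> h \<in> J" using J(6)[OF assms(7) car(1)] by simp
  from groebner[OF this lead_linear_wedge[OF assms(1,4) homog_carrier[OF assms(3)] assms(6,9)]]
  show "\<exists>k\<in>M. {p, k} \<in> H" using edge_in_insert assms(8) cardM by blast
  have "b \<cdot> (a \<cdot> b) = 0"
    using linear_anticommute[OF assms(1,2)] linear_square[OF assms(2)]
    by (simp add: wedge_assoc[of a b b] flip: wedge_assoc[of b a b])
  then have "b \<cdot> (a \<cdot> b + h) = b \<cdot> h" by (simp add: wedge_distribs)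
  then have "b \<cdot> h \<in> J" using J(6)[OF assms(7) car(2)] by simp
  from groebner[OF this lead_linear_wedge[OF assms(2,5) homog_carrier[OF assms(3)] assms(6,10)]]
  show "\<exists>k\<in>M. {q, k} \<in> H" using edge_in_insert assms(8) cardM by blast
qed

text \<open>The monomial of a set with at least n - 3 elements has a divisor in J, so the set
  contains an edge. There are no leaves because the neighbour of p found in M differs from
  q.\<close>

lemma six_edge_graph: "six_edge_graph {..<n} H"
proof
  show "finite {..<n}" by simp
  show "\<And>N. N \<in> H \<Longrightarrow> N \<subseteq> {..<n} \<and> card N = 2" using H by blast
  show "card H \<le> 6" by (rule card_H)
  show "card T + 4 \<le> card {..<n}" if T: "T \<subseteq> {..<n}" "\<And>N. N \<in> H \<Longrightarrow> \<not> N \<subseteq> T" for T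
  proof (rule ccontr)
    assume "\<not> ?thesis"
    then have "n - 3 \<le> card T" by simp
    then obtain S where S: "S \<subseteq> T" "card S = n - 3" by (meson obtain_subset_with_card_n)
    then have "mono S \<in> homog n (n - 3)" using mono_in[of S n] T(1) by auto
    then have "mono S \<in> J" using top(1) by blast
    from groebner[OF this lead_mono] T(2) S(1) show False by blast
  qed
  show "\<exists>s. s \<noteq> q \<and> {p, s} \<in> H" if pq: "{p, q} \<in> H" for p q
  proof -
    obtain a b h M where M: "a \<in> homog n 1" "b \<in> homog n 1" "h \<in> homog n 2" "lead r a {p}" "lead r b {q}"
      "lead r h M" "a \<cdot> b + h \<in> J" "M \<notin> H" "p \<notin> M" "q \<notin> M" using edge_completion[OF pq] by blast
    from completion_neighbours(1)[OF this] obtain k where "k \<in> M" "{p, k} \<in> H" by blast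
    then show ?thesis using M(10) by (intro exI[of _ k]) auto
  qed
qed

end

section \<open>Exclusion of two disjoint triangles\<close>

context quadratic_groebner
begin

interpretation graph: six_edge_graph "{..<n}" H
  by (rule six_edge_graph)

lemma not_adjacent_W: "w \<notin> graph.W \<Longrightarrow> N \<in> H \<Longrightarrow> w \<notin> N"
  by (auto simp: graph.W_def)

text \<open>The smallest vertex \<open>p\<close> with a neighbour lies in a triangle \<open>p \<prec> q \<prec> k\<close>, and the leading
  monomial of the correction term of the edge \<open>p q\<close> has to be \<open>k l\<close> with an isolated \<open>l\<close>.\<close>

lemma smallest_triangle:
  "\<exists>p q k l a b h. graph.nbrs p = {q, k} \<and> graph.nbrs q = {p, k} \<and> graph.nbrs k = {p, q} \<and>
    p \<noteq> q \<and> p \<noteq> k \<and> {q} \<prec> {k} \<and> {p} \<prec> {k} \<and> {l} \<prec> {p} \<and> l \<notin> graph.W \<and> l < n \<and> p < n \<and> q < n \<and> k < n \<and>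
    a \<in> homog n 1 \<and> b \<in> homog n 1 \<and> h \<in> homog n 2 \<and> lead r a {p} \<and> lead r b {q} \<and>
    lead r h {k, l} \<and> {k, l} \<prec> {p, q} \<and> a \<cdot> b + h \<in> J"
proof -
  have "graph.W \<noteq> {}" using graph.card_W by auto
  have "\<exists>p\<in>B. \<forall>v\<in>B. v \<noteq> p \<longrightarrow> {p} \<prec> {v}" if "finite B" "B \<noteq> {}" "B \<subseteq> {..<n}" for B
    using that
  proof (induction B rule: finite_ne_induct)
    case (insert t B)
    then obtain p where p: "p \<in> B" "\<forall>v\<in>B. v \<noteq> p \<longrightarrow> {p} \<prec> {v}" by auto
    have "t \<noteq> p" using p insert by blast
    then have "{t} \<prec> {p} \<or> {p} \<prec> {t}" using less_total[of "{t}" "{p}"] p insert by auto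
    then show ?case
    proof
      assume "{p} \<prec> {t}"
      with p show ?case by (intro bexI[of _ p]) auto
    next
      assume "{t} \<prec> {p}"
      with p show ?case by (intro bexI[of _ t]) (auto intro: less_trans)
    qed
  qed simp
  from this[OF graph.finite_W \<open>graph.W \<noteq> {}\<close> graph.W_subset] obtain p
    where p: "p \<in> graph.W" "\<And>v. v \<in> graph.W \<Longrightarrow> v \<noteq> p \<Longrightarrow> {p} \<prec> {v}" by blast
  obtain q0 k0 where qk0: "p \<noteq> q0" "p \<noteq> k0" "q0 \<noteq> k0" "graph.nbrs p = {q0, k0}"
    "graph.nbrs q0 = {p, k0}" "graph.nbrs k0 = {p, q0}" using graph.triangle[OF p(1)] by blast
  have lt0: "q0 < n" "k0 < n" "p < n" using graph.nbrs_subset[of p] graph.W_subset qk0 p(1) by auto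
  have "\<exists>q k. p \<noteq> q \<and> p \<noteq> k \<and> q \<noteq> k \<and> {q} \<prec> {k} \<and> q < n \<and> k < n \<and>
      graph.nbrs p = {q, k} \<and> graph.nbrs q = {p, k} \<and> graph.nbrs k = {p, q}"
  proof (cases "{q0} \<prec> {k0}")
    case True
    show ?thesis by (rule exI[of _ q0], rule exI[of _ k0]) (simp add: qk0 lt0 True)
  next
    case False
    then have kq: "{k0} \<prec> {q0}" using less_total[of "{q0}" "{k0}"] qk0 lt0 by auto
    show ?thesis
      by (rule exI[of _ k0], rule exI[of _ q0]) (use kq qk0 lt0 in \<open>simp add: insert_commute\<close>)
  qed
  then obtain q k where qk: "p \<noteq> q" "p \<noteq> k" "q \<noteq> k" "{q} \<prec> {k}" "q < n" "k < n"
    "graph.nbrs p = {q, k}" "graph.nbrs q = {p, k}" "graph.nbrs k = {p, q}" by blast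
  have pk: "{p} \<prec> {k}" using p(2)[of k] graph.nbrs_subset[of p] qk by auto
  have "q \<in> graph.nbrs p" using qk by simp
  then have "{p, q} \<in> H" by (simp add: graph.nbrs_def)
  then obtain a b h M where M: "a \<in> homog n 1" "b \<in> homog n 1" "h \<in> homog n 2" "lead r a {p}" "lead r b {q}"
    "lead r h M" "M \<prec> {p, q}" "a \<cdot> b + h \<in> J" "M \<notin> H" "p \<notin> M" "q \<notin> M" using edge_completion by blast
  obtain k' where k': "k' \<in> M" "{p, k'} \<in> H"
    using completion_neighbours(1)[OF M(1-6,8-11)] by blast
  then have "k' \<in> graph.nbrs p" by (simp add: graph.nbrs_def)
  \<comment> \<open>The monomial avoids q, the other neighbour of p.\<close>
  then have "k' = k" using qk(7) k' M(11) by auto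
  obtain s t where st: "M = {s, t}" "s \<noteq> t" "s < n" "t < n" by (rule lead_pairE[OF M(3,6)])
  have "\<exists>l. M = {k, l} \<and> k \<noteq> l \<and> l < n"
  proof (cases "k = s")
    case True
    then show ?thesis using st by blast
  next
    case False
    then have "k = t" using k'(1) \<open>k' = k\<close> st(1) by simp
    then show ?thesis using st by blast
  qed
  then obtain l where l: "M = {k, l}" "k \<noteq> l" "l < n" by blast
  have lpq: "l \<noteq> p" "l \<noteq> q" using M(10,11) l by auto
  \<comment> \<open>Otherwise k l would exceed k p, which exceeds p q because k is above q,
    contradicting that M is below p q. So l is smaller than the least vertex of an edge and hence
    isolated.\<close>
  have "\<not> {p} \<prec> {l}"
  proof
    assume "{p} \<prec> {l}"
    then have "insert k {p} \<prec> insert k {l}" using l qk lpq lt0 by (intro less_insert) auto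
    moreover have "insert p {q} \<prec> insert p {k}" using qk lt0 by (intro less_insert) auto
    ultimately have "{p, q} \<prec> {k, l}" using less_trans by (simp add: insert_commute)
    then show False using M(7) l(1) less_asym by simp
  qed
  then have lp: "{l} \<prec> {p}" using less_total[of "{l}" "{p}"] l lt0 lpq by auto
  then have "l \<notin> graph.W" using p(2)[of l] lpq less_asym by blast
  with qk pk lp l M lt0 show ?thesis
    by - (rule exI[of _ p], rule exI[of _ q], rule exI[of _ k], rule exI[of _ l], rule exI[of _ a],
        rule exI[of _ b], rule exI[of _ h], simp)
qed

lemma product_in_J_closed:
  assumes "g \<in> J" "a \<in> homog n 1"
  shows "a \<cdot> g \<in> J"
  using J(6)[OF assms(1)] homog_carrier[OF assms(2)] by blast

text \<open>Two quadrics of J are brought to the forms a b + \<kappa> \<mu> and a \<kappa> + \<mu> u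
  with u in the span of a, b, \<kappa>, \<mu>. On four linear forms, decomposability is the
  vanishing of the Pfaffian. Along the pencil it is a quadratic polynomial in the parameter, so
  apart from a degenerate case there is a root over the complex numbers, and with it a product of
  independent linear forms in J.\<close>

lemma contradiction: False
proof -
  obtain p q k l a0 b0 h0 where
    nb: "graph.nbrs p = {q, k}" "graph.nbrs q = {p, k}" "graph.nbrs k = {p, q}"
    and ne: "p \<noteq> q" "p \<noteq> k" and ord: "{q} \<prec> {k}" "{p} \<prec> {k}" "{l} \<prec> {p}" "l \<notin> graph.W"
    and lt: "l < n" "p < n" "q < n" "k < n"
    and abh0: "a0 \<in> homog n 1" "b0 \<in> homog n 1" "h0 \<in> homog n 2" "lead r a0 {p}" "lead r b0 {q}"
      "lead r h0 {k, l}" and klpq: "{k, l} \<prec> {p, q}" and J0: "a0 \<cdot> b0 + h0 \<in> J"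
    using smallest_triangle by blast
  have distinct: "q \<noteq> k" "l \<noteq> p" "l \<noteq> q" "l \<noteq> k"
    using ord less_irrefl nb graph.nbrs_subset[of p] by auto
  \<comment> \<open>An edge here misses the isolated l and is not M, so it joins p to M, but the
    only neighbours of p are q and k.\<close>
  have no_edge: "N \<notin> H" if "N \<subseteq> insert p (insert l M)" "M \<notin> H" "card M = 2" "q \<notin> M" "k \<notin> M" for N M
  proof
    assume N: "N \<in> H"
    then have "l \<notin> N" using not_adjacent_W ord(4) by blast
    then have "N \<subseteq> insert p M" using that(1) by blast
    from edge_in_insert[OF N this that(2,3)] obtain m where "m \<in> M" "{p, m} \<in> H" by blast
    then have "m \<in> graph.nbrs p" by (simp add: graph.nbrs_def)
    then show False using \<open>m \<in> M\<close> nb(1) that(4,5) by auto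
  qed

  \<comment> \<open>The correction term of the edge p q is split as \<kappa> \<mu> + h with h below
    k l. For minimal h nothing is left that an edge reduces or that one of the four factors
    absorbs.\<close>
  define P where "P = (\<lambda>(a, b, \<kappa>, \<mu>, h). a \<in> homog n 1 \<and> b \<in> homog n 1 \<and> \<kappa> \<in> homog n 1 \<and> \<mu> \<in> homog n 1 \<and>
    h \<in> homog n 2 \<and> lead r a {p} \<and> lead r b {q} \<and> lead r \<kappa> {k} \<and> lead r \<mu> {l} \<and> lower r h {k, l} \<and>
    a \<cdot> b + \<kappa> \<cdot> \<mu> + h \<in> J)"
  define rk where "rk = (\<lambda>(a :: ext, b :: ext, \<kappa> :: ext, \<mu> :: ext, h). rank h)"
  have "\<exists>z. P z"
  proof -
    obtain c where c: "c \<noteq> 0" "lower r (h0 - c *\<^sub>e (mono {k} \<cdot> mono {l})) {k, l}"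
      using lead_cancel[OF abh0(6) lead_linear_mono[OF mono_singleton_homog[OF lt(4)] lead_mono lt(1)]] distinct(4) by blast
    have "a0 \<cdot> b0 + (c *\<^sub>e mono {k}) \<cdot> mono {l} + (h0 - c *\<^sub>e (mono {k} \<cdot> mono {l})) = a0 \<cdot> b0 + h0" by simp
    then have "a0 \<cdot> b0 + (c *\<^sub>e mono {k}) \<cdot> mono {l} + (h0 - c *\<^sub>e (mono {k} \<cdot> mono {l})) \<in> J" using J0 by metis
    then have "P (a0, b0, c *\<^sub>e mono {k}, mono {l}, h0 - c *\<^sub>e (mono {k} \<cdot> mono {l}))"
      using abh0 c(2) lead_scale[OF lead_mono c(1)] lead_mono mono_singleton_homog[OF lt(1)]
        mono_singleton_homog[OF lt(4)] wedge_mono_homog[OF mono_singleton_homog[OF lt(4)] lt(1)]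
      unfolding P_def prod.case by (intro conjI homog_closed)
    then show ?thesis by blast
  qed
  then obtain z where z: "P z" "\<And>z'. P z' \<Longrightarrow> rk z \<le> rk z'"
    using ex_has_least_nat[of P _ rk] by blast
  obtain a b \<kappa> \<mu> h where z_eq: "z = (a, b, \<kappa>, \<mu>, h)" by (metis prod.exhaust)
  have hom: "a \<in> homog n 1" "b \<in> homog n 1" "\<kappa> \<in> homog n 1" "\<mu> \<in> homog n 1" "h \<in> homog n 2"
    and ld: "lead r a {p}" "lead r b {q}" "lead r \<kappa> {k}" "lead r \<mu> {l}" "lower r h {k, l}"
    and inJ: "a \<cdot> b + \<kappa> \<cdot> \<mu> + h \<in> J"
    using z(1) unfolding z_eq P_def prod.case by blast+
  note car = hom[THEN homog_carrier]
  have sq: "a \<cdot> a = 0" "b \<cdot> b = 0" "\<kappa> \<cdot> \<kappa> = 0" "\<mu> \<cdot> \<mu> = 0"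
    using hom(1-4)[THEN linear_square] by auto
  note anti = linear_anticommute
  have h: "h = 0"
  proof (rule ccontr)
    assume "h \<noteq> 0"
    then obtain M where M: "lead r h M" using lead_exists car(5) by blast
    have Mkl: "M \<prec> {k, l}" using lower_lead_less[OF ld(5) M] .
    have Mpq: "M \<prec> {p, q}" using less_trans[OF Mkl klpq] .
    obtain s t where st: "M = {s, t}" "s \<noteq> t" "s < n" "t < n" by (rule lead_pairE[OF hom(5) M])
    have contra: False if "P (a', b', \<kappa>', \<mu>', h')" "lower r h' M" for a' b' \<kappa>' \<mu>' h'
      using z(2)[OF that(1)] rank_less[OF car(5) M that(2)] by (simp add: rk_def z_eq)
    have step: False
      if "a' \<in> homog n 1" "b' \<in> homog n 1" "\<kappa>' \<in> homog n 1" "\<mu>' \<in> homog n 1" "h' \<in> homog n 2"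
        "lead r a' {p}" "lead r b' {q}" "lead r \<kappa>' {k}" "lead r \<mu>' {l}" "lower r h' M"
        "a' \<cdot> b' + \<kappa>' \<cdot> \<mu>' + h' = a \<cdot> b + \<kappa> \<cdot> \<mu> + h" for a' b' \<kappa>' \<mu>' h'
      using contra[of a' b' \<kappa>' \<mu>' h'] that inJ lower_trans[OF that(10) Mkl] by (simp add: P_def)
    have MH: "M \<notin> H"
    proof
      assume "M \<in> H"
      then obtain g where g: "g \<in> J" "g \<in> homog n 2" "lower r (h - g) M" using reduce_edge[OF M] by blast
      have "a \<cdot> b + \<kappa> \<cdot> \<mu> + (h - g) \<in> J" using J(4)[OF inJ g(1)] by (simp add: add_diff_eq)
      then have "P (a, b, \<kappa>, \<mu>, h - g)"
        using hom ld g lower_trans[OF g(3) Mkl] by (simp add: P_def)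
      then show False using contra g(3) by blast
    qed
    have other: "\<exists>u. M = {i, u} \<and> u < n \<and> i \<noteq> u" if "i \<in> M" for i using that st by auto
    have pM: "p \<notin> M"
    proof
      assume "p \<in> M"
      then obtain u where u: "M = {p, u}" "u < n" "p \<noteq> u" using other by blast
      obtain c where c: "lower r (h - c *\<^sub>e (a \<cdot> mono {u})) M" using absorb[OF hom(1) ld(1) u(2,3)] M u(1) by blast
      have "{u} \<prec> {q}" using pair_less_cancel[of p u q] Mpq u lt ne by simp
      then have l': "lead r (b + c *\<^sub>e mono {u}) {q}" using lead_perturb ld(2) by blast
      show False
        by (rule step[OF hom(1) _ hom(3,4) _ ld(1) l' ld(3,4) c])
           (use hom mono_singleton_homog[OF u(2)] wedge_mono_homog[OF hom(1) u(2)] in \<open>simp_all add: wedge_distribs\<close>)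
    qed
    have qM: "q \<notin> M"
    proof
      assume "q \<in> M"
      then obtain u where u: "M = {q, u}" "u < n" "q \<noteq> u" using other by blast
      obtain c where c: "lower r (h - c *\<^sub>e (b \<cdot> mono {u})) M" using absorb[OF hom(2) ld(2) u(2,3)] M u(1) by blast
      have "{q, u} \<prec> {q, p}" using Mpq u(1) by (simp add: insert_commute)
      then have "{u} \<prec> {p}" using pair_less_cancel[of q u p] u lt ne by simp
      then have l': "lead r (a - c *\<^sub>e mono {u}) {p}" using lead_perturb ld(1) by blast
      show False
        by (rule step[OF _ hom(2,3,4) _ l' ld(2,3,4) c])
           (use hom mono_singleton_homog[OF u(2)] wedge_mono_homog[OF hom(2) u(2)]
              anti[OF hom(2) mono_singleton_homog[OF u(2)]] in \<open>simp_all add: wedge_distribs scale_distribs\<close>)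
    qed
    have kM: "k \<notin> M"
    proof
      assume "k \<in> M"
      then obtain u where u: "M = {k, u}" "u < n" "k \<noteq> u" using other by blast
      obtain c where c: "lower r (h - c *\<^sub>e (\<kappa> \<cdot> mono {u})) M" using absorb[OF hom(3) ld(3) u(2,3)] M u(1) by blast
      have "{u} \<prec> {l}" using pair_less_cancel[of k u l] Mkl u lt distinct by simp
      then have l': "lead r (\<mu> + c *\<^sub>e mono {u}) {l}" using lead_perturb ld(4) by blast
      show False
        by (rule step[OF hom(1,2,3) _ _ ld(1,2,3) l' c])
           (use hom mono_singleton_homog[OF u(2)] wedge_mono_homog[OF hom(3) u(2)] in \<open>simp_all add: wedge_distribs\<close>)
    qed
    have lM: "l \<notin> M"
    proof
      assume "l \<in> M"
      then obtain u where u: "M = {l, u}" "u < n" "l \<noteq> u" using other by blast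
      obtain c where c: "lower r (h - c *\<^sub>e (\<mu> \<cdot> mono {u})) M" using absorb[OF hom(4) ld(4) u(2,3)] M u(1) by blast
      have "{l, u} \<prec> {l, k}" using Mkl u(1) by (simp add: insert_commute)
      then have "{u} \<prec> {k}" using pair_less_cancel[of l u k] u lt distinct by simp
      then have l': "lead r (\<kappa> - c *\<^sub>e mono {u}) {k}" using lead_perturb ld(3) by blast
      show False
        by (rule step[OF hom(1,2) _ hom(4) _ ld(1,2) l' ld(4) c])
           (use hom mono_singleton_homog[OF u(2)] wedge_mono_homog[OF hom(4) u(2)]
              anti[OF hom(4) mono_singleton_homog[OF u(2)]] in \<open>simp_all add: wedge_distribs scale_distribs\<close>)
    qed
    \<comment> \<open>The factor a kills a b and the factor \<mu> kills \<kappa> \<mu>, which leaves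
      a \<mu> h up to sign, with leading monomial p l M.\<close>
    have "\<mu> \<cdot> (a \<cdot> (a \<cdot> b + \<kappa> \<cdot> \<mu> + h)) \<in> J" using product_in_J_closed inJ hom by blast
    moreover have "\<mu> \<cdot> (a \<cdot> (\<kappa> \<cdot> \<mu>)) = 0"
    proof -
      have "\<mu> \<cdot> (a \<cdot> (\<kappa> \<cdot> \<mu>)) = \<mu> \<cdot> (a \<cdot> - (\<mu> \<cdot> \<kappa>))" by (simp add: anti[OF hom(4,3)])
      also have "\<dots> = - ((\<mu> \<cdot> a) \<cdot> \<mu> \<cdot> \<kappa>)" by (simp add: wedge_assoc)
      also have "\<dots> = (a \<cdot> \<mu>) \<cdot> \<mu> \<cdot> \<kappa>" by (simp add: anti[OF hom(1,4)])
      also have "\<dots> = a \<cdot> ((\<mu> \<cdot> \<mu>) \<cdot> \<kappa>)" by (simp only: wedge_assoc)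
      finally show ?thesis by (simp add: sq)
    qed
    moreover have "a \<cdot> (a \<cdot> b) = 0" by (simp add: sq flip: wedge_assoc)
    moreover have "\<mu> \<cdot> (a \<cdot> h) = - (a \<cdot> (\<mu> \<cdot> h))" by (simp add: anti[OF hom(1,4)] flip: wedge_assoc)
    ultimately have "- (a \<cdot> (\<mu> \<cdot> h)) \<in> J" by (simp add: wedge_distribs)
    from J(5)[OF this] have alh: "a \<cdot> (\<mu> \<cdot> h) \<in> J" by simp
    have "lead r (\<mu> \<cdot> h) (insert l M)" by (rule lead_linear_wedge[OF hom(4) ld(4) car(5) M lM])
    then have "lead r (a \<cdot> (\<mu> \<cdot> h)) (insert p (insert l M))"
      using pM distinct car by (intro lead_linear_wedge[OF hom(1) ld(1)]) auto
    from groebner[OF alh this] obtain N where "N \<in> H" "N \<subseteq> insert p (insert l M)" by blast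
    moreover have "card M = 2" using lead_subset[OF hom(5) M] by blast
    ultimately show False using no_edge[of N M] MH qM kM by blast
  qed
  have \<omega>1: "a \<cdot> b + \<kappa> \<cdot> \<mu> \<in> J" using inJ h by simp
  have a\<kappa>\<mu>: "a \<cdot> (\<kappa> \<cdot> \<mu>) \<in> J"
  proof -
    have "a \<cdot> (a \<cdot> b + \<kappa> \<cdot> \<mu>) = a \<cdot> (\<kappa> \<cdot> \<mu>)" by (simp add: wedge_distribs sq flip: wedge_assoc)
    with product_in_J_closed[OF \<omega>1 hom(1)] show ?thesis by simp
  qed
  have "\<mu> \<cdot> (a \<cdot> \<kappa>) = a \<cdot> (\<kappa> \<cdot> \<mu>)"
  proof -
    have "\<mu> \<cdot> (a \<cdot> \<kappa>) = (\<mu> \<cdot> a) \<cdot> \<kappa>" by (simp only: wedge_assoc)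
    also have "\<dots> = - (a \<cdot> (\<mu> \<cdot> \<kappa>))" by (simp add: anti[OF hom(1,4)] wedge_assoc)
    also have "\<dots> = a \<cdot> (\<kappa> \<cdot> \<mu>)" by (simp add: anti[OF hom(3,4)])
    finally show ?thesis .
  qed
  with a\<kappa>\<mu> have \<mu>a\<kappa>: "\<mu> \<cdot> (a \<cdot> \<kappa>) \<in> J" by simp

  \<comment> \<open>A second quadric a \<kappa> + \<mu> u + h in J with h minimal. Since \<mu> a
    \<kappa> is in J, multiplying by \<mu> isolates \<mu> h, whose leading monomial l M would have
    to contain an edge avoiding l, that is M itself.\<close>
  define P2 where "P2 = (\<lambda>(u, h). u \<in> homog n 1 \<and> h \<in> homog n 2 \<and> a \<cdot> \<kappa> + \<mu> \<cdot> u + h \<in> J)"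
  have "\<exists>z. P2 z"
  proof -
    have "{p, k} \<in> H" using nb(1) by (auto simp: graph.nbrs_def)
    then obtain g where g: "g \<in> J" "g \<in> homog n 2" using H by blast
    have "a \<cdot> \<kappa> + \<mu> \<cdot> 0 + (g - a \<cdot> \<kappa>) \<in> J" using g by simp
    then have "P2 (0, g - a \<cdot> \<kappa>)" using g linear_product_homog[OF hom(1,3)] by (simp add: P2_def)
    then show ?thesis by blast
  qed
  then obtain z2 where z2: "P2 z2" "\<And>z'. P2 z' \<Longrightarrow> rank (snd z2) \<le> rank (snd z')"
    using ex_has_least_nat[of P2 _ "\<lambda>z. rank (snd z)"] by blast
  obtain u h2 where z2_eq: "z2 = (u, h2)" by (metis prod.exhaust)
  have u: "u \<in> homog n 1" and h2: "h2 \<in> homog n 2" and inJ2: "a \<cdot> \<kappa> + \<mu> \<cdot> u + h2 \<in> J"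
    using z2(1) unfolding z2_eq P2_def prod.case by blast+
  have "h2 = 0"
  proof (rule ccontr)
    assume "h2 \<noteq> 0"
    then obtain M where M: "lead r h2 M" using lead_exists homog_carrier[OF h2] by blast
    obtain s t where st: "M = {s, t}" "s \<noteq> t" "s < n" "t < n" by (rule lead_pairE[OF h2 M])
    have contra: False if "P2 (u', h')" "lower r h' M" for u' h'
      using z2(2)[OF that(1)] rank_less[OF homog_carrier[OF h2] M that(2)] by (simp add: z2_eq)
    have MH: "M \<notin> H"
    proof
      assume "M \<in> H"
      then obtain g where g: "g \<in> J" "g \<in> homog n 2" "lower r (h2 - g) M" using reduce_edge[OF M] by blast
      have "a \<cdot> \<kappa> + \<mu> \<cdot> u + (h2 - g) \<in> J" using J(4)[OF inJ2 g(1)] by (simp add: add_diff_eq)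
      then have "P2 (u, h2 - g)" using u h2 g by (simp add: P2_def)
      then show False using contra g(3) by blast
    qed
    have lM: "l \<notin> M"
    proof
      assume "l \<in> M"
      then obtain v where v: "M = {l, v}" "v < n" "l \<noteq> v" using st by auto
      obtain c where c: "lower r (h2 - c *\<^sub>e (\<mu> \<cdot> mono {v})) M" using absorb[OF hom(4) ld(4) v(2,3)] M v(1) by blast
      have eq: "a \<cdot> \<kappa> + \<mu> \<cdot> (u + c *\<^sub>e mono {v}) + (h2 - c *\<^sub>e (\<mu> \<cdot> mono {v})) = a \<cdot> \<kappa> + \<mu> \<cdot> u + h2"
        by (simp add: wedge_distribs)
      have "a \<cdot> \<kappa> + \<mu> \<cdot> (u + c *\<^sub>e mono {v}) + (h2 - c *\<^sub>e (\<mu> \<cdot> mono {v})) \<in> J"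
        unfolding eq by (rule inJ2)
      then have "P2 (u + c *\<^sub>e mono {v}, h2 - c *\<^sub>e (\<mu> \<cdot> mono {v}))"
        using u h2 mono_singleton_homog[OF v(2)] wedge_mono_homog[OF hom(4) v(2)] by (simp add: P2_def)
      then show False using contra c by blast
    qed
    have "\<mu> \<cdot> (a \<cdot> \<kappa> + \<mu> \<cdot> u + h2) - \<mu> \<cdot> (a \<cdot> \<kappa>) \<in> J"
      by (rule J(4)[OF product_in_J_closed[OF inJ2 hom(4)] \<mu>a\<kappa>])
    moreover have "\<mu> \<cdot> (\<mu> \<cdot> u) = 0" by (simp add: sq flip: wedge_assoc)
    ultimately have "\<mu> \<cdot> h2 \<in> J" by (simp add: wedge_distribs)
    from groebner[OF this lead_linear_wedge[OF hom(4) ld(4) homog_carrier[OF h2] M lM]]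
    obtain N where N: "N \<in> H" "N \<subseteq> insert l M" by blast
    have "l \<notin> N" using not_adjacent_W ord(4) N(1) by blast
    then have "N \<subseteq> M" using N(2) by blast
    moreover have "card N = card M" using H[OF N(1)] lead_subset[OF h2 M] by simp
    ultimately have "N = M" using st(1) by (intro card_subset_eq) auto
    with MH N(1) show False by blast
  qed
  with inJ2 have \<omega>2: "a \<cdot> \<kappa> + \<mu> \<cdot> u \<in> J" by simp

  \<comment> \<open>Now u is reduced modulo a, b, \<kappa>, \<mu>. A remainder would have a leading
    variable s outside p, q, k, l, and a \<mu> times it has leading monomial p l s, which forces the
    impossible edge p s.\<close>
  define res where "res = (\<lambda>(c1, c2, c3, c4). u - c1 *\<^sub>e a - c2 *\<^sub>e b - c3 *\<^sub>e \<kappa> - c4 *\<^sub>e \<mu>)"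
  obtain cs where cs: "\<And>cs'. rank (res cs) \<le> rank (res cs')"
    using ex_has_least_nat[of "\<lambda>_. True" _ "\<lambda>cs. rank (res cs)"] by blast
  obtain c1 c2 c3 c4 where cs_eq: "cs = (c1, c2, c3, c4)" by (metis prod.exhaust)
  define u' where "u' = res cs"
  have u'_eq: "u' = u - c1 *\<^sub>e a - c2 *\<^sub>e b - c3 *\<^sub>e \<kappa> - c4 *\<^sub>e \<mu>" by (simp add: u'_def res_def cs_eq)
  have u'_hom: "u' \<in> homog n 1" unfolding u'_eq using u hom by (intro homog_closed)
  have "u' = 0"
  proof (rule ccontr)
    assume "u' \<noteq> 0"
    then obtain M where M: "lead r u' M" using lead_exists homog_carrier[OF u'_hom] by blast
    then obtain s where s: "M = {s}" using lead_subset[OF u'_hom M] by (auto simp: card_1_singleton_iff)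
    have contra: False if "res cs' = u' - c *\<^sub>e v" "lead r v M" "lower r (u' - c *\<^sub>e v) M" for cs' c v
      using cs[of cs'] rank_less[OF homog_carrier[OF u'_hom] M that(3)] that(1) by (simp add: u'_def)
    have "s \<noteq> p"
    proof
      assume "s = p"
      then obtain c where c: "lower r (u' - c *\<^sub>e a) M" using lead_cancel[OF M, of a] ld(1) s by blast
      show False
        by (rule contra[of "(c1 + c, c2, c3, c4)", OF _ _ c]) (use ld(1) s \<open>s = p\<close> in \<open>simp_all add: res_def u'_eq scale_distribs\<close>)
    qed
    moreover have "s \<noteq> q"
    proof
      assume "s = q"
      then obtain c where c: "lower r (u' - c *\<^sub>e b) M" using lead_cancel[OF M, of b] ld(2) s by blast
      show False
        by (rule contra[of "(c1, c2 + c, c3, c4)", OF _ _ c]) (use ld(2) s \<open>s = q\<close> in \<open>simp_all add: res_def u'_eq scale_distribs\<close>)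
    qed
    moreover have "s \<noteq> k"
    proof
      assume "s = k"
      then obtain c where c: "lower r (u' - c *\<^sub>e \<kappa>) M" using lead_cancel[OF M, of \<kappa>] ld(3) s by blast
      show False
        by (rule contra[of "(c1, c2, c3 + c, c4)", OF _ _ c]) (use ld(3) s \<open>s = k\<close> in \<open>simp_all add: res_def u'_eq scale_distribs\<close>)
    qed
    moreover have "s \<noteq> l"
    proof
      assume "s = l"
      then obtain c where c: "lower r (u' - c *\<^sub>e \<mu>) M" using lead_cancel[OF M, of \<mu>] ld(4) s by blast
      show False
        by (rule contra[of "(c1, c2, c3, c4 + c)", OF _ _ c]) (use ld(4) s \<open>s = l\<close> in \<open>simp_all add: res_def u'_eq scale_distribs\<close>)
    qed
    ultimately have s_ne: "s \<noteq> p" "s \<noteq> q" "s \<noteq> k" "s \<noteq> l" by blast+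
    have "a \<cdot> (\<mu> \<cdot> u') \<in> J"
    proof -
      have "a \<cdot> (a \<cdot> \<kappa> + \<mu> \<cdot> u) = a \<cdot> (\<mu> \<cdot> u)" by (simp add: wedge_distribs sq flip: wedge_assoc)
      with product_in_J_closed[OF \<omega>2 hom(1)] have 0: "a \<cdot> (\<mu> \<cdot> u) \<in> J" by simp
      have 1: "a \<cdot> (\<mu> \<cdot> a) = 0"
        using anti[OF hom(1,4)] by (simp add: sq flip: wedge_assoc)
      have "\<mu> \<cdot> (\<kappa> \<cdot> \<mu>) = 0"
        using anti[OF hom(4,3)] by (simp add: sq flip: wedge_assoc)
      then have "\<mu> \<cdot> (a \<cdot> b + \<kappa> \<cdot> \<mu>) = \<mu> \<cdot> (a \<cdot> b)" by (simp add: wedge_distribs)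
      with product_in_J_closed[OF \<omega>1 hom(4)] have "\<mu> \<cdot> (a \<cdot> b) \<in> J" by simp
      moreover have "a \<cdot> (\<mu> \<cdot> b) = - (\<mu> \<cdot> (a \<cdot> b))"
        using anti[OF hom(1,4)] by (simp flip: wedge_assoc)
      ultimately have 2: "a \<cdot> (\<mu> \<cdot> b) \<in> J" using J(5) by simp
      have 3: "a \<cdot> (\<mu> \<cdot> \<kappa>) \<in> J" using J(5)[OF a\<kappa>\<mu>] anti[OF hom(3,4)] by simp
      have "a \<cdot> (\<mu> \<cdot> u') = a \<cdot> (\<mu> \<cdot> u) - c2 *\<^sub>e (a \<cdot> (\<mu> \<cdot> b)) - c3 *\<^sub>e (a \<cdot> (\<mu> \<cdot> \<kappa>))"
        by (simp add: u'_eq wedge_distribs 1 sq)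
      then show ?thesis using J(4)[OF J(4)[OF 0 J(8)[OF 2]] J(8)[OF 3]] by simp
    qed
    moreover have "lead r (\<mu> \<cdot> u') (insert l {s})"
      using M s s_ne by (intro lead_linear_wedge[OF hom(4) ld(4) homog_carrier[OF u'_hom]]) auto
    then have "lead r (a \<cdot> (\<mu> \<cdot> u')) (insert p (insert l {s}))"
      using distinct s_ne car homog_carrier[OF u'_hom] by (intro lead_linear_wedge[OF hom(1) ld(1)]) auto
    ultimately obtain N where N: "N \<in> H" "N \<subseteq> {p, l, s}" using groebner by blast
    have "l \<notin> N" using not_adjacent_W ord(4) N(1) by blast
    then have "N \<subseteq> {p, s}" using N(2) by blast
    moreover have "card N = card {p, s}" using H[OF N(1)] s_ne by simp
    ultimately have "N = {p, s}" by (intro card_subset_eq) auto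
    then have "s \<in> graph.nbrs p" using N(1) by (simp add: graph.nbrs_def)
    then show False using nb(1) s_ne by simp
  qed
  then have u_eq: "u = c1 *\<^sub>e a + c2 *\<^sub>e b + c3 *\<^sub>e \<kappa> + c4 *\<^sub>e \<mu>" by (simp add: u'_eq algebra_simps)
  have "a \<cdot> \<kappa> + \<mu> \<cdot> u = a \<cdot> \<kappa> - c1 *\<^sub>e (a \<cdot> \<mu>) + c2 *\<^sub>e (\<mu> \<cdot> b) + c3 *\<^sub>e (\<mu> \<cdot> \<kappa>)"
    unfolding u_eq wedge_distribs wedge_simps sq anti[OF hom(1,4)] scale_simps scale_distribs
    by (simp only: add_0_right diff_conv_add_uminus add.assoc)
  with \<omega>2 have \<omega>2': "a \<cdot> \<kappa> - c1 *\<^sub>e (a \<cdot> \<mu>) + c2 *\<^sub>e (\<mu> \<cdot> b) + c3 *\<^sub>e (\<mu> \<cdot> \<kappa>) \<in> J" by simp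
  have lk: "{l} \<prec> {k}" using less_trans ord by blast
  show False
  \<comment> \<open>If both coefficients vanish, the Pfaffian of the pencil is the constant 1, but
    then the second quadric is itself a product.\<close>
  proof (cases "c2 = 0 \<and> c3 = 0")
    case True
    then have "a \<cdot> (\<kappa> - c1 *\<^sub>e \<mu>) \<in> J" using \<omega>2' by (simp add: wedge_distribs)
    moreover have "lead r (\<kappa> - c1 *\<^sub>e \<mu>) {k}"
      using lead_add_lower[OF ld(3) lower_closed(3)[OF lower_if_less[OF ld(4) lk], of "- c1"]]
      by (simp add: scale_distribs)
    moreover have "\<kappa> - c1 *\<^sub>e \<mu> \<in> homog n 1" using hom by (intro homog_closed)
    ultimately show False using no_product[OF hom(1) _ ld(1) _ ne(2)] by blast
  next
    case False
    \<comment> \<open>The polynomial is the Pfaffian of the first quadric plus t times the second,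
      in the forms a, b, \<kappa>, \<mu>. Its constant term 1 keeps every root away from 0, so that
      \<kappa> leads the second factor below.\<close>
    have "\<exists>t. c2 * t\<^sup>2 - c3 * t + 1 = 0"
    proof (cases "c2 = 0")
      case True
      then show ?thesis using False by (intro exI[of _ "1 / c3"]) simp
    next
      case c2: False
      define e where "e = csqrt (c3\<^sup>2 - 4 * c2)"
      have e: "e\<^sup>2 = c3\<^sup>2 - 4 * c2" by (simp add: e_def)
      have "4 * c2 * (c2 * ((c3 + e) / (2 * c2))\<^sup>2 - c3 * ((c3 + e) / (2 * c2)) + 1) = e\<^sup>2 - (c3\<^sup>2 - 4 * c2)"
        using c2 by (simp add: field_simps power2_eq_square)
      then show ?thesis using c2 e by (intro exI[of _ "(c3 + e) / (2 * c2)"]) simp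
    qed
    then obtain t where t: "c2 * t\<^sup>2 - c3 * t + 1 = 0" by blast
    then have t0: "t \<noteq> 0" by auto
    have ct: "c2 * t\<^sup>2 = c3 * t - 1" by (rule eq_if_diff[OF t]) simp
    have "(a + (t * c2) *\<^sub>e \<mu>) \<cdot> (b + t *\<^sub>e \<kappa> - (t * c1) *\<^sub>e \<mu>)
        = a \<cdot> b + \<kappa> \<cdot> \<mu> + t *\<^sub>e (a \<cdot> \<kappa> - c1 *\<^sub>e (a \<cdot> \<mu>) + c2 *\<^sub>e (\<mu> \<cdot> b) + c3 *\<^sub>e (\<mu> \<cdot> \<kappa>))"
    proof
      fix S
      have "c2 * t\<^sup>2 * (\<mu> \<cdot> \<kappa>) S = (c3 * t - 1) * (\<mu> \<cdot> \<kappa>) S" by (simp only: ct)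
      moreover have "(\<kappa> \<cdot> \<mu>) S = - (\<mu> \<cdot> \<kappa>) S" using anti[OF hom(4,3)] by (simp add: fun_eq_iff)
      ultimately show "((a + (t * c2) *\<^sub>e \<mu>) \<cdot> (b + t *\<^sub>e \<kappa> - (t * c1) *\<^sub>e \<mu>)) S
        = (a \<cdot> b + \<kappa> \<cdot> \<mu> + t *\<^sub>e (a \<cdot> \<kappa> - c1 *\<^sub>e (a \<cdot> \<mu>) + c2 *\<^sub>e (\<mu> \<cdot> b) + c3 *\<^sub>e (\<mu> \<cdot> \<kappa>))) S"
        by (simp add: wedge_distribs sq algebra_simps power2_eq_square)
    qed
    then have "(a + (t * c2) *\<^sub>e \<mu>) \<cdot> (b + t *\<^sub>e \<kappa> - (t * c1) *\<^sub>e \<mu>) \<in> J"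
      using J(3)[OF \<omega>1 J(8)[OF \<omega>2', of t]] by simp
    moreover have "lead r (a + (t * c2) *\<^sub>e \<mu>) {p}"
      by (intro lead_add_lower[OF ld(1)] lower_closed(3) lower_if_less[OF ld(4) ord(3)])
    moreover have "lead r (b + t *\<^sub>e \<kappa> - (t * c1) *\<^sub>e \<mu>) {k}"
    proof -
      have "lower r (b - (t * c1) *\<^sub>e \<mu>) {k}"
        by (intro lower_closed lower_if_less[OF ld(2) ord(1)] lower_if_less[OF ld(4) lk])
      from lead_add_lower[OF lead_scale[OF ld(3) t0] this] show ?thesis by (simp add: algebra_simps)
    qed
    moreover have "a + (t * c2) *\<^sub>e \<mu> \<in> homog n 1" "b + t *\<^sub>e \<kappa> - (t * c1) *\<^sub>e \<mu> \<in> homog n 1"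
      by (intro homog_closed hom)+
    ultimately show False using no_product[OF _ _ _ _ ne(2)] by blast
  qed
qed

end

section \<open>Changes of coordinates\<close>

text \<open>For linear forms y this is the algebra endomorphism with e_i \<mapsto> y_i, defined on
  the monomial basis so that linearity is immediate and multiplicativity has to be proved.\<close>

definition substitute :: "nat \<Rightarrow> (nat \<Rightarrow> ext) \<Rightarrow> ext \<Rightarrow> ext"
  where "substitute n y f = (\<Sum>S\<in>Pow {..<n}. f S *\<^sub>e coord_monomial n y S)"

lemma mono_insert_min:
  assumes "finite A" "\<forall>a\<in>A. b < a"
  shows "mono {b} \<cdot> mono A = mono (insert b A)"
proof -
  have "{(t, u). t \<in> {b} \<and> u \<in> A \<and> u < t} = {}" using assms(2) by auto
  then have "wedge_sign {b} A = 1" by (simp only: wedge_sign_def card.empty power_0)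
  moreover have "b \<notin> A" using assms(2) by auto
  ultimately show ?thesis using assms(1) by (simp add: mono_wedge)
qed

locale linear_forms =
  fixes n :: nat and y :: "nat \<Rightarrow> ext"
  assumes y: "\<And>i. i < n \<Longrightarrow> y i \<in> homog n 1"
begin

abbreviation cm :: "nat set \<Rightarrow> ext"
  where "cm \<equiv> coord_monomial n y"

abbreviation \<Phi> :: "ext \<Rightarrow> ext"
  where "\<Phi> \<equiv> substitute n y"

lemma cm_empty: "cm {} = mono {}"
  by (simp add: coord_monomial_def)

lemma cm_insert:
  assumes "finite A" "\<forall>a\<in>A. b < a"
  shows "cm (insert b A) = y b \<cdot> cm A"
proof -
  have "Min (insert b A) = b" using assms by (intro Min_eqI) auto
  moreover have "insert b A - {b} = A" using assms(2) by auto
  ultimately have "sorted_list_of_set (insert b A) = b # sorted_list_of_set A"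
    using sorted_list_of_set_nonempty[of "insert b A"] assms(1) by simp
  then show ?thesis by (simp add: coord_monomial_def)
qed

lemma cm_homog:
  assumes "S \<subseteq> {..<n}"
  shows "cm S \<in> homog n (card S)"
proof -
  have "finite S" using assms finite_subset by auto
  then show ?thesis using assms
  proof (induction S rule: finite_linorder_min_induct)
    case empty
    then show ?case using one_in_homog by (simp add: cm_empty)
  next
    case (insert b A)
    then have "b \<notin> A" by auto
    then show ?case using insert homog_wedge[OF y[of b], of "cm A" "card A"] by (simp add: cm_insert)
  qed
qed

lemma substitute_linear:
  "\<Phi> (f + g) = \<Phi> f + \<Phi> g" "\<Phi> (f - g) = \<Phi> f - \<Phi> g" "\<Phi> (c *\<^sub>e f) = c *\<^sub>e \<Phi> f" "\<Phi> 0 = 0"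
  by (simp_all add: substitute_def scale_distribs sum.distrib sum_subtractf scale_sum)

lemma substitute_sum:
  fixes f :: "'a \<Rightarrow> ext"
  shows "\<Phi> (\<Sum>i\<in>A. f i) = (\<Sum>i\<in>A. \<Phi> (f i))"
  using sum_comp_morphism[of \<Phi> f A] by (simp add: substitute_linear comp_def)

lemma substitute_mono:
  assumes "S \<subseteq> {..<n}"
  shows "\<Phi> (mono S) = cm S"
proof
  fix X
  have "\<Phi> (mono S) X = (\<Sum>T\<in>Pow {..<n}. of_bool (S = T) * cm T X)"
    unfolding substitute_def sum_fun_apply by (intro sum.cong) (auto simp: mono_def)
  also have "\<dots> = cm S X" using assms by (intro sum_of_bool_mult) auto
  finally show "\<Phi> (mono S) X = cm S X" .
qed

lemma substitute_homog:
  assumes "f \<in> homog n d"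
  shows "\<Phi> f \<in> homog n d"
proof -
  have "f S *\<^sub>e cm S \<in> homog n d" if "S \<in> Pow {..<n}" for S
  proof (cases "f S = 0")
    case False
    then have "card S = d" using homogD[OF assms] by blast
    then show ?thesis using cm_homog[of S] that by simp
  qed simp
  then show ?thesis unfolding substitute_def by (rule homog_sum)
qed

lemma substitute_carrier: "\<Phi> f \<in> ext_carrier n"
  unfolding substitute_def using cm_homog homog_carrier by (intro ext_carrier_sum ext_carrier_closed(5)) auto

text \<open>Induction on the least index b of S. If i exceeds b, the two are exchanged on both sides
  with the same sign. What remains is a multiple of a monomial with all indices above b, to which b
  can be prepended without a sign.\<close>

lemma substitute_mono_mono:
  assumes "S \<subseteq> {..<n}" "i < n"
  shows "\<Phi> (mono {i} \<cdot> mono S) = y i \<cdot> cm S"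
proof -
  have "finite S" using assms(1) finite_subset by auto
  then show ?thesis using assms(1)
  proof (induction S rule: finite_linorder_min_induct)
    case empty
    have "\<Phi> (mono {i} \<cdot> mono {}) = cm (insert i {})"
      using assms(2) by (simp add: mono_wedge substitute_mono)
    then show ?case by (subst (asm) cm_insert) auto
  next
    case (insert b A)
    have b: "b < n" "A \<subseteq> {..<n}" using insert.prems by auto
    consider "i < b" | "i = b" | "b < i" by linarith
    then show ?case
    proof cases
      case 1
      then have min: "\<forall>a\<in>insert b A. i < a" using insert.hyps(2) by auto
      then show ?thesis using insert.hyps(1) insert.prems assms(2)
        by (simp add: mono_insert_min cm_insert[of "insert b A" i] substitute_mono)
    next
      case 2
      have z1: "mono {i} \<cdot> mono (insert b A) = 0" using 2 insert.hyps by (simp add: mono_wedge)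
      have z2: "y i \<cdot> cm (insert b A) = 0"
        using 2 linear_square[OF y[OF assms(2)]] insert.hyps by (simp add: cm_insert flip: wedge_assoc)
      show ?thesis unfolding z1 z2 by (rule substitute_linear(4))
    next
      case 3
      have "\<exists>c B. mono {i} \<cdot> mono A = c *\<^sub>e mono B \<and> B \<subseteq> {..<n} \<and> finite B \<and> (\<forall>a\<in>B. b < a)"
      proof (cases "i \<in> A")
        case True
        then show ?thesis using insert.hyps by (intro exI[of _ 0] exI[of _ "{}"]) (simp add: mono_wedge)
      next
        case False
        then show ?thesis using insert.hyps b assms(2) 3
          by (intro exI[of _ "wedge_sign {i} A"] exI[of _ "insert i A"]) (simp add: mono_wedge)
      qed
      then obtain c B where B: "mono {i} \<cdot> mono A = c *\<^sub>e mono B" "B \<subseteq> {..<n}" "finite B" "\<forall>a\<in>B. b < a"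
        by blast
      have "mono {i} \<cdot> mono (insert b A) = mono {i} \<cdot> (mono {b} \<cdot> mono A)"
        using insert.hyps by (simp add: mono_insert_min)
      also have "\<dots> = - (mono {b} \<cdot> (mono {i} \<cdot> mono A))"
        using linear_anticommute[OF mono_singleton_homog[OF b(1)] mono_singleton_homog[OF assms(2)]]
        by (simp flip: wedge_assoc)
      also have "\<dots> = (- c) *\<^sub>e mono (insert b B)" using B by (simp add: mono_insert_min scale_distribs)
      finally have "\<Phi> (mono {i} \<cdot> mono (insert b A)) = (- c) *\<^sub>e cm (insert b B)"
        using B b by (simp add: substitute_linear(3) substitute_mono)
      also have "\<dots> = - (y b \<cdot> (c *\<^sub>e cm B))" using B by (simp add: cm_insert scale_distribs)
      also have "c *\<^sub>e cm B = \<Phi> (mono {i} \<cdot> mono A)" using B by (simp add: substitute_linear substitute_mono)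
      also have "\<dots> = y i \<cdot> cm A" by (rule insert.IH[OF b(2)])
      also have "- (y b \<cdot> (y i \<cdot> cm A)) = y i \<cdot> (y b \<cdot> cm A)"
        using linear_anticommute[OF y[OF assms(2)] y[OF b(1)]] by (simp flip: wedge_assoc)
      finally show ?thesis using insert.hyps by (simp add: cm_insert)
    qed
  qed
qed

lemma substitute_gen_wedge:
  assumes "f \<in> ext_carrier n" "i < n"
  shows "\<Phi> (mono {i} \<cdot> f) = y i \<cdot> \<Phi> f"
proof -
  have "\<Phi> (mono {i} \<cdot> f) = \<Phi> (mono {i} \<cdot> (\<Sum>S\<in>Pow {..<n}. f S *\<^sub>e mono S))"
    using ext_eq_sum_mono[OF assms(1)] by simp
  also have "\<dots> = (\<Sum>S\<in>Pow {..<n}. f S *\<^sub>e \<Phi> (mono {i} \<cdot> mono S))"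
    by (simp add: wedge_sum_right substitute_sum substitute_linear)
  also have "\<dots> = (\<Sum>S\<in>Pow {..<n}. y i \<cdot> (f S *\<^sub>e cm S))"
    using assms(2) by (intro sum.cong) (auto simp: substitute_mono_mono)
  finally show ?thesis by (simp add: substitute_def wedge_sum_right)
qed

lemma substitute_mono_wedge:
  assumes "S \<subseteq> {..<n}" "f \<in> ext_carrier n"
  shows "\<Phi> (mono S \<cdot> f) = cm S \<cdot> \<Phi> f"
proof -
  have "finite S" using assms(1) finite_subset by auto
  then show ?thesis using assms(1)
  proof (induction S rule: finite_linorder_min_induct)
    case empty
    then show ?case using wedge_one(1)[OF assms(2)] wedge_one(1)[OF substitute_carrier] by (simp add: cm_empty)
  next
    case (insert b A)
    have "mono A \<cdot> f \<in> ext_carrier n"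
      using insert.prems assms(2) homog_carrier[OF mono_in[of A n]] by simp
    then have "\<Phi> (mono {b} \<cdot> (mono A \<cdot> f)) = y b \<cdot> (cm A \<cdot> \<Phi> f)"
      using substitute_gen_wedge insert by simp
    then show ?case
      unfolding mono_insert_min[OF insert.hyps(1,2), symmetric] cm_insert[OF insert.hyps(1,2)] wedge_assoc .
  qed
qed

lemma substitute_wedge:
  assumes "f \<in> ext_carrier n" "g \<in> ext_carrier n"
  shows "\<Phi> (f \<cdot> g) = \<Phi> f \<cdot> \<Phi> g"
proof -
  have "\<Phi> (f \<cdot> g) = \<Phi> ((\<Sum>S\<in>Pow {..<n}. f S *\<^sub>e mono S) \<cdot> g)"
    using ext_eq_sum_mono[OF assms(1)] by simp
  also have "\<dots> = (\<Sum>S\<in>Pow {..<n}. f S *\<^sub>e \<Phi> (mono S \<cdot> g))"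
    by (simp add: wedge_sum_left substitute_sum substitute_linear)
  also have "\<dots> = (\<Sum>S\<in>Pow {..<n}. (f S *\<^sub>e cm S) \<cdot> \<Phi> g)"
    using assms(2) by (intro sum.cong) (auto simp: substitute_mono_wedge)
  finally show ?thesis by (simp add: substitute_def wedge_sum_left)
qed

lemma substitute_eq_if_gens:
  assumes z: "linear_forms n z" and gens: "\<And>i. i < n \<Longrightarrow> substitute n z (y i) = mono {i}"
    and f: "f \<in> ext_carrier n"
  shows "substitute n z (\<Phi> f) = f"
proof -
  interpret z: linear_forms n z by fact
  have cm: "substitute n z (cm S) = mono S" if S: "S \<subseteq> {..<n}" for S
  proof -
    have "finite S" using S finite_subset by auto
    then show ?thesis using S
    proof (induction S rule: finite_linorder_min_induct)
      case empty
      show ?case using z.substitute_mono[of "{}"] by (simp add: cm_empty z.cm_empty)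
    next
      case (insert b A)
      have "cm A \<in> ext_carrier n" "y b \<in> ext_carrier n"
        using cm_homog[of A] y[of b] insert.prems homog_carrier by auto
      then show ?case using insert by (simp add: cm_insert z.substitute_wedge gens mono_insert_min)
    qed
  qed
  have "substitute n z (\<Phi> f) = (\<Sum>S\<in>Pow {..<n}. f S *\<^sub>e substitute n z (cm S))"
    unfolding substitute_def[of n y] by (simp add: z.substitute_sum z.substitute_linear)
  also have "\<dots> = (\<Sum>S\<in>Pow {..<n}. f S *\<^sub>e mono S)" using cm by (intro sum.cong) auto
  finally show ?thesis using ext_eq_sum_mono[OF f] by simp
qed

lemma substitute_linear_form: "substitute n y (\<Sum>i<n. c i *\<^sub>e mono {i}) = (\<Sum>i<n. c i *\<^sub>e y i)"
proof -
  have "\<Phi> (mono {i}) = y i" if "i < n" for i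
    using that substitute_mono[of "{i}"] cm_insert[of "{}" i] wedge_one(2)[OF homog_carrier[OF y[OF that]]]
    by (simp add: cm_empty)
  then show ?thesis by (simp add: substitute_sum substitute_linear)
qed

end

text \<open>Existence of coordinates expresses each e_i through the y_j and gives one composition;
  uniqueness makes the substitution injective on linear forms, which gives the other.\<close>

lemma coordinates_inverse:
  assumes "coordinates n y"
  shows "\<exists>z. linear_forms n y \<and> linear_forms n z \<and>
    (\<forall>f\<in>ext_carrier n. substitute n z (substitute n y f) = f \<and> substitute n y (substitute n z f) = f)"
proof -
  have hom: "y i \<in> homog n 1" if "i < n" for i using assms that by (simp add: coordinates_def)
  then interpret y: linear_forms n y by unfold_locales
  have fs: "(\<Oplus>\<^bsub>exterior n\<^esub>i\<in>{..<n}. c i \<odot>\<^bsub>exterior n\<^esub> y i) = (\<Sum>i<n. c i *\<^sub>e y i)" for c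
    by (subst finsum_exterior) (simp_all add: homog_carrier[OF hom])
  have ex1: "\<exists>!c. c \<in> {..<n} \<rightarrow>\<^sub>E (UNIV :: complex set) \<and> v = (\<Sum>i<n. c i *\<^sub>e y i)" if "v \<in> homog n 1" for v
    using assms that unfolding coordinates_def fs by simp
  have "\<exists>c. mono {i} = (\<Sum>j<n. c j *\<^sub>e y j)" if "i < n" for i
    using ex1[OF mono_singleton_homog[OF that]] by blast
  then obtain c where c: "\<And>i. i < n \<Longrightarrow> mono {i} = (\<Sum>j<n. c i j *\<^sub>e y j)" by metis
  define z where "z i = (\<Sum>j<n. c i j *\<^sub>e mono {j})" for i
  have zhom: "z i \<in> homog n 1" for i
    unfolding z_def by (intro homog_sum homog_closed mono_singleton_homog) simp
  interpret z: linear_forms n z by unfold_locales (rule zhom)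
  have yz: "substitute n y (z i) = mono {i}" if "i < n" for i
    unfolding z_def y.substitute_linear_form using c[OF that] by simp
  have inv1: "substitute n y (substitute n z f) = f" if "f \<in> ext_carrier n" for f
    by (rule z.substitute_eq_if_gens[OF y.linear_forms_axioms yz that])
  have inj: "a = b" if ab: "a \<in> homog n 1" "b \<in> homog n 1" "substitute n y a = substitute n y b" for a b
  proof -
    have eq: "(\<Sum>i<n. a {i} *\<^sub>e y i) = (\<Sum>i<n. b {i} *\<^sub>e y i)"
      using ab(3) unfolding y.substitute_linear_form[symmetric] linear_eq_sum[OF ab(1), symmetric]
        linear_eq_sum[OF ab(2), symmetric] .
    let ?a = "\<lambda>i\<in>{..<n}. a {i}" and ?b = "\<lambda>i\<in>{..<n}. b {i}"
    have "(\<Sum>i<n. a {i} *\<^sub>e y i) \<in> homog n 1" using hom by (intro homog_sum homog_closed) simp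
    then have ex: "\<exists>!c. c \<in> {..<n} \<rightarrow>\<^sub>E (UNIV :: complex set) \<and>
        (\<Sum>i<n. a {i} *\<^sub>e y i) = (\<Sum>i<n. c i *\<^sub>e y i)" by (rule ex1)
    have "?a \<in> {..<n} \<rightarrow>\<^sub>E UNIV \<and> (\<Sum>i<n. a {i} *\<^sub>e y i) = (\<Sum>i<n. ?a i *\<^sub>e y i)" by simp
    moreover have "?b \<in> {..<n} \<rightarrow>\<^sub>E UNIV \<and> (\<Sum>i<n. a {i} *\<^sub>e y i) = (\<Sum>i<n. ?b i *\<^sub>e y i)"
      using eq by simp
    ultimately have restr: "?a = ?b" using ex by blast
    have ab_eq: "a {i} = b {i}" if "i < n" for i using that fun_cong[OF restr, of i] by simp
    have "a = (\<Sum>i<n. b {i} *\<^sub>e mono {i})"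
      by (subst linear_eq_sum[OF ab(1)]) (simp add: ab_eq)
    then show ?thesis using linear_eq_sum[OF ab(2)] by simp
  qed
  have zy: "substitute n z (y i) = mono {i}" if i: "i < n" for i
  proof (rule inj)
    show "substitute n z (y i) \<in> homog n 1" using z.substitute_homog hom i by blast
    show "mono {i} \<in> homog n 1" by (rule mono_singleton_homog[OF i])
    have "substitute n y (mono {i}) = y i"
      using i y.substitute_mono[of "{i}"] y.cm_insert[of "{}" i] wedge_one(2)[OF homog_carrier[OF hom[OF i]]]
      by (simp add: y.cm_empty)
    then show "substitute n y (substitute n z (y i)) = substitute n y (mono {i})"
      using inv1[OF homog_carrier[OF hom[OF i]]] by simp
  qed
  have inv2: "substitute n z (substitute n y f) = f" if "f \<in> ext_carrier n" for f
    by (rule y.substitute_eq_if_gens[OF z.linear_forms_axioms zy that])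
  show ?thesis using inv1 inv2 y.linear_forms_axioms z.linear_forms_axioms by blast
qed

section \<open>G-quadratic algebras without quadrics of rank two\<close>

lemma (in ext_order) maximal_monomial:
  assumes "finite B" "B \<noteq> {}" "B \<subseteq> Pow {..<n}"
  shows "\<exists>M\<in>B. \<forall>S\<in>B. S \<noteq> M \<longrightarrow> S \<prec> M"
  using assms
proof (induction B rule: finite_ne_induct)
  case (insert T B)
  then obtain M where M: "M \<in> B" "\<forall>S\<in>B. S \<noteq> M \<longrightarrow> S \<prec> M" by auto
  have "T \<noteq> M" using M insert by blast
  then have "T \<prec> M \<or> M \<prec> T" using less_total[of T M] M insert by auto
  then show ?case
  proof
    assume "T \<prec> M"
    with M show ?case by (intro bexI[of _ M]) auto
  next
    assume "M \<prec> T"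
    with M show ?case by (intro bexI[of _ T]) (auto intro: less_trans)
  qed
qed simp

lemma ideal_divisible_monomials:
  "ideal {w \<in> ext_carrier n. \<forall>S. w S \<noteq> 0 \<longrightarrow> (\<exists>N\<in>H. N \<subseteq> S)} (exterior n)" (is "ideal ?Y _")
proof (rule ideal_exteriorI)
  have closed: "f \<cdot> g \<in> ?Y" if f: "f \<in> ext_carrier n" and g: "g \<in> ext_carrier n" and "f \<in> ?Y \<or> g \<in> ?Y" for f g
  proof (intro CollectI conjI allI impI)
    fix S assume "(f \<cdot> g) S \<noteq> 0"
    then obtain T where T: "T \<subseteq> S" "f T \<noteq> 0" "g (S - T) \<noteq> 0" using wedge_nonzero by blast
    then have "(\<exists>N\<in>H. N \<subseteq> T) \<or> (\<exists>N\<in>H. N \<subseteq> S - T)" using that(3) by blast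
    then show "\<exists>N\<in>H. N \<subseteq> S" using T(1) by blast
  qed (use f g in simp)
  show "f \<cdot> g \<in> ?Y" "g \<cdot> f \<in> ?Y" if "f \<in> ?Y" "g \<in> ext_carrier n" for f g
    using closed[of f g] closed[of g f] that by blast+
  show "f + g \<in> ?Y" if fg: "f \<in> ?Y" "g \<in> ?Y" for f g
  proof (intro CollectI conjI allI impI)
    fix S assume "(f + g) S \<noteq> 0"
    then have "f S \<noteq> 0 \<or> g S \<noteq> 0" by auto
    then show "\<exists>N\<in>H. N \<subseteq> S" using fg by blast
  qed (use fg in simp)
qed auto

text \<open>Coordinates are moved to the standard ones by pulling \<open>J\<close> back.
  \<open>H\<close> collects the leading monomials of all homogeneous quadrics in the pullback, so
  the leading terms of \<open>G\<close> lie in the image of the monomial ideal of \<open>H\<close>.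
  Equality of leading ideals carries this over to \<open>J\<close>, and every leading monomial is
  divisible by an edge.\<close>

lemma g_quadratic_standard:
  assumes gq: "g_quadratic n J"
  shows "\<exists>y z r H. linear_forms n y \<and> linear_forms n z \<and> monomial_order n r \<and>
    (\<forall>f\<in>ext_carrier n. substitute n z (substitute n y f) = f) \<and>
    (\<forall>f\<in>ext_carrier n. substitute n y (substitute n z f) = f) \<and>
    ideal {f \<in> ext_carrier n. substitute n y f \<in> J} (exterior n) \<and>
    (\<forall>N\<in>H. N \<subseteq> {..<n} \<and> card N = 2 \<and>
      (\<exists>g\<in>{f \<in> ext_carrier n. substitute n y f \<in> J}. g \<in> homog n 2 \<and> lead r g N)) \<and>
    (\<forall>f\<in>{f \<in> ext_carrier n. substitute n y f \<in> J}. \<forall>M. lead r f M \<longrightarrow> (\<exists>N\<in>H. N \<subseteq> M))"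
proof -
  obtain y r G where y: "coordinates n y" and r: "monomial_order n r"
    and GB: "groebner_basis n y r J G" and G2: "G \<subseteq> homog n 2" and J: "ideal J (exterior n)"
    using gq unfolding g_quadratic_def graded_ideal_def by auto
  obtain z where "linear_forms n y" "linear_forms n z"
    and inv: "\<And>f. f \<in> ext_carrier n \<Longrightarrow> substitute n z (substitute n y f) = f"
      "\<And>f. f \<in> ext_carrier n \<Longrightarrow> substitute n y (substitute n z f) = f"
    using coordinates_inverse[OF y] by blast
  interpret y: linear_forms n y by fact
  interpret z: linear_forms n z by fact
  interpret ext_order n r by unfold_locales (rule r)
  note JJ = ideal_exteriorD[OF J]
  define J' where "J' = {f \<in> ext_carrier n. substitute n y f \<in> J}"
  define H where "H = {N. \<exists>g\<in>J'. g \<in> homog n 2 \<and> lead r g N}"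
  have J': "ideal J' (exterior n)"
  proof (rule ideal_exteriorI)
    show "0 \<in> J'" using JJ(2) by (simp add: J'_def y.substitute_linear)
    show "f + g \<in> J'" if "f \<in> J'" "g \<in> J'" for f g
      using that JJ(3) by (simp add: J'_def y.substitute_linear)
    show "g \<cdot> f \<in> J'" "f \<cdot> g \<in> J'" if "f \<in> J'" "g \<in> ext_carrier n" for f g
      using that JJ(6,7) y.substitute_carrier by (simp_all add: J'_def y.substitute_wedge)
  qed (auto simp: J'_def)
  have lt: "is_leading_term n y r (substitute n y f) (f M *\<^sub>e coord_monomial n y M)"
    if f: "f \<in> ext_carrier n" "lead r f M" for f M
  proof -
    have "(\<Oplus>\<^bsub>exterior n\<^esub>S\<in>Pow {..<n}. f S \<odot>\<^bsub>exterior n\<^esub> coord_monomial n y S) = substitute n y f"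
      unfolding substitute_def
      by (subst finsum_exterior) (auto intro: homog_carrier[OF y.cm_homog])
    moreover have "M \<subseteq> {..<n}" using f by (auto simp: lead_def ext_carrier_def)
    ultimately show ?thesis using f(2)
      unfolding is_leading_term_def lead_def by (intro exI[of _ f] exI[of _ M]) auto
  qed
  have lt_conv: "\<exists>f M. f \<in> ext_carrier n \<and> g = substitute n y f \<and> lead r f M \<and> t = f M *\<^sub>e coord_monomial n y M"
    if t: "is_leading_term n y r g t" for g t
  proof -
    obtain a M where a: "g = (\<Oplus>\<^bsub>exterior n\<^esub>S\<in>Pow {..<n}. a S \<odot>\<^bsub>exterior n\<^esub> coord_monomial n y S)"
      "M \<subseteq> {..<n}" "a M \<noteq> 0" "\<forall>S. S \<subseteq> {..<n} \<and> a S \<noteq> 0 \<and> S \<noteq> M \<longrightarrow> (S, M) \<in> r"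
      "t = a M *\<^sub>e coord_monomial n y M"
      using t unfolding is_leading_term_def by auto
    define f where "f S = (if S \<subseteq> {..<n} then a S else 0)" for S
    have "g = (\<Sum>S\<in>Pow {..<n}. a S *\<^sub>e coord_monomial n y S)"
      unfolding a(1) by (subst finsum_exterior) (auto intro: homog_carrier[OF y.cm_homog])
    also have "\<dots> = substitute n y f" unfolding substitute_def by (intro sum.cong) (auto simp: f_def)
    finally have "g = substitute n y f" .
    moreover have "f \<in> ext_carrier n" by (auto simp: f_def ext_carrier_def)
    moreover have "lead r f M" using a(2-4) by (auto simp: lead_def f_def)
    moreover have "t = f M *\<^sub>e coord_monomial n y M" using a(2,5) by (simp add: f_def)
    ultimately show ?thesis by blast
  qed
  have H_sub: "N \<subseteq> {..<n} \<and> card N = 2 \<and> (\<exists>g\<in>J'. g \<in> homog n 2 \<and> lead r g N)" if N: "N \<in> H" for N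
  proof -
    obtain g where "g \<in> J'" "g \<in> homog n 2" "lead r g N" using N by (auto simp: H_def)
    then show ?thesis using lead_subset by blast
  qed
  have gb: "\<exists>N\<in>H. N \<subseteq> M" if f: "f \<in> J'" "lead r f M" for f M
  proof -
    define Y where "Y = {w \<in> ext_carrier n. \<forall>S. w S \<noteq> 0 \<longrightarrow> (\<exists>N\<in>H. N \<subseteq> S)}"
    have Y: "ideal Y (exterior n)" unfolding Y_def by (rule ideal_divisible_monomials)
    note YY = ideal_exteriorD[OF Y]
    have Z: "ideal (substitute n y ` Y) (exterior n)"
    proof (rule ideal_exteriorI)
      show "0 \<in> substitute n y ` Y" using YY(2) y.substitute_linear(4) by (metis image_eqI)
      show "v + w \<in> substitute n y ` Y" if vw: "v \<in> substitute n y ` Y" "w \<in> substitute n y ` Y" for v w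
      proof -
        obtain v' w' where "v' \<in> Y" "w' \<in> Y" "v = substitute n y v'" "w = substitute n y w'" using vw by blast
        then show ?thesis using YY(3) by (intro image_eqI[of _ _ "v' + w'"]) (auto simp: y.substitute_linear)
      qed
      show "w \<cdot> v \<in> substitute n y ` Y" "v \<cdot> w \<in> substitute n y ` Y"
        if vw: "v \<in> substitute n y ` Y" "w \<in> ext_carrier n" for v w
      proof -
        obtain v' where v': "v' \<in> Y" "v = substitute n y v'" using vw(1) by blast
        let ?w = "substitute n z w"
        have w: "?w \<in> ext_carrier n" "w = substitute n y ?w"
          using z.substitute_carrier inv(2)[OF vw(2)] by auto
        have "v' \<in> ext_carrier n" using v'(1) YY(1) by blast
        then have "w \<cdot> v = substitute n y (?w \<cdot> v')" "v \<cdot> w = substitute n y (v' \<cdot> ?w)"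
          using v' w y.substitute_wedge by simp_all
        then show "w \<cdot> v \<in> substitute n y ` Y" "v \<cdot> w \<in> substitute n y ` Y"
          using YY(6,7)[OF v'(1) w(1)] by blast+
      qed
    qed (use y.substitute_carrier in auto)
    have "{t. \<exists>g\<in>G. is_leading_term n y r g t} \<subseteq> substitute n y ` Y"
    proof
      fix t assume "t \<in> {t. \<exists>g\<in>G. is_leading_term n y r g t}"
      then obtain g where g: "g \<in> G" "is_leading_term n y r g t" by blast
      obtain f M where fM: "f \<in> ext_carrier n" "g = substitute n y f" "lead r f M"
        "t = f M *\<^sub>e coord_monomial n y M" using lt_conv[OF g(2)] by blast
      have "g \<in> J" using GB g(1) by (auto simp: groebner_basis_def)
      then have fJ: "f \<in> J'" using fM by (simp add: J'_def)
      have "f = substitute n z g" using inv(1)[OF fM(1)] fM(2) by simp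
      then have "f \<in> homog n 2" using z.substitute_homog G2 g(1) by blast
      with fJ fM(3) have MH: "M \<in> H" by (auto simp: H_def)
      have Msub: "M \<subseteq> {..<n}" using fM(1,3) by (auto simp: lead_def ext_carrier_def)
      have "f M *\<^sub>e mono M \<in> Y"
        using MH homog_carrier[OF mono_in[OF Msub]] by (auto simp: Y_def mono_def split: if_splits)
      moreover have "t = substitute n y (f M *\<^sub>e mono M)"
        using fM(4) Msub by (simp add: y.substitute_linear y.substitute_mono)
      ultimately show "t \<in> substitute n y ` Y" by blast
    qed
    then have "leading_ideal n y r G \<subseteq> substitute n y ` Y"
      unfolding leading_ideal_def by (intro exterior.genideal_minimal Z)
    moreover have "f M *\<^sub>e coord_monomial n y M \<in> leading_ideal n y r J"
    proof -
      have "{t. \<exists>g\<in>J. is_leading_term n y r g t} \<subseteq> carrier (exterior n)"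
      proof
        fix t assume "t \<in> {t. \<exists>g\<in>J. is_leading_term n y r g t}"
        then obtain g where "is_leading_term n y r g t" by blast
        from lt_conv[OF this] obtain f M where "f \<in> ext_carrier n" "lead r f M" "t = f M *\<^sub>e coord_monomial n y M" by blast
        moreover from this have "M \<subseteq> {..<n}" by (auto simp: lead_def ext_carrier_def)
        ultimately show "t \<in> carrier (exterior n)" using homog_carrier[OF y.cm_homog] by auto
      qed
      moreover have "f \<in> ext_carrier n" "substitute n y f \<in> J" using f(1) by (auto simp: J'_def)
      ultimately show ?thesis unfolding leading_ideal_def
        using lt[OF _ f(2)] by (intro subsetD[OF exterior.genideal_self]) auto
    qed
    moreover have "leading_ideal n y r G = leading_ideal n y r J" using GB by (simp add: groebner_basis_def)
    ultimately obtain w where w: "w \<in> Y" "f M *\<^sub>e coord_monomial n y M = substitute n y w" by blast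
    have Msub: "M \<subseteq> {..<n}" using f by (auto simp: J'_def lead_def ext_carrier_def)
    have "substitute n y (f M *\<^sub>e mono M) = substitute n y w"
      using w(2) Msub by (simp add: y.substitute_linear y.substitute_mono)
    then have "f M *\<^sub>e mono M = w"
      using inv(1)[of "f M *\<^sub>e mono M"] inv(1)[of w] homog_carrier[OF mono_in[OF Msub]] w(1) YY(1) by force
    then have "w M \<noteq> 0" using f(2) by (auto simp: lead_def mono_def)
    then show ?thesis using w(1) by (auto simp: Y_def)
  qed
  show ?thesis
    using y.linear_forms_axioms z.linear_forms_axioms r inv J' H_sub gb unfolding J'_def
    by - (rule exI[of _ y], rule exI[of _ z], rule exI[of _ r], rule exI[of _ H], blast)
qed

text \<open>The leading monomial of a linear form has one element and cannot contain an
  edge.\<close>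

lemma g_quadratic_no_linear_forms:
  assumes gq: "g_quadratic n J" and f: "f \<in> J" "f \<in> homog n 1"
  shows "f = 0"
proof (rule ccontr)
  assume "f \<noteq> 0"
  obtain y z r H where yz: "linear_forms n y" "linear_forms n z" and r: "monomial_order n r"
    and inv: "\<forall>f\<in>ext_carrier n. substitute n y (substitute n z f) = f"
    and H: "\<forall>N\<in>H. N \<subseteq> {..<n} \<and> card N = 2 \<and>
      (\<exists>g\<in>{f \<in> ext_carrier n. substitute n y f \<in> J}. g \<in> homog n 2 \<and> lead r g N)"
    and gb: "\<forall>f\<in>{f \<in> ext_carrier n. substitute n y f \<in> J}. \<forall>M. lead r f M \<longrightarrow> (\<exists>N\<in>H. N \<subseteq> M)"
    using g_quadratic_standard[OF gq] by (elim exE conjE) (rule that)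
  interpret y: linear_forms n y by fact
  interpret z: linear_forms n z by fact
  interpret ext_order n r by unfold_locales (rule r)
  let ?g = "substitute n z f"
  have g: "?g \<in> homog n 1" "substitute n y ?g = f"
    using z.substitute_homog[OF f(2)] inv homog_carrier[OF f(2)] by auto
  then have "?g \<noteq> 0" using \<open>f \<noteq> 0\<close> y.substitute_linear(4) by auto
  then obtain M where M: "lead r ?g M" using lead_exists homog_carrier[OF g(1)] by blast
  have "?g \<in> {f \<in> ext_carrier n. substitute n y f \<in> J}" using g f(1) homog_carrier[OF g(1)] by simp
  with gb M obtain N where N: "N \<in> H" "N \<subseteq> M" by blast
  have "M \<subseteq> {..<n}" "card M = 1" using lead_subset[OF g(1) M] by auto
  moreover have "card N = 2" using H N(1) by blast
  ultimately show False using card_mono[OF _ N(2)] finite_subset[of M "{..<n}"] by simp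
qed

text \<open>All hypotheses are invariant under changes of coordinates, so they pass to the pulled
  back ideal. The dependence of any seven quadrics bounds the number of edges.\<close>

lemma g_quadratic_rank_two:
  assumes gq: "g_quadratic n J"
    and no_rank_two: "\<And>a b. a \<in> homog n 1 \<Longrightarrow> b \<in> homog n 1 \<Longrightarrow> a \<cdot> b \<in> J
      \<Longrightarrow> \<exists>c d. (c \<noteq> 0 \<or> d \<noteq> 0) \<and> c *\<^sub>e a + d *\<^sub>e b = 0"
    and top: "homog n (n - 3) \<subseteq> J" "6 \<le> n"
    and quadrics: "\<And>g. (\<And>k. k < (7::nat) \<Longrightarrow> g k \<in> J \<inter> homog n 2)
      \<Longrightarrow> \<exists>d. (\<exists>k<7. d k \<noteq> 0) \<and> (\<Sum>k<7. d k *\<^sub>e g k) = 0"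
  shows False
proof -
  obtain y z r H where yz: "linear_forms n y" "linear_forms n z" and r: "monomial_order n r"
    and inv1: "\<forall>f\<in>ext_carrier n. substitute n z (substitute n y f) = f"
    and J'0: "ideal {f \<in> ext_carrier n. substitute n y f \<in> J} (exterior n)"
    and H0: "\<forall>N\<in>H. N \<subseteq> {..<n} \<and> card N = 2 \<and>
      (\<exists>g\<in>{f \<in> ext_carrier n. substitute n y f \<in> J}. g \<in> homog n 2 \<and> lead r g N)"
    and gb0: "\<forall>f\<in>{f \<in> ext_carrier n. substitute n y f \<in> J}. \<forall>M. lead r f M \<longrightarrow> (\<exists>N\<in>H. N \<subseteq> M)"
    using g_quadratic_standard[OF gq] by (elim exE conjE) (rule that)
  interpret y: linear_forms n y by fact
  interpret z: linear_forms n z by fact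
  interpret ext_order n r by unfold_locales (rule r)
  define J' where "J' = {f \<in> ext_carrier n. substitute n y f \<in> J}"
  have J': "ideal J' (exterior n)" using J'0 by (simp add: J'_def)
  have H_sub: "N \<subseteq> {..<n} \<and> card N = 2 \<and> (\<exists>g\<in>J'. g \<in> homog n 2 \<and> lead r g N)" if "N \<in> H" for N
    using H0 that by (simp add: J'_def)
  have gb: "\<exists>N\<in>H. N \<subseteq> M" if "f \<in> J'" "lead r f M" for f M
    using gb0 that unfolding J'_def by blast
  have inv: "substitute n z (substitute n y f) = f" if "f \<in> ext_carrier n" for f
    using inv1 that by blast
  have finH: "finite H" by (rule finite_subset[of _ "Pow {..<n}"]) (use H_sub in auto)
  \<comment> \<open>Quadrics with distinct leading monomials are independent: in a relation the
    largest of these monomials occurs in only one term.\<close>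
  have cardH: "card H \<le> 6"
  proof (rule ccontr)
    assume "\<not> card H \<le> 6"
    then obtain N where N: "inj_on N {..<7::nat}" "N ` {..<7} \<subseteq> H"
      using card_le_inj[of "{..<7::nat}" H] finH by auto
    have "\<exists>g. g \<in> J' \<and> g \<in> homog n 2 \<and> lead r g (N k)" if "k < 7" for k
      using H_sub[of "N k"] N(2) that by blast
    then obtain g where g: "\<And>k. k < 7 \<Longrightarrow> g k \<in> J'" "\<And>k. k < 7 \<Longrightarrow> g k \<in> homog n 2"
      "\<And>k. k < 7 \<Longrightarrow> lead r (g k) (N k)" by metis
    obtain d k0 where d: "k0 < 7" "d k0 \<noteq> 0" "(\<Sum>k<7. d k *\<^sub>e substitute n y (g k)) = 0"
      using quadrics[of "\<lambda>k. substitute n y (g k)"] g y.substitute_homog by (auto simp: J'_def)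
    let ?F = "\<Sum>k<7. d k *\<^sub>e g k"
    have "substitute n y ?F = 0" using d(3) by (simp add: y.substitute_sum y.substitute_linear)
    moreover have "?F \<in> ext_carrier n" using g(2) homog_carrier by (intro ext_carrier_sum ext_carrier_closed(5)) auto
    ultimately have F0: "?F = 0" using inv[of ?F] z.substitute_linear(4) by simp
    let ?B = "N ` {k. k < 7 \<and> d k \<noteq> 0}"
    have "\<exists>M\<in>?B. \<forall>S\<in>?B. S \<noteq> M \<longrightarrow> (S, M) \<in> r"
      using d(1,2) N(2) H_sub by (intro maximal_monomial) auto
    then obtain k where k: "k < 7" "d k \<noteq> 0" "\<And>k'. k' < 7 \<Longrightarrow> d k' \<noteq> 0 \<Longrightarrow> N k' \<noteq> N k \<Longrightarrow> (N k', N k) \<in> r" by auto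
    have vanish: "d k' * g k' (N k) = 0" if k': "k' < 7" "k' \<noteq> k" for k'
    proof (rule ccontr)
      assume nz: "d k' * g k' (N k) \<noteq> 0"
      have ne: "N k' \<noteq> N k" using N(1) k' k(1) by (auto simp: inj_on_def)
      then have "(N k', N k) \<in> r" using k(3)[of k'] k' nz by auto
      moreover have "(N k, N k') \<in> r" using g(3)[OF k'(1)] nz ne by (auto simp: lead_def)
      ultimately show False using less_asym by blast
    qed
    have "?F (N k) = (\<Sum>j<7. d j * g j (N k))" by (simp add: sum_fun_apply)
    also have "\<dots> = (\<Sum>j\<in>{k}. d j * g j (N k))"
      by (rule sum.mono_neutral_right) (use k(1) vanish in auto)
    finally have "?F (N k) = d k * g k (N k)" by simp
    moreover have "g k (N k) \<noteq> 0" using g(3)[OF k(1)] by (simp add: lead_def)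
    ultimately show False using F0 k(2) by simp
  qed
  have dep: "\<exists>c d. (c \<noteq> 0 \<or> d \<noteq> 0) \<and> c *\<^sub>e a + d *\<^sub>e b = 0"
    if ab: "a \<in> homog n 1" "b \<in> homog n 1" "a \<cdot> b \<in> J'" for a b
  proof -
    have car: "a \<in> ext_carrier n" "b \<in> ext_carrier n" using ab homog_carrier by auto
    then have "substitute n y a \<cdot> substitute n y b \<in> J"
      using ab(3) by (simp add: J'_def y.substitute_wedge)
    from no_rank_two[OF y.substitute_homog[OF ab(1)] y.substitute_homog[OF ab(2)] this]
    obtain c d where cd: "c \<noteq> 0 \<or> d \<noteq> 0" "c *\<^sub>e substitute n y a + d *\<^sub>e substitute n y b = 0" by blast
    then have "substitute n y (c *\<^sub>e a + d *\<^sub>e b) = 0" by (simp add: y.substitute_linear)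
    then have "c *\<^sub>e a + d *\<^sub>e b = 0"
      using inv[of "c *\<^sub>e a + d *\<^sub>e b"] car z.substitute_linear(4) by simp
    with cd(1) show ?thesis by blast
  qed
  have top': "homog n (n - 3) \<subseteq> J'"
    using top(1) y.substitute_homog homog_carrier unfolding J'_def by blast
  have "quadratic_groebner n r J' H"
    by (intro quadratic_groebner.intro quadratic_groebner_axioms.intro ext_order_axioms J' H_sub gb dep cardH top' top(2))
  then interpret quadratic_groebner n r J' H .
  show False by (rule contradiction)
qed

section \<open>Lifting along regular sequences\<close>

text \<open>The minors of a and b satisfy the Pluecker relations, so a product in the ideal is the
  zero combination of the quadrics. All minors then vanish and the forms are proportional.\<close>

lemma plucker_anisotropic_dependent:
  assumes x: "plucker_anisotropic x" and a: "a \<in> homog 6 1" and b: "b \<in> homog 6 1"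
    and ab: "a \<cdot> b \<in> quad_ideal x"
  shows "\<exists>c d. (c \<noteq> 0 \<or> d \<noteq> 0) \<and> c *\<^sub>e a + d *\<^sub>e b = 0"
proof -
  have eq: "a \<cdot> b = bilinear_quadric (\<lambda>j k. a {j} * b {k})"
    using wedge_linear_linear[of "\<lambda>j. a {j}" "\<lambda>k. b {k}"] linear_eq_sum[OF a] linear_eq_sum[OF b] by simp
  obtain c where c: "\<And>j k. j < k \<Longrightarrow> k < 6 \<Longrightarrow> a {j} * b {k} - a {k} * b {j} = (\<Sum>m<6. c m * x (m, j, k))"
    using ab unfolding eq quad_ideal_iff[OF bilinear_quadric_homog] by (auto simp: bilinear_quadric_apply)
  have "\<forall>m<6. c m = 0"
    using x unfolding plucker_anisotropic_def Let_def
  proof (rule allE[of _ c], elim mp)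
    show "\<forall>i j k l. i < j \<and> j < k \<and> k < l \<and> l < 6 \<longrightarrow>
        plucker_form (\<lambda>q. \<Sum>m<6. c m * x (m, q)) (\<lambda>q. \<Sum>m<6. c m * x (m, q)) i j k l = 0"
      unfolding plucker_form_def by (auto simp: c[symmetric] algebra_simps)
  qed
  then have 0: "a {j} * b {k} = a {k} * b {j}" if "j < k" "k < 6" for j k using c[OF that] by simp
  have sym: "a {j} * b {k} = a {k} * b {j}" if "j < 6" "k < 6" for j k
    using 0[of j k] 0[of k j] that by (cases j k rule: linorder_cases) auto
  show ?thesis
  proof (cases "a = 0")
    case True
    then show ?thesis by (intro exI[of _ 1] exI[of _ 0]) simp
  next
    case False
    then obtain S where "a S \<noteq> 0" by (auto simp: fun_eq_iff)
    then obtain j where j: "a {j} \<noteq> 0" "j < 6" using homogD[OF a, of S] by (auto simp: card_1_singleton_iff)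
    have "b {j} *\<^sub>e a - a {j} *\<^sub>e b = (\<Sum>k<6. (b {j} * a {k} - a {j} * b {k}) *\<^sub>e mono {k})"
      by (subst linear_eq_sum[OF a], subst linear_eq_sum[OF b]) (simp add: scale_sum sum_subtractf scale_distribs)
    also have "\<dots> = 0" by (rule sum.neutral) (use sym[OF j(2)] in \<open>simp add: mult.commute\<close>)
    finally have "b {j} *\<^sub>e a + (- a {j}) *\<^sub>e b = 0" by (simp add: scale_distribs)
    with j(1) show ?thesis by (intro exI[of _ "b {j}"] exI[of _ "- a {j}"]) simp
  qed
qed

section \<open>Adjoining the first linear forms of the sequence to the ideal\<close>

definition extended_ideal :: "nat \<Rightarrow> ext set \<Rightarrow> (nat \<Rightarrow> ext) \<Rightarrow> nat \<Rightarrow> ext set"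
  where "extended_ideal n J l i =
    {z. \<exists>g\<in>J. \<exists>w. (\<forall>j. w j \<in> ext_carrier n) \<and> z = g + (\<Sum>j<i. l j \<cdot> w j)}"

lemma sum_related:
  fixes f :: "'a \<Rightarrow> 'b::comm_monoid_add" and g :: "'a \<Rightarrow> 'c::comm_monoid_add"
  assumes "Q 0 0" "\<And>a b c d. Q a b \<Longrightarrow> Q c d \<Longrightarrow> Q (a + c) (b + d)" "\<And>i. i \<in> A \<Longrightarrow> Q (f i) (g i)"
  shows "Q (\<Sum>i\<in>A. f i) (\<Sum>i\<in>A. g i)"
  using assms(3) by (induction A rule: infinite_finite_induct) (auto intro: assms(1,2))

locale lifted_forms =
  fixes n :: nat and J :: "ext set" and l :: "nat \<Rightarrow> ext"
  assumes J: "ideal J (exterior n)" and l: "\<And>j. l j \<in> homog n 1"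
begin

abbreviation JJ :: "nat \<Rightarrow> ext set"
  where "JJ \<equiv> extended_ideal n J l"

lemmas JD = ideal_exteriorD[OF J]

lemma l_carrier: "l j \<in> ext_carrier n"
  by (rule homog_carrier[OF l])

lemma JJ_I: "g \<in> J \<Longrightarrow> (\<And>j. w j \<in> ext_carrier n) \<Longrightarrow> g + (\<Sum>j<i. l j \<cdot> w j) \<in> JJ i"
  unfolding extended_ideal_def by blast

lemma JJ_E:
  assumes "z \<in> JJ i"
  obtains g w where "g \<in> J" "\<forall>j. w j \<in> ext_carrier n" "z = g + (\<Sum>j<i. l j \<cdot> w j)"
proof -
  from assms obtain g w where *: "g \<in> J" "\<forall>j. w j \<in> ext_carrier n" "z = g + (\<Sum>j<i. l j \<cdot> w j)"
    unfolding extended_ideal_def by blast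
  then show ?thesis by (rule that)
qed

text \<open>Sums of right multiples of the l_j are already two-sided, because a factor on the left
  passes a linear form at the cost of its involution.\<close>

lemma ideal_JJ: "ideal (JJ i) (exterior n)"
proof (rule ideal_exteriorI)
  show "JJ i \<subseteq> ext_carrier n"
  proof
    fix z assume "z \<in> JJ i"
    then obtain g w where gw: "g \<in> J" "\<forall>j. w j \<in> ext_carrier n" "z = g + (\<Sum>j<i. l j \<cdot> w j)" by (rule JJ_E)
    have "(\<Sum>j<i. l j \<cdot> w j) \<in> ext_carrier n" using gw(2)[rule_format] l_carrier by (intro ext_carrier_sum) simp
    then show "z \<in> ext_carrier n" using gw(1,3) JD(1) by auto
  qed
  show "0 \<in> JJ i" using JJ_I[OF JD(2), of "\<lambda>_. 0" i] by simp
  show "f + g \<in> JJ i" if fg: "f \<in> JJ i" "g \<in> JJ i" for f g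
  proof -
    obtain f' v where f: "f' \<in> J" "\<forall>j. v j \<in> ext_carrier n" "f = f' + (\<Sum>j<i. l j \<cdot> v j)" by (rule JJ_E[OF fg(1)])
    obtain g' w where g: "g' \<in> J" "\<forall>j. w j \<in> ext_carrier n" "g = g' + (\<Sum>j<i. l j \<cdot> w j)" by (rule JJ_E[OF fg(2)])
    have "f + g = (f' + g') + (\<Sum>j<i. l j \<cdot> (v j + w j))"
      by (simp add: f g wedge_distribs sum.distrib)
    then show ?thesis using JJ_I[OF JD(3)[OF f(1) g(1)], of "\<lambda>j. v j + w j" i] f(2)[rule_format] g(2)[rule_format] by simp
  qed
  show "g \<cdot> f \<in> JJ i" "f \<cdot> g \<in> JJ i" if fg: "f \<in> JJ i" "g \<in> ext_carrier n" for f g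
  proof -
    obtain f' v where f: "f' \<in> J" "\<forall>j. v j \<in> ext_carrier n" "f = f' + (\<Sum>j<i. l j \<cdot> v j)" by (rule JJ_E[OF fg(1)])
    have "g \<cdot> (l j \<cdot> v j) = l j \<cdot> (involute g \<cdot> v j)" for j
      using linear_involute[OF l, of g] by (simp flip: wedge_assoc)
    then have "g \<cdot> f = g \<cdot> f' + (\<Sum>j<i. l j \<cdot> (involute g \<cdot> v j))"
      by (simp add: f wedge_distribs wedge_sum_right)
    then show "g \<cdot> f \<in> JJ i"
      using JJ_I[OF JD(6)[OF f(1) fg(2)], of "\<lambda>j. involute g \<cdot> v j" i] f(2)[rule_format] fg(2) by simp
    have "f \<cdot> g = f' \<cdot> g + (\<Sum>j<i. l j \<cdot> (v j \<cdot> g))"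
      by (simp add: f wedge_distribs wedge_sum_left wedge_assoc)
    then show "f \<cdot> g \<in> JJ i"
      using JJ_I[OF JD(7)[OF f(1) fg(2)], of "\<lambda>j. v j \<cdot> g" i] f(2)[rule_format] fg(2) by simp
  qed
qed

lemmas JJD = ideal_exteriorD[OF ideal_JJ]

lemma JJ_0: "JJ 0 = J"
  using JJ_I[of _ "\<lambda>_. 0" 0] by (auto elim!: JJ_E)

lemma JJ_mono:
  assumes "i \<le> i'"
  shows "JJ i \<subseteq> JJ i'"
proof
  fix z assume "z \<in> JJ i"
  then obtain g w where gw: "g \<in> J" "\<forall>j. w j \<in> ext_carrier n" "z = g + (\<Sum>j<i. l j \<cdot> w j)" by (rule JJ_E)
  have "(\<Sum>j<i. l j \<cdot> w j) = (\<Sum>j<i'. l j \<cdot> (if j < i then w j else 0))"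
    using assms by (intro sum.mono_neutral_cong_left) auto
  then show "z \<in> JJ i'" using JJ_I[OF gw(1), of "\<lambda>j. if j < i then w j else 0" i'] gw(2,3) by simp
qed

lemma l_in_JJ: "j < i \<Longrightarrow> v \<in> ext_carrier n \<Longrightarrow> l j \<cdot> v \<in> JJ i"
proof -
  assume j: "j < i" and v: "v \<in> ext_carrier n"
  have "(\<Sum>k<i. l k \<cdot> (if k = j then v else 0)) = l j \<cdot> v"
    using j by (subst sum.remove[of _ j]) (auto intro!: sum.neutral)
  then show ?thesis using JJ_I[OF JD(2), of "\<lambda>k. if k = j then v else 0" i] v by simp
qed

lemma l_span_in_JJ: "(\<Sum>j<i. c j *\<^sub>e l j) \<in> JJ i"
proof (rule ideal_exterior_sum[OF ideal_JJ])
  fix j assume "j \<in> {..<i}"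
  then have "l j \<cdot> mono {} \<in> JJ i" using homog_carrier[OF one_in_homog] by (intro l_in_JJ) auto
  then have "l j \<in> JJ i" by (simp add: wedge_one(2)[OF l_carrier])
  then show "c j *\<^sub>e l j \<in> JJ i" by (rule JJD(8))
qed

lemma l_mem: "j < i \<Longrightarrow> l j \<in> JJ i"
  using l_in_JJ[of j i "mono {}"] homog_carrier[OF one_in_homog] by (simp add: wedge_one(2)[OF l_carrier])

abbreviation alg :: "ext set graded_algebra"
  where "alg \<equiv> quotient_algebra (exterior n) J"

abbreviation pr :: "ext \<Rightarrow> ext set"
  where "pr \<equiv> (+>\<^bsub>exterior n\<^esub>) J"

abbreviation alg_quot :: "nat \<Rightarrow> ext set set graded_algebra"
  where "alg_quot i \<equiv> quotient_algebra alg (pr ` JJ i)"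

abbreviation pr_quot :: "nat \<Rightarrow> ext \<Rightarrow> ext set set"
  where "pr_quot i z \<equiv> (pr ` JJ i) +>\<^bsub>alg\<^esub> (pr z)"

end

context lifted_forms
begin

interpretation pr: ring_hom_ring "exterior n" alg pr
  by (rule ring_hom_quotient_algebra[OF J])

lemma pr_closed: "a \<in> ext_carrier n \<Longrightarrow> pr a \<in> carrier alg"
  using pr.hom_closed[of a] by simp

lemma pr_ops:
  assumes "a \<in> ext_carrier n" "b \<in> ext_carrier n"
  shows "pr a \<otimes>\<^bsub>alg\<^esub> pr b = pr (a \<cdot> b)" and "pr a \<oplus>\<^bsub>alg\<^esub> pr b = pr (a + b)"
  using pr.hom_mult[of a b] pr.hom_add[of a b] assms by simp_all

lemma pr_eq_iff:
  assumes "a \<in> ext_carrier n" "b \<in> ext_carrier n"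
  shows "pr a = pr b \<longleftrightarrow> a - b \<in> J"
  using rcos_eq_iff[OF J, of a b] assms a_minus_exterior(2)[OF assms] by simp

lemma pr_diff:
  assumes "a \<in> ext_carrier n" "b \<in> ext_carrier n"
  shows "pr a \<ominus>\<^bsub>alg\<^esub> pr b = pr (a - b)"
proof -
  have ab: "a - b \<in> ext_carrier n" using assms by simp
  have eq: "pr a = pr (a - b) \<oplus>\<^bsub>alg\<^esub> pr b" using pr_ops(2)[OF ab assms(2)] by simp
  show ?thesis unfolding eq using pr_closed[OF ab] pr_closed[OF assms(2)]
    by (simp add: a_minus_def pr.S.a_assoc pr.S.r_neg)
qed

lemma ideal_pr_JJ: "ideal (pr ` JJ i) alg"
  by (rule ideal_image_quotient_algebra[OF J ideal_JJ])

lemma pr_mem: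
  assumes z: "z \<in> ext_carrier n"
  shows "pr z \<in> pr ` JJ i \<longleftrightarrow> z \<in> JJ i"
proof
  assume "pr z \<in> pr ` JJ i"
  then obtain y where y: "y \<in> JJ i" "pr z = pr y" by blast
  have "y \<in> ext_carrier n" using y(1) JJD(1) by blast
  then have "z - y \<in> JJ i" using pr_eq_iff[OF z, of y] y(2) JJ_mono[of 0 i] JJ_0 by auto
  from JJD(3)[OF this y(1)] show "z \<in> JJ i" by simp
qed blast

lemma pr_quot_eq_iff:
  assumes "a \<in> ext_carrier n" "b \<in> ext_carrier n"
  shows "pr_quot i a = pr_quot i b \<longleftrightarrow> a - b \<in> JJ i"
  using rcos_eq_iff[OF ideal_pr_JJ pr_closed[OF assms(1)] pr_closed[OF assms(2)], of i]
    pr_mem[OF ext_carrier_closed(3)[OF assms], of i] unfolding pr_diff[OF assms] by simp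

lemma pr_quot_ops:
  assumes "a \<in> ext_carrier n" "b \<in> ext_carrier n"
  shows "pr_quot i a \<otimes>\<^bsub>alg_quot i\<^esub> pr_quot i b = pr_quot i (a \<cdot> b)"
    and "pr_quot i a \<oplus>\<^bsub>alg_quot i\<^esub> pr_quot i b = pr_quot i (a + b)"
  using assms by (simp_all add: quotient_algebra_ops[OF ideal_pr_JJ] pr_closed pr_ops)

lemma pr_quot_smult:
  assumes "a \<in> ext_carrier n"
  shows "c \<odot>\<^bsub>alg_quot i\<^esub> pr_quot i a = pr_quot i (c *\<^sub>e a)"
proof -
  interpret E: scalar_ring "exterior n" by (rule scalar_ring_exterior)
  interpret Q: scalar_ring alg by (rule E.scalar_ring_quotient_algebra[OF J])
  show ?thesis
    using assms by (simp add: Q.quotient_algebra_smult[OF ideal_pr_JJ] E.quotient_algebra_smult[OF J] pr_closed)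
qed

lemma pr_quot_carrier: "carrier (alg_quot i) = (\<lambda>z. pr_quot i z) ` ext_carrier n"
  by (simp add: quotient_algebra_sel image_image)

lemma pr_quot_component: "component (alg_quot i) d = (\<lambda>z. pr_quot i z) ` homog n d"
  by (simp add: quotient_algebra_sel image_image)

lemma pr_quot_zero_iff:
  assumes "a \<in> ext_carrier n"
  shows "pr_quot i a = \<zero>\<^bsub>alg_quot i\<^esub> \<longleftrightarrow> a \<in> JJ i"
proof -
  interpret q: ring_hom_ring alg "alg_quot i" "(+>\<^bsub>alg\<^esub>) (pr ` JJ i)"
    by (rule ring_hom_quotient_algebra[OF ideal_pr_JJ])
  have "pr_quot i 0 = \<zero>\<^bsub>alg_quot i\<^esub>" using q.hom_zero pr.hom_zero by simp
  then show ?thesis using pr_quot_eq_iff[OF assms ext_carrier_closed(1), of i] by simp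
qed

lemma Idl_linear_forms: "Idl\<^bsub>alg\<^esub> ((\<lambda>j. pr (l j)) ` {..<i}) = pr ` JJ i"
proof
  have "(\<lambda>j. pr (l j)) ` {..<i} \<subseteq> pr ` JJ i" using l_mem by blast
  from pr.S.genideal_minimal[OF ideal_pr_JJ this]
  show "Idl\<^bsub>alg\<^esub> ((\<lambda>j. pr (l j)) ` {..<i}) \<subseteq> pr ` JJ i" .
  have car: "(\<lambda>j. pr (l j)) ` {..<i} \<subseteq> carrier alg" using pr_closed[OF l_carrier] by blast
  interpret K: ideal "Idl\<^bsub>alg\<^esub> ((\<lambda>j. pr (l j)) ` {..<i})" alg
    by (rule pr.S.genideal_ideal[OF car])
  let ?K = "Idl\<^bsub>alg\<^esub> ((\<lambda>j. pr (l j)) ` {..<i})"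
  have 0: "pr 0 = \<zero>\<^bsub>alg\<^esub>" using pr.hom_zero by simp
  define X where "X = {z \<in> ext_carrier n. pr z \<in> ?K}"
  have X_add: "a + b \<in> X" if "a \<in> X" "b \<in> X" for a b
  proof -
    have ab: "a \<in> ext_carrier n" "b \<in> ext_carrier n" "pr a \<in> ?K" "pr b \<in> ?K" using that by (simp_all add: X_def)
    show ?thesis using K.a_closed[OF ab(3,4)] ab(1,2) by (simp add: X_def pr_ops)
  qed
  show "pr ` JJ i \<subseteq> ?K"
  proof
    fix y assume "y \<in> pr ` JJ i"
    then obtain z where z: "z \<in> JJ i" "y = pr z" by blast
    obtain g w where gw: "g \<in> J" "\<forall>j. w j \<in> ext_carrier n" "z = g + (\<Sum>j<i. l j \<cdot> w j)" by (rule JJ_E[OF z(1)])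
    have g: "g \<in> ext_carrier n" using gw(1) JD(1) by blast
    then have "pr g = \<zero>\<^bsub>alg\<^esub>" using pr_eq_iff[OF g ext_carrier_closed(1)] gw(1) 0 by simp
    then have "g \<in> X" using g K.zero_closed by (simp add: X_def)
    moreover have "(\<Sum>j<i. l j \<cdot> w j) \<in> X"
    proof (rule sum_closed)
      show "0 \<in> X" using 0 K.zero_closed by (simp add: X_def)
      fix j assume "j \<in> {..<i}"
      then have "pr (l j) \<in> ?K" using pr.S.genideal_self[OF car] by blast
      from K.I_r_closed[OF this pr_closed[OF gw(2)[rule_format, of j]]]
      show "l j \<cdot> w j \<in> X" using gw(2)[rule_format, of j] l_carrier[of j] by (simp add: X_def pr_ops)
    qed (rule X_add)
    ultimately have "z \<in> X" unfolding gw(3) by (rule X_add)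
    then show "y \<in> ?K" unfolding z(2) X_def by blast
  qed
qed

text \<open>The quotient of the quotient is eliminated here: regularity is restated for
  representatives in the exterior algebra, in the direction that annihilated elements are
  multiples.\<close>

lemma regular_form_lift:
  assumes reg: "regular_form (alg_quot i) (pr_quot i (l i))"
    and z: "z \<in> ext_carrier n" "l i \<cdot> z \<in> JJ i"
  shows "z \<in> JJ (Suc i)"
proof -
  have "pr_quot i (l i) \<otimes>\<^bsub>alg_quot i\<^esub> pr_quot i z = \<zero>\<^bsub>alg_quot i\<^esub>"
    unfolding pr_quot_ops(1)[OF l_carrier z(1)]
    using pr_quot_zero_iff[of "l i \<cdot> z" i] z(2) ext_carrier_wedge[OF l_carrier z(1)] by blast
  moreover have "pr_quot i z \<in> carrier (alg_quot i)" using z(1) unfolding pr_quot_carrier by blast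
  ultimately have "pr_quot i z \<in> (\<lambda>m. pr_quot i (l i) \<otimes>\<^bsub>alg_quot i\<^esub> m) ` carrier (alg_quot i)"
    using reg unfolding regular_form_def by blast
  then obtain w where w: "w \<in> ext_carrier n" "pr_quot i z = pr_quot i (l i) \<otimes>\<^bsub>alg_quot i\<^esub> pr_quot i w"
    unfolding pr_quot_carrier by blast
  have "pr_quot i z = pr_quot i (l i \<cdot> w)" using w(2) unfolding pr_quot_ops(1)[OF l_carrier w(1)] .
  then have "z - l i \<cdot> w \<in> JJ i"
    using pr_quot_eq_iff[OF z(1) ext_carrier_wedge[OF l_carrier[of i] w(1)], of i] by blast
  then have "z - l i \<cdot> w \<in> JJ (Suc i)" using JJ_mono[of i "Suc i"] by auto
  from JJD(3)[OF this l_in_JJ[OF lessI w(1)]] show ?thesis by simp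
qed

end

text \<open>The relation \<open>rel\<close> compares representatives of an element of \<open>R\<close> in the two exterior algebras;
  \<open>l\<close> lifts the regular sequence.\<close>

locale regular_lift = generic_quadrics x + lifted_forms n J l for x n J l +
  fixes r :: nat and rel :: "ext \<Rightarrow> ext \<Rightarrow> bool"
  assumes graded: "\<And>f d. f \<in> J \<Longrightarrow> part d f \<in> J"
    and no_linear: "\<And>f. f \<in> J \<Longrightarrow> f \<in> homog n 1 \<Longrightarrow> f = 0"
    and regular: "\<And>i z. i < r \<Longrightarrow> z \<in> ext_carrier n \<Longrightarrow> l i \<cdot> z \<in> extended_ideal n J l i
      \<Longrightarrow> z \<in> extended_ideal n J l (Suc i)"
    and rel_add: "\<And>z z' u u'. rel z u \<Longrightarrow> rel z' u' \<Longrightarrow> rel (z + z') (u + u')"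
    and rel_mult: "\<And>z z' u u'. rel z u \<Longrightarrow> rel z' u' \<Longrightarrow> rel (z \<cdot> z') (u \<cdot> u')"
    and rel_scale: "\<And>z u c. rel z u \<Longrightarrow> rel (c *\<^sub>e z) (c *\<^sub>e u)"
    and rel_iff: "\<And>z u. rel z u \<Longrightarrow> z \<in> extended_ideal n J l r \<longleftrightarrow> u \<in> quad_ideal x"
    and rel_total: "\<And>z d. z \<in> homog n d \<Longrightarrow> \<exists>u\<in>homog 6 d. rel z u"
    and rel_onto: "\<And>u d. u \<in> homog 6 d \<Longrightarrow> \<exists>z\<in>homog n d. rel z u"
begin

lemma part_JJ: "z \<in> JJ i \<Longrightarrow> part (Suc d) z \<in> JJ i"
proof -
  assume "z \<in> JJ i"
  then obtain g w where gw: "g \<in> J" "\<forall>j. w j \<in> ext_carrier n" "z = g + (\<Sum>j<i. l j \<cdot> w j)" by (rule JJ_E)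
  have "part (Suc d) z = part (Suc d) g + (\<Sum>j<i. l j \<cdot> part d (w j))"
    by (simp add: gw part_linear part_sum part_linear_wedge[OF l])
  then show ?thesis
    using JJ_I[OF graded[OF gw(1)], of "\<lambda>j. part d (w j)" "Suc d" i] homog_carrier[OF part_homog[OF gw(2)[rule_format]]] by simp
qed

text \<open>\<open>J\<close> contains no linear forms, so the degree-1 part of a member comes from
  the constant terms of the cofactors of the l_j.\<close>

lemma linear_in_JJ:
  assumes "z \<in> JJ i" "z \<in> homog n 1"
  shows "\<exists>c. z = (\<Sum>j<i. c j *\<^sub>e l j)"
proof -
  obtain g w where gw: "g \<in> J" "\<forall>j. w j \<in> ext_carrier n" "z = g + (\<Sum>j<i. l j \<cdot> w j)" by (rule JJ_E[OF assms(1)])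
  have "g \<in> ext_carrier n" using gw(1) JD(1) by blast
  then have g0: "part 1 g = 0" using no_linear[OF graded[OF gw(1)]] part_homog by blast
  have "z = part 1 z" using assms(2) by (simp add: part_of_homog)
  also have "\<dots> = part 1 g + (\<Sum>j<i. part (Suc 0) (l j \<cdot> w j))" by (simp add: gw(3) part_linear part_sum)
  also have "\<dots> = (\<Sum>j<i. w j {} *\<^sub>e l j)"
    unfolding g0 by (simp add: part_linear_wedge[OF l] part_0_eq[OF gw(2)[rule_format]] wedge_one(2)[OF l_carrier])
  finally show ?thesis by (rule exI[of _ "\<lambda>j. w j {}"])
qed

lemma one_notin_JJ: "mono {} \<notin> JJ r"
proof
  assume one: "mono {} \<in> JJ r"
  obtain z where z: "z \<in> homog n 0" "rel z (mono {})" using rel_onto[OF one_in_homog] by blast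
  have "z \<cdot> mono {} \<in> JJ r" using JJD(6)[OF one homog_carrier[OF z(1)]] .
  then have "mono {} \<in> quad_ideal x" using rel_iff[OF z(2)] wedge_one(2)[OF homog_carrier[OF z(1)]] by simp
  then have "part 0 (mono {}) = 0" by (simp add: quad_ideal_def)
  then show False by (auto simp: part_def mono_def fun_eq_iff dest: spec[of _ "{}"])
qed

text \<open>In a relation the last form l_m with nonzero coefficient lies in the ideal of its
  predecessors. Regularity, applied to the element 1, then puts 1 into the extended ideal, although
  the final quotient is not zero.\<close>

lemma l_independent:
  assumes "(\<Sum>j<r. c j *\<^sub>e l j) = 0" "j < r"
  shows "c j = 0"
proof (rule ccontr)
  assume "c j \<noteq> 0"
  define m where "m = Max {k. k < r \<and> c k \<noteq> 0}"
  have fin: "finite {k. k < r \<and> c k \<noteq> 0}" and ne: "{k. k < r \<and> c k \<noteq> 0} \<noteq> {}" using \<open>c j \<noteq> 0\<close> assms(2) by auto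
  have m: "m < r" "c m \<noteq> 0" using Max_in[OF fin ne] by (simp_all add: m_def)
  have above: "c k = 0" if "k < r" "m < k" for k
  proof (rule ccontr)
    assume "c k \<noteq> 0"
    then have "k \<le> m" unfolding m_def using that(1) by (intro Max_ge fin) simp
    with that(2) show False by simp
  qed
  have "(\<Sum>j<r. c j *\<^sub>e l j) = (\<Sum>j<Suc m. c j *\<^sub>e l j)"
    using m(1) above by (intro sum.mono_neutral_right) auto
  then have "c m *\<^sub>e l m = - (\<Sum>j<m. c j *\<^sub>e l j)" using assms(1) by (simp add: eq_neg_iff_add_eq_0 add.commute)
  then have "c m *\<^sub>e l m \<in> JJ m" using JJD(5)[OF l_span_in_JJ] by simp
  then have "(1 / c m) *\<^sub>e (c m *\<^sub>e l m) \<in> JJ m" by (rule JJD(8))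
  then have "l m \<cdot> mono {} \<in> JJ m" using m(2) by (simp add: wedge_one(2)[OF l_carrier])
  from regular[OF m(1) homog_carrier[OF one_in_homog] this] have "mono {} \<in> JJ (Suc m)" .
  then show False using one_notin_JJ JJ_mono[of "Suc m" r] m(1) by auto
qed

text \<open>Each linear form removed raises the degree bound by one. An element of degree s is z' +
  l_i w with z' in the smaller ideal and w of degree s - 1, so w lies in the larger ideal by
  induction; multiplying by l_i kills the l_i term of w, and l_i w falls into the smaller ideal as
  well.\<close>

lemma high_degree_in_JJ: "i \<le> r \<Longrightarrow> s \<ge> 3 + r - i \<Longrightarrow> homog n s \<subseteq> JJ i"
proof (induction i arbitrary: s rule: inc_induct)
  case base
  show ?case
  proof
    fix z assume "z \<in> homog n s"
    then obtain u where u: "u \<in> homog 6 s" "rel z u" using rel_total by blast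
    then show "z \<in> JJ r" using rel_iff[OF u(2)] homog_in_quad_ideal[OF u(1)] base by simp
  qed
next
  case (step i)
  then obtain s' where s': "s = Suc s'" by (cases s) auto
  have IH: "homog n s \<subseteq> JJ (Suc i)" "homog n s' \<subseteq> JJ (Suc i)" using step s' by (auto intro!: step.IH)
  show ?case
  proof
    fix z assume z: "z \<in> homog n s"
    then have "z \<in> JJ (Suc i)" using IH by blast
    then obtain g w where gw: "g \<in> J" "\<forall>j. w j \<in> ext_carrier n" "z = g + (\<Sum>j<Suc i. l j \<cdot> w j)" by (rule JJ_E)
    define z' where "z' = g + (\<Sum>j<i. l j \<cdot> w j)"
    have z': "z' \<in> JJ i" unfolding z'_def by (rule JJ_I[OF gw(1) gw(2)[rule_format]])
    have "z = part s z" using z by (simp add: part_of_homog)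
    also have "\<dots> = part s z' + l i \<cdot> part s' (w i)"
      by (simp add: gw(3) z'_def part_linear s' part_linear_wedge[OF l] add.assoc)
    finally have eq: "z = part s z' + l i \<cdot> part s' (w i)" .
    have "part s' (w i) \<in> JJ (Suc i)" using part_homog[OF gw(2)[rule_format]] IH(2) by blast
    then obtain h v where hv: "h \<in> J" "\<forall>j. v j \<in> ext_carrier n" "part s' (w i) = h + (\<Sum>j<Suc i. l j \<cdot> v j)" by (rule JJ_E)
    have "l i \<cdot> part s' (w i) = l i \<cdot> (h + (\<Sum>j<i. l j \<cdot> v j))"
      using linear_square[OF l, of i] by (simp add: hv(3) wedge_distribs flip: wedge_assoc)
    also have "\<dots> \<in> JJ i" by (intro JJD(6) JJ_I hv(1) hv(2)[rule_format] l_carrier)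
    finally have "l i \<cdot> part s' (w i) \<in> JJ i" .
    moreover have "part s z' \<in> JJ i" unfolding s' by (rule part_JJ[OF z'])
    ultimately show "z \<in> JJ i" unfolding eq by (rule JJD(3)[rotated])
  qed
qed

lemma rel_0: "rel 0 0"
proof -
  obtain u where "rel 0 u" using rel_total[OF homog_closed(1)[of n 0]] by blast
  from rel_scale[OF this, of 0] show ?thesis by simp
qed

lemma rel_sum:
  fixes f g :: "'a \<Rightarrow> ext"
  assumes "\<And>i. i \<in> A \<Longrightarrow> rel (f i) (g i)"
  shows "rel (\<Sum>i\<in>A. f i) (\<Sum>i\<in>A. g i)"
  by (rule sum_related[where Q = rel]) (rule rel_0, erule (1) rel_add, erule assms)

definition \<epsilon> :: "nat \<Rightarrow> ext"
  where "\<epsilon> i = (SOME z. z \<in> homog n 1 \<and> rel z (mono {i}))"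

lemma \<epsilon>:
  assumes "i < 6"
  shows "\<epsilon> i \<in> homog n 1 \<and> rel (\<epsilon> i) (mono {i})"
proof -
  obtain z where "z \<in> homog n 1 \<and> rel z (mono {i})" using rel_onto[OF mono_singleton_homog[OF assms]] by blast
  then show ?thesis unfolding \<epsilon>_def by (rule someI[where P = "\<lambda>z. z \<in> homog n 1 \<and> rel z (mono {i})"])
qed

lemma rel_\<epsilon>_sum: "rel (\<Sum>i<6. a i *\<^sub>e \<epsilon> i) (\<Sum>i<6. a i *\<^sub>e mono {i})"
proof (rule rel_sum)
  fix i :: nat assume "i \<in> {..<6}"
  then have "rel (\<epsilon> i) (mono {i})" using \<epsilon>[of i] by simp
  then show "rel (a i *\<^sub>e \<epsilon> i) (a i *\<^sub>e mono {i})" by (rule rel_scale)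
qed

lemma \<epsilon>_sum_homog: "(\<Sum>i<6. a i *\<^sub>e \<epsilon> i) \<in> homog n 1"
proof (rule homog_sum)
  fix i :: nat assume "i \<in> {..<6}"
  then show "a i *\<^sub>e \<epsilon> i \<in> homog n 1" using \<epsilon>[of i] by simp
qed

lemma l_sum_homog: "(\<Sum>j<i. c j *\<^sub>e l j) \<in> homog n 1"
  by (meson homog_closed(5) homog_sum l)

lemma linear_span:
  assumes z: "z \<in> homog n 1"
  shows "\<exists>a c. z = (\<Sum>i<6. a i *\<^sub>e \<epsilon> i) + (\<Sum>j<r. c j *\<^sub>e l j)"
proof -
  obtain u where u: "u \<in> homog 6 1" "rel z u" using rel_total[OF z] by blast
  let ?s = "\<Sum>i<6. u {i} *\<^sub>e \<epsilon> i"
  have "rel (z + (- 1) *\<^sub>e ?s) (u + (- 1) *\<^sub>e (\<Sum>i<6. u {i} *\<^sub>e mono {i}))"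
    by (rule rel_add[OF u(2) rel_scale[OF rel_\<epsilon>_sum]])
  then have "rel (z - ?s) 0" unfolding linear_eq_sum[OF u(1), symmetric] by simp
  from rel_iff[OF this] have "z - ?s \<in> JJ r" using ideal_exteriorD(2)[OF ideal_quad_ideal[of x]] by simp
  from linear_in_JJ[OF this homog_closed(3)[OF z \<epsilon>_sum_homog]]
  obtain c where c: "z - ?s = (\<Sum>j<r. c j *\<^sub>e l j)" by blast
  have "z = ?s + (\<Sum>j<r. c j *\<^sub>e l j)" unfolding c[symmetric] by (simp add: algebra_simps)
  then show ?thesis by auto
qed

text \<open>The six lifted variables together with the r forms are independent: a relation maps to a
  linear form in the ideal of quadrics, hence to 0, and what is left is a relation between the
  l_j.\<close>

lemma n_ge: "r + 6 \<le> n"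
proof (rule ccontr)
  assume small: "\<not> r + 6 \<le> n"
  define b where "b k = (if k < 6 then \<epsilon> k else l (k - 6))" for k
  have b: "b k \<in> homog n 1" for k using \<epsilon>[of k] l[of "k - 6"] by (simp add: b_def)
  have "card {..<n} < card {..<r + 6}" using small by simp
  from underdetermined_system[where M = "\<lambda>i k. b k {i}", OF finite_lessThan finite_lessThan this]
  obtain y where y: "\<exists>k\<in>{..<r + 6}. y k \<noteq> 0" "\<forall>i\<in>{..<n}. (\<Sum>k\<in>{..<r + 6}. b k {i} * y k) = 0" by blast
  let ?S = "\<Sum>k<r + 6. y k *\<^sub>e b k"
  let ?A = "\<Sum>k<6. y k *\<^sub>e \<epsilon> k" and ?B = "\<Sum>j<r. y (j + 6) *\<^sub>e l j"
  have hom: "?S \<in> homog n 1" by (meson b homog_closed(5) homog_sum)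
  have coord: "?S {i} = 0" if "i < n" for i
    using bspec[OF y(2), of i] that by (simp add: sum_fun_apply mult.commute)
  have S0: "?S = 0"
  proof -
    have "?S = (\<Sum>i<n. ?S {i} *\<^sub>e mono {i})" by (rule linear_eq_sum[OF hom])
    also have "\<dots> = 0" by (rule sum.neutral) (simp add: coord)
    finally show ?thesis .
  qed
  have split: "{..<r + 6} = {..<6} \<union> {6..<r + 6}" by auto
  have "?S = (\<Sum>k<6. y k *\<^sub>e b k) + (\<Sum>k\<in>{6..<r + 6}. y k *\<^sub>e b k)"
    unfolding split by (rule sum.union_disjoint) auto
  moreover have "(\<Sum>k\<in>{6..<r + 6}. y k *\<^sub>e b k) = (\<Sum>j<r. y (j + 6) *\<^sub>e b (j + 6))"
    by (rule sum.reindex_bij_witness[of _ "\<lambda>j. j + 6" "\<lambda>k. k - 6"]) auto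
  ultimately have "?S = ?A + ?B" by (simp add: b_def)
  then have "?A + ?B = 0" by (rule trans[OF sym S0])
  then have AB: "?A = - ?B" by (rule eq_neg_iff_add_eq_0[THEN iffD2])
  have "?A \<in> JJ r" unfolding AB by (rule JJD(5)[OF l_span_in_JJ])
  then have q: "(\<Sum>k<6. y k *\<^sub>e mono {k}) \<in> quad_ideal x" using rel_iff[OF rel_\<epsilon>_sum[of y]] by simp
  have hom': "(\<Sum>k<6. y k *\<^sub>e mono {k}) \<in> homog 6 1"
    by (rule homog_sum) (simp add: mono_singleton_homog[unfolded One_nat_def])
  have "(\<Sum>k<6. y k *\<^sub>e mono {k}) = part 1 (\<Sum>k<6. y k *\<^sub>e mono {k})" using part_of_homog[OF hom', of 1] by simp
  also have "\<dots> = 0" using q unfolding quad_ideal_def by blast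
  finally have z: "(\<Sum>k<6. y k *\<^sub>e mono {k}) = 0" .
  have y0: "y k = 0" if k: "k < 6" for k
  proof -
    have "(\<Sum>j<6. y j *\<^sub>e mono {j}) {k} = (\<Sum>j<6. of_bool (k = j) * y j)"
      unfolding sum_fun_apply by (intro sum.cong) (auto simp: mono_def)
    also have "\<dots> = y k" using k by (intro sum_of_bool_mult) auto
    finally show ?thesis unfolding z by simp
  qed
  have "?A = 0" by (rule sum.neutral) (simp add: y0)
  then have "?B = 0" using AB by simp
  then have yl: "y (j + 6) = 0" if "j < r" for j by (rule l_independent) (rule that)
  have "y k = 0" if "k < r + 6" for k
  proof (cases "k < 6")
    case False
    then show ?thesis using yl[of "k - 6"] that by simp
  qed (rule y0)
  then show False using y(1) by auto
qed

text \<open>Descending along the sequence, a nontrivial combination s of a and b lies in the next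
  larger ideal. If it involves l_i, it is corrected by a or b, chosen so that the product with s is
  a multiple of a b; regularity then applies to that form.\<close>

lemma dependent_mod_JJ:
  assumes a: "a \<in> homog n 1" and b: "b \<in> homog n 1"
  shows "i \<le> r \<Longrightarrow> a \<cdot> b \<in> JJ i \<Longrightarrow> \<exists>c d. (c \<noteq> 0 \<or> d \<noteq> 0) \<and> c *\<^sub>e a + d *\<^sub>e b \<in> JJ i"
proof (induction i rule: inc_induct)
  case base
  obtain u where u: "u \<in> homog 6 1" "rel a u" using rel_total[OF a] by blast
  obtain v where v: "v \<in> homog 6 1" "rel b v" using rel_total[OF b] by blast
  have "u \<cdot> v \<in> quad_ideal x" using rel_iff[OF rel_mult[OF u(2) v(2)]] base by simp
  from plucker_anisotropic_dependent[OF anisotropic u(1) v(1) this]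
  obtain c d where cd: "c \<noteq> 0 \<or> d \<noteq> 0" "c *\<^sub>e u + d *\<^sub>e v = 0" by blast
  have "rel (c *\<^sub>e a + d *\<^sub>e b) (c *\<^sub>e u + d *\<^sub>e v)" by (rule rel_add[OF rel_scale[OF u(2)] rel_scale[OF v(2)]])
  from rel_iff[OF this] have "c *\<^sub>e a + d *\<^sub>e b \<in> JJ r"
    unfolding cd(2) using ideal_exteriorD(2)[OF ideal_quad_ideal[of x]] by blast
  then show ?case using cd(1) by blast
next
  case (step i)
  have "a \<cdot> b \<in> JJ (Suc i)" using JJ_mono[of i "Suc i"] step.prems by auto
  from step.IH[OF this] obtain c d where cd: "c \<noteq> 0 \<or> d \<noteq> 0" "c *\<^sub>e a + d *\<^sub>e b \<in> JJ (Suc i)" by blast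
  define s where "s = c *\<^sub>e a + d *\<^sub>e b"
  have s: "s \<in> homog n 1" "s \<in> JJ (Suc i)" using a b cd(2) by (simp_all add: s_def)
  obtain e where e: "s = (\<Sum>j<Suc i. e j *\<^sub>e l j)" using linear_in_JJ[OF s(2,1)] by blast
  define s0 where "s0 = (\<Sum>j<i. e j *\<^sub>e l j)"
  have s0: "s0 \<in> JJ i" unfolding s0_def by (rule l_span_in_JJ)
  have e': "s = s0 + e i *\<^sub>e l i" by (simp add: e s0_def)
  show ?case
  proof (cases "e i = 0")
    case True
    then have "s \<in> JJ i" using s0 e' by simp
    then show ?thesis using cd(1) unfolding s_def by blast
  next
    case False
    note ei = this
    \<comment> \<open>From w s one gets l_i w in the smaller ideal, so w is a combination of l_0,
      ..., l_i by regularity. The multiple of s is chosen to cancel l_i.\<close>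
    have key: "\<exists>f. e i *\<^sub>e w - f *\<^sub>e s \<in> JJ i" if w: "w \<in> homog n 1" "w \<cdot> s \<in> JJ i" for w
    proof -
      have "w \<cdot> s0 \<in> JJ i" by (rule JJD(6)[OF s0 homog_carrier[OF w(1)]])
      from JJD(4)[OF w(2) this] have "e i *\<^sub>e (w \<cdot> l i) \<in> JJ i" by (simp add: e' wedge_distribs)
      moreover have "l i \<cdot> w = (- inverse (e i)) *\<^sub>e (e i *\<^sub>e (w \<cdot> l i))"
        using ei linear_anticommute[OF w(1) l[of i]] by simp
      ultimately have "l i \<cdot> w \<in> JJ i" using JJD(8)[of "e i *\<^sub>e (w \<cdot> l i)" i "- inverse (e i)"] by simp
      from regular[OF step.hyps(2) homog_carrier[OF w(1)] this] have "w \<in> JJ (Suc i)" .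
      from linear_in_JJ[OF this w(1)] obtain f where f: "w = (\<Sum>j<Suc i. f j *\<^sub>e l j)" by blast
      have "e i *\<^sub>e w - f i *\<^sub>e s = e i *\<^sub>e (\<Sum>j<i. f j *\<^sub>e l j) - f i *\<^sub>e s0"
        by (simp add: f e' scale_distribs mult.commute)
      moreover have "e i *\<^sub>e (\<Sum>j<i. f j *\<^sub>e l j) - f i *\<^sub>e s0 \<in> JJ i"
        by (rule JJD(4)[OF JJD(8)[OF l_span_in_JJ] JJD(8)[OF s0]])
      ultimately have "e i *\<^sub>e w - f i *\<^sub>e s \<in> JJ i" by simp
      then show ?thesis by (rule exI)
    qed
    have sq: "a \<cdot> a = 0" "b \<cdot> b = 0" using linear_square[OF a] linear_square[OF b] by simp_all
    show ?thesis
    \<comment> \<open>For d = 0 the form b is used, which s does not involve; otherwise a is used,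
      and the new combination is nontrivial because f and d are not both harmless: f = 0 leaves the
      coefficient \<open>e i\<close> of a, and f nonzero leaves that of b.\<close>
    proof (cases "d = 0")
      case True
      have "b \<cdot> s = (- c) *\<^sub>e (a \<cdot> b)"
        using True linear_anticommute[OF a b] by (simp add: s_def wedge_distribs scale_distribs)
      then have "b \<cdot> s \<in> JJ i" using JJD(8)[OF step.prems, of "- c"] by simp
      from key[OF b this] obtain f where f: "e i *\<^sub>e b - f *\<^sub>e s \<in> JJ i" by blast
      have "e i *\<^sub>e b - f *\<^sub>e s = (- (f * c)) *\<^sub>e a + e i *\<^sub>e b"
        using True by (simp add: s_def fun_eq_iff algebra_simps)
      with f have "(- (f * c)) *\<^sub>e a + e i *\<^sub>e b \<in> JJ i" by metis
      then show ?thesis using ei by blast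
    next
      case False
      have "a \<cdot> s = d *\<^sub>e (a \<cdot> b)" using sq by (simp add: s_def wedge_distribs)
      then have "a \<cdot> s \<in> JJ i" using JJD(8)[OF step.prems, of d] by simp
      from key[OF a this] obtain f where f: "e i *\<^sub>e a - f *\<^sub>e s \<in> JJ i" by blast
      have "e i *\<^sub>e a - f *\<^sub>e s = (e i - f * c) *\<^sub>e a + (- (f * d)) *\<^sub>e b"
        by (simp add: s_def fun_eq_iff algebra_simps)
      with f have "(e i - f * c) *\<^sub>e a + (- (f * d)) *\<^sub>e b \<in> JJ i" by metis
      moreover have "e i - f * c \<noteq> 0 \<or> - (f * d) \<noteq> 0" using ei False by (cases "f = 0") auto
      ultimately show ?thesis by blast
    qed
  qed
qed

lemma dependent_J:
  assumes "a \<in> homog n 1" "b \<in> homog n 1" "a \<cdot> b \<in> J"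
  shows "\<exists>c d. (c \<noteq> 0 \<or> d \<noteq> 0) \<and> c *\<^sub>e a + d *\<^sub>e b = 0"
proof -
  obtain c d where cd: "c \<noteq> 0 \<or> d \<noteq> 0" "c *\<^sub>e a + d *\<^sub>e b \<in> J"
    using dependent_mod_JJ[OF assms(1,2) le0] assms(3) unfolding JJ_0 by blast
  have "c *\<^sub>e a + d *\<^sub>e b \<in> homog n 1" using assms(1,2) by simp
  from no_linear[OF cd(2) this] show ?thesis using cd(1) by blast
qed

section \<open>Dimension of the space of quadrics in the lift\<close>

text \<open>The quadrics divisible by the first i linear forms, with linear cofactors. This is the
  part of a quadric that is invisible in the quotient.\<close>

definition mixed :: "nat \<Rightarrow> ext set"
  where "mixed i = {z. \<exists>v. (\<forall>j. v j \<in> homog n 1) \<and> z = (\<Sum>j<i. l j \<cdot> v j)}"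

lemma mixed_I:
  assumes "\<And>j. v j \<in> homog n 1"
  shows "(\<Sum>j<i. l j \<cdot> v j) \<in> mixed i"
  unfolding mixed_def by (rule CollectI, rule exI[of _ v]) (simp add: assms[unfolded One_nat_def])

lemma mixed_E:
  assumes "z \<in> mixed i"
  obtains v where "\<forall>j. v j \<in> homog n 1" "z = (\<Sum>j<i. l j \<cdot> v j)"
proof -
  from assms obtain v where v: "\<forall>j. v j \<in> homog n 1" "z = (\<Sum>j<i. l j \<cdot> v j)"
    unfolding mixed_def by blast
  then show ?thesis by (rule that)
qed

lemma mixed_zero: "0 \<in> mixed i"
  using mixed_I[of "\<lambda>_. 0" i] by simp

lemma mixed_0: "z \<in> mixed 0 \<Longrightarrow> z = 0"
  by (auto simp: mixed_def)

lemma mixed_add: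
  assumes "z \<in> mixed i" "z' \<in> mixed i"
  shows "z + z' \<in> mixed i"
proof -
  obtain v where v: "\<forall>j. v j \<in> homog n 1" "z = (\<Sum>j<i. l j \<cdot> v j)" by (rule mixed_E[OF assms(1)])
  obtain w where w: "\<forall>j. w j \<in> homog n 1" "z' = (\<Sum>j<i. l j \<cdot> w j)" by (rule mixed_E[OF assms(2)])
  have "z + z' = (\<Sum>j<i. l j \<cdot> (v j + w j))" by (simp add: v(2) w(2) wedge_distribs sum.distrib)
  moreover have "(\<Sum>j<i. l j \<cdot> (v j + w j)) \<in> mixed i"
    by (rule mixed_I) (rule homog_closed(2)[OF v(1)[rule_format] w(1)[rule_format]])
  ultimately show ?thesis by simp
qed

lemma mixed_scale:
  assumes "z \<in> mixed i"
  shows "c *\<^sub>e z \<in> mixed i"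
proof -
  obtain v where v: "\<forall>j. v j \<in> homog n 1" "z = (\<Sum>j<i. l j \<cdot> v j)" by (rule mixed_E[OF assms])
  have "c *\<^sub>e z = (\<Sum>j<i. l j \<cdot> (c *\<^sub>e v j))" by (simp add: v(2) scale_sum)
  moreover have "(\<Sum>j<i. l j \<cdot> (c *\<^sub>e v j)) \<in> mixed i"
    by (rule mixed_I) (rule homog_closed(5)[OF v(1)[rule_format]])
  ultimately show ?thesis by simp
qed

lemma mixed_sum:
  fixes f :: "'a \<Rightarrow> ext"
  assumes "\<And>k. k \<in> A \<Longrightarrow> f k \<in> mixed i"
  shows "(\<Sum>k\<in>A. f k) \<in> mixed i"
  by (rule sum_closed) (rule mixed_zero, erule (1) mixed_add, erule assms)

lemma mixed_JJ:
  assumes "z \<in> mixed i"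
  shows "z \<in> JJ i"
proof -
  obtain v where v: "\<forall>j. v j \<in> homog n 1" "z = (\<Sum>j<i. l j \<cdot> v j)" by (rule mixed_E[OF assms])
  show ?thesis unfolding v(2)
  proof (rule ideal_exterior_sum[OF ideal_JJ])
    fix j assume "j \<in> {..<i}"
    then show "l j \<cdot> v j \<in> JJ i" by (intro l_in_JJ homog_carrier[OF v(1)[rule_format]]) simp
  qed
qed

text \<open>Lift of \<open>bilinear_quadric\<close> to n variables, with the chosen representatives
  of the six variables in place of the variables.\<close>

definition eps_quadric :: "(nat \<Rightarrow> nat \<Rightarrow> complex) \<Rightarrow> ext"
  where "eps_quadric q = (\<Sum>a<6. \<Sum>b<6. q a b *\<^sub>e (\<epsilon> a \<cdot> \<epsilon> b))"

lemma rel_eps_quadric: "rel (eps_quadric q) (bilinear_quadric q)"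
  unfolding eps_quadric_def bilinear_quadric_def
proof (rule rel_sum, rule rel_sum)
  fix a b :: nat assume "a \<in> {..<6}" "b \<in> {..<6}"
  then have "rel (\<epsilon> a) (mono {a})" "rel (\<epsilon> b) (mono {b})" using \<epsilon>[of a] \<epsilon>[of b] by simp_all
  then show "rel (q a b *\<^sub>e (\<epsilon> a \<cdot> \<epsilon> b)) (q a b *\<^sub>e (mono {a} \<cdot> mono {b}))" by (intro rel_scale rel_mult)
qed

lemma eps_quadric_add: "eps_quadric (\<lambda>a b. q a b + q' a b) = eps_quadric q + eps_quadric q'"
  by (simp add: eps_quadric_def sum.distrib scale_distribs)

lemma eps_quadric_scale: "c *\<^sub>e eps_quadric q = eps_quadric (\<lambda>a b. c * q a b)"
  by (simp add: eps_quadric_def scale_sum)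

lemma eps_quadric_sum:
  fixes q :: "'a \<Rightarrow> nat \<Rightarrow> nat \<Rightarrow> complex"
  shows "(\<Sum>k\<in>A. eps_quadric (q k)) = eps_quadric (\<lambda>a b. \<Sum>k\<in>A. q k a b)"
proof -
  have "eps_quadric (\<lambda>a b. \<Sum>k\<in>A. q k a b) = (\<Sum>a<6. \<Sum>k\<in>A. \<Sum>b<6. q k a b *\<^sub>e (\<epsilon> a \<cdot> \<epsilon> b))"
    unfolding eps_quadric_def sum_scale by (rule sum.cong[OF refl], rule sum.swap)
  also have "\<dots> = (\<Sum>k\<in>A. \<Sum>a<6. \<Sum>b<6. q k a b *\<^sub>e (\<epsilon> a \<cdot> \<epsilon> b))" by (rule sum.swap)
  finally show ?thesis by (simp only: eps_quadric_def)
qed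

lemma eps_quadric_symmetric:
  assumes "\<And>a b. a < 6 \<Longrightarrow> b < 6 \<Longrightarrow> Q a b = Q b a"
  shows "eps_quadric Q = 0"
proof -
  have "eps_quadric Q = (\<Sum>b<6. \<Sum>a<6. Q a b *\<^sub>e (\<epsilon> a \<cdot> \<epsilon> b))" unfolding eps_quadric_def by (rule sum.swap)
  also have "\<dots> = (\<Sum>b<6. \<Sum>a<6. - (Q b a *\<^sub>e (\<epsilon> b \<cdot> \<epsilon> a)))"
  proof (rule sum.cong[OF refl], rule sum.cong[OF refl])
    fix a b :: nat assume "b \<in> {..<6}" "a \<in> {..<6}"
    then show "Q a b *\<^sub>e (\<epsilon> a \<cdot> \<epsilon> b) = - (Q b a *\<^sub>e (\<epsilon> b \<cdot> \<epsilon> a))"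
      using assms[of a b] linear_anticommute[of "\<epsilon> b" n "\<epsilon> a"] \<epsilon>[of a] \<epsilon>[of b] by (simp add: scale_distribs)
  qed
  also have "\<dots> = - eps_quadric Q" by (simp add: eps_quadric_def sum_negf)
  finally have eq: "eps_quadric Q = - eps_quadric Q" .
  have "eps_quadric Q S = 0" for S using fun_cong[OF eq, of S] by (simp add: complex_eq_iff)
  then show ?thesis by (simp add: fun_eq_iff)
qed

lemma product_span:
  assumes a: "a \<in> homog n 1" and b: "b \<in> homog n 1"
  shows "\<exists>q. a \<cdot> b - eps_quadric q \<in> mixed r"
proof -
  obtain \<alpha> c where \<alpha>: "a = (\<Sum>i<6. \<alpha> i *\<^sub>e \<epsilon> i) + (\<Sum>j<r. c j *\<^sub>e l j)" using linear_span[OF a] by blast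
  obtain \<beta> d where \<beta>: "b = (\<Sum>i<6. \<beta> i *\<^sub>e \<epsilon> i) + (\<Sum>j<r. d j *\<^sub>e l j)" using linear_span[OF b] by blast
  define A B C D where "A = (\<Sum>i<6. \<alpha> i *\<^sub>e \<epsilon> i)" and "B = (\<Sum>i<6. \<beta> i *\<^sub>e \<epsilon> i)"
    and "C = (\<Sum>j<r. c j *\<^sub>e l j)" and "D = (\<Sum>j<r. d j *\<^sub>e l j)"
  have ab: "a = A + C" "b = B + D" unfolding A_def B_def C_def D_def by (rule \<alpha>, rule \<beta>)
  have hom: "A \<in> homog n 1" "D \<in> homog n 1" unfolding A_def D_def by (rule \<epsilon>_sum_homog, rule l_sum_homog)
  have span: "(\<Sum>j<r. e j *\<^sub>e l j) \<cdot> w \<in> mixed r" if w: "w \<in> homog n 1" for e w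
  proof -
    have "(\<Sum>j<r. e j *\<^sub>e l j) \<cdot> w = (\<Sum>j<r. l j \<cdot> (e j *\<^sub>e w))" by (simp add: wedge_sum_left)
    moreover have "(\<Sum>j<r. l j \<cdot> (e j *\<^sub>e w)) \<in> mixed r" by (rule mixed_I) (rule homog_closed(5)[OF w])
    ultimately show ?thesis by simp
  qed
  have "A \<cdot> B = (\<Sum>i<6. \<Sum>k<6. (\<alpha> i *\<^sub>e \<epsilon> i) \<cdot> (\<beta> k *\<^sub>e \<epsilon> k))"
    unfolding A_def B_def by (simp only: wedge_sum_left) (simp only: wedge_sum_right)
  also have "\<dots> = eps_quadric (\<lambda>i k. \<alpha> i * \<beta> k)" by (simp add: eps_quadric_def mult.commute)
  finally have AB: "A \<cdot> B = eps_quadric (\<lambda>i k. \<alpha> i * \<beta> k)" .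
  have "A \<cdot> D = (- 1) *\<^sub>e (D \<cdot> A)" using linear_anticommute[OF hom(2,1)] by simp
  moreover have "a \<cdot> b = A \<cdot> b + C \<cdot> b" unfolding ab(1) by (rule wedge_distribs(1))
  moreover have "A \<cdot> b = A \<cdot> B + A \<cdot> D" unfolding ab(2) by (rule wedge_distribs(2))
  ultimately have "a \<cdot> b - eps_quadric (\<lambda>i k. \<alpha> i * \<beta> k) = (- 1) *\<^sub>e (D \<cdot> A) + C \<cdot> b"
    unfolding AB[symmetric] by simp
  moreover have "(- 1) *\<^sub>e (D \<cdot> A) + C \<cdot> b \<in> mixed r"
    by (rule mixed_add[OF mixed_scale[OF span[OF hom(1), of d, folded D_def]] span[OF b, of c, folded C_def]])
  ultimately have "a \<cdot> b - eps_quadric (\<lambda>i k. \<alpha> i * \<beta> k) \<in> mixed r" by metis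
  then show ?thesis by metis
qed

lemma quadric_span:
  assumes z: "z \<in> homog n 2"
  shows "\<exists>q. z - eps_quadric q \<in> mixed r"
proof -
  define X where "X = {z. \<exists>q. z - eps_quadric q \<in> mixed r}"
  have "0 - eps_quadric (\<lambda>_ _. 0) \<in> mixed r" using mixed_zero by (simp add: eps_quadric_def)
  then have X0: "0 \<in> X" unfolding X_def by blast
  have X_add: "f + g \<in> X" if fg: "f \<in> X" "g \<in> X" for f g
  proof -
    obtain q q' where q: "f - eps_quadric q \<in> mixed r" "g - eps_quadric q' \<in> mixed r" using fg unfolding X_def by blast
    have "f + g - eps_quadric (\<lambda>a b. q a b + q' a b) = (f - eps_quadric q) + (g - eps_quadric q')"
      unfolding eps_quadric_add by simp
    then have "f + g - eps_quadric (\<lambda>a b. q a b + q' a b) \<in> mixed r" using mixed_add[OF q] by metis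
    then show ?thesis unfolding X_def by blast
  qed
  have mono_X: "z S *\<^sub>e mono S \<in> X" for S
  proof (cases "z S = 0")
    case True
    then show ?thesis using X0 by simp
  next
    case False
    then have S: "S \<subseteq> {..<n}" "card S = 2" using homogD[OF z] by blast+
    then obtain s t where st: "S = {s, t}" "s \<noteq> t" by (auto simp: card_2_iff)
    then have stn: "s < n" "t < n" using S(1) by auto
    have eq: "z S *\<^sub>e mono S = ((z S * wedge_sign {s} {t}) *\<^sub>e mono {s}) \<cdot> mono {t}"
      using st by (simp add: mono_wedge mult.assoc insert_commute)
    show ?thesis unfolding eq X_def
      by (rule CollectI, rule product_span[OF homog_closed(5)[OF mono_singleton_homog[OF stn(1)]] mono_singleton_homog[OF stn(2)]])
  qed
  have "(\<Sum>S\<in>Pow {..<n}. z S *\<^sub>e mono S) \<in> X" by (rule sum_closed) (rule X0, erule (1) X_add, rule mono_X)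
  then have "z \<in> X" unfolding ext_eq_sum_mono[OF homog_carrier[OF z], symmetric] .
  then show ?thesis unfolding X_def by blast
qed

text \<open>Modulo all linear forms the seven quadrics fall into a six-dimensional space, which
  yields one relation. The same coefficients persist as forms are removed: if l_i v is in the
  smaller ideal, then v is a combination of l_0, ..., l_i by regularity, and l_i v needs only the
  earlier forms because l_i^2 = 0. For i = 0 the relation is exact.\<close>

lemma relation_mod_mixed:
  assumes g2: "\<And>k. k < 7 \<Longrightarrow> g k \<in> homog n 2"
  shows "i \<le> r \<Longrightarrow> (\<forall>k<7. g k \<in> JJ i) \<Longrightarrow> \<exists>d. (\<exists>k<(7::nat). d k \<noteq> 0) \<and> (\<Sum>k<7. d k *\<^sub>e g k) \<in> mixed i"
proof (induction i rule: inc_induct)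
  case base
  have "\<forall>k\<in>{..<7}. \<exists>q. g k - eps_quadric q \<in> mixed r" using quadric_span[OF g2] by simp
  from bchoice[OF this] obtain q where q: "\<forall>k\<in>{..<7}. g k - eps_quadric (q k) \<in> mixed r" by blast
  have "\<forall>k\<in>{..<7}. \<exists>c. \<forall>a b. a < b \<and> b < 6 \<longrightarrow> q k a b - q k b a = (\<Sum>m<6. c m * x (m, a, b))"
  proof
    fix k :: nat assume k: "k \<in> {..<7}"
    have "g k \<in> JJ r" using base k by simp
    from JJD(4)[OF this mixed_JJ[OF bspec[OF q k]]] have "eps_quadric (q k) \<in> JJ r" by simp
    then have B: "bilinear_quadric (q k) \<in> quad_ideal x" using rel_iff[OF rel_eps_quadric[of "q k"]] by simp
    from B[unfolded quad_ideal_iff[OF bilinear_quadric_homog]]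
    obtain c where c: "\<forall>a b. a < b \<and> b < 6 \<longrightarrow> bilinear_quadric (q k) {a, b} = (\<Sum>m<6. c m * x (m, a, b))" by blast
    have "\<forall>a b. a < b \<and> b < 6 \<longrightarrow> q k a b - q k b a = (\<Sum>m<6. c m * x (m, a, b))"
    proof (intro allI impI)
      fix a b :: nat assume ab: "a < b \<and> b < 6"
      show "q k a b - q k b a = (\<Sum>m<6. c m * x (m, a, b))"
        using c[rule_format, OF ab] bilinear_quadric_apply[of a b "q k"] ab by simp
    qed
    then show "\<exists>c. \<forall>a b. a < b \<and> b < 6 \<longrightarrow> q k a b - q k b a = (\<Sum>m<6. c m * x (m, a, b))" by auto
  qed
  from bchoice[OF this] obtain c where
    c: "\<forall>k\<in>{..<7}. \<forall>a b. a < b \<and> b < 6 \<longrightarrow> q k a b - q k b a = (\<Sum>m<6. c k m * x (m, a, b))" by blast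
  \<comment> \<open>Each quadric has six coefficients with respect to x. The combination that kills
    them all has a symmetric coefficient matrix, hence vanishes by anticommutativity.\<close>
  have "card {..<6::nat} < card {..<7::nat}" by simp
  from underdetermined_system[where M = "\<lambda>m k. c k m", OF finite_lessThan finite_lessThan this]
  obtain y where y: "\<exists>k\<in>{..<7}. y k \<noteq> 0" "\<forall>m\<in>{..<6}. (\<Sum>k\<in>{..<7}. c k m * y k) = 0" by blast
  define Q where "Q = (\<lambda>a b. \<Sum>k<7. y k * q k a b)"
  have Q_less: "Q a b = Q b a" if ab: "a < b" "b < 6" for a b
  proof -
    have "Q a b - Q b a = (\<Sum>k<7. y k * (q k a b - q k b a))"
      by (simp add: Q_def sum_subtractf right_diff_distrib)
    also have "\<dots> = (\<Sum>k<7. \<Sum>m<6. (c k m * y k) * x (m, a, b))"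
    proof (rule sum.cong[OF refl])
      fix k :: nat assume "k \<in> {..<7}"
      then have "q k a b - q k b a = (\<Sum>m<6. c k m * x (m, a, b))" using c ab by blast
      then show "y k * (q k a b - q k b a) = (\<Sum>m<6. (c k m * y k) * x (m, a, b))"
        by (simp add: sum_distrib_left mult_ac)
    qed
    also have "\<dots> = (\<Sum>m<6. (\<Sum>k<7. c k m * y k) * x (m, a, b))"
      by (subst sum.swap) (simp add: sum_distrib_right)
    also have "\<dots> = 0" by (rule sum.neutral) (use y(2) in simp)
    finally show ?thesis by simp
  qed
  have "Q a b = Q b a" if "a < 6" "b < 6" for a b
    using Q_less[of a b] Q_less[of b a] that by (cases a b rule: linorder_cases) auto
  then have Q0: "eps_quadric Q = 0" by (rule eps_quadric_symmetric)
  have "(\<Sum>k<7. y k *\<^sub>e eps_quadric (q k)) = eps_quadric Q"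
    unfolding eps_quadric_scale eps_quadric_sum Q_def by (rule refl)
  then have "(\<Sum>k<7. y k *\<^sub>e g k) = (\<Sum>k<7. y k *\<^sub>e (g k - eps_quadric (q k)))"
    unfolding Q0 by (simp add: scale_distribs sum_subtractf)
  moreover have "(\<Sum>k<7. y k *\<^sub>e (g k - eps_quadric (q k))) \<in> mixed r"
    by (rule mixed_sum) (rule mixed_scale[OF bspec[OF q]])
  ultimately have "(\<Sum>k<7. y k *\<^sub>e g k) \<in> mixed r" by simp
  moreover have "\<exists>k<7. y k \<noteq> 0" using y(1) by auto
  ultimately show ?case by blast
next
  case (step i)
  have "\<forall>k<7. g k \<in> JJ (Suc i)" using JJ_mono[of i "Suc i"] step.prems by auto
  from step.IH[OF this] obtain d where d: "\<exists>k<7. d k \<noteq> 0" "(\<Sum>k<7. d k *\<^sub>e g k) \<in> mixed (Suc i)" by blast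
  define z where "z = (\<Sum>k<7. d k *\<^sub>e g k)"
  obtain v where v: "\<forall>j. v j \<in> homog n 1" "z = (\<Sum>j<Suc i. l j \<cdot> v j)"
    unfolding z_def by (rule mixed_E[OF d(2)])
  define z0 where "z0 = (\<Sum>j<i. l j \<cdot> v j)"
  have z0: "z0 \<in> mixed i" unfolding z0_def by (rule mixed_I) (rule v(1)[rule_format])
  have z': "z = z0 + l i \<cdot> v i" by (simp add: v(2) z0_def)
  have zJ: "z \<in> JJ i" unfolding z_def
  proof (rule ideal_exterior_sum[OF ideal_JJ])
    fix k :: nat assume "k \<in> {..<7}"
    then show "d k *\<^sub>e g k \<in> JJ i" using step.prems by (intro JJD(8)) simp
  qed
  have "l i \<cdot> v i \<in> JJ i" using JJD(4)[OF zJ mixed_JJ[OF z0]] by (simp add: z')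
  from regular[OF step.hyps(2) homog_carrier[OF v(1)[rule_format]] this] have "v i \<in> JJ (Suc i)" .
  from linear_in_JJ[OF this v(1)[rule_format]] obtain e where e: "v i = (\<Sum>j<Suc i. e j *\<^sub>e l j)" by blast
  have "l i \<cdot> v i = (\<Sum>j<i. e j *\<^sub>e (l i \<cdot> l j))"
    using linear_square[OF l, of i] by (simp add: e wedge_sum_right wedge_distribs)
  also have "\<dots> = (\<Sum>j<i. l j \<cdot> ((- e j) *\<^sub>e l i))"
  proof (rule sum.cong[OF refl])
    fix j
    show "e j *\<^sub>e (l i \<cdot> l j) = l j \<cdot> ((- e j) *\<^sub>e l i)"
      using linear_anticommute[OF l[of j] l[of i]] by (simp add: scale_distribs)
  qed
  also have "\<dots> \<in> mixed i" by (rule mixed_I) (rule homog_closed(5)[OF l])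
  finally have "z \<in> mixed i" unfolding z' by (rule mixed_add[OF z0])
  then show ?case using d(1) unfolding z_def by blast
qed

text \<open>By n >= r + 6 the degree n - 3 is at least r + 3, where \<open>J\<close> contains
  everything. Absence of products and the bound on quadrics have been pulled back as well, so all
  conditions for the contradiction are met.\<close>

lemma not_g_quadratic: "\<not> g_quadratic n J"
proof
  assume gq: "g_quadratic n J"
  have top: "homog n (n - 3) \<subseteq> J" using high_degree_in_JJ[of 0 "n - 3"] n_ge unfolding JJ_0 by simp
  have n6: "6 \<le> n" using n_ge by simp
  have seven: "\<exists>d. (\<exists>k<(7::nat). d k \<noteq> 0) \<and> (\<Sum>k<7. d k *\<^sub>e g k) = 0"
    if g: "\<forall>k<7. g k \<in> J \<and> g k \<in> homog n 2" for g
  proof -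
    have "\<exists>d. (\<exists>k<(7::nat). d k \<noteq> 0) \<and> (\<Sum>k<7. d k *\<^sub>e g k) \<in> mixed 0"
      by (rule relation_mod_mixed[OF _ le0]) (use g JJ_0 in auto)
    then show ?thesis using mixed_0 by blast
  qed
  have quads: "\<And>g. (\<And>k. k < (7::nat) \<Longrightarrow> g k \<in> J \<inter> homog n 2)
      \<Longrightarrow> \<exists>d. (\<exists>k<7. d k \<noteq> 0) \<and> (\<Sum>k<7. d k *\<^sub>e g k) = 0"
    by (rule seven, blast | rule seven, simp | intro allI impI, rule seven, blast)
  show False by (rule g_quadratic_rank_two[OF gq dependent_J top n6 quads])
qed

end

section \<open>From an LG-quadratic presentation to a regular lift\<close>

lemma (in generic_quadrics) not_lg_quadratic: "\<not> lg_quadratic R"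
proof
  assume "lg_quadratic R"
  then obtain n J ls where gq: "g_quadratic n J"
    and reg: "regular_sequence (quotient_algebra (exterior n) J) ls"
    and iso: "graded_iso R (quotient_algebra (quotient_algebra (exterior n) J)
      (Idl\<^bsub>quotient_algebra (exterior n) J\<^esub> (set ls)))"
    unfolding lg_quadratic_def Let_def by blast
  define r where "r = length ls"
  have J: "ideal J (exterior n)" and graded: "\<forall>f\<in>J. \<forall>d. part d f \<in> J"
    using gq unfolding g_quadratic_def graded_ideal_def part_def by blast+
  have "\<forall>i\<in>{..<r}. \<exists>a. a \<in> homog n 1 \<and> ls ! i = J +>\<^bsub>exterior n\<^esub> a"
  proof
    fix i assume "i \<in> {..<r}"
    then have "ls ! i \<in> set ls" by (simp add: r_def)
    then have "ls ! i \<in> component (quotient_algebra (exterior n) J) 1"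
      using reg unfolding regular_sequence_def by blast
    then show "\<exists>a. a \<in> homog n 1 \<and> ls ! i = J +>\<^bsub>exterior n\<^esub> a"
      unfolding quotient_algebra_sel exterior_sel by blast
  qed
  from bchoice[OF this] obtain l0 where
    l0: "\<forall>i\<in>{..<r}. l0 i \<in> homog n 1 \<and> ls ! i = J +>\<^bsub>exterior n\<^esub> (l0 i)" by blast
  \<comment> \<open>Padding with 0 beyond the length of the sequence makes every \<open>l i\<close>
    a linear form.\<close>
  define l where "l i = (if i < r then l0 i else 0)" for i
  have l: "l i \<in> homog n 1" for i using l0 by (simp add: l_def)
  have ls: "ls ! i = J +>\<^bsub>exterior n\<^esub> (l i)" if "i < r" for i using l0 that by (simp add: l_def)
  interpret L: lifted_forms n J l by (rule lifted_forms.intro[OF J l])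
  have Idl_eq: "Idl\<^bsub>quotient_algebra (exterior n) J\<^esub> (set (take i ls))
      = (+>\<^bsub>exterior n\<^esub>) J ` extended_ideal n J l i" if i: "i \<le> r" for i
  proof -
    have "set (take i ls) = (!) ls ` {..<i}" using i nth_image[of i ls] by (simp add: r_def lessThan_atLeast0)
    also have "\<dots> = (\<lambda>j. J +>\<^bsub>exterior n\<^esub> (l j)) ` {..<i}" using ls i by (intro image_cong refl) simp
    finally show ?thesis using L.Idl_linear_forms[of i] by simp
  qed
  have regular: "z \<in> extended_ideal n J l (Suc i)"
    if i: "i < r" and z: "z \<in> ext_carrier n" "l i \<cdot> z \<in> extended_ideal n J l i" for i z
  proof (rule L.regular_form_lift[OF _ z])
    show "regular_form (quotient_algebra (quotient_algebra (exterior n) J) ((+>\<^bsub>exterior n\<^esub>) J ` extended_ideal n J l i))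
        (((+>\<^bsub>exterior n\<^esub>) J ` extended_ideal n J l i) +>\<^bsub>quotient_algebra (exterior n) J\<^esub> (J +>\<^bsub>exterior n\<^esub> (l i)))"
      using reg i unfolding regular_sequence_def Let_def r_def[symmetric] Idl_eq[OF less_imp_le[OF i], symmetric] ls[OF i, symmetric] by blast
  qed
  define B where "B = quotient_algebra (quotient_algebra (exterior n) J) ((+>\<^bsub>exterior n\<^esub>) J ` extended_ideal n J l r)"
  define q where "q = (\<lambda>z. ((+>\<^bsub>exterior n\<^esub>) J ` extended_ideal n J l r)
    +>\<^bsub>quotient_algebra (exterior n) J\<^esub> (J +>\<^bsub>exterior n\<^esub> z))"
  have "set ls = set (take r ls)" by (simp add: r_def)
  then have "graded_iso R B" using iso Idl_eq[of r] by (simp add: B_def)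
  then obtain h where h: "h \<in> ring_iso R B" "\<forall>c. \<forall>y\<in>carrier R. h (c \<odot>\<^bsub>R\<^esub> y) = c \<odot>\<^bsub>B\<^esub> h y"
      "\<forall>d. h ` component R d = component B d"
    unfolding graded_iso_def by blast
  have hom: "h \<in> ring_hom R B" "inj_on h (carrier R)" using h(1) by (auto simp: ring_iso_def bij_betw_def)
  have ringR: "ring R" by (rule ring_quotient_algebra[OF ideal_quad_ideal])
  have ringB: "ring B" unfolding B_def by (rule ring_quotient_algebra[OF L.ideal_pr_JJ])
  have q_ops: "q (a \<cdot> b) = q a \<otimes>\<^bsub>B\<^esub> q b" "q (a + b) = q a \<oplus>\<^bsub>B\<^esub> q b"
    if "a \<in> ext_carrier n" "b \<in> ext_carrier n" for a b
    unfolding q_def B_def L.pr_quot_ops[OF that] by (rule refl)+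
  have q_scale: "q (c *\<^sub>e a) = c \<odot>\<^bsub>B\<^esub> q a" if "a \<in> ext_carrier n" for a c
    unfolding q_def B_def L.pr_quot_smult[OF that] by (rule refl)
  have q_zero: "q a = \<zero>\<^bsub>B\<^esub> \<longleftrightarrow> a \<in> extended_ideal n J l r" if "a \<in> ext_carrier n" for a
    unfolding q_def B_def by (rule L.pr_quot_zero_iff[OF that])
  have h_add: "h (proj (u + v)) = h (proj u) \<oplus>\<^bsub>B\<^esub> h (proj v)" if "u \<in> ext_carrier 6" "v \<in> ext_carrier 6" for u v
    using ring_hom_add[OF hom(1) proj_closed[OF that(1)] proj_closed[OF that(2)]]
      quotient_algebra_ops(2)[OF ideal_quad_ideal[of x], of u v] that by simp
  have h_mult: "h (proj (u \<cdot> v)) = h (proj u) \<otimes>\<^bsub>B\<^esub> h (proj v)" if "u \<in> ext_carrier 6" "v \<in> ext_carrier 6" for u v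
    using ring_hom_mult[OF hom(1) proj_closed[OF that(1)] proj_closed[OF that(2)]] proj_mult[OF that] by simp
  have h_scale: "h (proj (c *\<^sub>e u)) = c \<odot>\<^bsub>B\<^esub> h (proj u)" if "u \<in> ext_carrier 6" for u c
    using h(2)[rule_format, OF proj_closed[OF that], of c]
      scalar_ring.quotient_algebra_smult[OF scalar_ring_exterior ideal_quad_ideal[of x], of u c] that by simp
  have h_zero: "h (proj u) = \<zero>\<^bsub>B\<^esub> \<longleftrightarrow> u \<in> quad_ideal x" if u: "u \<in> ext_carrier 6" for u
  proof -
    interpret RR: ring R by (rule ringR)
    have "h \<zero>\<^bsub>R\<^esub> = \<zero>\<^bsub>B\<^esub>" by (rule ring_hom_zero[OF hom(1) ringR ringB])
    then show ?thesis
      using inj_on_eq_iff[OF hom(2) proj_closed[OF u] RR.zero_closed] proj_eq_zero_iff[OF u] by simp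
  qed
  have comp: "q ` homog n d = (\<lambda>u. h (proj u)) ` homog 6 d" for d
  proof -
    have "component R d = proj ` homog 6 d" by (simp add: quotient_algebra_sel)
    moreover have "component B d = q ` homog n d" unfolding B_def q_def by (rule L.pr_quot_component)
    ultimately show ?thesis using h(3)[rule_format, of d] by (simp add: image_image)
  qed
  \<comment> \<open>Representatives are related when their classes correspond under the isomorphism.
    A relation avoids choosing a lift of the isomorphism to a map between the exterior
    algebras.\<close>
  define rel where "rel z u \<longleftrightarrow> z \<in> ext_carrier n \<and> u \<in> ext_carrier 6 \<and> q z = h (proj u)" for z u
  have "regular_lift x n J l r rel"
  proof (rule regular_lift.intro[OF generic_quadrics_axioms L.lifted_forms_axioms], rule regular_lift_axioms.intro)
    show "part d f \<in> J" if "f \<in> J" for f d using graded that by blast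
    show "f = 0" if "f \<in> J" "f \<in> homog n 1" for f using g_quadratic_no_linear_forms gq that by blast
    show "z \<in> extended_ideal n J l (Suc i)"
      if "i < r" "z \<in> ext_carrier n" "l i \<cdot> z \<in> extended_ideal n J l i" for i z by (rule regular[OF that])
    show "rel (z + z') (u + u')" if "rel z u" "rel z' u'" for z z' u u'
      using that by (simp add: rel_def q_ops h_add)
    show "rel (z \<cdot> z') (u \<cdot> u')" if "rel z u" "rel z' u'" for z z' u u'
      using that by (simp add: rel_def q_ops h_mult)
    show "rel (c *\<^sub>e z) (c *\<^sub>e u)" if "rel z u" for z u c
      using that by (simp add: rel_def q_scale h_scale)
    show "z \<in> extended_ideal n J l r \<longleftrightarrow> u \<in> quad_ideal x" if "rel z u" for z u
      using that q_zero[of z] h_zero[of u] by (simp add: rel_def)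
    show "\<exists>u\<in>homog 6 d. rel z u" if z: "z \<in> homog n d" for z d
    proof -
      have "q z \<in> (\<lambda>u. h (proj u)) ` homog 6 d" unfolding comp[symmetric] using z by (rule imageI)
      then obtain u where "u \<in> homog 6 d" "q z = h (proj u)" by blast
      then show ?thesis using homog_carrier[OF z] homog_carrier unfolding rel_def by blast
    qed
    show "\<exists>z\<in>homog n d. rel z u" if u: "u \<in> homog 6 d" for u d
    proof -
      have "h (proj u) \<in> q ` homog n d" unfolding comp using u by (rule imageI)
      then obtain z where "z \<in> homog n d" "h (proj u) = q z" by blast
      then show ?thesis using homog_carrier[OF u] homog_carrier unfolding rel_def by metis
    qed
  qed
  from regular_lift.not_g_quadratic[OF this] gq show False by blast
qed

theorem theorem5p4:
  shows "holds_for_generic_quadrics 6 6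
    (\<lambda>f. let I = Idl\<^bsub>exterior 6\<^esub> (f ` {..<6}); R = quotient_algebra (exterior 6) I
         in koszul R \<and> \<not> lg_quadratic R)"
proof -
  obtain p where p: "p \<noteq> 0" "multihomogeneous 6 6 p" "\<forall>x. poly_value p x \<noteq> 0 \<longrightarrow> plucker_anisotropic x"
    using plucker_anisotropic_generic by blast
  obtain c where c: "c \<noteq> 0" "multihomogeneous 6 6 c" "\<forall>x. poly_value c x \<noteq> 0 \<longrightarrow> cubics_generated x"
    using cubics_generated_generic by blast
  have "\<forall>i. \<exists>p. p \<noteq> 0 \<and> multihomogeneous 6 6 p \<and> (\<forall>x. poly_value p x \<noteq> 0 \<longrightarrow> normal_determined x i)"
    by (rule allI) (rule normal_determined_generic)
  from choice[OF this] obtain d where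
    d: "\<forall>i. d i \<noteq> 0 \<and> multihomogeneous 6 6 (d i) \<and> (\<forall>x. poly_value (d i) x \<noteq> 0 \<longrightarrow> normal_determined x i)" by blast
  \<comment> \<open>Indices 0 and 1 carry the two single conditions; the tensor condition in degree
    i sits at index i + 2.\<close>
  define P :: "nat \<Rightarrow> coord_poly" where "P j = (if j = 0 then p else if j = 1 then c else d (j - 2))" for j
  show ?thesis unfolding holds_for_generic_quadrics_def
  proof (rule exI[of _ P], intro conjI allI impI)
    show "P j \<noteq> 0" for j using p(1) c(1) d[rule_format, of "j - 2"] by (simp add: P_def)
    show "multihomogeneous 6 6 (P j)" for j using p(2) c(2) d[rule_format, of "j - 2"] by (simp add: P_def)
    fix x :: "coord \<Rightarrow> complex"
    assume x: "(\<forall>k<6. \<exists>q\<in>index_pairs 6. x (k, q) \<noteq> 0) \<and> (\<forall>j. poly_value (P j) x \<noteq> 0)"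
    then have ne: "poly_value (P j) x \<noteq> 0" for j by blast
    have g: "generic_quadrics x"
    proof
      show "plucker_anisotropic x" using p(3)[rule_format, of x] ne[of 0] by (simp add: P_def)
      show "normal_determined x i" for i using d[rule_format, of i] ne[of "i + 2"] by (simp add: P_def)
      show "cubics_generated x" using c(3)[rule_format, of x] ne[of 1] by (simp add: P_def)
    qed
    have eq: "(\<lambda>k. quadric 6 (\<lambda>q. x (k, q))) = gen_quadric x" by (rule HOL.ext) (simp add: gen_quadric_def)
    show "let I = Idl\<^bsub>exterior 6\<^esub> ((\<lambda>k. quadric 6 (\<lambda>q. x (k, q))) ` {..<6}); R = quotient_algebra (exterior 6) I
         in koszul R \<and> \<not> lg_quadratic R"
      unfolding eq Let_def Idl_generic[OF generic_quadrics.cubics[OF g]]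
      using generic_quadrics.koszul_generic[OF g] generic_quadrics.not_lg_quadratic[OF g] by blast
  qed
qed

end
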